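(* Let $(M,g)$ be a ($C^2$, time-oriented) strongly causal, causally closed Lorentzian manifold. Let $H=\partial I^+(A)$ for some compact, space-like, achronal $C^2$ submanifold $A\subset M$ (of codimension at least $2$). (1) Let $G$ be any natural gauge for $H$, continuously extendible to $0$ at $A$. If $(M,g)$ is weakly future null complete, then $G$ is proper. (2) Conversely, if $H$ admits a proper natural gauge $G$, then for every maximally (on the right) defined null geodesic $\gamma:[0,b)\to M$ the following dichotomy holds: either $b=\infty$, or $\gamma$ definitively leaves $H$ (i.e. there is $t_0\in[0,b)$ with $\gamma_t\notin H$ for all $t\in[t_0,b)$). (3) Finally, if every future light-cone $\partial I^+(p)$, $p\in M$, admits a proper natural gauge, then $(M,g)$ is weakly future null complete.
   Context: Signature $(-,+,\dots,+)$; $\ll,\le$ are the usual chronological and causal relations. Null geodesics are future-directed solutions of the geodesic equation. Causally closed: $\{(x,y):x\le y\}$ is closed. Strongly causal: every point has arbitrarily small neighbourhoods $U$ in which any $x\le y$ are joined by a causal curve contained in $U$. Weakly future null complete: for any maximally-defined (on the right) null geodesic $\gamma:[0,b)\to M$, either $b=\infty$ or $\gamma_0\ll\gamma_t$ for some $t\in[0,b)$. For the closed achronal set $H$: $\mathfrak a=\{m\in H:\nexists x\in H,\ x\le m,\ x\ne m\}$, $\mathfrak b=\{m\in H:\nexists x\in H,\ m\le x,\ x\ne m\}$, $H^\circ=H\setminus(\mathfrak a\cup\mathfrak b)$. Natural gauge. Let $(M,g)$ be a $C^2$, time-oriented, strongly causal, causally closed Lorentzian manifold and let $H=\partial I^+(A)$,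 where $A\subset M$ is a compact, space-like, achronal $C^2$ submanifold of codimension at least $2$. Then one has $\mathfrak a\subset A$, and $\mathfrak a$ is open in $A$, hence a submanifold with normal bundle $\mathscr N\mathfrak a$. Fix a future-directed timelike vector field $W$ on $M$ inducing the time orientation with $W|_A$ normal to $A$. For $x\in H^\circ$, let $M^-(x)$ be the $\le$-minimum of $J^-(x)\cap A$ (it belongs to $\mathfrak a$); there is a unique $v\in\mathscr N_{M^-(x)}\mathfrak a$ with $g(v,v)=0$, $g(v,W)<0$ and $\exp(v)=x$. The natural gauge (associated to $W$) is $G:H^\circ\to\mathbb R$, $G(x)=-g(v,W)$; it extends by $0$ to $\mathfrak a$, continuously along each null generator. The case of a light-cone is $A=\{p\}$. A gauge $G$ is proper if the pre-image under $G$ of every compact subset of $\mathbb R$ is precompact. *)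

theory Defs
  imports "HOL-Analysis.Analysis"
begin

section \<open>Functions of class \<open>C\<^sup>k\<close> on open sets\<close>

text \<open>Only used for open \<open>S\<close>. The quantifier over \<open>v\<close> is over constant directions, so in finite
  dimension this says that all iterated partial derivatives up to order \<open>k\<close> exist as
  Frechet derivatives and are continuous.\<close>

primrec Ck_on :: "nat \<Rightarrow> ('a::euclidean_space \<Rightarrow> 'b::real_normed_vector) \<Rightarrow> 'a set \<Rightarrow> bool" where
  "Ck_on 0 f S \<longleftrightarrow> continuous_on S f"
| "Ck_on (Suc k) f S \<longleftrightarrow>
     f differentiable_on S \<and> (\<forall>v. Ck_on k (\<lambda>x. frechet_derivative f (at x) v) S)"


section \<open>Charts and tangent vectors\<close>

type_synonym ('m, 'n) chart = "'m set \<times> ('m \<Rightarrow> real ^ 'n)"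

abbreviation cdom :: "('m, 'n::finite) chart \<Rightarrow> 'm set" where
  "cdom \<equiv> fst"

abbreviation cmap :: "('m, 'n::finite) chart \<Rightarrow> 'm \<Rightarrow> real ^ 'n" where
  "cmap \<equiv> snd"

definition cinv :: "('m, 'n::finite) chart \<Rightarrow> real ^ 'n \<Rightarrow> 'm" where
  "cinv c = inv_into (cdom c) (cmap c)"

definition transition :: "('m, 'n::finite) chart \<Rightarrow> ('m, 'n) chart \<Rightarrow> real ^ 'n \<Rightarrow> real ^ 'n" where
  "transition c d = cmap d \<circ> cinv c"

definition is_chart :: "('m::topological_space, 'n::finite) chart \<Rightarrow> bool" where
  "is_chart c \<longleftrightarrow> open (cdom c) \<and> open (cmap c ` cdom c) \<and>
     homeomorphism (cdom c) (cmap c ` cdom c) (cmap c) (cinv c)"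

definition compatible :: "nat \<Rightarrow> ('m, 'n::finite) chart \<Rightarrow> ('m, 'n) chart \<Rightarrow> bool" where
  "compatible k c d \<longleftrightarrow>
     Ck_on k (transition c d) (cmap c ` (cdom c \<inter> cdom d)) \<and>
     Ck_on k (transition d c) (cmap d ` (cdom c \<inter> cdom d))"

text \<open>A tangent vector is the family of its coordinate representations in all charts around its
  base point (and \<open>0\<close> in every other chart, so that equality of tangent vectors is equality
  of families); the transformation law is imposed in \<open>tangent_space\<close> below.\<close>

type_synonym ('m, 'n) tvector = "('m, 'n) chart \<Rightarrow> real ^ 'n"

text \<open>The manifold is the whole type \<open>'m\<close>; it is Hausdorff and second countable through the sort of
  \<open>'m\<close>, and its dimension is \<open>CARD('n)\<close>. The field \<open>torient\<close> is a timelike vector field that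
  represents the time orientation.\<close>

record ('m, 'n) spacetime =
  charts :: "('m, 'n) chart set"
  met :: "'m \<Rightarrow> ('m, 'n) tvector \<Rightarrow> ('m, 'n) tvector \<Rightarrow> real"
  torient :: "'m \<Rightarrow> ('m, 'n) tvector"

definition charts_at :: "('m, 'n::finite) spacetime \<Rightarrow> 'm \<Rightarrow> ('m, 'n) chart set" where
  "charts_at M p = {c \<in> charts M. p \<in> cdom c}"

definition tangent_space :: "('m, 'n::finite) spacetime \<Rightarrow> 'm \<Rightarrow> ('m, 'n) tvector set" where
  "tangent_space M p = {v.
     (\<forall>c \<in> charts_at M p. \<forall>d \<in> charts_at M p.
        v d = frechet_derivative (transition c d) (at (cmap c p)) (v c)) \<and>
     (\<forall>c. c \<notin> charts_at M p \<longrightarrow> v c = 0)}"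

text \<open>The coordinate vector \<open>\<partial>/\<partial>x\<^sup>i\<close> of the chart \<open>c\<close> at \<open>p\<close>.\<close>

definition coord_vec ::
  "('m, 'n::finite) spacetime \<Rightarrow> ('m, 'n) chart \<Rightarrow> 'm \<Rightarrow> 'n \<Rightarrow> ('m, 'n) tvector" where
  "coord_vec M c p i = (\<lambda>d. if d \<in> charts_at M p
     then frechet_derivative (transition c d) (at (cmap c p)) (axis i 1) else 0)"

definition continuous_vector_field ::
  "('m::topological_space, 'n::finite) spacetime \<Rightarrow> ('m \<Rightarrow> ('m, 'n) tvector) \<Rightarrow> bool" where
  "continuous_vector_field M X \<longleftrightarrow>
     (\<forall>p. X p \<in> tangent_space M p) \<and>
     (\<forall>c \<in> charts M. continuous_on (cdom c) (\<lambda>p. X p c))"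


section \<open>Time-oriented Lorentzian manifolds\<close>

definition metric_matrix ::
  "('m, 'n::finite) spacetime \<Rightarrow> ('m, 'n) chart \<Rightarrow> real ^ 'n \<Rightarrow> real ^ 'n ^ 'n" where
  "metric_matrix M c y =
     (\<chi> i j. met M (cinv c y) (coord_vec M c (cinv c y) i) (coord_vec M c (cinv c y) j))"

text \<open>A metric of class \<open>C\<^sup>2\<close> needs an atlas of class (at least) \<open>C\<^sup>3\<close>; smooth atlases are a special
  case. Signature \<open>(-,+,\<dots>,+)\<close> is expressed by a pseudo-orthonormal frame with exactly one
  timelike member; having \<open>CARD('n)\<close> members, such a frame is automatically a basis.\<close>

definition lorentzian :: "('m::topological_space, 'n::finite) spacetime \<Rightarrow> bool" where
  "lorentzian M \<longleftrightarrow>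
     (\<forall>c \<in> charts M. is_chart c) \<and> (\<Union>c \<in> charts M. cdom c) = UNIV \<and>
     (\<forall>c \<in> charts M. \<forall>d \<in> charts M. compatible 3 c d) \<and>
     (\<forall>p. \<forall>u \<in> tangent_space M p. \<forall>v \<in> tangent_space M p. met M p u v = met M p v u) \<and>
     (\<forall>p. \<forall>u \<in> tangent_space M p. \<forall>v \<in> tangent_space M p. \<forall>w \<in> tangent_space M p. \<forall>a b.
        met M p (\<lambda>c. a *\<^sub>R u c + b *\<^sub>R v c) w = a * met M p u w + b * met M p v w) \<and>
     (\<forall>p. \<exists>E :: 'n \<Rightarrow> ('m, 'n) tvector. \<exists>i0. (\<forall>i. E i \<in> tangent_space M p) \<and>
        (\<forall>i j. met M p (E i) (E j) = (if i = j then if i = i0 then -1 else 1 else 0))) \<and>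
     (\<forall>c \<in> charts M. \<forall>i j. Ck_on 2 (\<lambda>y. metric_matrix M c y $ i $ j) (cmap c ` cdom c))"

definition causal_vec :: "('m, 'n::finite) spacetime \<Rightarrow> 'm \<Rightarrow> ('m, 'n) tvector \<Rightarrow> bool" where
  "causal_vec M p v \<longleftrightarrow> v \<in> tangent_space M p \<and> v \<noteq> (\<lambda>c. 0) \<and> met M p v v \<le> 0"

definition timelike_vec :: "('m, 'n::finite) spacetime \<Rightarrow> 'm \<Rightarrow> ('m, 'n) tvector \<Rightarrow> bool" where
  "timelike_vec M p v \<longleftrightarrow> v \<in> tangent_space M p \<and> met M p v v < 0"

definition null_vec :: "('m, 'n::finite) spacetime \<Rightarrow> 'm \<Rightarrow> ('m, 'n) tvector \<Rightarrow> bool" where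
  "null_vec M p v \<longleftrightarrow> v \<in> tangent_space M p \<and> v \<noteq> (\<lambda>c. 0) \<and> met M p v v = 0"

text \<open>Meaningful for causal \<open>v\<close>.\<close>

definition future_vec :: "('m, 'n::finite) spacetime \<Rightarrow> 'm \<Rightarrow> ('m, 'n) tvector \<Rightarrow> bool" where
  "future_vec M p v \<longleftrightarrow> met M p v (torient M p) < 0"

definition time_oriented_lorentzian :: "('m::topological_space, 'n::finite) spacetime \<Rightarrow> bool" where
  "time_oriented_lorentzian M \<longleftrightarrow> lorentzian M \<and>
     continuous_vector_field M (torient M) \<and> (\<forall>p. timelike_vec M p (torient M p))"


section \<open>Curves and causal relations\<close>

definition has_velocity :: "('m, 'n::finite) spacetime \<Rightarrow> (real \<Rightarrow> 'm) \<Rightarrow> ('m, 'n) tvector \<Rightarrow>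
    real \<Rightarrow> real set \<Rightarrow> bool" where
  "has_velocity M \<gamma> v t J \<longleftrightarrow> v \<in> tangent_space M (\<gamma> t) \<and>
     (\<forall>c \<in> charts_at M (\<gamma> t). ((cmap c \<circ> \<gamma>) has_vector_derivative v c) (at t within J))"

text \<open>\<open>\<gamma>\<close> is a \<open>C\<^sup>1\<close> curve on the interval \<open>J\<close> with velocity field \<open>w\<close> (one-sided at end points).\<close>

definition C1_curve :: "('m::topological_space, 'n::finite) spacetime \<Rightarrow> (real \<Rightarrow> 'm) \<Rightarrow>
    (real \<Rightarrow> ('m, 'n) tvector) \<Rightarrow> real set \<Rightarrow> bool" where
  "C1_curve M \<gamma> w J \<longleftrightarrow> continuous_on J \<gamma> \<and> (\<forall>t \<in> J. has_velocity M \<gamma> (w t) t J) \<and>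
     (\<forall>c \<in> charts M. continuous_on {t \<in> J. \<gamma> t \<in> cdom c} (\<lambda>t. w t c))"

text \<open>\<open>\<gamma>\<close> is a future-directed piecewise \<open>C\<^sup>1\<close> curve on \<open>{a..b}\<close> whose velocities (both one-sided
  ones at the break points \<open>s i\<close>) satisfy \<open>P\<close>.\<close>

definition future_curve :: "('m::topological_space, 'n::finite) spacetime \<Rightarrow>
    ('m \<Rightarrow> ('m, 'n) tvector \<Rightarrow> bool) \<Rightarrow> (real \<Rightarrow> 'm) \<Rightarrow> real \<Rightarrow> real \<Rightarrow> bool" where
  "future_curve M P \<gamma> a b \<longleftrightarrow> (\<exists>(k::nat) (s :: nat \<Rightarrow> real).
     0 < k \<and> s 0 = a \<and> s k = b \<and>
     (\<forall>i<k. s i < s (Suc i) \<and>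
       (\<exists>w. C1_curve M \<gamma> w {s i..s (Suc i)} \<and>
          (\<forall>t \<in> {s i..s (Suc i)}. P (\<gamma> t) (w t) \<and> future_vec M (\<gamma> t) (w t)))))"

definition chron :: "('m::topological_space, 'n::finite) spacetime \<Rightarrow> 'm \<Rightarrow> 'm \<Rightarrow> bool" where
  "chron M x y \<longleftrightarrow>
     (\<exists>\<gamma> a b. future_curve M (timelike_vec M) \<gamma> a b \<and> \<gamma> a = x \<and> \<gamma> b = y)"

text \<open>Equal points count as joined by a (constant) causal curve.\<close>

definition causal_in ::
  "('m::topological_space, 'n::finite) spacetime \<Rightarrow> 'm set \<Rightarrow> 'm \<Rightarrow> 'm \<Rightarrow> bool" where
  "causal_in M U x y \<longleftrightarrow> (x = y \<and> x \<in> U) \<or>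
     (\<exists>\<gamma> a b. future_curve M (causal_vec M) \<gamma> a b \<and> \<gamma> a = x \<and> \<gamma> b = y \<and> \<gamma> ` {a..b} \<subseteq> U)"

abbreviation causal :: "('m::topological_space, 'n::finite) spacetime \<Rightarrow> 'm \<Rightarrow> 'm \<Rightarrow> bool" where
  "causal M \<equiv> causal_in M UNIV"

definition chron_future ::
  "('m::topological_space, 'n::finite) spacetime \<Rightarrow> 'm set \<Rightarrow> 'm set" where
  "chron_future M A = {y. \<exists>x \<in> A. chron M x y}"

definition achronal :: "('m::topological_space, 'n::finite) spacetime \<Rightarrow> 'm set \<Rightarrow> bool" where
  "achronal M S \<longleftrightarrow> (\<forall>x \<in> S. \<forall>y \<in> S. \<not> chron M x y)"

definition causally_closed :: "('m::topological_space, 'n::finite) spacetime \<Rightarrow> bool" where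
  "causally_closed M \<longleftrightarrow> closed {(x, y). causal M x y}"

definition strongly_causal :: "('m::topological_space, 'n::finite) spacetime \<Rightarrow> bool" where
  "strongly_causal M \<longleftrightarrow> (\<forall>p V. open V \<and> p \<in> V \<longrightarrow>
     (\<exists>U. open U \<and> p \<in> U \<and> U \<subseteq> V \<and>
        (\<forall>x \<in> U. \<forall>y \<in> U. causal M x y \<longrightarrow> causal_in M U x y)))"


section \<open>Geodesics\<close>

definition partial_deriv :: "'n \<Rightarrow> (real ^ 'n \<Rightarrow> real) \<Rightarrow> real ^ 'n::finite \<Rightarrow> real" where
  "partial_deriv i f y = frechet_derivative f (at y) (axis i 1)"

definition christoffel :: "('m, 'n::finite) spacetime \<Rightarrow> ('m, 'n) chart \<Rightarrow> real ^ 'n \<Rightarrow>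
    'n \<Rightarrow> 'n \<Rightarrow> 'n \<Rightarrow> real" where
  "christoffel M c y k i j = (1 / 2) * (\<Sum>l\<in>UNIV. matrix_inv (metric_matrix M c y) $ k $ l *
     (partial_deriv i (\<lambda>z. metric_matrix M c z $ j $ l) y
      + partial_deriv j (\<lambda>z. metric_matrix M c z $ i $ l) y
      - partial_deriv l (\<lambda>z. metric_matrix M c z $ i $ j) y))"

text \<open>\<open>\<gamma>\<close> is an affinely parametrized geodesic on the interval \<open>J\<close>, with velocity field \<open>w\<close>.\<close>

definition geodesic :: "('m::topological_space, 'n::finite) spacetime \<Rightarrow> (real \<Rightarrow> 'm) \<Rightarrow>
    (real \<Rightarrow> ('m, 'n) tvector) \<Rightarrow> real set \<Rightarrow> bool" where
  "geodesic M \<gamma> w J \<longleftrightarrow> continuous_on J \<gamma> \<and> (\<forall>t \<in> J. has_velocity M \<gamma> (w t) t J \<and>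
     (\<forall>c \<in> charts_at M (\<gamma> t). ((\<lambda>s. w s c) has_vector_derivative
        (\<chi> k. - (\<Sum>i\<in>UNIV. \<Sum>j\<in>UNIV.
            christoffel M c (cmap c (\<gamma> t)) k i j * w t c $ i * w t c $ j))) (at t within J)))"

text \<open>The interval \<open>[0, b)\<close>, where \<open>b = \<infinity>\<close> is allowed.\<close>

definition ray :: "ereal \<Rightarrow> real set" where
  "ray b = {t. 0 \<le> t \<and> ereal t < b}"

definition null_geodesic ::
  "('m::topological_space, 'n::finite) spacetime \<Rightarrow> (real \<Rightarrow> 'm) \<Rightarrow> ereal \<Rightarrow> bool" where
  "null_geodesic M \<gamma> b \<longleftrightarrow> 0 < b \<and> (\<exists>w. geodesic M \<gamma> w (ray b) \<and>
     (\<forall>t \<in> ray b. null_vec M (\<gamma> t) (w t) \<and> future_vec M (\<gamma> t) (w t)))"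

definition maximal_null_geodesic ::
  "('m::topological_space, 'n::finite) spacetime \<Rightarrow> (real \<Rightarrow> 'm) \<Rightarrow> ereal \<Rightarrow> bool" where
  "maximal_null_geodesic M \<gamma> b \<longleftrightarrow> null_geodesic M \<gamma> b \<and>
     \<not> (\<exists>\<gamma>' b' w'. b < b' \<and> geodesic M \<gamma>' w' (ray b') \<and> (\<forall>t \<in> ray b. \<gamma>' t = \<gamma> t))"

definition weakly_future_null_complete ::
  "('m::topological_space, 'n::finite) spacetime \<Rightarrow> bool" where
  "weakly_future_null_complete M \<longleftrightarrow> (\<forall>\<gamma> b. maximal_null_geodesic M \<gamma> b \<longrightarrow>
     b = \<infinity> \<or> (\<exists>t \<in> ray b. chron M (\<gamma> 0) (\<gamma> t)))"

text \<open>\<open>is_exp M p v x\<close>: \<open>v\<close> is in the domain of the exponential map at \<open>p\<close>, and \<open>exp v = x\<close>.\<close>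

definition is_exp ::
  "('m::topological_space, 'n::finite) spacetime \<Rightarrow> 'm \<Rightarrow> ('m, 'n) tvector \<Rightarrow> 'm \<Rightarrow> bool" where
  "is_exp M p v x \<longleftrightarrow>
     (\<exists>\<gamma> w. geodesic M \<gamma> w {0..1} \<and> \<gamma> 0 = p \<and> w 0 = v \<and> \<gamma> 1 = x)"


section \<open>Submanifolds\<close>

text \<open>Embedded \<open>C\<^sup>r\<close> submanifolds of dimension \<open>k\<close> without boundary, by slice charts.\<close>

definition submanifold ::
  "nat \<Rightarrow> ('m::topological_space, 'n::finite) spacetime \<Rightarrow> nat \<Rightarrow> 'm set \<Rightarrow> bool" where
  "submanifold r M k A \<longleftrightarrow> (\<forall>p \<in> A. \<exists>c L. is_chart c \<and> p \<in> cdom c \<and>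
     (\<forall>d \<in> charts M. compatible r c d) \<and> subspace L \<and> dim L = k \<and>
     cmap c ` (A \<inter> cdom c) = cmap c ` cdom c \<inter> L)"

definition tangent_of ::
  "('m::topological_space, 'n::finite) spacetime \<Rightarrow> 'm set \<Rightarrow> 'm \<Rightarrow> ('m, 'n) tvector set" where
  "tangent_of M S p = {v. \<exists>\<gamma> w \<epsilon>. 0 < \<epsilon> \<and> C1_curve M \<gamma> w {-\<epsilon><..<\<epsilon>} \<and>
     \<gamma> ` {-\<epsilon><..<\<epsilon>} \<subseteq> S \<and> \<gamma> 0 = p \<and> w 0 = v}"

definition normal_space ::
  "('m::topological_space, 'n::finite) spacetime \<Rightarrow> 'm set \<Rightarrow> 'm \<Rightarrow> ('m, 'n) tvector set" where
  "normal_space M S p = {v \<in> tangent_space M p. \<forall>u \<in> tangent_of M S p. met M p v u = 0}"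

definition spacelike :: "('m::topological_space, 'n::finite) spacetime \<Rightarrow> 'm set \<Rightarrow> bool" where
  "spacelike M S \<longleftrightarrow> (\<forall>p \<in> S. \<forall>v \<in> tangent_of M S p. v \<noteq> (\<lambda>c. 0) \<longrightarrow> 0 < met M p v v)"

definition admissible_source ::
  "('m::topological_space, 'n::finite) spacetime \<Rightarrow> 'm set \<Rightarrow> bool" where
  "admissible_source M A \<longleftrightarrow> compact A \<and> spacelike M A \<and> achronal M A \<and>
     (\<exists>k. submanifold 2 M k A \<and> k + 2 \<le> CARD('n))"


section \<open>The hypersurface and its natural gauges\<close>

definition hypersurface ::
  "('m::topological_space, 'n::finite) spacetime \<Rightarrow> 'm set \<Rightarrow> 'm set" where
  "hypersurface M A = frontier (chron_future M A)"

definition initial_points ::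
  "('m::topological_space, 'n::finite) spacetime \<Rightarrow> 'm set \<Rightarrow> 'm set" where
  "initial_points M H = {m \<in> H. \<not> (\<exists>x \<in> H. causal M x m \<and> x \<noteq> m)}"

definition final_points ::
  "('m::topological_space, 'n::finite) spacetime \<Rightarrow> 'm set \<Rightarrow> 'm set" where
  "final_points M H = {m \<in> H. \<not> (\<exists>x \<in> H. causal M m x \<and> x \<noteq> m)}"

definition regular_part ::
  "('m::topological_space, 'n::finite) spacetime \<Rightarrow> 'm set \<Rightarrow> 'm set" where
  "regular_part M H = H - (initial_points M H \<union> final_points M H)"

text \<open>\<open>M\<^sup>-(x)\<close>, the \<open>\<le>\<close>-minimum of \<open>J\<^sup>-(x) \<inter> A\<close>.\<close>

definition past_min ::
  "('m::topological_space, 'n::finite) spacetime \<Rightarrow> 'm set \<Rightarrow> 'm \<Rightarrow> 'm" where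
  "past_min M A x = (THE p. p \<in> A \<and> causal M p x \<and> (\<forall>q \<in> A. causal M q x \<longrightarrow> causal M p q))"

definition gauge_field :: "('m::topological_space, 'n::finite) spacetime \<Rightarrow> 'm set \<Rightarrow>
    ('m \<Rightarrow> ('m, 'n) tvector) \<Rightarrow> bool" where
  "gauge_field M A W \<longleftrightarrow> continuous_vector_field M W \<and>
     (\<forall>p. timelike_vec M p (W p) \<and> future_vec M p (W p)) \<and>
     (\<forall>p \<in> A. W p \<in> normal_space M A p)"

definition gauge_vec :: "('m::topological_space, 'n::finite) spacetime \<Rightarrow> 'm set \<Rightarrow>
    ('m \<Rightarrow> ('m, 'n) tvector) \<Rightarrow> 'm \<Rightarrow> ('m, 'n) tvector" where
  "gauge_vec M A W x = (let p = past_min M A x in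
     THE v. v \<in> normal_space M (initial_points M (hypersurface M A)) p \<and>
       met M p v v = 0 \<and> met M p v (W p) < 0 \<and> is_exp M p v x)"

text \<open>Only the values of \<open>G\<close> on the regular part of the hypersurface are significant.\<close>

definition natural_gauge :: "('m::topological_space, 'n::finite) spacetime \<Rightarrow> 'm set \<Rightarrow>
    ('m \<Rightarrow> real) \<Rightarrow> bool" where
  "natural_gauge M A G \<longleftrightarrow> (\<exists>W. gauge_field M A W \<and>
     (\<forall>x \<in> regular_part M (hypersurface M A).
        G x = - met M (past_min M A x) (gauge_vec M A W x) (W (past_min M A x))))"

text \<open>Continuity of the extension of \<open>G\<close> by \<open>0\<close> is required along each null generator only,
  i.e. along null geodesics that start at an initial point and then run in the regular part.\<close>

definition extends_by_zero :: "('m::topological_space, 'n::finite) spacetime \<Rightarrow> 'm set \<Rightarrow>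
    ('m \<Rightarrow> real) \<Rightarrow> bool" where
  "extends_by_zero M A G \<longleftrightarrow> (\<forall>\<gamma> b. null_geodesic M \<gamma> b \<and>
     \<gamma> 0 \<in> initial_points M (hypersurface M A) \<and>
     \<gamma> ` (ray b - {0}) \<subseteq> regular_part M (hypersurface M A) \<longrightarrow>
     ((G \<circ> \<gamma>) \<longlongrightarrow> 0) (at_right 0))"

definition proper_gauge :: "('m::topological_space, 'n::finite) spacetime \<Rightarrow> 'm set \<Rightarrow>
    ('m \<Rightarrow> real) \<Rightarrow> bool" where
  "proper_gauge M A G \<longleftrightarrow> (\<forall>K. compact K \<longrightarrow>
     compact (closure {x \<in> regular_part M (hypersurface M A). G x \<in> K}))"

end

theory Submission
  imports Defs
begin

text \<open>A point of \<open>H\<close> outside \<open>A\<close> is reached from \<open>A\<close> by an unbroken null geodesic: a causal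
  curve that cannot be varied into a timelike one satisfies, by a du Bois-Reymond argument, the
  geodesic equation up to reparametrization. Two generators ending at the same point of
  \<open>H\<close> that continues inside \<open>H\<close> coincide backwards, so along a generator issuing from
  \<open>p \<in> A\<close> at parameter \<open>e\<close> with velocity \<open>V\<close> the gauge \<open>- (t - e) * g(V, W)\<close> is an affine
  parameter.

  For (1), a bound on the gauge confines the initial vectors \<open>v\<close> with \<open>exp(v) = x\<close> to a compact
  set. The geodesic of a limit vector exists up to parameter \<open>1\<close>: otherwise weak completeness
  makes it enter the open set \<open>I\<^sup>+(A)\<close>, and by continuous dependence nearby generators would
  leave \<open>H\<close> too early. For (2), if \<open>b\<close> is finite and the geodesic stays in \<open>H\<close>, its gauge is
  bounded, so it stays in a compact set. It converges by causal closedness and antisymmetry, a Riccati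
  inequality bounds its velocity, and local existence extends it beyond \<open>b\<close>. For (3), apply the argument of (2) to \<open>A = {\<gamma> 0}\<close>.\<close>

section \<open>Calculus\<close>

text \<open>With a metric of class C^2 the Christoffel symbols are only C^1, and no Gauss lemma or
  convex neighbourhood is built. The substitute is a first-order computation in one chart: a causal
  curve is varied additively, and a negative first variation of g(v, v) makes the varied curve
  timelike. Push-up through causal segments, absence of corners, normality at the source and the
  geodesic property of unbroken causal curves are four choices of the variation field.

  Regular points matter because each has a strictly later point of H: a generator can be followed
  past x, and a corner at x is then detectable. Uniqueness backwards from x also puts all points of
  A below x on one curve, which yields their minimum.

  The compactness behind (1) is linear algebra: on the future causal cone the norm of v is at most a
  constant times -g(v, W), uniformly near each base point. Since H is described by points only
  (causally but not chronologically after A), limits of points replace limits of curves; curves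
  converge only as solutions of an ODE. Chart changes are handled by characterizing the acceleration
  weakly, through the Euler-Lagrange equation tested against all vectors.\<close>

lemma real_interval_induct:
  fixes a b :: real
  assumes "a \<le> b" and P0: "P a"
    and step: "\<And>x. a \<le> x \<Longrightarrow> x < b \<Longrightarrow> \<forall>y\<in>{a..x}. P y \<Longrightarrow> \<exists>d>x. \<forall>y. x < y \<and> y < d \<and> y \<le> b \<longrightarrow> P y"
    and lim: "\<And>x. a < x \<Longrightarrow> x \<le> b \<Longrightarrow> \<forall>y\<in>{a..<x}. P y \<Longrightarrow> P x"
  shows "\<forall>y\<in>{a..b}. P y"
proof -
  \<comment> \<open>Bisection needs a property of intervals that composes: validity up to
    \<open>s\<close> implies validity up to \<open>t\<close>.\<close>
  define Q where "Q s t \<longleftrightarrow> (a \<le> s \<longrightarrow> s \<le> t \<longrightarrow> t \<le> b \<longrightarrow> (\<forall>y\<in>{a..s}. P y) \<longrightarrow> (\<forall>y\<in>{a..t}. P y))" for s t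
  have "Q a b"
  proof (rule Bolzano[OF \<open>a \<le> b\<close>])
    fix r s t assume "Q r s" "Q s t" "r \<le> s" "s \<le> t" then show "Q r t"
      unfolding Q_def by (meson order_trans)
  next
    fix x assume x: "a \<le> x" "x \<le> b"
    show "\<exists>d>0. \<forall>s t. s \<le> x \<and> x \<le> t \<and> t - s < d \<longrightarrow> Q s t"
    proof (cases "\<forall>y\<in>{a..<x}. P y")
      case True
      then have "P x" using lim[of x] P0 x by (cases "a = x") auto
      with True have all: "\<forall>y\<in>{a..x}. P y" by (metis atLeastAtMost_iff atLeastLessThan_iff order_le_less)
      show ?thesis
      proof (cases "x = b")
        case True then show ?thesis unfolding Q_def using all by (intro exI[of _ 1]) auto
      next
        case False
        then obtain d where d: "d > x" "\<forall>y. x < y \<and> y < d \<and> y \<le> b \<longrightarrow> P y"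
          using step[of x] x all by auto
        show ?thesis
        proof (intro exI[of _ "d - x"] conjI allI impI)
          fix s t assume st: "s \<le> x \<and> x \<le> t \<and> t - s < d - x"
          show "Q s t" unfolding Q_def
          proof (intro impI ballI)
            fix y assume "t \<le> b" "y \<in> {a..t}"
            then show "P y" using all d(2) st by (cases "y \<le> x") auto
          qed
        qed (use d in auto)
      qed
    next
      case False
      then obtain y where y: "a \<le> y" "y < x" "\<not> P y" by auto
      show ?thesis
        by (rule exI[of _ "x - y"]) (use y in \<open>auto simp: Q_def\<close>)
    qed
  qed
  then show ?thesis using P0 \<open>a \<le> b\<close> unfolding Q_def by auto
qed

section \<open>Symmetry of mixed derivatives\<close>

text \<open>Two mean value theorems, the first along \<open>u\<close> for the increment in direction
  \<open>v\<close>, the second along \<open>v\<close> for \<open>fu\<close>, turn the quotient into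
  a value of \<open>fuv\<close> close to \<open>x\<close>; continuity does the rest.\<close>

lemma second_difference_limit:
  fixes f :: "'a::real_normed_vector \<Rightarrow> real"
  assumes "open S" "x \<in> S"
    and fu: "\<And>y. y \<in> S \<Longrightarrow> ((\<lambda>s. f (y + s *\<^sub>R u)) has_real_derivative fu y) (at 0)"
    and fuv: "\<And>y. y \<in> S \<Longrightarrow> ((\<lambda>s. fu (y + s *\<^sub>R v)) has_real_derivative fuv y) (at 0)"
    and cont: "continuous_on S fuv" and "e > 0"
  shows "\<exists>h0>0. \<forall>h. 0 < h \<and> h < h0 \<longrightarrow>
    \<bar>(f (x + h *\<^sub>R u + h *\<^sub>R v) - f (x + h *\<^sub>R u) - f (x + h *\<^sub>R v) + f x) / h\<^sup>2 - fuv x\<bar> < e"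
proof -
  have "isCont fuv x" using cont assms(1,2) by (simp add: continuous_on_eq_continuous_at)
  then obtain d1 where d1: "d1 > 0" "\<And>y. dist y x < d1 \<Longrightarrow> dist (fuv y) (fuv x) < e"
    using \<open>e > 0\<close> unfolding continuous_at_eps_delta dist_norm by blast
  obtain d2 where d2: "d2 > 0" "ball x d2 \<subseteq> S" using assms(1,2) openE by blast
  define d where "d = min d1 d2"
  have d: "d > 0" "ball x d \<subseteq> S" "\<And>y. y \<in> ball x d \<Longrightarrow> \<bar>fuv y - fuv x\<bar> < e"
    using d1 d2 by (auto simp: d_def dist_real_def dist_commute)
  \<comment> \<open>Below \<open>h0\<close> the parallelogram spanned at \<open>x\<close> by
    \<open>h\<close> times \<open>u\<close> and \<open>h\<close> times \<open>v\<close> stays in the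
    ball of radius \<open>d\<close>.\<close>
  define h0 where "h0 = d / (norm u + norm v + 1)"
  have h0: "h0 > 0" using d by (simp add: h0_def add_nonneg_pos)
  have inb: "x + s *\<^sub>R u + t *\<^sub>R v \<in> ball x d" if "0 \<le> s" "s \<le> h" "0 \<le> t" "t \<le> h" "h < h0" "0 < h" for s t h
  proof -
    have "norm (s *\<^sub>R u + t *\<^sub>R v) \<le> s * norm u + t * norm v"
      using that norm_triangle_ineq[of "s *\<^sub>R u" "t *\<^sub>R v"] by simp
    also have "\<dots> \<le> h * norm u + h * norm v" using that by (intro add_mono mult_right_mono) auto
    also have "\<dots> \<le> h * (norm u + norm v + 1)" using that by (simp add: algebra_simps)
    also have "\<dots> < h0 * (norm u + norm v + 1)"
      using that by (intro mult_strict_right_mono add_nonneg_pos) auto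
    also have "\<dots> = d"
    proof -
      have "norm u + norm v + 1 \<noteq> 0" by (smt (verit) norm_ge_zero)
      then show ?thesis by (simp add: h0_def)
    qed
    finally have n: "norm (s *\<^sub>R u + t *\<^sub>R v) < d" .
    have "x - (x + s *\<^sub>R u + t *\<^sub>R v) = - (s *\<^sub>R u + t *\<^sub>R v)" by (simp add: algebra_simps)
    then show ?thesis using n unfolding mem_ball dist_norm by (metis norm_minus_cancel)
  qed
  have shiftu: "((\<lambda>s. f (y + s *\<^sub>R u)) has_real_derivative fu (y + s *\<^sub>R u)) (at s)"
    if "y + s *\<^sub>R u \<in> S" for y s
  proof -
    have "((\<lambda>t. f (y + (t + s) *\<^sub>R u)) has_real_derivative fu (y + s *\<^sub>R u)) (at 0)"
      using fu[OF that] by (simp add: scaleR_add_left add.commute add.left_commute)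
    then show ?thesis
      using DERIV_shift[of "\<lambda>s. f (y + s *\<^sub>R u)" "fu (y + s *\<^sub>R u)" 0 s] by simp
  qed
  have shiftv: "((\<lambda>s. fu (y + s *\<^sub>R v)) has_real_derivative fuv (y + s *\<^sub>R v)) (at s)"
    if "y + s *\<^sub>R v \<in> S" for y s
  proof -
    have "((\<lambda>t. fu (y + (t + s) *\<^sub>R v)) has_real_derivative fuv (y + s *\<^sub>R v)) (at 0)"
      using fuv[OF that] by (simp add: scaleR_add_left add.commute add.left_commute)
    then show ?thesis
      using DERIV_shift[of "\<lambda>s. fu (y + s *\<^sub>R v)" "fuv (y + s *\<^sub>R v)" 0 s] by simp
  qed
  show ?thesis
  proof (intro exI[of _ h0] conjI allI impI h0)
    fix h assume h: "0 < h \<and> h < h0"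
    let ?g = "\<lambda>s. f (x + h *\<^sub>R v + s *\<^sub>R u) - f (x + s *\<^sub>R u)"
    have "\<exists>z. 0 < z \<and> z < h \<and> ?g h - ?g 0 = (h - 0) * (fu (x + h *\<^sub>R v + z *\<^sub>R u) - fu (x + z *\<^sub>R u))"
    proof (rule MVT2)
      fix s assume s: "0 \<le> s" "s \<le> h"
      have "x + h *\<^sub>R v + s *\<^sub>R u \<in> S" "x + s *\<^sub>R u \<in> S"
        using inb[of s h h] inb[of s h 0] s h d(2) by (auto simp: algebra_simps)
      then show "(?g has_real_derivative fu (x + h *\<^sub>R v + s *\<^sub>R u) - fu (x + s *\<^sub>R u)) (at s)"
        by (intro derivative_intros shiftu)
    qed (use h in auto)
    then obtain z where z: "0 < z" "z < h"
      "?g h - ?g 0 = h * (fu (x + h *\<^sub>R v + z *\<^sub>R u) - fu (x + z *\<^sub>R u))" by auto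
    have "\<exists>w. 0 < w \<and> w < h \<and> fu (x + z *\<^sub>R u + h *\<^sub>R v) - fu (x + z *\<^sub>R u + 0 *\<^sub>R v) = (h - 0) * fuv (x + z *\<^sub>R u + w *\<^sub>R v)"
    proof (rule MVT2)
      fix s assume s: "0 \<le> s" "s \<le> h"
      have "x + z *\<^sub>R u + s *\<^sub>R v \<in> S"
        using inb[of z h s] s h z d(2) by auto
      then show "((\<lambda>s. fu (x + z *\<^sub>R u + s *\<^sub>R v)) has_real_derivative fuv (x + z *\<^sub>R u + s *\<^sub>R v)) (at s)"
        by (rule shiftv)
    qed (use h in auto)
    then obtain w where w: "0 < w" "w < h"
      "fu (x + z *\<^sub>R u + h *\<^sub>R v) - fu (x + z *\<^sub>R u) = h * fuv (x + z *\<^sub>R u + w *\<^sub>R v)" by auto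
    have "f (x + h *\<^sub>R u + h *\<^sub>R v) - f (x + h *\<^sub>R u) - f (x + h *\<^sub>R v) + f x = h * (h * fuv (x + z *\<^sub>R u + w *\<^sub>R v))"
      using z(3) w(3) by (simp add: algebra_simps)
    then have "(f (x + h *\<^sub>R u + h *\<^sub>R v) - f (x + h *\<^sub>R u) - f (x + h *\<^sub>R v) + f x) / h\<^sup>2 = fuv (x + z *\<^sub>R u + w *\<^sub>R v)"
      using h by (simp add: power2_eq_square)
    then show "\<bar>(f (x + h *\<^sub>R u + h *\<^sub>R v) - f (x + h *\<^sub>R u) - f (x + h *\<^sub>R v) + f x) / h\<^sup>2 - fuv x\<bar> < e"
      using d(3)[OF inb[of z h w]] z w h by auto
  qed
qed

text \<open>The second difference is symmetric in \<open>u\<close> and \<open>v\<close>, so both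
  mixed derivatives are limits of the same quotient. This yields
  \<open>transition_deriv2_sym\<close>, on which the chart independence of the geodesic equation
  rests.\<close>

lemma mixed_directional_derivatives_eq:
  fixes f :: "'a::real_normed_vector \<Rightarrow> real"
  assumes "open S" "x \<in> S"
    and "\<And>y. y \<in> S \<Longrightarrow> ((\<lambda>s. f (y + s *\<^sub>R u)) has_real_derivative fu y) (at 0)"
    and "\<And>y. y \<in> S \<Longrightarrow> ((\<lambda>s. f (y + s *\<^sub>R v)) has_real_derivative fv y) (at 0)"
    and "\<And>y. y \<in> S \<Longrightarrow> ((\<lambda>s. fu (y + s *\<^sub>R v)) has_real_derivative fuv y) (at 0)"
    and "\<And>y. y \<in> S \<Longrightarrow> ((\<lambda>s. fv (y + s *\<^sub>R u)) has_real_derivative fvu y) (at 0)"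
    and "continuous_on S fuv" "continuous_on S fvu"
  shows "fuv x = fvu x"
proof (rule ccontr)
  assume "fuv x \<noteq> fvu x"
  define e where "e = \<bar>fuv x - fvu x\<bar> / 2"
  have e: "e > 0" using \<open>fuv x \<noteq> fvu x\<close> by (simp add: e_def)
  let ?D = "\<lambda>h. (f (x + h *\<^sub>R u + h *\<^sub>R v) - f (x + h *\<^sub>R u) - f (x + h *\<^sub>R v) + f x) / h\<^sup>2"
  obtain h1 where h1: "h1 > 0" "\<And>h. 0 < h \<and> h < h1 \<Longrightarrow> \<bar>?D h - fuv x\<bar> < e"
    using second_difference_limit[OF assms(1,2,3,5,7) e] by blast
  obtain h2 where h2: "h2 > 0" "\<And>h. 0 < h \<and> h < h2 \<Longrightarrow>
      \<bar>(f (x + h *\<^sub>R v + h *\<^sub>R u) - f (x + h *\<^sub>R v) - f (x + h *\<^sub>R u) + f x) / h\<^sup>2 - fvu x\<bar> < e"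
    using second_difference_limit[OF assms(1,2,4,6,8) e] by blast
  define h where "h = min h1 h2 / 2"
  have "f (x + h *\<^sub>R v + h *\<^sub>R u) - f (x + h *\<^sub>R v) - f (x + h *\<^sub>R u) + f x =
      f (x + h *\<^sub>R u + h *\<^sub>R v) - f (x + h *\<^sub>R u) - f (x + h *\<^sub>R v) + f x"
    by (simp add: algebra_simps)
  moreover have "0 < h" "h < h1" "h < h2" using h1(1) h2(1) by (auto simp: h_def)
  ultimately have "\<bar>?D h - fuv x\<bar> < e" "\<bar>?D h - fvu x\<bar> < e"
    using h1(2)[of h] h2(2)[of h] by (auto simp: algebra_simps)
  moreover have "False" if "\<bar>X - a\<bar> < \<bar>a - b\<bar> / 2" "\<bar>X - b\<bar> < \<bar>a - b\<bar> / 2" for X a b :: real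
    using that by (auto simp: abs_if split: if_splits)
  ultimately show False unfolding e_def by blast
qed

section \<open>Calculus of locally Lipschitz maps\<close>

text \<open>Local Lipschitz continuity at a point, phrased by a filter so that bounds can be combined
  with \<open>eventually_elim\<close>.\<close>

definition loclip :: "('a::metric_space \<Rightarrow> 'b::metric_space) \<Rightarrow> 'a \<Rightarrow> bool" where
  "loclip f x \<longleftrightarrow> (\<exists>L. \<forall>\<^sub>F p in nhds (x, x). dist (f (fst p)) (f (snd p)) \<le> L * dist (fst p) (snd p))"

lemma loclipE:
  assumes "loclip f x"
  obtains L r where "L > 0" "r > 0" "\<And>y z. y \<in> cball x r \<Longrightarrow> z \<in> cball x r \<Longrightarrow> dist (f y) (f z) \<le> L * dist y z"
proof -
  obtain L where "\<forall>\<^sub>F p in nhds (x, x). dist (f (fst p)) (f (snd p)) \<le> L * dist (fst p) (snd p)"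
    using assms unfolding loclip_def by blast
  then obtain d where d: "d > 0" "\<And>p. dist p (x,x) < d \<Longrightarrow> dist (f (fst p)) (f (snd p)) \<le> L * dist (fst p) (snd p)"
    unfolding eventually_nhds_metric by blast
  have *: "dist (f y) (f z) \<le> max L 1 * dist y z" if "y \<in> cball x (d/3)" "z \<in> cball x (d/3)" for y z
  proof -
    have "dist (y, z) (x, x) \<le> dist y x + dist z x"
      unfolding dist_Pair_Pair by (rule sqrt_sum_squares_le_sum) auto
    then have "dist (y,z) (x,x) < d" using that d(1) by (auto simp: dist_commute)
    from d(2)[OF this] have "dist (f y) (f z) \<le> L * dist y z" by simp
    also have "\<dots> \<le> max L 1 * dist y z" by (intro mult_right_mono) auto
    finally show ?thesis .
  qed
  show ?thesis by (rule that[of "max L 1" "d/3"]) (use d * in auto)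
qed

lemma loclipI:
  assumes "r > 0" "\<And>y z. y \<in> ball x r \<Longrightarrow> z \<in> ball x r \<Longrightarrow> dist (f y) (f z) \<le> L * dist y z"
  shows "loclip f x"
  unfolding loclip_def
proof (intro exI)
  have "\<forall>\<^sub>F p in nhds (x, x). p \<in> ball x r \<times> ball x r"
    by (rule eventually_nhds_in_open) (use assms(1) in \<open>auto intro: open_Times\<close>)
  then show "\<forall>\<^sub>F p in nhds (x, x). dist (f (fst p)) (f (snd p)) \<le> L * dist (fst p) (snd p)"
    by eventually_elim (use assms in auto)
qed

lemma loclip_isCont: "loclip f x \<Longrightarrow> isCont f x"
proof -
  assume "loclip f x"
  then obtain L r where L: "L > 0" "r > 0" "\<And>y z. y \<in> cball x r \<Longrightarrow> z \<in> cball x r \<Longrightarrow> dist (f y) (f z) \<le> L * dist y z"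
    by (rule loclipE) blast
  show ?thesis unfolding continuous_at_eps_delta
  proof (intro allI impI)
    fix e :: real assume "e > 0"
    then show "\<exists>d>0. \<forall>y. dist y x < d \<longrightarrow> dist (f y) (f x) < e"
    proof (intro exI[of _ "min r (e / L)"] conjI allI impI)
      fix y assume "dist y x < min r (e / L)"
      then have "dist (f y) (f x) \<le> L * dist y x" "dist y x < e / L" using L by (auto simp: dist_commute)
      then show "dist (f y) (f x) < e" using L(1) by (simp add: field_simps)
    qed (use L in auto)
  qed
qed

lemma loclip_const [intro]: "loclip (\<lambda>_. c) x"
  by (rule loclipI[of 1 _ _ 0]) auto

lemma loclip_bounded_linear: "bounded_linear f \<Longrightarrow> loclip f x"
proof -
  assume "bounded_linear f"
  then interpret bounded_linear f .
  obtain K where "\<And>x. norm (f x) \<le> norm x * K" using bounded by blast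
  then show ?thesis
    by (intro loclipI[of 1 _ _ K]) (auto simp: dist_norm mult.commute simp flip: diff)
qed

lemma loclip_compose:
  assumes "loclip f (g x)" "loclip g x"
  shows "loclip (\<lambda>y. f (g y)) x"
proof -
  obtain L where L: "\<forall>\<^sub>F p in nhds (g x, g x). dist (f (fst p)) (f (snd p)) \<le> L * dist (fst p) (snd p)"
    using assms unfolding loclip_def by blast
  obtain K where K: "\<forall>\<^sub>F p in nhds (x, x). dist (g (fst p)) (g (snd p)) \<le> K * dist (fst p) (snd p)"
    using assms unfolding loclip_def by blast
  have c: "isCont g x" using assms loclip_isCont by blast
  have "((\<lambda>p. (g (fst p), g (snd p))) \<longlongrightarrow> (g x, g x)) (nhds (x, x))"
    using c by (intro tendsto_Pair)
      (auto intro!: tendsto_compose_filtermap filterlim_compose[of g "nhds (g x)" "nhds x"]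
         filterlim_fst filterlim_snd simp: nhds_prod isCont_def tendsto_at_iff_tendsto_nhds)
  then have "\<forall>\<^sub>F p in nhds (x, x). dist (f (g (fst p))) (f (g (snd p))) \<le> L * dist (g (fst p)) (g (snd p))"
    using L unfolding filterlim_iff by (auto dest!: spec)
  then have "\<forall>\<^sub>F p in nhds (x, x). dist (f (g (fst p))) (f (g (snd p))) \<le> (max L 0 * K) * dist (fst p) (snd p)"
    using K
  proof eventually_elim
    case (elim p)
    \<comment> \<open>\<open>L\<close> may be negative; only its nonnegative part can be combined
      with the bound for \<open>g\<close>.\<close>
    have "L * dist (g (fst p)) (g (snd p)) \<le> max L 0 * dist (g (fst p)) (g (snd p))"
      by (intro mult_right_mono) auto
    also have "\<dots> \<le> max L 0 * (K * dist (fst p) (snd p))" using elim by (intro mult_left_mono) auto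
    finally show ?case using elim by (simp add: mult.assoc)
  qed
  then show ?thesis unfolding loclip_def by blast
qed

lemma loclip_add:
  fixes f g :: "'a::metric_space \<Rightarrow> 'b::real_normed_vector"
  assumes "loclip f x" "loclip g x"
  shows "loclip (\<lambda>y. f y + g y) x"
proof -
  obtain L K where L: "\<forall>\<^sub>F p in nhds (x, x). dist (f (fst p)) (f (snd p)) \<le> L * dist (fst p) (snd p)"
     "\<forall>\<^sub>F p in nhds (x, x). dist (g (fst p)) (g (snd p)) \<le> K * dist (fst p) (snd p)"
    using assms unfolding loclip_def by blast
  have "\<forall>\<^sub>F p in nhds (x, x). dist (f (fst p) + g (fst p)) (f (snd p) + g (snd p)) \<le> (L + K) * dist (fst p) (snd p)"
    using L
  proof eventually_elim
    case (elim p)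
    then show ?case using dist_triangle_add[of "f (fst p)" "g (fst p)" "f (snd p)" "g (snd p)"]
      by (simp add: algebra_simps)
  qed
  then show ?thesis unfolding loclip_def by blast
qed

lemma loclip_mult:
  fixes f g :: "'a::metric_space \<Rightarrow> real"
  assumes "loclip f x" "loclip g x"
  shows "loclip (\<lambda>y. f y * g y) x"
proof -
  obtain L K where L: "\<forall>\<^sub>F p in nhds (x, x). dist (f (fst p)) (f (snd p)) \<le> L * dist (fst p) (snd p)"
     "\<forall>\<^sub>F p in nhds (x, x). dist (g (fst p)) (g (snd p)) \<le> K * dist (fst p) (snd p)"
    using assms unfolding loclip_def by blast
  have b: "\<forall>\<^sub>F y in nhds x. \<bar>h y\<bar> < \<bar>h x\<bar> + 1" if "loclip h x" for h :: "'a \<Rightarrow> real"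
  proof -
    have "((\<lambda>y. \<bar>h y\<bar>) \<longlongrightarrow> \<bar>h x\<bar>) (nhds x)"
      using loclip_isCont[OF that] unfolding isCont_def tendsto_at_iff_tendsto_nhds by (rule tendsto_rabs)
    then show ?thesis by (rule order_tendstoD) simp
  qed
  have f1: "\<forall>\<^sub>F p in nhds (x, x). \<bar>f (fst p)\<bar> < \<bar>f x\<bar> + 1"
    unfolding nhds_prod by (rule eventually_compose_filterlim[OF b[OF assms(1)] filterlim_fst])
  have g1: "\<forall>\<^sub>F p in nhds (x, x). \<bar>g (snd p)\<bar> < \<bar>g x\<bar> + 1"
    unfolding nhds_prod by (rule eventually_compose_filterlim[OF b[OF assms(2)] filterlim_snd])
  have "\<forall>\<^sub>F p in nhds (x, x). dist (f (fst p) * g (fst p)) (f (snd p) * g (snd p)) \<le>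
     ((\<bar>f x\<bar> + 1) * K + (\<bar>g x\<bar> + 1) * L) * dist (fst p) (snd p)"
    using L f1 g1
  proof eventually_elim
    case (elim p)
    have "f (fst p) * g (fst p) - f (snd p) * g (snd p) =
       f (fst p) * (g (fst p) - g (snd p)) + g (snd p) * (f (fst p) - f (snd p))"
      by (simp add: algebra_simps)
    then have "dist (f (fst p) * g (fst p)) (f (snd p) * g (snd p)) \<le>
       \<bar>f (fst p)\<bar> * dist (g (fst p)) (g (snd p)) + \<bar>g (snd p)\<bar> * dist (f (fst p)) (f (snd p))"
      unfolding dist_real_def by (metis abs_mult abs_triangle_ineq)
    also have "\<dots> \<le> (\<bar>f x\<bar> + 1) * (K * dist (fst p) (snd p)) + (\<bar>g x\<bar> + 1) * (L * dist (fst p) (snd p))"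
      using elim by (intro add_mono mult_mono) auto
    finally show ?case by (simp add: algebra_simps)
  qed
  then show ?thesis unfolding loclip_def by blast
qed

lemma loclip_sum:
  fixes f :: "'i \<Rightarrow> 'a::metric_space \<Rightarrow> 'b::real_normed_vector"
  assumes "\<And>i. i \<in> I \<Longrightarrow> loclip (f i) x"
  shows "loclip (\<lambda>y. \<Sum>i\<in>I. f i y) x"
  using assms by (induction I rule: infinite_finite_induct) (auto intro: loclip_add)

lemma loclip_prod:
  fixes f :: "'i \<Rightarrow> 'a::metric_space \<Rightarrow> real"
  assumes "\<And>i. i \<in> I \<Longrightarrow> loclip (f i) x"
  shows "loclip (\<lambda>y. \<Prod>i\<in>I. f i y) x"
  using assms by (induction I rule: infinite_finite_induct) (auto intro: loclip_mult)

lemma loclip_inverse: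
  assumes "(c::real) \<noteq> 0" shows "loclip inverse c"
proof (rule loclipI[of "\<bar>c\<bar>/2" _ _ "4 / c\<^sup>2"])
  fix y z assume "y \<in> ball c (\<bar>c\<bar>/2)" "z \<in> ball c (\<bar>c\<bar>/2)"
  then have "\<bar>c - y\<bar> * 2 < \<bar>c\<bar>" "\<bar>c - z\<bar> * 2 < \<bar>c\<bar>" by (auto simp: dist_real_def)
  then have yz: "\<bar>y\<bar> > \<bar>c\<bar>/2" "\<bar>z\<bar> > \<bar>c\<bar>/2"
    by (auto simp: abs_if split: if_splits)
  then have n: "y \<noteq> 0" "z \<noteq> 0" by auto
  \<comment> \<open>Both points keep at least half the modulus of \<open>c\<close>; this is the
    origin of the constant \<open>4 / c\<^sup>2\<close>.\<close>
  have "\<bar>c\<bar>/2 * (\<bar>c\<bar>/2) \<le> \<bar>y\<bar> * \<bar>z\<bar>" using yz by (intro mult_mono) auto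
  then have c: "c\<^sup>2 / 4 \<le> \<bar>y * z\<bar>" by (simp add: abs_mult power2_eq_square)
  have "dist (inverse y) (inverse z) = \<bar>(z - y) / (y * z)\<bar>" unfolding dist_real_def
    using n by (simp add: field_simps)
  also have "\<dots> = dist y z / \<bar>y * z\<bar>" by (simp add: dist_real_def abs_minus_commute)
  also have "\<dots> \<le> dist y z / (c\<^sup>2/4)" using c assms n by (intro divide_left_mono mult_pos_pos) auto
  finally show "dist (inverse y) (inverse z) \<le> 4 / c\<^sup>2 * dist y z" by (simp add: mult.commute)
qed (use assms in auto)

lemma loclip_divide:
  fixes f g :: "'a::metric_space \<Rightarrow> real"
  assumes "loclip f x" "loclip g x" "g x \<noteq> 0"
  shows "loclip (\<lambda>y. f y / g y) x"
  unfolding divide_inverse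
  by (intro loclip_mult assms loclip_compose[of inverse g] loclip_inverse)

lemma loclip_minus:
  fixes f :: "'a::metric_space \<Rightarrow> 'b::real_normed_vector"
  shows "loclip f x \<Longrightarrow> loclip (\<lambda>y. - f y) x"
  unfolding loclip_def by (simp add: dist_norm norm_minus_commute)

lemma loclip_diff:
  fixes f g :: "'a::metric_space \<Rightarrow> 'b::real_normed_vector"
  assumes "loclip f x" "loclip g x" shows "loclip (\<lambda>y. f y - g y) x"
  using loclip_add[OF assms(1) loclip_minus[OF assms(2)]] by simp

lemma loclip_Pair:
  assumes "loclip f x" "loclip g x" shows "loclip (\<lambda>y. (f y, g y)) x"
proof -
  obtain L K where L: "\<forall>\<^sub>F p in nhds (x, x). dist (f (fst p)) (f (snd p)) \<le> L * dist (fst p) (snd p)"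
     "\<forall>\<^sub>F p in nhds (x, x). dist (g (fst p)) (g (snd p)) \<le> K * dist (fst p) (snd p)"
    using assms unfolding loclip_def by blast
  have "\<forall>\<^sub>F p in nhds (x, x). dist (f (fst p), g (fst p)) (f (snd p), g (snd p)) \<le> (L + K) * dist (fst p) (snd p)"
    using L
  proof eventually_elim
    case (elim p)
    have "dist (f (fst p), g (fst p)) (f (snd p), g (snd p)) \<le> dist (f (fst p)) (f (snd p)) + dist (g (fst p)) (g (snd p))"
      unfolding dist_Pair_Pair by (rule sqrt_sum_squares_le_sum) auto
    then show ?case using elim by (simp add: algebra_simps)
  qed
  then show ?thesis unfolding loclip_def by blast
qed

lemma loclip_vec:
  fixes f :: "'a::metric_space \<Rightarrow> real ^ 'n"
  assumes "\<And>i. loclip (\<lambda>y. f y $ i) x" shows "loclip f x"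
proof -
  have 1: "loclip (\<lambda>y. (f y $ i) *\<^sub>R (axis i 1 :: real^'n)) x" for i
    by (rule loclip_compose[of "\<lambda>r. r *\<^sub>R axis i 1" "\<lambda>y. f y $ i"])
      (auto intro: assms loclip_bounded_linear bounded_linear_scaleR_left)
  have "(\<lambda>y. \<Sum>i\<in>UNIV. (f y $ i) *\<^sub>R (axis i 1 :: real^'n)) = f"
    by (rule ext) (simp only: basis_expansion flip: scalar_mult_eq_scaleR)
  then show ?thesis using loclip_sum[of UNIV "\<lambda>i y. (f y $ i) *\<^sub>R (axis i 1 :: real^'n)" x] 1 by simp
qed

lemma loclip_component:
  fixes f :: "'a::metric_space \<Rightarrow> real ^ 'n"
  assumes "loclip f x" shows "loclip (\<lambda>y. f y $ i) x"
  by (rule loclip_compose[OF loclip_bounded_linear assms]) (rule bounded_linear_vec_nth)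

lemma loclip_det:
  fixes A :: "'a::metric_space \<Rightarrow> real ^ 'n ^ 'n"
  assumes "\<And>i j. loclip (\<lambda>y. A y $ i $ j) x" shows "loclip (\<lambda>y. det (A y)) x"
  unfolding det_def by (intro loclip_sum loclip_mult loclip_prod assms loclip_const)

text \<open>\<open>Ck_on\<close> speaks of one constant direction at a time. Summing over a basis
  bounds the operator norm of the derivative on a closed ball, and convexity of the ball allows the
  mean value inequality.\<close>

lemma loclip_C1:
  fixes f :: "'a::euclidean_space \<Rightarrow> real"
  assumes "open S" "x \<in> S" "f differentiable_on S"
    and cont: "\<And>v. continuous_on S (\<lambda>y. frechet_derivative f (at y) v)"
  shows "loclip f x"
proof -
  obtain r where r: "r > 0" "cball x r \<subseteq> S" using assms open_contains_cball by blast
  have der: "(f has_derivative frechet_derivative f (at y)) (at y)" if "y \<in> S" for y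
    using assms(1,3) that at_within_open differentiable_on_def frechet_derivative_works by metis
  have "continuous_on (cball x r) (\<lambda>y. \<Sum>b\<in>Basis. \<bar>frechet_derivative f (at y) b\<bar>)"
    by (intro continuous_intros continuous_on_subset[OF cont r(2)])
  then have "compact ((\<lambda>y. \<Sum>b\<in>Basis. \<bar>frechet_derivative f (at y) b\<bar>) ` cball x r)"
    by (intro compact_continuous_image) auto
  then have "bounded ((\<lambda>y. \<Sum>b\<in>Basis. \<bar>frechet_derivative f (at y) b\<bar>) ` cball x r)"
    by (rule compact_imp_bounded)
  then obtain B where "\<forall>z\<in>(\<lambda>y. \<Sum>b\<in>Basis. \<bar>frechet_derivative f (at y) b\<bar>) ` cball x r. norm z \<le> B"
    unfolding bounded_iff by blast
  then have B: "(\<Sum>b\<in>Basis. \<bar>frechet_derivative f (at y) b\<bar>) \<le> B" if "y \<in> cball x r" for y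
    using that by fastforce
  have on: "onorm (frechet_derivative f (at y)) \<le> B" if "y \<in> cball x r" for y
  proof (rule onorm_bound)
    interpret bounded_linear "frechet_derivative f (at y)"
      using der[of y] that r(2) has_derivative_bounded_linear by blast
    have s: "(\<Sum>b\<in>Basis. \<bar>frechet_derivative f (at y) b\<bar>) \<le> B" by (rule B[OF that])
    then show "B \<ge> 0" by (meson abs_ge_zero order_trans sum_nonneg)
    fix v
    have "frechet_derivative f (at y) v = frechet_derivative f (at y) (\<Sum>b\<in>Basis. (v \<bullet> b) *\<^sub>R b)"
      by (simp add: euclidean_representation)
    also have "\<dots> = (\<Sum>b\<in>Basis. (v \<bullet> b) * frechet_derivative f (at y) b)" by (simp add: sum scale)
    finally have "norm (frechet_derivative f (at y) v) \<le> (\<Sum>b\<in>Basis. \<bar>v \<bullet> b\<bar> * \<bar>frechet_derivative f (at y) b\<bar>)"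
      by (auto intro!: order_trans[OF sum_abs] simp: abs_mult)
    also have "\<dots> \<le> (\<Sum>b\<in>Basis. norm v * \<bar>frechet_derivative f (at y) b\<bar>)"
      by (intro sum_mono mult_right_mono Basis_le_norm) auto
    also have "\<dots> \<le> B * norm v" unfolding sum_distrib_left[symmetric]
      using s by (metis mult.commute mult_left_mono norm_ge_zero)
    finally show "norm (frechet_derivative f (at y) v) \<le> B * norm v" .
  qed
  show ?thesis
  proof (rule loclipI[OF r(1)])
    fix y z assume yz: "y \<in> ball x r" "z \<in> ball x r"
    have "norm (f y - f z) \<le> B * norm (y - z)"
      by (rule differentiable_bound[of "cball x r" f "\<lambda>y. frechet_derivative f (at y)"])
        (use yz r on in \<open>auto intro!: has_derivative_at_withinI der\<close>)
    then show "dist (f y) (f z) \<le> B * dist y z" by (simp add: dist_norm)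
  qed
qed

section \<open>Ordinary differential equations: local existence and Gronwall's inequality\<close>

text \<open>Banach's fixed point theorem for the integral equation. The point of the formulation is
  the uniformity: a single time span \<open>e\<close> serves all initial values near
  \<open>z0\<close>.\<close>

lemma picard_local:
  fixes f :: "'a::euclidean_space \<Rightarrow> 'a"
  assumes "loclip f z0" "0 < R"
  shows "\<exists>e>0. \<exists>r>0. \<forall>z\<in>cball z0 r. \<exists>x. x 0 = z \<and>
    (\<forall>t\<in>{0..e}. x t \<in> cball z0 R \<and> (x has_vector_derivative f (x t)) (at t within {0..e}))"
proof -
  obtain L R1 where L: "L > 0" "R1 > 0" "\<And>y z. y \<in> cball z0 R1 \<Longrightarrow> z \<in> cball z0 R1 \<Longrightarrow> dist (f y) (f z) \<le> L * dist y z"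
    using assms(1) by (rule loclipE) blast
  \<comment> \<open>Within \<open>S\<close> the solution is still inside the prescribed ball and
    \<open>f\<close> is Lipschitz.\<close>
  define S where "S = min R R1"
  have S: "S > 0" "S \<le> R" "S \<le> R1" using assms L by (auto simp: S_def)
  define C where "C = cball z0 S"
  have lip: "dist (f y) (f z) \<le> L * dist y z" if "y \<in> C" "z \<in> C" for y z
    using L(3)[of y z] that S by (auto simp: C_def)
  have cf: "continuous_on C f"
    by (rule lipschitz_on_continuous_on[of L]) (use lip L in \<open>auto intro: lipschitz_onI\<close>)
  define K where "K = norm (f z0) + L * S + 1"
  have K: "K > 0" using L S by (simp add: K_def add_nonneg_pos)
  have fK: "norm (f y) \<le> K" if "y \<in> C" for y
  proof -
    have "z0 \<in> C" using S by (simp add: C_def)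
    have "norm (f y) \<le> norm (f z0) + dist (f y) (f z0)" by (metis dist_commute dist_norm norm_triangle_sub)
    also have "dist (f y) (f z0) \<le> L * dist y z0" using lip[OF that \<open>z0 \<in> C\<close>] .
    also have "L * dist y z0 \<le> L * S" using that L by (intro mult_left_mono) (auto simp: C_def dist_commute)
    finally show ?thesis by (simp add: K_def)
  qed
  \<comment> \<open>The first bound keeps the integral below S/2, for initial values that are
    themselves within S/2 of \<open>z0\<close>; the second makes the Picard operator a contraction
    with factor 1/2.\<close>
  define e where "e = min (S / (2*K)) (1 / (2*L))"
  have e: "e > 0" "e * K \<le> S / 2" "e * L \<le> 1/2"
    using S K L by (auto simp: e_def min_def field_simps)
  \<comment> \<open>Clamping the time lets the operator act on bounded continuous functions on the
    whole line, a complete space.\<close>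
  define cl where "cl t = max 0 (min e t)" for t :: real
  have cl: "0 \<le> cl t" "cl t \<le> e" "t \<in> {0..e} \<Longrightarrow> cl t = t" for t using e by (auto simp: cl_def)
  have ccl: "continuous_on UNIV cl" unfolding cl_def by (intro continuous_intros)
  have *: "\<exists>x. x 0 = z \<and> (\<forall>t\<in>{0..e}. x t \<in> C \<and> (x has_vector_derivative f (x t)) (at t within {0..e}))"
    if z: "z \<in> cball z0 (S/2)" for z
  proof -
    let ?S = "PiC UNIV (\<lambda>_::real. C)"
    define J where "J \<phi> t = integral {0..t} (\<lambda>s. f (apply_bcontfun \<phi> s))" for \<phi> :: "real \<Rightarrow>\<^sub>C 'a" and t
    define F where "F \<phi> t = z + J \<phi> (cl t)" for \<phi> t
    have cphi: "continuous_on A (\<lambda>s. f (apply_bcontfun \<phi> s))" if "\<phi> \<in> ?S" for \<phi> A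
    proof (rule continuous_on_compose2[OF cf])
      show "(apply_bcontfun \<phi>) ` A \<subseteq> C" using that by (auto simp: mem_PiC_iff)
    qed auto
    have intg: "(\<lambda>s. f (apply_bcontfun \<phi> s)) integrable_on {u..v}" if "\<phi> \<in> ?S" for \<phi> u v
      by (intro integrable_continuous_interval cphi that)
    have Jb: "norm (J \<phi> (cl t)) \<le> S / 2" if "\<phi> \<in> ?S" for \<phi> t
    proof -
      have "norm (J \<phi> (cl t)) \<le> K * (cl t - 0)" unfolding J_def
        by (intro integral_bound cphi that fK) (use that cl in \<open>auto simp: mem_PiC_iff\<close>)
      also have "\<dots> \<le> e * K" using cl[of t] K by (simp add: mult.commute)
      finally show ?thesis using e by simp
    qed
    have cF: "continuous_on UNIV (F \<phi>)" if "\<phi> \<in> ?S" for \<phi>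
    proof -
      have "continuous_on {0..e} (J \<phi>)" unfolding J_def
        by (intro indefinite_integral_continuous_1 intg that)
      then have "continuous_on UNIV (\<lambda>t. J \<phi> (cl t))"
        by (rule continuous_on_compose2[OF _ ccl]) (use cl in auto)
      then show ?thesis unfolding F_def by (intro continuous_intros)
    qed
    have FC: "F \<phi> t \<in> C" if "\<phi> \<in> ?S" for \<phi> t
    proof -
      have "dist z0 (F \<phi> t) \<le> dist z0 z + norm (J \<phi> (cl t))"
        unfolding F_def by (metis add_diff_cancel_left' dist_commute dist_norm dist_triangle)
      then show ?thesis using z Jb[OF that, of t] by (simp add: C_def)
    qed
    have bF: "F \<phi> \<in> bcontfun" if "\<phi> \<in> ?S" for \<phi>
    proof (rule bcontfun_normI[OF cF[OF that]])
      fix t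
      have "norm (F \<phi> t) \<le> norm z0 + dist z0 (F \<phi> t)" by (metis dist_commute dist_norm norm_triangle_sub)
      then show "norm (F \<phi> t) \<le> norm z0 + S" using FC[OF that, of t] by (simp add: C_def)
    qed
    have app: "apply_bcontfun (Bcontfun (F \<phi>)) = F \<phi>" if "\<phi> \<in> ?S" for \<phi>
      using bF[OF that] by (rule Bcontfun_inverse)
    have "\<exists>!\<phi>\<in>?S. Bcontfun (F \<phi>) = \<phi>"
    proof (rule Banach_fix[where c = "1/2"])
      show "complete ?S" by (intro complete_eq_closed[THEN iffD2] closed_PiC) (simp add: C_def)
      have "const_bcontfun z0 \<in> ?S" using S by (simp add: mem_PiC_iff C_def)
      then show "?S \<noteq> {}" by blast
      show "(\<lambda>\<phi>. Bcontfun (F \<phi>)) ` ?S \<subseteq> ?S" using FC app by (auto simp: mem_PiC_iff)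
      fix \<phi> \<psi> assume pp: "\<phi> \<in> ?S" "\<psi> \<in> ?S"
      show "dist (Bcontfun (F \<phi>)) (Bcontfun (F \<psi>)) \<le> 1/2 * dist \<phi> \<psi>"
      proof (rule dist_bound)
        fix t
        have "dist (F \<phi> t) (F \<psi> t) = norm (integral {0..cl t} (\<lambda>s. f (\<phi> s) - f (\<psi> s)))"
          unfolding F_def J_def dist_norm using integral_diff[OF intg[OF pp(1)] intg[OF pp(2)], of 0 "cl t"] by simp
        also have "\<dots> \<le> (L * dist \<phi> \<psi>) * (cl t - 0)"
        proof (intro integral_bound continuous_intros cphi pp cl)
          fix s
          have "norm (f (\<phi> s) - f (\<psi> s)) \<le> L * dist (\<phi> s) (\<psi> s)"
            using lip[of "\<phi> s" "\<psi> s"] pp by (auto simp: mem_PiC_iff dist_norm)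
          also have "\<dots> \<le> L * dist \<phi> \<psi>" using L by (intro mult_left_mono dist_bounded) auto
          finally show "norm (f (\<phi> s) - f (\<psi> s)) \<le> L * dist \<phi> \<psi>" .
        qed
        also have "\<dots> \<le> (L * dist \<phi> \<psi>) * e" using cl[of t] L by (intro mult_left_mono) auto
        also have "\<dots> = (e * L) * dist \<phi> \<psi>" by simp
        also have "\<dots> \<le> 1/2 * dist \<phi> \<psi>" using e by (intro mult_right_mono) auto
        finally show "dist (Bcontfun (F \<phi>) t) (Bcontfun (F \<psi>) t) \<le> 1/2 * dist \<phi> \<psi>"
          using app pp by simp
      qed
    qed auto
    then obtain \<phi> where phi: "\<phi> \<in> ?S" "Bcontfun (F \<phi>) = \<phi>" by blast
    then have "apply_bcontfun \<phi> = F \<phi>" using app[OF phi(1)] by simp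
    then have eq: "apply_bcontfun \<phi> t = z + J \<phi> (cl t)" for t by (metis F_def)
    have J0: "J \<phi> 0 = 0" by (simp add: J_def)
    show ?thesis
    proof (intro exI[of _ "apply_bcontfun \<phi>"] conjI ballI)
      show "apply_bcontfun \<phi> 0 = z" using cl(3)[of 0] e J0 by (simp add: eq)
      fix t assume t: "t \<in> {0..e}"
      show "apply_bcontfun \<phi> t \<in> C" using phi by (auto simp: mem_PiC_iff)
      have "(J \<phi> has_vector_derivative f (\<phi> t)) (at t within {0..e})" unfolding J_def
        by (rule integral_has_vector_derivative[OF cphi[OF phi(1)] t])
      then have d: "((\<lambda>s. z + J \<phi> s) has_vector_derivative f (\<phi> t)) (at t within {0..e})"
        by (auto intro: derivative_eq_intros)
      show "(apply_bcontfun \<phi> has_vector_derivative f (\<phi> t)) (at t within {0..e})"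
        by (rule has_vector_derivative_transform[OF t _ d]) (simp add: eq cl(3))
    qed
  qed
  have "\<exists>x. x 0 = z \<and> (\<forall>t\<in>{0..e}. x t \<in> cball z0 R \<and> (x has_vector_derivative f (x t)) (at t within {0..e}))"
    if z: "z \<in> cball z0 (S/2)" for z
  proof -
    obtain x where x: "x 0 = z"
      "\<And>t. t \<in> {0..e} \<Longrightarrow> x t \<in> C \<and> (x has_vector_derivative f (x t)) (at t within {0..e})"
      using *[OF z] by blast
    moreover have "x t \<in> cball z0 R" if "t \<in> {0..e}" for t using x(2)[OF that] S(2) by (auto simp: C_def)
    ultimately show ?thesis by (intro exI[of _ x]) (auto simp: C_def)
  qed
  then show ?thesis using e(1) S(1) by (metis half_gt_zero)
qed

text \<open>The squared distance D satisfies |D'| <= 2 L D, so exp(-2 L r) D is nonincreasing and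
  exp(2 L r) D is nondecreasing. Both directions are used: geodesics are compared forwards and
  backwards in time.\<close>

lemma gronwall_right:
  fixes y z :: "real \<Rightarrow> 'a::real_inner"
  assumes "s \<le> t"
    and y: "\<And>r. r \<in> {s..t} \<Longrightarrow> (y has_vector_derivative y' r) (at r within {s..t})"
    and z: "\<And>r. r \<in> {s..t} \<Longrightarrow> (z has_vector_derivative z' r) (at r within {s..t})"
    and L: "\<And>r. r \<in> {s..t} \<Longrightarrow> norm (y' r - z' r) \<le> L * norm (y r - z r)"
  shows "norm (y t - z t) \<le> exp (L * (t - s)) * norm (y s - z s)"
    and "norm (y s - z s) \<le> exp (L * (t - s)) * norm (y t - z t)"
proof -
  let ?D = "\<lambda>r. (y r - z r) \<bullet> (y r - z r)"
  let ?D' = "\<lambda>r. 2 * ((y r - z r) \<bullet> (y' r - z' r))"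
  have dd: "((\<lambda>r. y r - z r) has_vector_derivative (y' r - z' r)) (at r within {s..t})" if "r \<in> {s..t}" for r
    by (intro has_vector_derivative_diff y z that)
  have D: "(?D has_real_derivative ?D' r) (at r within {s..t})" if "r \<in> {s..t}" for r
    using bounded_bilinear.has_vector_derivative[OF bounded_bilinear_inner dd[OF that] dd[OF that]]
    by (simp add: has_real_derivative_iff_has_vector_derivative inner_commute)
  have bd: "\<bar>?D' r\<bar> \<le> 2 * L * ?D r" if "r \<in> {s..t}" for r
  proof -
    have "\<bar>(y r - z r) \<bullet> (y' r - z' r)\<bar> \<le> norm (y r - z r) * norm (y' r - z' r)"
      by (rule Cauchy_Schwarz_ineq2)
    also have "\<dots> \<le> norm (y r - z r) * (L * norm (y r - z r))"
      by (intro mult_left_mono L that) auto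
    also have "\<dots> = L * ?D r" by (simp add: power2_norm_eq_inner[symmetric] power2_eq_square)
    finally show ?thesis by simp
  qed
  have cD: "continuous_on {s..t} ?D"
    using D by (meson DERIV_continuous continuous_on_eq_continuous_within)
  have Di: "(?D has_real_derivative ?D' r) (at r)" if "s < r" "r < t" for r
    using D[of r] that at_within_Icc_at[of s r t] by auto
  have 1: "exp (- (2*L) * t) * ?D t \<le> exp (- (2*L) * s) * ?D s"
    proof (rule DERIV_nonpos_imp_decreasing_open[where f = "\<lambda>r. exp (- (2*L) * r) * ?D r", OF \<open>s \<le> t\<close>])
      fix r assume r: "s < r" "r < t"
      have "((\<lambda>r. exp (- (2*L) * r) * ?D r) has_real_derivative
         exp (- (2*L) * r) * (?D' r - 2 * L * ?D r)) (at r)"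
        by (rule derivative_eq_intros Di r refl | simp add: algebra_simps)+
      moreover have "exp (- (2*L) * r) * (?D' r - 2 * L * ?D r) \<le> 0"
        using bd[of r] r by (intro mult_nonneg_nonpos) auto
      ultimately show "\<exists>v. ((\<lambda>r. exp (- (2*L) * r) * ?D r) has_real_derivative v) (at r) \<and> v \<le> 0" by blast
    next
      show "continuous_on {s..t} (\<lambda>r. exp (- (2*L) * r) * ?D r)" by (intro continuous_intros cD)
    qed
  have 2: "exp (2*L * s) * ?D s \<le> exp (2*L * t) * ?D t"
    proof (rule DERIV_nonneg_imp_increasing_open[where f = "\<lambda>r. exp (2*L * r) * ?D r", OF \<open>s \<le> t\<close>])
      fix r assume r: "s < r" "r < t"
      have "((\<lambda>r. exp (2*L * r) * ?D r) has_real_derivative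
         exp (2*L * r) * (?D' r + 2 * L * ?D r)) (at r)"
        by (rule derivative_eq_intros Di r refl | simp add: algebra_simps)+
      moreover have "exp (2*L * r) * (?D' r + 2 * L * ?D r) \<ge> 0"
        using bd[of r] r by (intro mult_nonneg_nonneg) auto
      ultimately show "\<exists>v. ((\<lambda>r. exp (2*L * r) * ?D r) has_real_derivative v) (at r) \<and> 0 \<le> v" by blast
    next
      show "continuous_on {s..t} (\<lambda>r. exp (2*L * r) * ?D r)" by (intro continuous_intros cD)
    qed
  have sq: "?D r = (norm (y r - z r))\<^sup>2" for r by (simp add: power2_norm_eq_inner)
  have ex: "exp (2*L*(t-s)) = (exp (L * (t - s)))\<^sup>2" by (simp add: mult.assoc exp_double)
  have e1: "exp (2*L*t) * exp (- (2*L) * t) = 1" "exp (2*L*t) * exp (- (2*L) * s) = exp (2*L*(t-s))"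
    and e2: "exp (- (2*L) * s) * exp (2*L * s) = 1" "exp (- (2*L) * s) * exp (2*L*t) = exp (2*L*(t-s))"
    by (simp_all add: algebra_simps flip: exp_add)
  have "exp (2*L*t) * (exp (- (2*L) * t) * ?D t) \<le> exp (2*L*t) * (exp (- (2*L) * s) * ?D s)"
    using 1 by (intro mult_left_mono) auto
  then have "?D t \<le> exp (2*L*(t-s)) * ?D s" unfolding mult.assoc[symmetric] e1 by simp
  then have "(norm (y t - z t))\<^sup>2 \<le> (exp (L * (t - s)) * norm (y s - z s))\<^sup>2"
    unfolding sq ex by (simp add: power_mult_distrib)
  then show "norm (y t - z t) \<le> exp (L * (t - s)) * norm (y s - z s)"
    by (rule power2_le_imp_le) auto
  have "exp (- (2*L) * s) * (exp (2*L * s) * ?D s) \<le> exp (- (2*L) * s) * (exp (2*L * t) * ?D t)"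
    using 2 by (intro mult_left_mono) auto
  then have "?D s \<le> exp (2*L*(t-s)) * ?D t" unfolding mult.assoc[symmetric] e2 by simp
  then have "(norm (y s - z s))\<^sup>2 \<le> (exp (L * (t - s)) * norm (y t - z t))\<^sup>2"
    unfolding sq ex by (simp add: power_mult_distrib)
  then show "norm (y s - z s) \<le> exp (L * (t - s)) * norm (y t - z t)"
    by (rule power2_le_imp_le) auto
qed

text \<open>Expanding the vector in a basis reduces joint continuity to the continuity of finitely
  many fixed directions.\<close>

lemma continuous_on_linear_family:
  fixes D :: "'a::topological_space \<Rightarrow> 'b::euclidean_space \<Rightarrow> 'c::real_normed_vector"
  assumes "\<And>y. y \<in> S \<Longrightarrow> linear (D y)" "\<And>v. continuous_on S (\<lambda>y. D y v)"
  shows "continuous_on (S \<times> UNIV) (\<lambda>(y, v). D y v)"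
proof -
  have "continuous_on (S \<times> UNIV) (\<lambda>p. \<Sum>b\<in>Basis. (snd p \<bullet> b) *\<^sub>R D (fst p) b)"
    by (intro continuous_intros continuous_on_compose2[OF assms(2), of _ fst]) auto
  moreover have "(\<Sum>b\<in>Basis. (snd p \<bullet> b) *\<^sub>R D (fst p) b) = (case p of (y, v) \<Rightarrow> D y v)" if "p \<in> S \<times> UNIV" for p
  proof -
    interpret linear "D (fst p)" using that assms(1) by auto
    show ?thesis using euclidean_representation[of "snd p"]
      by (simp add: case_prod_beta flip: scaleR sum)
  qed
  ultimately show ?thesis by (simp cong: continuous_on_cong)
qed

text \<open>A du Bois-Reymond argument: if no admissible variation makes the linear functional
  negative along the curve, the momentum \<open>\<ell>\<close> satisfies the Euler-Lagrange equation after a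
  rescaling by an integrating factor.\<close>

lemma momentum_equation:
  fixes l m :: "real \<Rightarrow> 'a::euclidean_space"
  assumes ab: "a < b" and cl: "continuous_on {a..b} l" and cm: "continuous_on {a..b} m"
    and T: "\<And>t. t \<in> {a..b} \<Longrightarrow> l t \<bullet> T < 0"
    and no: "\<And>V V'. (\<And>t. t \<in> {a..b} \<Longrightarrow> (V has_vector_derivative V' t) (at t within {a..b})) \<Longrightarrow>
       continuous_on {a..b} V' \<Longrightarrow> V a = 0 \<Longrightarrow> V b = 0 \<Longrightarrow>
       (\<And>t. t \<in> {a..b} \<Longrightarrow> 2 * (V' t \<bullet> l t) + V t \<bullet> m t < 0) \<Longrightarrow> False"
  obtains c :: "real \<Rightarrow> real" where "continuous_on {a..b} c" "\<And>t. t \<in> {a..b} \<Longrightarrow> 0 < c t"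
    "\<And>t. t \<in> {a..b} \<Longrightarrow> ((\<lambda>t. c t *\<^sub>R l t) has_vector_derivative (c t / 2) *\<^sub>R m t) (at t within {a..b})"
proof -
  \<comment> \<open>Tested against the fixed vector \<open>T\<close>, the desired equation for
    \<open>c\<close> becomes the scalar equation mu' = - k mu for mu = - 2 c (l . T). Solving it
    determines \<open>c\<close>.\<close>
  define k where "k t = (m t \<bullet> T) / (- 2 * (l t \<bullet> T))" for t
  have ck: "continuous_on {a..b} k" unfolding k_def
    using T by (intro continuous_intros cl cm) fastforce
  define mu where "mu t = exp (- integral {a..t} k)" for t
  have mu': "(mu has_vector_derivative - (k t * mu t)) (at t within {a..b})" if "t \<in> {a..b}" for t
    unfolding mu_def has_real_derivative_iff_has_vector_derivative[symmetric]
    by (rule derivative_eq_intros refl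
      integral_has_vector_derivative[OF ck that, folded has_real_derivative_iff_has_vector_derivative] | simp)+
  have cmu: "continuous_on {a..b} mu"
    using mu' by (rule continuous_on_vector_derivative)
  have mu0: "mu t > 0" for t by (simp add: mu_def)
  define c where "c t = mu t / (- 2 * (l t \<bullet> T))" for t
  have cc: "continuous_on {a..b} c" unfolding c_def
    using T by (intro continuous_intros cl cmu) fastforce
  have c0: "c t > 0" if "t \<in> {a..b}" for t unfolding c_def using mu0[of t] T[OF that] by (intro divide_pos_pos) auto
  define N where "N t = integral {a..t} (\<lambda>t. c t *\<^sub>R m t)" for t
  have N': "(N has_vector_derivative c t *\<^sub>R m t) (at t within {a..b})" if "t \<in> {a..b}" for t
    unfolding N_def by (rule integral_has_vector_derivative[OF _ that]) (intro continuous_intros cc cm)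
  have cN: "continuous_on {a..b} N" using N' by (rule continuous_on_vector_derivative)
  \<comment> \<open>\<open>N\<close> is a primitive of c m, so the desired equation says exactly
    that \<open>D\<close> is constant.\<close>
  define D where "D t = (2 * c t) *\<^sub>R l t - N t" for t
  have cD: "continuous_on {a..b} D" unfolding D_def by (intro continuous_intros cc cl cN)
  \<comment> \<open>\<open>C\<close> is the mean of \<open>D\<close>; hence the primitive
    \<open>U\<close> of D - C vanishes at both ends and is an admissible variation.\<close>
  define C where "C = (1 / (b - a)) *\<^sub>R integral {a..b} D"
  define U where "U t = integral {a..t} (\<lambda>t. D t - C)" for t
  have U': "(U has_vector_derivative D t - C) (at t within {a..b})" if "t \<in> {a..b}" for t
    unfolding U_def by (rule integral_has_vector_derivative[OF _ that]) (intro continuous_intros cD)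
  have cU: "continuous_on {a..b} U" using U' by (rule continuous_on_vector_derivative)
  have U0: "U a = 0" "U b = 0"
  proof -
    show "U a = 0" by (simp add: U_def)
    have "U b = integral {a..b} D - (b - a) *\<^sub>R C"
      unfolding U_def using ab
      by (subst integral_diff) (auto intro!: integrable_continuous_interval cD)
    then show "U b = 0" using ab by (simp add: C_def)
  qed
  \<comment> \<open>This is \<open>c\<close> times the variation density of \<open>U\<close>; by
    parts its integral is that of |D - C|^2.\<close>
  define h where "h t = c t * (2 * (l t \<bullet> (D t - C)) + m t \<bullet> U t)" for t
  have ch: "continuous_on {a..b} h" unfolding h_def by (intro continuous_intros cc cl cm cD cU)
  define psi where "psi t = integral {a..t} h" for t
  have psi': "(psi has_vector_derivative h t) (at t within {a..b})" if "t \<in> {a..b}" for t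
    unfolding psi_def by (rule integral_has_vector_derivative[OF ch that])
  have cI: "continuous_on {a..b} (\<lambda>t. (D t - C) \<bullet> (D t - C))" by (intro continuous_intros cD)
  define I where "I t = integral {a..t} (\<lambda>t. (D t - C) \<bullet> (D t - C))" for t
  have I': "(I has_vector_derivative (D t - C) \<bullet> (D t - C)) (at t within {a..b})" if "t \<in> {a..b}" for t
    unfolding I_def by (rule integral_has_vector_derivative[OF cI that])
  have psiI: "psi b = I b"
  proof -
    let ?E = "\<lambda>t. psi t - U t \<bullet> N t - U t \<bullet> C - I t"
    have "(?E has_vector_derivative h t - (U t \<bullet> (c t *\<^sub>R m t) + (D t - C) \<bullet> N t) - (D t - C) \<bullet> C - (D t - C) \<bullet> (D t - C))
        (at t within {a..b})" if "t \<in> {a..b}" for t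
      by (intro has_vector_derivative_diff psi' I' that bounded_bilinear.has_vector_derivative[OF bounded_bilinear_inner]
          bounded_linear.has_vector_derivative[OF bounded_linear_inner_left] U' N')
    moreover have "h t - (U t \<bullet> (c t *\<^sub>R m t) + (D t - C) \<bullet> N t) - (D t - C) \<bullet> C - (D t - C) \<bullet> (D t - C) = 0" for t
    proof -
      have "(D t - C) \<bullet> ((2 * c t) *\<^sub>R l t - N t - D t) = 0" by (simp add: D_def)
      then show ?thesis unfolding h_def
        by (simp add: inner_diff_right inner_diff_left inner_commute algebra_simps)
    qed
    ultimately have E0: "(?E has_vector_derivative 0) (at t within {a..b})" if "t \<in> {a..b}" for t
      using that by simp
    obtain v where "\<And>t. t \<in> {a..b} \<Longrightarrow> ?E t = v"
      by (rule has_vector_derivative_zero_constant[of "{a..b}" ?E]) (use E0 in auto)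
    then have "?E a = ?E b" using ab by simp
    then show ?thesis using U0 by (simp add: psi_def I_def)
  qed
  have Dc: "D t = C" if "t \<in> {a..b}" for t
  proof (rule ccontr)
    assume "D t \<noteq> C"
    have "I b \<noteq> 0" unfolding I_def
      using integral_eq_0_iff[OF cI] ab that \<open>D t \<noteq> C\<close> by auto
    moreover have "I b \<ge> 0" unfolding I_def
      by (intro integral_nonneg integrable_continuous_interval cI) auto
    ultimately have I0: "I b > 0" by simp
    define d where "d = I b / (b - a)"
    have d: "d > 0" using I0 ab by (simp add: d_def)
    \<comment> \<open>The variation -U has negative total but not pointwise negative density. Adding
      q T spreads it evenly: \<open>c\<close> times the density becomes the constant -d. Its
      numerator vanishes at \<open>b\<close> because \<open>d\<close> is the mean of |D - C|^2 and
      \<open>psi b = I b\<close>.\<close>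
    define q where "q t = (d * (t - a) - psi t) / mu t" for t
    have q': "(q has_vector_derivative ((d - h t) + k t * (d * (t - a) - psi t)) / mu t) (at t within {a..b})"
      if "t \<in> {a..b}" for t
      unfolding q_def has_real_derivative_iff_has_vector_derivative[symmetric]
      using mu0[of t]
      by (auto intro!: derivative_eq_intros psi'[OF that, folded has_real_derivative_iff_has_vector_derivative]
          mu'[OF that, folded has_real_derivative_iff_has_vector_derivative] simp: field_simps)
    let ?V = "\<lambda>t. - U t + q t *\<^sub>R T"
    let ?V' = "\<lambda>t. - (D t - C) + (((d - h t) + k t * (d * (t - a) - psi t)) / mu t) *\<^sub>R T"
    show False
    proof (rule no[of ?V ?V'])
      show "continuous_on {a..b} ?V'"
        using mu0 by (intro continuous_intros cD ch ck cmu continuous_on_vector_derivative[OF psi']) (auto simp: less_le)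
      show "?V a = 0" using U0 by (simp add: q_def psi_def)
      show "?V b = 0" using U0 ab by (simp add: q_def psiI d_def)
      fix t assume t: "t \<in> {a..b}"
      show "(?V has_vector_derivative ?V' t) (at t within {a..b})"
        by (intro has_vector_derivative_add has_vector_derivative_minus U'[OF t]
          bounded_linear.has_vector_derivative[OF bounded_linear_scaleR_left] q'[OF t])
      have lT: "l t \<bullet> T \<noteq> 0" using T[OF t] by simp
      have kk: "c t * (m t \<bullet> T) = mu t * k t" "c t * (l t \<bullet> T) * 2 = - mu t" using lT by (simp_all add: c_def k_def)
      have "c t * (2 * (?V' t \<bullet> l t) + ?V t \<bullet> m t) = - h t +
         (((d - h t) + k t * (d * (t - a) - psi t)) / mu t) * (c t * (l t \<bullet> T) * 2) + q t * (c t * (m t \<bullet> T))"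
        by (simp add: h_def inner_add_left inner_diff_left inner_diff_right inner_commute algebra_simps)
      also have "\<dots> = - d" unfolding kk q_def using mu0[of t] by (simp add: field_simps)
      finally have "c t * (2 * (?V' t \<bullet> l t) + ?V t \<bullet> m t) < 0" using d by simp
      then show "2 * (?V' t \<bullet> l t) + ?V t \<bullet> m t < 0" using c0[OF t] by (simp add: mult_less_0_iff)
    qed
  qed
  show thesis
  proof (rule that[OF cc c0])
    fix t assume t: "t \<in> {a..b}"
    have "((\<lambda>t. (1/2) *\<^sub>R (C + N t)) has_vector_derivative (1/2) *\<^sub>R (0 + c t *\<^sub>R m t)) (at t within {a..b})"
      by (intro bounded_linear.has_vector_derivative[OF bounded_linear_scaleR_right] has_vector_derivative_add
        has_vector_derivative_const N'[OF t])
    then have d: "((\<lambda>t. (1/2) *\<^sub>R (C + N t)) has_vector_derivative (c t / 2) *\<^sub>R m t) (at t within {a..b})" by simp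
    show "((\<lambda>t. c t *\<^sub>R l t) has_vector_derivative (c t / 2) *\<^sub>R m t) (at t within {a..b})"
    proof (rule has_vector_derivative_transform[OF t _ d])
      fix s assume "s \<in> {a..b}"
      then have "C = (2 * c s) *\<^sub>R l s - N s" using Dc[of s] by (simp add: D_def)
      then show "c s *\<^sub>R l s = (1/2) *\<^sub>R (C + N s)" by simp
    qed
  qed
qed

section \<open>Lorentz forms\<close>

definition lorentz_mat :: "real ^ 'n ^ 'n \<Rightarrow> bool" where
  "lorentz_mat A \<longleftrightarrow> (\<forall>u v. u \<bullet> (A *v v) = v \<bullet> (A *v u)) \<and>
     (\<exists>E :: 'n \<Rightarrow> real ^ 'n. \<exists>i0. \<forall>i j. E i \<bullet> (A *v E j) = (if i = j then if i = i0 then -1 else 1 else 0))"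

text \<open>\<open>f\<close> reads off coordinates in the pseudo-orthonormal frame. The frame map
  \<open>g\<close> is injective because the form pulled back along it is nondegenerate, hence
  invertible in finite dimension.\<close>

lemma lorentz_mat_normal_form:
  fixes A :: "real ^ 'n ^ 'n"
  assumes "lorentz_mat A"
  obtains f :: "real ^ 'n \<Rightarrow> real ^ 'n" and i0 where "linear f" "inj f"
    "\<And>u v. u \<bullet> (A *v v) = f u \<bullet> f v - 2 * (f u $ i0) * (f v $ i0)"
proof -
  obtain E :: "'n \<Rightarrow> real ^ 'n" and i0 where
    E: "\<And>i j. E i \<bullet> (A *v E j) = (if i = j then if i = i0 then -1 else 1 else 0)"
    using assms unfolding lorentz_mat_def by metis
  define g where "g a = (\<Sum>i\<in>UNIV. (a $ i) *\<^sub>R E i)" for a :: "real ^ 'n"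
  have lg: "linear g" unfolding g_def
    by (rule linearI) (simp_all add: scaleR_add_left sum.distrib scaleR_sum_right)
  have form: "g a \<bullet> (A *v g b) = a \<bullet> b - 2 * (a $ i0) * (b $ i0)" for a b
  proof -
    have "A *v g b = (\<Sum>j\<in>UNIV. (b $ j) *\<^sub>R (A *v E j))"
      unfolding g_def by (simp add: linear_sum[OF matrix_vector_mul_linear] linear_cmul[OF matrix_vector_mul_linear])
    then have "g a \<bullet> (A *v g b) = (\<Sum>j\<in>UNIV. b $ j * (\<Sum>i\<in>UNIV. a $ i * (E i \<bullet> (A *v E j))))"
      by (simp add: g_def inner_sum_left inner_sum_right)
    also have "\<dots> = (\<Sum>i\<in>UNIV. \<Sum>j\<in>UNIV. a $ i * (b $ j * (E i \<bullet> (A *v E j))))"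
      by (subst sum.swap) (simp add: sum_distrib_left mult.left_commute)
    also have "\<dots> = (\<Sum>i\<in>UNIV. \<Sum>j\<in>UNIV. if i = j then a $ i * (b $ j * (if i = i0 then -1 else 1)) else 0)"
      by (intro sum.cong refl) (simp add: E)
    also have "\<dots> = (\<Sum>i\<in>UNIV. a $ i * b $ i - (if i = i0 then 2 * (a $ i * b $ i) else 0))"
      by (intro sum.cong refl) (simp add: sum.delta)
    also have "\<dots> = a \<bullet> b - 2 * (a $ i0) * (b $ i0)"
      by (simp add: sum_subtractf inner_vec_def sum.delta)
    finally show ?thesis .
  qed
  have inj: "inj g"
  proof (rule linear_injective_0[OF lg, THEN iffD2], intro allI impI)
    fix a assume "g a = 0"
    then have *: "a \<bullet> b - 2 * (a $ i0) * (b $ i0) = 0" for b using form[of a b] by simp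
    show "a = 0"
    proof (rule vec_eq_iff[THEN iffD2], rule allI)
      fix j
      have "axis j (1::real) $ i0 = (if j = i0 then 1 else 0)" by (simp add: axis_def)
      then show "a $ j = 0 $ j" using *[of "axis j 1"] by (cases "j = i0") (simp_all add: inner_axis)
    qed
  qed
  obtain f where f: "linear f" "\<And>x. f (g x) = x" "\<And>x. g (f x) = x"
    using linear_injective_isomorphism[OF lg inj] by blast
  show ?thesis
  proof (rule that[OF f(1)])
    show "inj f" using f(3) by (metis injI)
    fix u v show "u \<bullet> (A *v v) = f u \<bullet> f v - 2 * (f u $ i0) * (f v $ i0)"
      using form[of "f u" "f v"] f by simp
  qed
qed

lemma lorentz_mat_sym: "lorentz_mat A \<Longrightarrow> u \<bullet> (A *v v) = v \<bullet> (A *v u)"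
  unfolding lorentz_mat_def by blast

lemma lorentz_mat_ker:
  fixes A :: "real ^ 'n ^ 'n"
  assumes "lorentz_mat A" "A *v v = 0" shows "v = 0"
proof -
  obtain f :: "real ^ 'n \<Rightarrow> real ^ 'n" and i0 where f: "linear f" "inj f" "\<And>u v. u \<bullet> (A *v v) = f u \<bullet> f v - 2 * (f u $ i0) * (f v $ i0)"
    by (rule lorentz_mat_normal_form[OF assms(1)]) blast
  have "surj f" using linear_injective_imp_surjective[OF f(1,2)] by simp
  have "f v = 0"
  proof (rule vec_eq_iff[THEN iffD2], rule allI)
    fix j
    obtain u where "f u = axis j 1" using \<open>surj f\<close> by (metis surjD)
    then have "axis j 1 \<bullet> f v - 2 * (axis j 1 $ i0) * (f v $ i0) = 0"
      using f(3)[of u v] assms(2) by simp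
    moreover have "axis j (1::real) $ i0 = (if j = i0 then 1 else 0)" by (simp add: axis_def)
    ultimately show "f v $ j = 0 $ j" by (cases "j = i0") (simp_all add: inner_axis')
  qed
  then show ?thesis using injD[OF f(2), of v 0] linear_0[OF f(1)] by auto
qed

lemma lorentz_mat_invertible: "lorentz_mat A \<Longrightarrow> invertible A"
  using lorentz_mat_ker[of A] by (auto simp: invertible_left_inverse matrix_left_invertible_ker)

text \<open>Reversed Cauchy-Schwarz: the spatial parts \<open>?x\<close> and \<open>?y\<close> are
  at most, respectively less than, the time components in length, while orthogonality equates their
  inner product with the product of these components.\<close>

lemma timelike_not_orthogonal_causal:
  fixes A :: "real ^ 'n ^ 'n"
  assumes "lorentz_mat A" "T \<bullet> (A *v T) < 0" "v \<bullet> (A *v v) \<le> 0" "v \<noteq> 0"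
  shows "v \<bullet> (A *v T) \<noteq> 0"
proof
  assume o: "v \<bullet> (A *v T) = 0"
  obtain f :: "real ^ 'n \<Rightarrow> real ^ 'n" and i0 where f: "linear f" "inj f" "\<And>u v. u \<bullet> (A *v v) = f u \<bullet> f v - 2 * (f u $ i0) * (f v $ i0)"
    by (rule lorentz_mat_normal_form[OF assms(1)]) blast
  let ?x = "f v - (f v $ i0) *\<^sub>R axis i0 1" and ?y = "f T - (f T $ i0) *\<^sub>R axis i0 1"
  have pr: "(a - (a $ i0) *\<^sub>R axis i0 1) \<bullet> (b - (b $ i0) *\<^sub>R axis i0 1) = a \<bullet> b - (a $ i0) * (b $ i0)" for a b :: "real ^ 'n"
    by (simp add: inner_diff_left inner_diff_right inner_axis inner_axis')
  have x: "?x \<bullet> ?x \<le> (f v $ i0)\<^sup>2" using assms(3) unfolding f(3) pr by (simp add: power2_eq_square)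
  have y: "?y \<bullet> ?y < (f T $ i0)\<^sup>2" using assms(2) unfolding f(3) pr by (simp add: power2_eq_square)
  have xy: "?x \<bullet> ?y = (f v $ i0) * (f T $ i0)" using o unfolding f(3) pr by simp
  have v0: "f v $ i0 \<noteq> 0"
  proof
    assume "f v $ i0 = 0"
    then have "f v \<bullet> f v \<le> 0" using assms(3) unfolding f(3) by simp
    then have "f v = 0" using inner_gt_zero_iff[of "f v"] by linarith
    then show False using assms(4) injD[OF f(2), of v 0] linear_0[OF f(1)] \<open>f v = 0\<close> by auto
  qed
  have "((f v $ i0) * (f T $ i0))\<^sup>2 \<le> (?x \<bullet> ?x) * (?y \<bullet> ?y)"
    using Cauchy_Schwarz_ineq[of ?x ?y] unfolding xy .
  also have "\<dots> \<le> (f v $ i0)\<^sup>2 * (?y \<bullet> ?y)" using x by (intro mult_right_mono) auto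
  also have "\<dots> < (f v $ i0)\<^sup>2 * (f T $ i0)\<^sup>2" using y v0 by (intro mult_strict_left_mono) auto
  finally show False by (simp add: power_mult_distrib)
qed

text \<open>If the sign were wrong, a nonnegative combination of \<open>T\<close> and
  \<open>W\<close> would be timelike and orthogonal to the causal vector \<open>v\<close>. The lemma
  moves the test for future direction from one timelike vector to another in the same cone.\<close>

lemma time_cone:
  assumes L: "lorentz_mat A" and "T \<bullet> (A *v T) < 0" "W \<bullet> (A *v W) < 0" "T \<bullet> (A *v W) < 0"
    and "v \<bullet> (A *v v) \<le> 0" "v \<bullet> (A *v T) < 0"
  shows "v \<bullet> (A *v W) < 0"
proof (rule ccontr)
  assume n: "\<not> ?thesis"
  define a b where "a = v \<bullet> (A *v W)" and "b = - (v \<bullet> (A *v T))"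
  have ab: "a \<ge> 0" "b > 0" using n assms by (auto simp: a_def b_def)
  let ?S = "a *\<^sub>R T + b *\<^sub>R W"
  have lin: "u \<bullet> (A *v ?S) = a * (u \<bullet> (A *v T)) + b * (u \<bullet> (A *v W))" for u
    by (simp add: matrix_vector_right_distrib matrix_vector_mult_scaleR inner_add_right)
  have "v \<bullet> (A *v ?S) = 0" unfolding lin by (simp add: a_def b_def)
  moreover have "?S \<bullet> (A *v ?S) < 0"
  proof -
    have "?S \<bullet> (A *v ?S) = a * (a * (T \<bullet> (A *v T)) + b * (T \<bullet> (A *v W))) + b * (a * (T \<bullet> (A *v W)) + b * (W \<bullet> (A *v W)))"
      unfolding lin by (simp add: inner_add_left lorentz_mat_sym[OF L, of W T])
    moreover have "a * (a * (T \<bullet> (A *v T)) + b * (T \<bullet> (A *v W))) \<le> 0"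
      using ab assms by (intro mult_nonneg_nonpos add_nonpos_nonpos) (auto simp: less_imp_le)
    moreover have "b * (a * (T \<bullet> (A *v W)) + b * (W \<bullet> (A *v W))) < 0"
      using ab assms by (intro mult_pos_neg add_nonpos_neg mult_nonneg_nonpos) (auto simp: less_imp_le)
    ultimately show ?thesis by linarith
  qed
  moreover have "v \<noteq> 0" using assms by auto
  ultimately show False using timelike_not_orthogonal_causal[OF L _ assms(5), of ?S] by blast
qed

text \<open>The difference of the two normalized covectors works, by strictness in Cauchy-Schwarz
  for vectors that are not positively proportional. \<open>Z\<close> is the direction in which a
  corner with velocities \<open>X\<close> and \<open>Y\<close> gets cut off.\<close>

lemma separating_vector:
  assumes L: "lorentz_mat A" and "X \<noteq> 0" "Y \<noteq> 0" "\<not> (\<exists>c>0. Y = c *\<^sub>R X)"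
  obtains Z where "Z \<bullet> (A *v X) < 0" "0 < Z \<bullet> (A *v Y)"
proof -
  let ?a = "A *v X" and ?b = "A *v Y"
  have ne: "?a \<noteq> 0" "?b \<noteq> 0" using lorentz_mat_ker[OF L] assms by blast+
  let ?Z = "?b /\<^sub>R norm ?b - ?a /\<^sub>R norm ?a"
  have s: "?a \<bullet> ?b < norm ?a * norm ?b"
  proof (rule ccontr)
    assume "\<not> ?thesis"
    then have "?a \<bullet> ?b = norm ?a * norm ?b" using norm_cauchy_schwarz[of ?a ?b] by linarith
    then have "norm ?a *\<^sub>R ?b = norm ?b *\<^sub>R ?a" by (simp add: norm_cauchy_schwarz_eq)
    then have "A *v (norm ?a *\<^sub>R Y - norm ?b *\<^sub>R X) = 0"
      by (simp add: matrix_vector_mult_diff_distrib matrix_vector_mult_scaleR)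
    then have e: "norm ?a *\<^sub>R Y = norm ?b *\<^sub>R X" using lorentz_mat_ker[OF L] by fastforce
    have "Y = (1 / norm ?a) *\<^sub>R (norm ?a *\<^sub>R Y)" using ne by simp
    also have "\<dots> = (norm ?b / norm ?a) *\<^sub>R X" unfolding e by simp
    finally show False using assms(4) ne by (metis divide_pos_pos zero_less_norm_iff)
  qed
  have na: "norm ?a > 0" "norm ?b > 0" using ne by auto
  have sq: "?a \<bullet> ?a = norm ?a * norm ?a" "?b \<bullet> ?b = norm ?b * norm ?b"
    by (simp_all add: dot_square_norm power2_eq_square)
  show ?thesis
  proof (rule that[of ?Z])
    have "?Z \<bullet> ?a = (?a \<bullet> ?b) / norm ?b - norm ?a"
      using na unfolding inner_diff_left inner_scaleR_left sq by (simp add: inner_commute divide_inverse)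
    also have "\<dots> < 0" using s na by (simp add: field_simps)
    finally show "?Z \<bullet> ?a < 0" .
    have "?Z \<bullet> ?b = norm ?b - (?a \<bullet> ?b) / norm ?a"
      using na unfolding inner_diff_left inner_scaleR_left sq by (simp add: inner_commute divide_inverse)
    also have "\<dots> > 0" using s na by (simp add: field_simps)
    finally show "0 < ?Z \<bullet> ?b" .
  qed
qed

section \<open>Coordinates\<close>

locale spacetime_locale =
  fixes M :: "('m::{t2_space, second_countable_topology}, 'n::finite) spacetime"
  assumes time_oriented: "time_oriented_lorentzian M"
begin

abbreviation "img c \<equiv> cmap c ` cdom c"

definition transition_deriv :: "('m, 'n) chart \<Rightarrow> ('m, 'n) chart \<Rightarrow> real ^ 'n \<Rightarrow> real ^ 'n \<Rightarrow> real ^ 'n" where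
  "transition_deriv c d y = frechet_derivative (transition c d) (at y)"

definition lift :: "('m, 'n) chart \<Rightarrow> 'm \<Rightarrow> real ^ 'n \<Rightarrow> ('m, 'n) tvector" where
  "lift c p u = (\<lambda>d. if d \<in> charts_at M p then transition_deriv c d (cmap c p) u else 0)"

abbreviation "G \<equiv> metric_matrix M"

definition coord_met :: "('m, 'n) chart \<Rightarrow> real ^ 'n \<Rightarrow> real ^ 'n \<Rightarrow> real ^ 'n \<Rightarrow> real" where
  "coord_met c y u v = u \<bullet> (G c y *v v)"

definition coord_orient :: "('m, 'n) chart \<Rightarrow> real ^ 'n \<Rightarrow> real ^ 'n" where
  "coord_orient c y = torient M (cinv c y) c"

lemma lorentzian_M: "lorentzian M" using time_oriented unfolding time_oriented_lorentzian_def by blast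

lemma is_chart: "c \<in> charts M \<Longrightarrow> is_chart c"
  using lorentzian_M by (simp add: lorentzian_def)

lemma charts_atD [dest]: "c \<in> charts_at M p \<Longrightarrow> c \<in> charts M" "c \<in> charts_at M p \<Longrightarrow> p \<in> cdom c"
  by (auto simp: charts_at_def)

lemma charts_atI [intro]: "c \<in> charts M \<Longrightarrow> p \<in> cdom c \<Longrightarrow> c \<in> charts_at M p"
  by (auto simp: charts_at_def)

lemma charts_at_ex: "\<exists>c. c \<in> charts_at M p"
proof -
  have "p \<in> (\<Union>c \<in> charts M. cdom c)" using lorentzian_M by (simp add: lorentzian_def)
  then show ?thesis by blast
qed

lemma open_cdom: "c \<in> charts M \<Longrightarrow> open (cdom c)"
  and open_img: "c \<in> charts M \<Longrightarrow> open (img c)"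
  and cont_cmap: "c \<in> charts M \<Longrightarrow> continuous_on (cdom c) (cmap c)"
  and cont_cinv: "c \<in> charts M \<Longrightarrow> continuous_on (img c) (cinv c)"
  and cinv_cmap: "c \<in> charts M \<Longrightarrow> p \<in> cdom c \<Longrightarrow> cinv c (cmap c p) = p"
  and cmap_cinv: "c \<in> charts M \<Longrightarrow> y \<in> img c \<Longrightarrow> cmap c (cinv c y) = y"
  and cinv_in: "c \<in> charts M \<Longrightarrow> y \<in> img c \<Longrightarrow> cinv c y \<in> cdom c"
  using is_chart[of c] unfolding is_chart_def homeomorphism_def by auto

lemma overlap_eq: "c \<in> charts M \<Longrightarrow> cmap c ` (cdom c \<inter> cdom d) = img c \<inter> cinv c -` cdom d"
  using cinv_cmap[of c] by auto

lemma open_overlap: "c \<in> charts M \<Longrightarrow> d \<in> charts M \<Longrightarrow> open (cmap c ` (cdom c \<inter> cdom d))"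
  unfolding overlap_eq by (rule continuous_open_preimage[OF cont_cinv open_img open_cdom])

lemma Ck_transition:
  assumes "c \<in> charts M" "d \<in> charts M"
  shows "Ck_on 3 (transition c d) (cmap c ` (cdom c \<inter> cdom d))"
  using lorentzian_M assms unfolding lorentzian_def compatible_def by blast

lemma Ck_Suc_deriv:
  assumes "Ck_on (Suc k) f S" "open S" "y \<in> S"
  shows "(f has_derivative frechet_derivative f (at y)) (at y)"
  using assms by (metis Ck_on.simps(2) at_within_open differentiable_on_def frechet_derivative_works)

lemma transition_deriv_deriv:
  assumes "c \<in> charts_at M p" "d \<in> charts_at M p"
  shows "(transition c d has_derivative transition_deriv c d (cmap c p)) (at (cmap c p))"
  unfolding transition_deriv_def
  by (rule Ck_Suc_deriv[where k = 2]) (use assms Ck_transition[of c d] open_overlap[of c d] in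
     \<open>auto simp: numeral_3_eq_3 numeral_2_eq_2\<close>)

lemma transition_cmap: "c \<in> charts_at M p \<Longrightarrow> transition c d (cmap c p) = cmap d p"
  unfolding transition_def by (simp add: cinv_cmap charts_atD)

lemma transition_deriv_id:
  assumes "c \<in> charts_at M p" shows "transition_deriv c c (cmap c p) u = u"
proof -
  have "((\<lambda>y. y) has_derivative (\<lambda>h. h)) (at (cmap c p))" by (rule has_derivative_ident)
  then have "(transition c c has_derivative (\<lambda>h. h)) (at (cmap c p))"
    by (rule has_derivative_transform_within_open[of _ _ _ _ "img c"])
      (use assms open_img[of c] in \<open>auto simp: transition_def cmap_cinv cinv_cmap charts_at_def\<close>)
  then show ?thesis using transition_deriv_deriv[OF assms assms] has_derivative_unique by metis
qed

lemma transition_deriv_comp: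
  assumes "c \<in> charts_at M p" "d \<in> charts_at M p" "e \<in> charts_at M p"
  shows "transition_deriv d e (cmap d p) (transition_deriv c d (cmap c p) u) = transition_deriv c e (cmap c p) u"
proof -
  have "(transition d e has_derivative transition_deriv d e (cmap d p)) (at (transition c d (cmap c p)))"
    using transition_deriv_deriv[OF assms(2,3)] transition_cmap[OF assms(1)] by simp
  then have "((\<lambda>y. transition d e (transition c d y)) has_derivative (\<lambda>u. transition_deriv d e (cmap d p) (transition_deriv c d (cmap c p) u))) (at (cmap c p))"
    using has_derivative_compose[OF transition_deriv_deriv[OF assms(1,2)]] by blast
  then have "(transition c e has_derivative (\<lambda>u. transition_deriv d e (cmap d p) (transition_deriv c d (cmap c p) u))) (at (cmap c p))"
  proof (rule has_derivative_transform_within_open[of _ _ _ _ "cmap c ` (cdom c \<inter> cdom d)"])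
    fix y assume "y \<in> cmap c ` (cdom c \<inter> cdom d)"
    then show "transition d e (transition c d y) = transition c e y"
      using assms by (auto simp: transition_def cinv_cmap charts_at_def)
  qed (use assms open_overlap[of c d] in auto)
  then show ?thesis using transition_deriv_deriv[OF assms(1,3)] has_derivative_unique by metis
qed

lemma transition_deriv_linear: "c \<in> charts_at M p \<Longrightarrow> d \<in> charts_at M p \<Longrightarrow> linear (transition_deriv c d (cmap c p))"
  using transition_deriv_deriv has_derivative_linear by blast

lemma lift_self: "c \<in> charts_at M p \<Longrightarrow> lift c p u c = u"
  by (simp add: lift_def transition_deriv_id)

lemma lift_tangent: "c \<in> charts_at M p \<Longrightarrow> lift c p u \<in> tangent_space M p"
  unfolding tangent_space_def lift_def transition_deriv_def[symmetric] by (auto simp: transition_deriv_comp)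

lemma tangent_lift:
  assumes "v \<in> tangent_space M p" "c \<in> charts_at M p" shows "v = lift c p (v c)"
proof
  fix d
  have "d \<in> charts_at M p \<Longrightarrow> v d = transition_deriv c d (cmap c p) (v c)" "d \<notin> charts_at M p \<Longrightarrow> v d = 0"
    using assms unfolding tangent_space_def transition_deriv_def by blast+
  then show "v d = lift c p (v c) d" unfolding lift_def by (metis (full_types))
qed

lemma tangent_transition_deriv:
  assumes "v \<in> tangent_space M p" "c \<in> charts_at M p" "d \<in> charts_at M p"
  shows "v d = transition_deriv c d (cmap c p) (v c)"
  using assms unfolding tangent_space_def transition_deriv_def by blast

lemma tangent_eq_iff:
  assumes "u \<in> tangent_space M p" "v \<in> tangent_space M p" "c \<in> charts_at M p"
  shows "u = v \<longleftrightarrow> u c = v c"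
  using assms tangent_lift by metis

lemma tangent_zero: "(\<lambda>c. 0) \<in> tangent_space M p"
  unfolding tangent_space_def transition_deriv_def[symmetric] using linear_0[OF transition_deriv_linear] by simp

lemma lift_combine:
  assumes "c \<in> charts_at M p"
  shows "lift c p (a *\<^sub>R u + b *\<^sub>R v) = (\<lambda>d. a *\<^sub>R lift c p u d + b *\<^sub>R lift c p v d)"
  unfolding lift_def using assms by (auto simp: fun_eq_iff linear_add linear_cmul transition_deriv_linear)

lemma tangent_scale:
  assumes "v \<in> tangent_space M p" shows "(\<lambda>d. a *\<^sub>R v d) \<in> tangent_space M p"
proof -
  obtain c where c: "c \<in> charts_at M p" using charts_at_ex by blast
  have "(\<lambda>d. a *\<^sub>R v d) = lift c p (a *\<^sub>R v c + 0 *\<^sub>R v c)"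
    using lift_combine[OF c, of a "v c" 0 "v c"] tangent_lift[OF assms c] by simp
  then show ?thesis using lift_tangent[OF c] by metis
qed

lemma met_sym: "u \<in> tangent_space M p \<Longrightarrow> v \<in> tangent_space M p \<Longrightarrow> met M p u v = met M p v u"
  using lorentzian_M unfolding lorentzian_def by blast

lemma met_lin: "u \<in> tangent_space M p \<Longrightarrow> v \<in> tangent_space M p \<Longrightarrow> w \<in> tangent_space M p \<Longrightarrow>
   met M p (\<lambda>c. a *\<^sub>R u c + b *\<^sub>R v c) w = a * met M p u w + b * met M p v w"
  using lorentzian_M unfolding lorentzian_def by blast

lemma met_lift:
  assumes c: "c \<in> charts_at M p"
  shows "met M p (lift c p x) (lift c p y) = coord_met c (cmap c p) x y"
proof -
  have l1: "linear (\<lambda>x. met M p (lift c p x) w)" if "w \<in> tangent_space M p" for w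
  proof (rule linearI)
    fix x y show "met M p (lift c p (x + y)) w = met M p (lift c p x) w + met M p (lift c p y) w"
      using met_lin[OF lift_tangent[OF c] lift_tangent[OF c] that, of 1 x 1 y]
       lift_combine[OF c, of 1 x 1 y] by simp
  next
    fix r x show "met M p (lift c p (r *\<^sub>R x)) w = r *\<^sub>R met M p (lift c p x) w"
      using met_lin[OF lift_tangent[OF c] lift_tangent[OF c] that, of r x 0 x]
       lift_combine[OF c, of r x 0 x] by simp
  qed
  have l2: "linear (\<lambda>y. met M p w (lift c p y))" if "w \<in> tangent_space M p" for w
    using l1[OF that] met_sym[OF lift_tangent[OF c] that] by simp
  have cp: "cinv c (cmap c p) = p" using c cinv_cmap by blast
  have ax: "coord_vec M c p i = lift c p (axis i 1)" for i
    unfolding coord_vec_def lift_def transition_deriv_def by simp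
  have ex: "x = (\<Sum>i\<in>UNIV. (x $ i) *\<^sub>R axis i 1)" for x :: "real ^ 'n"
    by (simp only: basis_expansion flip: scalar_mult_eq_scaleR)
  have "met M p (lift c p x) (lift c p y) = (\<Sum>i\<in>UNIV. x $ i * met M p (lift c p (axis i 1)) (lift c p y))"
    by (subst ex[of x]) (simp add: linear_sum[OF l1[OF lift_tangent[OF c]]] linear_cmul[OF l1[OF lift_tangent[OF c]]])
  also have "\<dots> = (\<Sum>i\<in>UNIV. x $ i * (\<Sum>j\<in>UNIV. y $ j * met M p (lift c p (axis i 1)) (lift c p (axis j 1))))"
    by (subst ex[of y]) (simp add: linear_sum[OF l2[OF lift_tangent[OF c]]] linear_cmul[OF l2[OF lift_tangent[OF c]]])
  also have "\<dots> = coord_met c (cmap c p) x y"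
    unfolding coord_met_def inner_vec_def matrix_vector_mult_def metric_matrix_def
    by (simp add: cp ax mult.commute)
  finally show ?thesis .
qed

lemma met_coord:
  assumes "u \<in> tangent_space M p" "v \<in> tangent_space M p" "c \<in> charts_at M p"
  shows "met M p u v = coord_met c (cmap c p) (u c) (v c)"
  using met_lift[OF assms(3), of "u c" "v c"] tangent_lift[OF assms(1,3)] tangent_lift[OF assms(2,3)] by simp

lemma G_lorentz:
  assumes "c \<in> charts M" "y \<in> img c" shows "lorentz_mat (G c y)"
proof -
  obtain p where p: "p \<in> cdom c" "y = cmap c p" using assms by auto
  then have c: "c \<in> charts_at M p" using assms by auto
  have "u \<bullet> (G c y *v v) = v \<bullet> (G c y *v u)" for u v
    using met_lift[OF c, of u v] met_lift[OF c, of v u] met_sym[OF lift_tangent[OF c] lift_tangent[OF c], of u v]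
    by (simp add: coord_met_def p)
  moreover have "\<exists>E :: 'n \<Rightarrow> real ^ 'n. \<exists>i0. \<forall>i j. E i \<bullet> (G c y *v E j) = (if i = j then if i = i0 then -1 else 1 else 0)"
  proof -
    obtain E :: "'n \<Rightarrow> ('m, 'n) tvector" and i0 where E: "\<forall>i. E i \<in> tangent_space M p"
       "\<forall>i j. met M p (E i) (E j) = (if i = j then if i = i0 then -1 else 1 else 0)"
    proof -
      have "\<forall>p. \<exists>E :: 'n \<Rightarrow> ('m, 'n) tvector. \<exists>i0. (\<forall>i. E i \<in> tangent_space M p) \<and>
        (\<forall>i j. met M p (E i) (E j) = (if i = j then if i = i0 then -1 else 1 else 0))"
        using lorentzian_M unfolding lorentzian_def by (elim conjE) assumption
      then show ?thesis using that by blast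
    qed
    have "E i c \<bullet> (G c y *v E j c) = (if i = j then if i = i0 then -1 else 1 else 0)" for i j
      using met_coord[OF E(1)[rule_format, of i] E(1)[rule_format, of j] c] E(2) by (simp add: coord_met_def p)
    then show ?thesis by (intro exI[of _ "\<lambda>i. E i c"] exI[of _ i0]) blast
  qed
  ultimately show ?thesis unfolding lorentz_mat_def by blast
qed

end

lemma bounded_bilinear_matrix_vector:
  "bounded_bilinear ((*v) :: real ^ 'n ^ 'm \<Rightarrow> real ^ 'n \<Rightarrow> real ^ 'm)"
proof -
  have "bilinear ((*v) :: real ^ 'n ^ 'm \<Rightarrow> real ^ 'n \<Rightarrow> real ^ 'm)"
    unfolding bilinear_def
  proof (intro conjI allI)
    fix A :: "real ^ 'n ^ 'm" show "linear ((*v) A)" by simp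
  next
    fix v :: "real ^ 'n"
    show "linear (\<lambda>A :: real ^ 'n ^ 'm. A *v v)"
    proof (rule linearI)
      fix r and A :: "real ^ 'n ^ 'm"
      show "(r *\<^sub>R A) *v v = r *\<^sub>R (A *v v)"
        by (simp add: matrix_vector_mult_def vec_eq_iff sum_distrib_left mult.assoc)
    qed (simp add: matrix_vector_mult_add_rdistrib)
  qed
  then show ?thesis by (simp add: bilinear_conv_bounded_bilinear)
qed

lemmas tendsto_mv [tendsto_intros] = bounded_bilinear.tendsto[OF bounded_bilinear_matrix_vector]
lemmas continuous_on_mv [continuous_intros] = bounded_bilinear.continuous_on[OF bounded_bilinear_matrix_vector]

lemma has_derivative_vecI:
  fixes f :: "'a::real_normed_vector \<Rightarrow> ('b::euclidean_space) ^ 'n"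
  assumes "\<And>i. ((\<lambda>x. f x $ i) has_derivative (\<lambda>h. f' h $ i)) (at a within S)"
  shows "(f has_derivative f') (at a within S)"
proof (subst has_derivative_componentwise_within, rule ballI)
  fix k :: "'b ^ 'n" assume "k \<in> Basis"
  then obtain i b where k: "k = axis i b" by (auto simp: Basis_vec_def)
  show "((\<lambda>x. f x \<bullet> k) has_derivative (\<lambda>x. f' x \<bullet> k)) (at a within S)"
    unfolding k inner_axis by (intro has_derivative_inner_left assms)
qed

lemma inner_mv_has_derivative:
  fixes B :: "'a::real_normed_vector \<Rightarrow> real ^ 'n ^ 'm"
  assumes "(u has_derivative u') (at x within S)" "(B has_derivative B') (at x within S)" "(v has_derivative v') (at x within S)"
  shows "((\<lambda>z. u z \<bullet> (B z *v v z)) has_derivative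
     (\<lambda>h. u x \<bullet> (B x *v v' h + B' h *v v x) + u' h \<bullet> (B x *v v x))) (at x within S)"
  by (rule has_derivative_inner[OF assms(1) bounded_bilinear.FDERIV[OF bounded_bilinear_matrix_vector assms(2,3)]])

lemma inner_mv_expand:
  fixes A :: "real ^ 'n ^ 'm"
  shows "u \<bullet> (A *v v) = (\<Sum>i\<in>UNIV. \<Sum>j\<in>UNIV. u $ i * A $ i $ j * v $ j)"
  by (simp add: inner_vec_def matrix_vector_mult_def sum_distrib_left mult.assoc)

section \<open>The coordinate acceleration and the Euler-Lagrange equation\<close>

context spacetime_locale
begin

definition dG :: "('m, 'n) chart \<Rightarrow> real ^ 'n \<Rightarrow> real ^ 'n \<Rightarrow> real ^ 'n ^ 'n" where
  "dG c y h = (\<chi> i j. frechet_derivative (\<lambda>z. G c z $ i $ j) (at y) h)"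

text \<open>The Euler-Lagrange equation of the energy g(v, v)/2 with lowered index, solved for the
  term that contains the acceleration.\<close>

definition acc_rhs :: "('m, 'n) chart \<Rightarrow> real ^ 'n \<Rightarrow> real ^ 'n \<Rightarrow> real ^ 'n" where
  "acc_rhs c y v = (\<chi> l. (1/2) * (v \<bullet> (dG c y (axis l 1) *v v)) - (dG c y v *v v) $ l)"

text \<open>The coordinate acceleration of a geodesic, written by Cramer's rule so that its
  local Lipschitz continuity is visible.\<close>

definition acc :: "('m, 'n) chart \<Rightarrow> real ^ 'n \<Rightarrow> real ^ 'n \<Rightarrow> real ^ 'n" where
  "acc c y v = (\<chi> k. det (\<chi> i j. if j = k then acc_rhs c y v $ i else G c y $ i $ j) / det (G c y))"

lemma Ck_G: "c \<in> charts M \<Longrightarrow> Ck_on 2 (\<lambda>y. G c y $ i $ j) (img c)"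
  using lorentzian_M unfolding lorentzian_def by blast

lemma dG_deriv:
  assumes "c \<in> charts M" "y \<in> img c" shows "(G c has_derivative dG c y) (at y)"
proof (intro has_derivative_vecI)
  fix i j
  show "((\<lambda>x. G c x $ i $ j) has_derivative (\<lambda>h. dG c y h $ i $ j)) (at y)"
    using Ck_Suc_deriv[of 1 "\<lambda>y. G c y $ i $ j" "img c" y] Ck_G[OF assms(1), of i j] open_img[OF assms(1)] assms(2)
    by (simp add: dG_def numeral_2_eq_2)
qed

lemma dG_linear: "c \<in> charts M \<Longrightarrow> y \<in> img c \<Longrightarrow> linear (dG c y)"
  using dG_deriv has_derivative_linear by blast

lemma dG_frechet:
  "frechet_derivative (\<lambda>z. G c z $ i $ j) (at y) h = dG c y h $ i $ j"
  by (simp add: dG_def)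

lemma dG_C1:
  assumes "c \<in> charts M"
  shows "(\<lambda>y. dG c y h $ i $ j) differentiable_on img c"
    and "continuous_on (img c) (\<lambda>y. frechet_derivative (\<lambda>y. dG c y h $ i $ j) (at y) k)"
  using Ck_G[OF assms, of i j] by (auto simp: numeral_2_eq_2 dG_frechet)

lemma loclip_dG: "c \<in> charts M \<Longrightarrow> y \<in> img c \<Longrightarrow> loclip (\<lambda>y. dG c y h $ i $ j) y"
  by (rule loclip_C1[OF open_img]) (auto intro: dG_C1)

lemma cont_dG: "c \<in> charts M \<Longrightarrow> continuous_on (img c) (\<lambda>y. dG c y h)"
proof -
  assume c: "c \<in> charts M"
  have "continuous_on (img c) (\<lambda>y. dG c y h $ i $ j)" for i j
    using dG_C1(1)[OF c] by (rule differentiable_imp_continuous_on)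
  then have "continuous_on (img c) (\<lambda>y. \<chi> i j. dG c y h $ i $ j)"
    by (intro continuous_on_vec_lambda)
  then show ?thesis by simp
qed

lemma cont_dG_joint: "c \<in> charts M \<Longrightarrow> continuous_on (img c \<times> UNIV) (\<lambda>(y, h). dG c y h)"
  by (rule continuous_on_linear_family[OF dG_linear cont_dG])

lemma loclip_G: "c \<in> charts M \<Longrightarrow> y \<in> img c \<Longrightarrow> loclip (\<lambda>y. G c y $ i $ j) y"
proof (rule loclip_C1[OF open_img])
  assume c: "c \<in> charts M"
  show "(\<lambda>y. G c y $ i $ j) differentiable_on img c"
    using Ck_G[OF c, of i j] by (simp add: numeral_2_eq_2)
  show "continuous_on (img c) (\<lambda>y. frechet_derivative (\<lambda>y. G c y $ i $ j) (at y) v)" for v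
    unfolding dG_frechet using cont_dG[OF c] by (intro continuous_intros)
qed

lemma cont_G: "c \<in> charts M \<Longrightarrow> continuous_on (img c) (G c)"
  using dG_deriv by (metis continuous_at_imp_continuous_on has_derivative_continuous)

lemma G_sym: "c \<in> charts M \<Longrightarrow> y \<in> img c \<Longrightarrow> u \<bullet> (G c y *v v) = v \<bullet> (G c y *v u)"
  using lorentz_mat_sym[OF G_lorentz] by blast

lemma coord_met_sym: "c \<in> charts M \<Longrightarrow> y \<in> img c \<Longrightarrow> coord_met c y u v = coord_met c y v u"
  unfolding coord_met_def by (rule G_sym)

lemma form_deriv:
  assumes "c \<in> charts M" "y \<in> img c"
  shows "((\<lambda>z. u \<bullet> (G c z *v v)) has_derivative (\<lambda>h. u \<bullet> (dG c y h *v v))) (at y)"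
  using inner_mv_has_derivative[OF has_derivative_const dG_deriv[OF assms] has_derivative_const, of u v] by simp

lemma dG_sym:
  assumes "c \<in> charts M" "y \<in> img c"
  shows "u \<bullet> (dG c y h *v v) = v \<bullet> (dG c y h *v u)"
proof -
  have "((\<lambda>z. u \<bullet> (G c z *v v)) has_derivative (\<lambda>h. v \<bullet> (dG c y h *v u))) (at y)"
    by (rule has_derivative_transform_within_open[OF form_deriv[OF assms] open_img[OF assms(1)] assms(2)])
      (rule G_sym[OF assms(1)])
  from has_derivative_unique[OF this form_deriv[OF assms]] show ?thesis by metis
qed

lemma det_G: "c \<in> charts M \<Longrightarrow> y \<in> img c \<Longrightarrow> det (G c y) \<noteq> 0"
  using lorentz_mat_invertible[OF G_lorentz] invertible_det_nz by blast

lemma G_acc: "c \<in> charts M \<Longrightarrow> y \<in> img c \<Longrightarrow> G c y *v acc c y v = acc_rhs c y v"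
  unfolding cramer[OF det_G] by (simp add: acc_def)

lemma acc_rhs_inner:
  assumes "c \<in> charts M" "y \<in> img c"
  shows "h \<bullet> acc_rhs c y v = (1/2) * (v \<bullet> (dG c y h *v v)) - h \<bullet> (dG c y v *v v)"
proof -
  have "h \<bullet> acc_rhs c y v = (\<Sum>l\<in>UNIV. h $ l * ((1/2) * (v \<bullet> (dG c y (axis l 1) *v v)))) - h \<bullet> (dG c y v *v v)"
    by (simp add: inner_vec_def acc_rhs_def right_diff_distrib sum_subtractf)
  also have "(\<Sum>l\<in>UNIV. h $ l * ((1/2) * (v \<bullet> (dG c y (axis l 1) *v v)))) =
     (1/2) * (v \<bullet> (dG c y (\<Sum>l\<in>UNIV. (h $ l) *\<^sub>R axis l 1) *v v))"
  proof -
    interpret bounded_bilinear "(*v) :: real^'n^'n \<Rightarrow> real^'n \<Rightarrow> real^'n" by (rule bounded_bilinear_matrix_vector)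
    show ?thesis
      by (simp add: linear_sum[OF dG_linear[OF assms]] linear_cmul[OF dG_linear[OF assms]] sum_left inner_sum_right
          scaleR_left sum_distrib_left mult.left_commute)
  qed
  also have "(\<Sum>l\<in>UNIV. (h $ l) *\<^sub>R axis l 1) = h"
    by (simp only: basis_expansion flip: scalar_mult_eq_scaleR)
  finally show ?thesis .
qed

lemma euler_lagrange:
  assumes "c \<in> charts M" "y \<in> img c"
  shows "h \<bullet> (G c y *v acc c y v) + h \<bullet> (dG c y v *v v) = (1/2) * (v \<bullet> (dG c y h *v v))"
  using acc_rhs_inner[OF assms, of h v] by (simp add: G_acc[OF assms])

text \<open>Nondegeneracy makes the weak equation, tested against every \<open>h\<close>, a
  characterization. Scaling, change of chart and rigidity are all verified through it instead of
  through Christoffel symbols.\<close>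

lemma acc_unique:
  assumes "c \<in> charts M" "y \<in> img c"
    and "\<And>h. h \<bullet> (G c y *v a) + h \<bullet> (dG c y v *v v) = (1/2) * (v \<bullet> (dG c y h *v v))"
  shows "a = acc c y v"
proof -
  have "h \<bullet> (G c y *v (a - acc c y v)) = 0" for h
    using assms(3)[of h] euler_lagrange[OF assms(1,2), of h v]
    by (simp add: matrix_vector_mult_diff_distrib inner_diff_right)
  then have "G c y *v (a - acc c y v) = 0" by (metis inner_eq_zero_iff)
  then show ?thesis using lorentz_mat_ker[OF G_lorentz[OF assms(1,2)]] by fastforce
qed

lemma acc_scale:
  assumes "c \<in> charts M" "y \<in> img c"
  shows "acc c y (k *\<^sub>R v) = (k * k) *\<^sub>R acc c y v"
proof (rule acc_unique[OF assms, symmetric])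
  fix h
  interpret bounded_bilinear "(*v) :: real^'n^'n \<Rightarrow> real^'n \<Rightarrow> real^'n" by (rule bounded_bilinear_matrix_vector)
  have "dG c y (k *\<^sub>R v) = k *\<^sub>R dG c y v" by (rule linear_cmul[OF dG_linear[OF assms]])
  then have "h \<bullet> (G c y *v ((k * k) *\<^sub>R acc c y v)) + h \<bullet> (dG c y (k *\<^sub>R v) *v (k *\<^sub>R v)) =
     (k * k) * (h \<bullet> (G c y *v acc c y v) + h \<bullet> (dG c y v *v v))"
    by (simp add: scaleR_right scaleR_left algebra_simps)
  also have "\<dots> = 1/2 * (k *\<^sub>R v \<bullet> (dG c y h *v (k *\<^sub>R v)))"
    unfolding euler_lagrange[OF assms] by (simp add: scaleR_right)
  finally show "h \<bullet> (G c y *v ((k * k) *\<^sub>R acc c y v)) + h \<bullet> (dG c y (k *\<^sub>R v) *v (k *\<^sub>R v)) =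
     1/2 * (k *\<^sub>R v \<bullet> (dG c y h *v (k *\<^sub>R v)))" .
qed

text \<open>Contracted twice with \<open>v\<close>, the first two derivative terms of the
  Christoffel symbol agree after exchanging the summation indices, and together with the third they
  give minus \<open>acc_rhs\<close>. Cramer's rule then turns the inverse matrix into
  determinants.\<close>

lemma acc_christoffel:
  assumes "c \<in> charts M" "y \<in> img c"
  shows "(\<chi> k. - (\<Sum>i\<in>UNIV. \<Sum>j\<in>UNIV. christoffel M c y k i j * v $ i * v $ j)) = acc c y v"
proof -
  have sym: "dG c y h $ i $ j = dG c y h $ j $ i" for h i j
    using dG_sym[OF assms, of "axis i 1" h "axis j 1"]
    by (simp add: inner_axis' matrix_vector_mult_basis column_def)
  have ex: "dG c y v $ l $ j = (\<Sum>i\<in>UNIV. v $ i * dG c y (axis i 1) $ l $ j)" for l j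
  proof -
    have "dG c y v = dG c y (\<Sum>i\<in>UNIV. (v $ i) *\<^sub>R axis i 1)"
      by (simp only: basis_expansion flip: scalar_mult_eq_scaleR)
    then show ?thesis
      by (simp add: linear_sum[OF dG_linear[OF assms]] linear_cmul[OF dG_linear[OF assms]])
  qed
  let ?r = "\<lambda>l. (\<Sum>i\<in>UNIV. \<Sum>j\<in>UNIV. (1/2) * (dG c y (axis i 1) $ j $ l + dG c y (axis j 1) $ i $ l - dG c y (axis l 1) $ i $ j) * v $ i * v $ j)"
  have r: "?r l = - (acc_rhs c y v $ l)" for l
  proof -
    let ?s = "\<Sum>i\<in>UNIV. \<Sum>j\<in>UNIV. dG c y (axis i 1) $ j $ l * v $ i * v $ j"
    have a: "(\<Sum>i\<in>UNIV. \<Sum>j\<in>UNIV. dG c y (axis j 1) $ i $ l * v $ i * v $ j) = ?s"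
      by (subst sum.swap) (simp add: mult.commute mult.left_commute)
    have "(dG c y v *v v) $ l = ?s"
    proof -
      have "(dG c y v *v v) $ l = (\<Sum>j\<in>UNIV. \<Sum>i\<in>UNIV. dG c y (axis i 1) $ l $ j * v $ i * v $ j)"
        unfolding matrix_vector_mult_def by (simp add: ex sum_distrib_left sum_distrib_right mult.commute)
      also have "\<dots> = (\<Sum>i\<in>UNIV. \<Sum>j\<in>UNIV. dG c y (axis i 1) $ l $ j * v $ i * v $ j)"
        by (rule sum.swap)
      also have "\<dots> = ?s" by (intro sum.cong refl) (simp only: sym[of _ l])
      finally show ?thesis .
    qed
    moreover have "v \<bullet> (dG c y (axis l 1) *v v) = (\<Sum>i\<in>UNIV. \<Sum>j\<in>UNIV. dG c y (axis l 1) $ i $ j * v $ i * v $ j)"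
      unfolding inner_mv_expand by (simp add: mult.commute mult.left_commute)
    moreover have "?r l = (1/2) * (?s + (\<Sum>i\<in>UNIV. \<Sum>j\<in>UNIV. dG c y (axis j 1) $ i $ l * v $ i * v $ j) -
       (\<Sum>i\<in>UNIV. \<Sum>j\<in>UNIV. dG c y (axis l 1) $ i $ j * v $ i * v $ j))"
      by (simp add: sum_distrib_left sum.distrib[symmetric] sum_subtractf[symmetric] algebra_simps)
    ultimately show ?thesis unfolding a acc_rhs_def by (simp add: algebra_simps)
  qed
  have "invertible (G c y)" by (rule lorentz_mat_invertible[OF G_lorentz[OF assms]])
  then have inv: "G c y ** matrix_inv (G c y) = mat 1"
    unfolding invertible_def matrix_inv_def by (rule someI2_ex) blast
  have "(\<chi> k. - (\<Sum>i\<in>UNIV. \<Sum>j\<in>UNIV. christoffel M c y k i j * v $ i * v $ j)) = matrix_inv (G c y) *v acc_rhs c y v"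
  proof (rule vec_eq_iff[THEN iffD2], rule allI)
    fix k
    have "(\<Sum>i\<in>UNIV. \<Sum>j\<in>UNIV. christoffel M c y k i j * v $ i * v $ j) =
      (\<Sum>i\<in>UNIV. \<Sum>j\<in>UNIV. \<Sum>l\<in>UNIV. matrix_inv (G c y) $ k $ l * ((1/2) * (dG c y (axis i 1) $ j $ l + dG c y (axis j 1) $ i $ l - dG c y (axis l 1) $ i $ j) * v $ i * v $ j))"
      unfolding christoffel_def partial_deriv_def dG_frechet
      by (simp add: sum_distrib_left sum_distrib_right mult.assoc mult.left_commute)
    also have "\<dots> = (\<Sum>l\<in>UNIV. matrix_inv (G c y) $ k $ l * ?r l)"
      unfolding sum_distrib_left
      by (subst sum.swap[of _ UNIV UNIV], rule sum.cong[OF refl], rule sum.swap)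
    finally show "(\<chi> k. - (\<Sum>i\<in>UNIV. \<Sum>j\<in>UNIV. christoffel M c y k i j * v $ i * v $ j)) $ k = (matrix_inv (G c y) *v acc_rhs c y v) $ k"
      unfolding r by (simp add: matrix_vector_mult_def sum_negf)
  qed
  then have "G c y *v (\<chi> k. - (\<Sum>i\<in>UNIV. \<Sum>j\<in>UNIV. christoffel M c y k i j * v $ i * v $ j)) = acc_rhs c y v"
    by (simp add: matrix_vector_mul_assoc inv)
  then show ?thesis unfolding cramer[OF det_G[OF assms]] acc_def .
qed

text \<open>The metric is C^2, so its first derivatives are C^1 and hence locally Lipschitz;
  \<open>acc\<close> is built from them, from \<open>G\<close> and from the velocity by sums,
  products and one division by a nonzero determinant.\<close>

lemma loclip_acc:
  assumes c: "c \<in> charts M" "y \<in> img c"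
  shows "loclip (\<lambda>p. acc c (fst p) (snd p)) (y, v)"
proof (rule loclip_vec)
  fix k
  have lf: "loclip (\<lambda>p. h (fst p)) (y, v)" if "loclip h y" for h :: "real ^ 'n \<Rightarrow> real"
    by (rule loclip_compose) (auto intro: that loclip_bounded_linear bounded_linear_fst)
  have ls: "loclip (\<lambda>p. snd p $ i) (y, v)" for i :: 'n
    by (intro loclip_component loclip_bounded_linear bounded_linear_snd)
  have "acc_rhs c z w $ l = (1/2) * (\<Sum>i\<in>UNIV. \<Sum>j\<in>UNIV. w $ i * dG c z (axis l 1) $ i $ j * w $ j) -
    (\<Sum>j\<in>UNIV. (\<Sum>i\<in>UNIV. w $ i * dG c z (axis i 1) $ l $ j) * w $ j)" if z: "z \<in> img c" for z w l
  proof -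
    have "dG c z w = dG c z (\<Sum>i\<in>UNIV. (w $ i) *\<^sub>R axis i 1)"
      by (simp only: basis_expansion flip: scalar_mult_eq_scaleR)
    then have "dG c z w $ l $ j = (\<Sum>i\<in>UNIV. w $ i * dG c z (axis i 1) $ l $ j)" for j
      by (simp add: linear_sum[OF dG_linear[OF c(1) z]] linear_cmul[OF dG_linear[OF c(1) z]])
    then show ?thesis unfolding acc_rhs_def inner_mv_expand[symmetric] by (simp add: matrix_vector_mult_def)
  qed
  note e = this
  have "loclip (\<lambda>p. (1/2) * (\<Sum>i\<in>UNIV. \<Sum>j\<in>UNIV. snd p $ i * dG c (fst p) (axis l 1) $ i $ j * snd p $ j) -
    (\<Sum>j\<in>UNIV. (\<Sum>i\<in>UNIV. snd p $ i * dG c (fst p) (axis i 1) $ l $ j) * snd p $ j)) (y, v)" (is "loclip (?R l) _") for l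
    by (intro loclip_diff loclip_mult loclip_sum loclip_const ls lf loclip_dG c)
  then have "loclip (\<lambda>p. det (\<chi> i j. if j = k then ?R i p else G c (fst p) $ i $ j) / det (G c (fst p))) (y, v)"
  proof -
    assume r: "\<And>l. loclip (?R l) (y, v)"
    have g: "loclip (\<lambda>p. G c (fst p) $ i $ j) (y, v)" for i j by (intro lf loclip_G c)
    have *: "loclip (\<lambda>p. (\<chi> i j. if j = k then ?R i p else G c (fst p) $ i $ j) $ i $ j) (y, v)" for i j
      unfolding vec_lambda_beta using r[of i] g[of i j] by (cases "j = k") simp_all
    show ?thesis by (intro loclip_divide loclip_det * g) (simp add: det_G c)
  qed
  note R = this
  \<comment> \<open>The expanded formula for \<open>acc_rhs\<close> uses linearity of
    \<open>dG\<close>, known only on the chart image; hence the restriction to a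
    neighbourhood.\<close>
  have "\<forall>\<^sub>F p in nhds ((y, v), (y, v)). p \<in> (img c \<times> UNIV) \<times> (img c \<times> UNIV)"
    by (rule eventually_nhds_in_open) (use c open_img[OF c(1)] in \<open>auto intro!: open_Times\<close>)
  moreover obtain L where "\<forall>\<^sub>F p in nhds ((y, v), (y, v)).
     dist (det (\<chi> i j. if j = k then ?R i (fst p) else G c (fst (fst p)) $ i $ j) / det (G c (fst (fst p))))
      (det (\<chi> i j. if j = k then ?R i (snd p) else G c (fst (snd p)) $ i $ j) / det (G c (fst (snd p)))) \<le> L * dist (fst p) (snd p)"
    using R unfolding loclip_def by blast
  ultimately have "\<forall>\<^sub>F p in nhds ((y, v), (y, v)). dist (acc c (fst (fst p)) (snd (fst p)) $ k) (acc c (fst (snd p)) (snd (snd p)) $ k) \<le> L * dist (fst p) (snd p)"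
  proof eventually_elim
    case (elim p)
    then have "fst (fst p) \<in> img c" "fst (snd p) \<in> img c" by auto
    then show ?case using elim(2) unfolding acc_def by (simp add: e cong: if_cong)
  qed
  then show "loclip (\<lambda>p. acc c (fst p) (snd p) $ k) (y, v)" unfolding loclip_def by blast
qed

section \<open>Change of coordinates\<close>

definition transition_deriv2 :: "('m, 'n) chart \<Rightarrow> ('m, 'n) chart \<Rightarrow> real ^ 'n \<Rightarrow> real ^ 'n \<Rightarrow> real ^ 'n \<Rightarrow> real ^ 'n" where
  "transition_deriv2 c d y h u = frechet_derivative (\<lambda>z. transition_deriv c d z u) (at y) h"

abbreviation "overlap c d \<equiv> cmap c ` (cdom c \<inter> cdom d)"

lemma overlap_charts_at:
  assumes "c \<in> charts M" "d \<in> charts M" "y \<in> overlap c d"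
  shows "c \<in> charts_at M (cinv c y)" "d \<in> charts_at M (cinv c y)" "cmap c (cinv c y) = y" "y \<in> img c"
    "transition c d y \<in> img d" "transition c d y \<in> overlap d c"
    "cinv d (transition c d y) = cinv c y"
  using assms by (auto simp: cinv_cmap transition_def)

lemma transition_deriv_deriv_at:
  assumes "c \<in> charts M" "d \<in> charts M" "y \<in> overlap c d"
  shows "(transition c d has_derivative transition_deriv c d y) (at y)"
  using transition_deriv_deriv[OF overlap_charts_at(1,2)[OF assms]] overlap_charts_at(3)[OF assms] by simp

lemma transition_deriv_lin_at:
  assumes "c \<in> charts M" "d \<in> charts M" "y \<in> overlap c d" shows "linear (transition_deriv c d y)"
  using transition_deriv_deriv_at[OF assms] has_derivative_linear by blast

lemma transition_deriv_C1:
  assumes "c \<in> charts M" "d \<in> charts M"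
  shows "Ck_on 2 (\<lambda>z. transition_deriv c d z u) (overlap c d)"
  using Ck_transition[OF assms] unfolding transition_deriv_def by (simp add: numeral_3_eq_3 numeral_2_eq_2)

lemma transition_deriv2_deriv:
  assumes "c \<in> charts M" "d \<in> charts M" "y \<in> overlap c d"
  shows "((\<lambda>z. transition_deriv c d z u) has_derivative (\<lambda>h. transition_deriv2 c d y h u)) (at y)"
  unfolding transition_deriv2_def
  by (rule Ck_Suc_deriv[where k = 1]) (use transition_deriv_C1[OF assms(1,2), of u] open_overlap[OF assms(1,2)] assms(3) in
    \<open>simp_all add: numeral_2_eq_2\<close>)

lemma cont_transition_deriv: "c \<in> charts M \<Longrightarrow> d \<in> charts M \<Longrightarrow> continuous_on (overlap c d) (\<lambda>z. transition_deriv c d z u)"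
  using transition_deriv_C1[of c d u] differentiable_imp_continuous_on by (fastforce simp: numeral_2_eq_2)

lemma cont_transition_deriv_joint:
  "c \<in> charts M \<Longrightarrow> d \<in> charts M \<Longrightarrow> continuous_on (overlap c d \<times> UNIV) (\<lambda>(z, u). transition_deriv c d z u)"
  by (rule continuous_on_linear_family[OF transition_deriv_lin_at cont_transition_deriv])

lemma cont_transition_deriv2:
  assumes "c \<in> charts M" "d \<in> charts M" shows "continuous_on (overlap c d) (\<lambda>z. transition_deriv2 c d z h u)"
proof -
  have "Ck_on 1 (\<lambda>x. frechet_derivative (\<lambda>z. transition_deriv c d z u) (at x) h) (overlap c d)"
    using transition_deriv_C1[OF assms, of u] by (simp add: numeral_2_eq_2)
  then show ?thesis unfolding transition_deriv2_def using differentiable_imp_continuous_on by auto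
qed

lemma directional_derivative:
  assumes "(f has_derivative f') (at (y :: real ^ 'n))"
  shows "((\<lambda>s. f (y + s *\<^sub>R u) \<bullet> e) has_real_derivative f' u \<bullet> e) (at 0)"
proof -
  have "((\<lambda>s. y + s *\<^sub>R u) has_derivative (\<lambda>s. s *\<^sub>R u)) (at 0)"
    by (auto intro!: derivative_eq_intros)
  moreover have "(f has_derivative f') (at (y + 0 *\<^sub>R u))" using assms by simp
  ultimately have "((\<lambda>s. f (y + s *\<^sub>R u)) has_derivative (\<lambda>s. f' (s *\<^sub>R u))) (at 0)"
    using has_derivative_compose[of "\<lambda>s. y + s *\<^sub>R u" "\<lambda>s. s *\<^sub>R u" 0 UNIV f f'] by simp
  then have "((\<lambda>s. f (y + s *\<^sub>R u) \<bullet> e) has_derivative (\<lambda>s. f' (s *\<^sub>R u) \<bullet> e)) (at 0)"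
    by (rule has_derivative_inner_left)
  moreover have "f' (s *\<^sub>R u) \<bullet> e = (f' u \<bullet> e) * s" for s
    using linear_cmul[OF has_derivative_linear[OF assms]] by (simp add: mult.commute)
  ultimately show ?thesis by (simp add: has_field_derivative_def)
qed

lemma transition_deriv2_sym:
  assumes cd: "c \<in> charts M" "d \<in> charts M" and y: "y \<in> overlap c d"
  shows "transition_deriv2 c d y h u = transition_deriv2 c d y u h"
proof (rule euclidean_eqI)
  fix b :: "real ^ 'n" assume "b \<in> Basis"
  have "transition_deriv2 c d y u h \<bullet> b = transition_deriv2 c d y h u \<bullet> b"
  proof (rule mixed_directional_derivatives_eq[where S = "overlap c d" and f = "\<lambda>z. transition c d z \<bullet> b"
        and u = h and v = u and fu = "\<lambda>z. transition_deriv c d z h \<bullet> b" and fv = "\<lambda>z. transition_deriv c d z u \<bullet> b"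
        and fuv = "\<lambda>z. transition_deriv2 c d z u h \<bullet> b" and fvu = "\<lambda>z. transition_deriv2 c d z h u \<bullet> b"])
    show "open (overlap c d)" by (rule open_overlap[OF cd])
  qed (use y in \<open>auto intro!: directional_derivative transition_deriv_deriv_at transition_deriv2_deriv cd continuous_intros cont_transition_deriv2 simp del: image_iff\<close>)
  then show "transition_deriv2 c d y h u \<bullet> b = transition_deriv2 c d y u h \<bullet> b" by simp
qed

lemma transition_deriv2_lin:
  assumes "c \<in> charts M" "d \<in> charts M" "y \<in> overlap c d" shows "linear (\<lambda>h. transition_deriv2 c d y h u)"
  using transition_deriv2_deriv[OF assms] has_derivative_linear by blast

text \<open>A product rule by components: differentiability in the base point is available only for
  constant vectors, so the moving vector is expanded in the standard basis.\<close>

lemma transition_deriv_moving: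
  assumes cd: "c \<in> charts M" "d \<in> charts M" and y: "x t \<in> overlap c d"
    and x: "(x has_vector_derivative x') (at t within J)" and v: "(v has_vector_derivative a) (at t within J)"
    and J: "t \<in> J"
  shows "((\<lambda>s. transition_deriv c d (x s) (v s)) has_vector_derivative transition_deriv c d (x t) a + transition_deriv2 c d (x t) x' (v t)) (at t within J)"
proof -
  let ?e = "\<lambda>i. axis i 1 :: real ^ 'n"
  have ex: "w = (\<Sum>i\<in>UNIV. (w $ i) *\<^sub>R ?e i)" for w :: "real ^ 'n"
    by (simp only: basis_expansion flip: scalar_mult_eq_scaleR)
  have lin: "transition_deriv c d z w = (\<Sum>i\<in>UNIV. (w $ i) *\<^sub>R transition_deriv c d z (?e i))" if "z \<in> overlap c d" for z w
    by (subst ex[of w]) (simp add: linear_sum[OF transition_deriv_lin_at[OF cd that]] linear_cmul[OF transition_deriv_lin_at[OF cd that]])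
  \<comment> \<open>Linearity is known in the slot of differentiation; symmetry carries it over to
    the vector slot.\<close>
  have lin2: "transition_deriv2 c d (x t) h w = (\<Sum>i\<in>UNIV. (w $ i) *\<^sub>R transition_deriv2 c d (x t) h (?e i))" for h w
    unfolding transition_deriv2_sym[OF cd y, of h]
    by (subst ex[of w]) (simp add: linear_sum[OF transition_deriv2_lin[OF cd y]] linear_cmul[OF transition_deriv2_lin[OF cd y]])
  have vi: "((\<lambda>s. v s $ i) has_real_derivative a $ i) (at t within J)" for i
    using bounded_linear.has_vector_derivative[OF bounded_linear_vec_nth v, of i]
    by (simp add: has_real_derivative_iff_has_vector_derivative)
  have ti: "((\<lambda>s. transition_deriv c d (x s) (?e i)) has_vector_derivative transition_deriv2 c d (x t) x' (?e i)) (at t within J)" for i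
    using has_derivative_compose[OF x[unfolded has_vector_derivative_def] transition_deriv2_deriv[OF cd y, of "?e i"]]
    by (simp add: has_vector_derivative_def linear_cmul[OF transition_deriv2_lin[OF cd y]])
  have "((\<lambda>s. \<Sum>i\<in>UNIV. (v s $ i) *\<^sub>R transition_deriv c d (x s) (?e i)) has_vector_derivative
     (\<Sum>i\<in>UNIV. (v t $ i) *\<^sub>R transition_deriv2 c d (x t) x' (?e i) + (a $ i) *\<^sub>R transition_deriv c d (x t) (?e i))) (at t within J)"
    by (intro has_vector_derivative_sum has_vector_derivative_scaleR vi ti)
  moreover have "(\<Sum>i\<in>UNIV. (v t $ i) *\<^sub>R transition_deriv2 c d (x t) x' (?e i) + (a $ i) *\<^sub>R transition_deriv c d (x t) (?e i)) =
     transition_deriv c d (x t) a + transition_deriv2 c d (x t) x' (v t)"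
    unfolding sum.distrib lin[OF y, of a] lin2[of x' "v t"] by (rule add.commute)
  ultimately have D: "((\<lambda>s. \<Sum>i\<in>UNIV. (v s $ i) *\<^sub>R transition_deriv c d (x s) (?e i)) has_vector_derivative
     transition_deriv c d (x t) a + transition_deriv2 c d (x t) x' (v t)) (at t within J)" by simp
  have "\<forall>\<^sub>F s in at t within J. x s \<in> overlap c d"
    using has_vector_derivative_continuous[OF x] open_overlap[OF cd] y
    by (auto simp: continuous_within tendsto_def)
  then have E: "\<forall>\<^sub>F s in at t within J. (\<Sum>i\<in>UNIV. (v s $ i) *\<^sub>R transition_deriv c d (x s) (?e i)) = transition_deriv c d (x s) (v s)"
    by eventually_elim (rule lin[symmetric])
  show ?thesis
    using has_derivative_transform_eventually[OF D[unfolded has_vector_derivative_def] E lin[OF y, symmetric] J]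
    by (simp add: has_vector_derivative_def)
qed

lemma G_transform:
  assumes "c \<in> charts M" "d \<in> charts M" "z \<in> overlap c d"
  shows "u \<bullet> (G c z *v v) = transition_deriv c d z u \<bullet> (G d (transition c d z) *v transition_deriv c d z v)"
proof -
  note o = overlap_charts_at[OF assms]
  have "met M (cinv c z) (lift c (cinv c z) u) (lift c (cinv c z) v) = coord_met d (cmap d (cinv c z)) (lift c (cinv c z) u d) (lift c (cinv c z) v d)"
    by (rule met_coord[OF lift_tangent[OF o(1)] lift_tangent[OF o(1)] o(2)])
  then show ?thesis using met_lift[OF o(1), of u v] o by (simp add: coord_met_def lift_def transition_def)
qed

lemma dG_transform:
  assumes cd: "c \<in> charts M" "d \<in> charts M" and z: "z \<in> overlap c d"
  shows "u \<bullet> (dG c z h *v v) =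
     transition_deriv c d z u \<bullet> (G d (transition c d z) *v transition_deriv2 c d z h v) +
     transition_deriv c d z u \<bullet> (dG d (transition c d z) (transition_deriv c d z h) *v transition_deriv c d z v) +
     transition_deriv2 c d z h u \<bullet> (G d (transition c d z) *v transition_deriv c d z v)"
proof -
  note o = overlap_charts_at[OF assms]
  have "((\<lambda>z. G d (transition c d z)) has_derivative (\<lambda>h. dG d (transition c d z) (transition_deriv c d z h))) (at z)"
    using has_derivative_compose[OF transition_deriv_deriv_at[OF assms] dG_deriv[OF cd(2) o(5)]] by simp
  from inner_mv_has_derivative[OF transition_deriv2_deriv[OF assms, of u] this transition_deriv2_deriv[OF assms, of v]]
  have "((\<lambda>z. u \<bullet> (G c z *v v)) has_derivative (\<lambda>h. transition_deriv c d z u \<bullet> (G d (transition c d z) *v transition_deriv2 c d z h v +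
     dG d (transition c d z) (transition_deriv c d z h) *v transition_deriv c d z v) +
     transition_deriv2 c d z h u \<bullet> (G d (transition c d z) *v transition_deriv c d z v))) (at z)"
    by (rule has_derivative_transform_within_open[OF _ open_overlap[OF cd] z]) (rule G_transform[OF cd, symmetric])
  from fun_cong[OF has_derivative_unique[OF this form_deriv[OF cd(1) o(4), of u v]], of h]
  show ?thesis by (simp add: inner_add_right)
qed

text \<open>Every test vector in \<open>d\<close> comes from one in \<open>c\<close>, so the
  Euler-Lagrange equation can be pulled back. The second derivatives of the transition in directions
  \<open>v\<close> and \<open>h\<close> cancel by symmetry, and the one in \<open>v\<close> twice
  survives as the inhomogeneous term.\<close>

lemma acc_transform:
  assumes cd: "c \<in> charts M" "d \<in> charts M" and z: "z \<in> overlap c d"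
  shows "transition_deriv c d z (acc c z v) + transition_deriv2 c d z v v = acc d (transition c d z) (transition_deriv c d z v)"
proof -
  note o = overlap_charts_at[OF assms]
  let ?y = "transition c d z" and ?D = "transition_deriv c d z" and ?w = "transition_deriv c d z v"
  show ?thesis
  proof (rule acc_unique[OF cd(2) o(5)])
    fix h'
    obtain h where h: "h' = ?D h"
      using transition_deriv_comp[OF o(2,1,2), of h'] transition_deriv_id[OF o(2), of h'] o(3) by metis
    have 1: "h \<bullet> (G c z *v acc c z v) = ?D h \<bullet> (G d ?y *v ?D (acc c z v))" by (rule G_transform[OF assms])
    have 2: "h \<bullet> (dG c z v *v v) = ?D h \<bullet> (G d ?y *v transition_deriv2 c d z v v) + ?D h \<bullet> (dG d ?y ?w *v ?w) +
       transition_deriv2 c d z v h \<bullet> (G d ?y *v ?w)" by (rule dG_transform[OF assms])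
    have 3: "v \<bullet> (dG c z h *v v) = ?w \<bullet> (G d ?y *v transition_deriv2 c d z h v) + ?w \<bullet> (dG d ?y (?D h) *v ?w) +
       transition_deriv2 c d z h v \<bullet> (G d ?y *v ?w)" by (rule dG_transform[OF assms])
    have 4: "?w \<bullet> (G d ?y *v transition_deriv2 c d z h v) = transition_deriv2 c d z h v \<bullet> (G d ?y *v ?w)"
      by (rule G_sym[OF cd(2) o(5)])
    have 5: "transition_deriv2 c d z v h = transition_deriv2 c d z h v" by (rule transition_deriv2_sym[OF assms])
    have "h' \<bullet> (G d ?y *v (?D (acc c z v) + transition_deriv2 c d z v v)) =
       ?D h \<bullet> (G d ?y *v ?D (acc c z v)) + ?D h \<bullet> (G d ?y *v transition_deriv2 c d z v v)"
      unfolding h by (simp add: matrix_vector_right_distrib inner_add_right)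
    then show "h' \<bullet> (G d ?y *v (?D (acc c z v) + transition_deriv2 c d z v v)) + h' \<bullet> (dG d ?y ?w *v ?w) =
        1/2 * (?w \<bullet> (dG d ?y h' *v ?w))"
      using euler_lagrange[OF cd(1) o(4), of h v] 1 2 3 4 5 unfolding h by (simp add: field_simps)
  qed
qed

section \<open>Vector fields, causal cones and local time functions in coordinates\<close>

definition coord_field :: "('m \<Rightarrow> ('m, 'n) tvector) \<Rightarrow> ('m, 'n) chart \<Rightarrow> real ^ 'n \<Rightarrow> real ^ 'n" where
  "coord_field X c y = X (cinv c y) c"

lemma cont_coord_field:
  assumes "continuous_vector_field M X" "c \<in> charts M"
  shows "continuous_on (img c) (coord_field X c)"
  unfolding coord_field_def
  by (rule continuous_on_compose2[of "cdom c" "\<lambda>p. X p c", OF _ cont_cinv[OF assms(2)]])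
    (use assms in \<open>auto simp: continuous_vector_field_def cinv_cmap\<close>)

lemma coord_orient_coord_field: "coord_orient = coord_field (torient M)" by (simp add: coord_orient_def coord_field_def fun_eq_iff)

lemma torient_field: "continuous_vector_field M (torient M)" "timelike_vec M p (torient M p)" "torient M p \<in> tangent_space M p"
  using time_oriented unfolding time_oriented_lorentzian_def timelike_vec_def by auto

lemma cont_coord_orient: "c \<in> charts M \<Longrightarrow> continuous_on (img c) (coord_orient c)"
  unfolding coord_orient_coord_field by (rule cont_coord_field[OF torient_field(1)])

lemma coord_field_cmap: "c \<in> charts_at M p \<Longrightarrow> coord_field X c (cmap c p) = X p c"
  by (simp add: coord_field_def cinv_cmap charts_atD)

lemma coord_orient_timelike:
  assumes "c \<in> charts M" "y \<in> img c" shows "coord_met c y (coord_orient c y) (coord_orient c y) < 0"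
proof -
  obtain p where p: "p \<in> cdom c" "y = cmap c p" using assms by auto
  then have c: "c \<in> charts_at M p" using assms by auto
  then show ?thesis using torient_field(2)[of p] met_coord[OF torient_field(3) torient_field(3) c]
    by (simp add: timelike_vec_def coord_orient_coord_field coord_field_cmap p)
qed

text \<open>The strict inequality selects the future half of the cone and at the same time excludes
  the zero vector.\<close>

definition causal_dir :: "('m, 'n) chart \<Rightarrow> real ^ 'n \<Rightarrow> real ^ 'n \<Rightarrow> bool" where
  "causal_dir c y u \<longleftrightarrow> coord_met c y u u \<le> 0 \<and> coord_met c y u (coord_orient c y) < 0"

definition timelike_dir :: "('m, 'n) chart \<Rightarrow> real ^ 'n \<Rightarrow> real ^ 'n \<Rightarrow> bool" where
  "timelike_dir c y u \<longleftrightarrow> coord_met c y u u < 0 \<and> coord_met c y u (coord_orient c y) < 0"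

lemma timelike_dir_causal_dir: "timelike_dir c y u \<Longrightarrow> causal_dir c y u" by (simp add: timelike_dir_def causal_dir_def)

lemma causal_dir_nonzero: "causal_dir c y u \<Longrightarrow> u \<noteq> 0" by (auto simp: causal_dir_def coord_met_def)

lemma future_vec_coord:
  assumes "v \<in> tangent_space M p" "c \<in> charts_at M p"
  shows "future_vec M p v \<longleftrightarrow> coord_met c (cmap c p) (v c) (coord_orient c (cmap c p)) < 0"
  unfolding future_vec_def met_coord[OF assms(1) torient_field(3) assms(2)] coord_orient_coord_field coord_field_cmap[OF assms(2)] ..

lemma causal_dir_coord:
  assumes "v \<in> tangent_space M p" "c \<in> charts_at M p"
  shows "causal_vec M p v \<and> future_vec M p v \<longleftrightarrow> causal_dir c (cmap c p) (v c)"
  unfolding causal_vec_def causal_dir_def future_vec_coord[OF assms] met_coord[OF assms(1,1,2)]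
  using assms(1) by (auto simp: coord_met_def)

lemma timelike_dir_coord:
  assumes "v \<in> tangent_space M p" "c \<in> charts_at M p"
  shows "timelike_vec M p v \<and> future_vec M p v \<longleftrightarrow> timelike_dir c (cmap c p) (v c)"
  unfolding timelike_vec_def timelike_dir_def future_vec_coord[OF assms] met_coord[OF assms(1,1,2)]
  using assms(1) by (auto simp: coord_met_def)

lemma coord_met_scale: "coord_met c y (a *\<^sub>R u) v = a * coord_met c y u v" "coord_met c y u (a *\<^sub>R v) = a * coord_met c y u v"
  by (simp_all add: coord_met_def matrix_vector_mult_scaleR)

lemma causal_dir_scale: "0 < k \<Longrightarrow> causal_dir c y u \<Longrightarrow> causal_dir c y (k *\<^sub>R u)"
  by (auto simp: causal_dir_def coord_met_scale mult_pos_neg mult_nonneg_nonpos)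

lemma causal_dir_timelike_dir_neg:
  assumes "c \<in> charts M" "y \<in> img c" "causal_dir c y u" "timelike_dir c y T"
  shows "coord_met c y u T < 0"
proof (rule ccontr)
  assume n: "\<not> ?thesis"
  have t: "coord_orient c y \<bullet> (G c y *v T) < 0" using assms coord_met_sym[OF assms(1,2)] by (simp add: timelike_dir_def coord_met_def)
  show False
    using time_cone[OF G_lorentz[OF assms(1,2)], of "coord_orient c y" T u] coord_orient_timelike[OF assms(1,2)] t n assms
    by (auto simp: coord_met_def timelike_dir_def causal_dir_def)
qed

lemma cont_coord_met:
  assumes "c \<in> charts M" "continuous_on S x" "x ` S \<subseteq> img c" "continuous_on S u" "continuous_on S v"
  shows "continuous_on S (\<lambda>t. coord_met c (x t) (u t) (v t))"
  unfolding coord_met_def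
  by (intro continuous_intros assms continuous_on_compose2[OF cont_G[OF assms(1)] assms(2)])

text \<open>Unit causal directions near \<open>y0\<close> form a compact family in the limit, on
  which the covector dual to \<open>-T\<close> is positive. A constant \<open>\<omega>\<close> gives
  local time functions; the variable one dual to a gauge field turns a bound on the gauge into a
  bound on vectors.\<close>

lemma cone_bound:
  assumes c: "c \<in> charts M" and y0: "y0 \<in> img c" and T: "timelike_dir c y0 T"
    and om: "continuous_on (img c) \<omega>" "\<omega> y0 = - (G c y0 *v T)"
  obtains \<delta> C where "\<delta> > 0" "C > 0" "ball y0 \<delta> \<subseteq> img c"
    "\<And>y u. y \<in> ball y0 \<delta> \<Longrightarrow> causal_dir c y u \<Longrightarrow> norm u \<le> C * (\<omega> y \<bullet> u)"
proof -
  obtain r where r: "r > 0" "ball y0 r \<subseteq> img c" using open_img[OF c] y0 openE by blast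
  \<comment> \<open>One index governs both the radius and the constant, so failure for all
    \<open>n\<close> produces base points tending to \<open>y0\<close> and unit directions on which
    \<open>\<omega>\<close> is at most 1/(n+1).\<close>
  have "\<exists>n::nat. \<forall>y u. y \<in> ball y0 (r / (real n + 1)) \<longrightarrow> causal_dir c y u \<longrightarrow> norm u \<le> (real n + 1) * (\<omega> y \<bullet> u)"
  proof (rule ccontr)
    assume "\<not> ?thesis"
    then have "\<forall>n::nat. \<exists>y u. y \<in> ball y0 (r / (real n + 1)) \<and> causal_dir c y u \<and> \<not> norm u \<le> (real n + 1) * (\<omega> y \<bullet> u)" by blast
    then obtain y u :: "nat \<Rightarrow> real ^ 'n" where yu: "\<And>n::nat. y n \<in> ball y0 (r / (real n + 1))" "\<And>n. causal_dir c (y n) (u n)"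
       "\<And>n::nat. \<not> norm (u n) \<le> (real n + 1) * (\<omega> (y n) \<bullet> u n)" by metis
    define U where "U n = (1 / norm (u n)) *\<^sub>R u n" for n
    have n0: "norm (u n) > 0" for n using causal_dir_nonzero[OF yu(2)] by simp
    have cU: "causal_dir c (y n) (U n)" for n unfolding U_def using n0 yu(2) by (intro causal_dir_scale) auto
    have nU: "norm (U n) = 1" for n unfolding U_def using n0[of n] by simp
    have oU: "\<omega> (y n) \<bullet> U n < 1 / (real n + 1)" for n
    proof -
      have "norm (U n) = (1 / norm (u n)) * norm (u n)" using nU[of n] n0[of n] by simp
      also have "\<dots> > (1 / norm (u n)) * ((real n + 1) * (\<omega> (y n) \<bullet> u n))"
        using yu(3)[of n] n0[of n] by (intro mult_strict_left_mono) auto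
      finally have "(real n + 1) * (\<omega> (y n) \<bullet> U n) < 1" unfolding nU by (simp add: U_def mult.left_commute)
      then show ?thesis by (simp add: field_simps)
    qed
    have "compact (sphere (0 :: real ^ 'n) 1)" by simp
    then obtain u0 s where s: "u0 \<in> sphere 0 1" "strict_mono s" "(U \<circ> s) \<longlonglongrightarrow> u0"
      using nU unfolding compact_eq_seq_compact_metric seq_compact_def by (metis mem_sphere_0)
    have y: "y \<longlonglongrightarrow> y0"
    proof (rule metric_tendsto_imp_tendsto)
      show "(\<lambda>n. r / (real n + 1)) \<longlonglongrightarrow> 0" by real_asymp
      show "\<forall>\<^sub>F n in sequentially. dist (y n) y0 \<le> dist (r / (real n + 1)) 0"
        using yu(1) r(1) by (auto simp: dist_commute less_imp_le)
    qed
    have ys: "(y \<circ> s) \<longlonglongrightarrow> y0" by (rule LIMSEQ_subseq_LIMSEQ[OF y s(2)])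
    have yi: "\<forall>\<^sub>F n in sequentially. (y \<circ> s) n \<in> img c"
    proof (rule always_eventually, rule allI)
      fix n
      have "r / (real (s n) + 1) \<le> r" using r(1) by (simp add: field_simps)
      then have "(y \<circ> s) n \<in> ball y0 r" using yu(1)[of "s n"] by auto
      then show "(y \<circ> s) n \<in> img c" using r(2) by blast
    qed
    have Gl: "(\<lambda>n. G c ((y \<circ> s) n)) \<longlonglongrightarrow> G c y0"
      by (rule continuous_on_tendsto_compose[OF cont_G[OF c] ys y0 yi])
    have tl: "(\<lambda>n. coord_orient c ((y \<circ> s) n)) \<longlonglongrightarrow> coord_orient c y0"
      by (rule continuous_on_tendsto_compose[OF cont_coord_orient[OF c] ys y0 yi])
    have ol: "(\<lambda>n. \<omega> ((y \<circ> s) n)) \<longlonglongrightarrow> \<omega> y0"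
      by (rule continuous_on_tendsto_compose[OF om(1) ys y0 yi])
    have "(\<lambda>n. coord_met c ((y \<circ> s) n) ((U \<circ> s) n) ((U \<circ> s) n)) \<longlonglongrightarrow> coord_met c y0 u0 u0"
      unfolding coord_met_def by (intro tendsto_intros Gl s(3))
    then have 1: "coord_met c y0 u0 u0 \<le> 0"
      by (rule tendsto_upperbound) (use cU in \<open>auto simp: causal_dir_def\<close>)
    have "(\<lambda>n. coord_met c ((y \<circ> s) n) ((U \<circ> s) n) (coord_orient c ((y \<circ> s) n))) \<longlonglongrightarrow> coord_met c y0 u0 (coord_orient c y0)"
      unfolding coord_met_def by (intro tendsto_intros Gl s(3) tl)
    then have 2: "coord_met c y0 u0 (coord_orient c y0) \<le> 0"
      by (rule tendsto_upperbound) (use cU in \<open>auto simp: causal_dir_def less_imp_le\<close>)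
    have "u0 \<noteq> 0" using s(1) by auto
    \<comment> \<open>The limit preserves only weak inequalities. A nonzero causal vector is never
      orthogonal to a timelike one, so \<open>u0\<close> remains strictly future-directed.\<close>
    then have "coord_met c y0 u0 (coord_orient c y0) \<noteq> 0"
      using timelike_not_orthogonal_causal[OF G_lorentz[OF c y0], of "coord_orient c y0" u0] coord_orient_timelike[OF c y0] 1
      by (auto simp: coord_met_def)
    then have "causal_dir c y0 u0" using 1 2 by (auto simp: causal_dir_def)
    then have "coord_met c y0 u0 T < 0" by (rule causal_dir_timelike_dir_neg[OF c y0 _ T])
    then have pos: "\<omega> y0 \<bullet> u0 > 0" unfolding om(2) coord_met_def by (simp add: inner_commute)
    have "(\<lambda>n. \<omega> ((y \<circ> s) n) \<bullet> (U \<circ> s) n - 1 / (real (s n) + 1)) \<longlonglongrightarrow> \<omega> y0 \<bullet> u0 - 0"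
    proof (intro tendsto_intros ol s(3))
      have "(\<lambda>n. 1 / (real n + 1)) \<longlonglongrightarrow> 0" by real_asymp
      from LIMSEQ_subseq_LIMSEQ[OF this s(2)] show "(\<lambda>n. 1 / (real (s n) + 1)) \<longlonglongrightarrow> 0" by (simp add: o_def)
    qed
    then have "\<omega> y0 \<bullet> u0 - 0 \<le> 0"
      by (rule tendsto_upperbound) (use oU in \<open>auto intro!: always_eventually less_imp_le\<close>)
    then show False using pos by simp
  qed
  then obtain n :: nat where n: "\<And>y u. y \<in> ball y0 (r / (real n + 1)) \<Longrightarrow> causal_dir c y u \<Longrightarrow> norm u \<le> (real n + 1) * (\<omega> y \<bullet> u)"
    by blast
  show ?thesis
  proof (rule that[of "r / (real n + 1)" "real n + 1"])
    have "r / (real n + 1) \<le> r" using r(1) by (simp add: field_simps)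
    then show "ball y0 (r / (real n + 1)) \<subseteq> img c" using r(2) by (meson order_trans subset_ball)
  qed (use r n in auto)
qed

text \<open>In a good_region region the constant vector \<open>T\<close> is timelike and \<open>\<xi>\<close> is a local time function.\<close>

definition good_region :: "('m, 'n) chart \<Rightarrow> (real ^ 'n) set \<Rightarrow> real ^ 'n \<Rightarrow> real ^ 'n \<Rightarrow> bool" where
  "good_region c B T \<xi> \<longleftrightarrow> c \<in> charts M \<and> open B \<and> B \<subseteq> img c \<and> (\<forall>y\<in>B. timelike_dir c y T) \<and>
     (\<forall>y\<in>B. \<forall>u. causal_dir c y u \<longrightarrow> 0 < \<xi> \<bullet> u)"

lemma good_regionD:
  assumes "good_region c B T \<xi>"
  shows "c \<in> charts M" "open B" "B \<subseteq> img c" "\<And>y. y \<in> B \<Longrightarrow> timelike_dir c y T"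
    "\<And>y u. y \<in> B \<Longrightarrow> causal_dir c y u \<Longrightarrow> 0 < \<xi> \<bullet> u" "\<And>y. y \<in> B \<Longrightarrow> y \<in> img c"
  using assms unfolding good_region_def by auto

lemma good_region_ex:
  assumes "c \<in> charts M" "y0 \<in> img c"
  obtains B T \<xi> where "good_region c B T \<xi>" "y0 \<in> B"
proof -
  define T where "T = coord_orient c y0"
  have T: "timelike_dir c y0 T" unfolding T_def timelike_dir_def using coord_orient_timelike[OF assms] by simp
  \<comment> \<open>The covector dual to \<open>-T\<close> at \<open>y0\<close>, kept constant over
    the region; \<open>cone_bound\<close> says that it stays positive on causal directions near
    \<open>y0\<close>.\<close>
  define \<xi> where "\<xi> = - (G c y0 *v T)"
  obtain \<delta> C where d: "\<delta> > 0" "C > 0" "ball y0 \<delta> \<subseteq> img c"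
    "\<And>y u. y \<in> ball y0 \<delta> \<Longrightarrow> causal_dir c y u \<Longrightarrow> norm u \<le> C * (\<xi> \<bullet> u)"
    by (rule cone_bound[OF assms T, of "\<lambda>_. \<xi>"]) (auto simp: \<xi>_def)
  have "continuous_on (img c) (\<lambda>y. coord_met c y T T)" "continuous_on (img c) (\<lambda>y. coord_met c y T (coord_orient c y))"
    by (auto intro!: cont_coord_met assms cont_coord_orient)
  then have "open {y \<in> img c. coord_met c y T T < 0 }" "open {y \<in> img c. coord_met c y T (coord_orient c y) < 0}"
    using continuous_open_preimage[OF _ open_img[OF assms(1)] open_lessThan, of _ 0]
    by (simp_all add: Collect_conj_eq vimage_def)
  then have o: "open ({y \<in> img c. coord_met c y T T < 0 } \<inter> {y \<in> img c. coord_met c y T (coord_orient c y) < 0} \<inter> ball y0 \<delta>)"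
    by auto
  show ?thesis
  proof (rule that[of "{y \<in> img c. coord_met c y T T < 0 } \<inter> {y \<in> img c. coord_met c y T (coord_orient c y) < 0} \<inter> ball y0 \<delta>" T \<xi>])
    show "good_region c ({y \<in> img c. coord_met c y T T < 0 } \<inter> {y \<in> img c. coord_met c y T (coord_orient c y) < 0} \<inter> ball y0 \<delta>) T \<xi>"
      unfolding good_region_def
    proof (intro conjI o assms ballI allI impI)
      fix y u assume y: "y \<in> {y \<in> img c. coord_met c y T T < 0 } \<inter> {y \<in> img c. coord_met c y T (coord_orient c y) < 0} \<inter> ball y0 \<delta>" and "causal_dir c y u"
      then have "norm u \<le> C * (\<xi> \<bullet> u)" "norm u > 0" using d(4) causal_dir_nonzero by auto
      then have "0 < C * (\<xi> \<bullet> u)" by linarith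
      then show "0 < \<xi> \<bullet> u" using d(2) by (simp add: zero_less_mult_iff)
    qed (auto simp: timelike_dir_def)
    show "y0 \<in> {y \<in> img c. coord_met c y T T < 0 } \<inter> {y \<in> img c. coord_met c y T (coord_orient c y) < 0} \<inter> ball y0 \<delta>"
      using T d(1) assms by (auto simp: timelike_dir_def)
  qed
qed

lemma good_region_at:
  obtains c B T \<xi> where "good_region c B T \<xi>" "c \<in> charts_at M p" "cmap c p \<in> B"
proof -
  obtain c where c: "c \<in> charts_at M p" using charts_at_ex by blast
  then have "c \<in> charts M" "cmap c p \<in> img c" by auto
  then obtain B T \<xi> where "good_region c B T \<xi>" "cmap c p \<in> B" by (rule good_region_ex)
  then show ?thesis using that c by blast
qed

end

lemma has_vector_derivative_affine:
  assumes "(f has_vector_derivative D) (at (k * t + s) within J)"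
    and "\<And>r. r \<in> I \<Longrightarrow> k * r + s \<in> J"
  shows "((\<lambda>t. f (k * t + s)) has_vector_derivative k *\<^sub>R D) (at t within I)"
proof -
  have "((\<lambda>t. k * t + s) has_vector_derivative k) (at t within I)"
    unfolding has_real_derivative_iff_has_vector_derivative[symmetric] by (auto intro!: derivative_eq_intros)
  moreover have "(f has_vector_derivative D) (at (k * t + s) within (\<lambda>t. k * t + s) ` I)"
    by (rule has_vector_derivative_within_subset[OF assms(1)]) (use assms(2) in auto)
  ultimately show ?thesis using vector_diff_chain_within[of "\<lambda>t. k * t + s" k t I f D] by (simp add: o_def)
qed

context spacetime_locale
begin

section \<open>The causal relations through curves in charts\<close>

definition coord_curve :: "(('m, 'n) chart \<Rightarrow> real ^ 'n \<Rightarrow> real ^ 'n \<Rightarrow> bool) \<Rightarrow> ('m, 'n) chart \<Rightarrow> (real ^ 'n) set \<Rightarrow>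
    (real \<Rightarrow> real ^ 'n) \<Rightarrow> (real \<Rightarrow> real ^ 'n) \<Rightarrow> real \<Rightarrow> real \<Rightarrow> bool" where
  "coord_curve R c B \<alpha> \<beta> a b \<longleftrightarrow> a < b \<and> continuous_on {a..b} \<beta> \<and>
     (\<forall>t\<in>{a..b}. \<alpha> t \<in> B \<and> R c (\<alpha> t) (\<beta> t) \<and> (\<alpha> has_vector_derivative \<beta> t) (at t within {a..b}))"

lemma coord_curveD:
  assumes "coord_curve R c B \<alpha> \<beta> a b"
  shows "a < b" "continuous_on {a..b} \<beta>" "continuous_on {a..b} \<alpha>" "\<And>t. t \<in> {a..b} \<Longrightarrow> \<alpha> t \<in> B"
    "\<And>t. t \<in> {a..b} \<Longrightarrow> R c (\<alpha> t) (\<beta> t)"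
    "\<And>t. t \<in> {a..b} \<Longrightarrow> (\<alpha> has_vector_derivative \<beta> t) (at t within {a..b})"
  using assms unfolding coord_curve_def by (auto intro: continuous_on_vector_derivative)

text \<open>The links into which causal and timelike curves are cut, with \<open>causal_dir\<close>
  or \<open>timelike_dir\<close> for \<open>R\<close>. Inside one chart a variation is simply added
  to the coordinates.\<close>

definition chart_seg :: "(('m, 'n) chart \<Rightarrow> real ^ 'n \<Rightarrow> real ^ 'n \<Rightarrow> bool) \<Rightarrow> 'm \<Rightarrow> 'm \<Rightarrow> bool" where
  "chart_seg R x y \<longleftrightarrow> (\<exists>c B T \<xi> \<alpha> \<beta> a b. good_region c B T \<xi> \<and> x \<in> cdom c \<and> y \<in> cdom c \<and>
     \<alpha> a = cmap c x \<and> \<alpha> b = cmap c y \<and> coord_curve R c B \<alpha> \<beta> a b)"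

lemma chart_segI:
  assumes "good_region c B T \<xi>" "coord_curve R c B \<alpha> \<beta> a b"
  shows "chart_seg R (cinv c (\<alpha> a)) (cinv c (\<alpha> b))"
proof -
  note g = good_regionD[OF assms(1)] and cc = coord_curveD[OF assms(2)]
  have "\<alpha> a \<in> img c" "\<alpha> b \<in> img c" using cc(1) cc(4) g(6) by auto
  then show ?thesis unfolding chart_seg_def using assms cinv_in[OF g(1)] cmap_cinv[OF g(1)] by metis
qed

lemma chart_seg_timelike_dir_causal_dir: "chart_seg timelike_dir x y \<Longrightarrow> chart_seg causal_dir x y"
  unfolding chart_seg_def coord_curve_def using timelike_dir_causal_dir by meson

lemma coord_curve_velocity:
  assumes c: "c \<in> charts M" and B: "B \<subseteq> img c" and cc: "coord_curve R c B \<alpha> \<beta> a b"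
  shows "C1_curve M (\<lambda>t. cinv c (\<alpha> t)) (\<lambda>t. lift c (cinv c (\<alpha> t)) (\<beta> t)) {a..b}"
  unfolding C1_curve_def
proof (intro conjI ballI)
  note d = coord_curveD[OF cc]
  have im: "\<alpha> t \<in> img c" if "t \<in> {a..b}" for t using d(4)[OF that] B by auto
  have ch: "c \<in> charts_at M (cinv c (\<alpha> t))" if "t \<in> {a..b}" for t using cinv_in[OF c im[OF that]] c by auto
  show "continuous_on {a..b} (\<lambda>t. cinv c (\<alpha> t))"
    by (rule continuous_on_compose2[OF cont_cinv[OF c] d(3)]) (use im in auto)
  show "has_velocity M (\<lambda>t. cinv c (\<alpha> t)) (lift c (cinv c (\<alpha> t)) (\<beta> t)) t {a..b}" if t: "t \<in> {a..b}" for t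
    unfolding has_velocity_def
  proof (intro conjI ballI)
    show "lift c (cinv c (\<alpha> t)) (\<beta> t) \<in> tangent_space M (cinv c (\<alpha> t))"
      by (intro lift_tangent ch t)
    fix e assume e: "e \<in> charts_at M (cinv c (\<alpha> t))"
    have o: "\<alpha> t \<in> overlap c e" using e im[OF t] cinv_in[OF c im[OF t]] cmap_cinv[OF c im[OF t]]
      by (metis IntI charts_atD(2) image_eqI)
    have "((transition c e \<circ> \<alpha>) has_vector_derivative transition_deriv c e (\<alpha> t) (\<beta> t)) (at t within {a..b})"
      using has_derivative_compose[OF d(6)[OF t, unfolded has_vector_derivative_def] transition_deriv_deriv_at[OF c charts_atD(1)[OF e] o]]
      by (simp add: has_vector_derivative_def o_def linear_cmul[OF transition_deriv_lin_at[OF c charts_atD(1)[OF e] o]])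
    then show "((cmap e \<circ> (\<lambda>t. cinv c (\<alpha> t))) has_vector_derivative lift c (cinv c (\<alpha> t)) (\<beta> t) e) (at t within {a..b})"
      using e by (simp add: lift_def cmap_cinv[OF c im[OF t]] transition_def o_def)
  qed
  show "continuous_on {t \<in> {a..b}. cinv c (\<alpha> t) \<in> cdom e} (\<lambda>t. lift c (cinv c (\<alpha> t)) (\<beta> t) e)" if e: "e \<in> charts M" for e
  proof -
    let ?S = "{t \<in> {a..b}. cinv c (\<alpha> t) \<in> cdom e}"
    have "continuous_on ?S (\<lambda>t. (case (\<alpha> t, \<beta> t) of (z, u) \<Rightarrow> transition_deriv c e z u))"
    proof (rule continuous_on_compose2[OF cont_transition_deriv_joint[OF c e]])
      show "continuous_on ?S (\<lambda>t. (\<alpha> t, \<beta> t))"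
        by (intro continuous_intros continuous_on_subset[OF d(3)] continuous_on_subset[OF d(2)]) auto
      show "(\<lambda>t. (\<alpha> t, \<beta> t)) ` ?S \<subseteq> overlap c e \<times> UNIV"
      proof (rule image_subsetI)
        fix t assume "t \<in> ?S"
        then have t: "t \<in> {a..b}" "cinv c (\<alpha> t) \<in> cdom e" by auto
        have "\<alpha> t \<in> overlap c e" using cinv_in[OF c im[OF t(1)]] cmap_cinv[OF c im[OF t(1)]] t(2)
          by (metis IntI image_eqI)
        then show "(\<alpha> t, \<beta> t) \<in> overlap c e \<times> UNIV" by simp
      qed
    qed
    then show ?thesis
      by (rule continuous_on_eq) (use e im in \<open>auto simp: lift_def charts_at_def cmap_cinv[OF c]\<close>)
  qed
qed

lemma C1_curve_cong:
  assumes "C1_curve M \<gamma> w J" "\<And>t. t \<in> J \<Longrightarrow> \<delta> t = \<gamma> t"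
  shows "C1_curve M \<delta> w J"
  unfolding C1_curve_def
proof (intro conjI ballI)
  note a = assms(1)[unfolded C1_curve_def]
  show "continuous_on J \<delta>" using a assms(2) by (simp cong: continuous_on_cong)
  show "has_velocity M \<delta> (w t) t J" if t: "t \<in> J" for t
    unfolding has_velocity_def
  proof (intro conjI ballI)
    show "w t \<in> tangent_space M (\<delta> t)" using a t assms(2) by (simp add: has_velocity_def)
    fix c assume "c \<in> charts_at M (\<delta> t)"
    then have d: "((cmap c \<circ> \<gamma>) has_vector_derivative w t c) (at t within J)"
      using a t assms(2) by (simp add: has_velocity_def)
    show "((cmap c \<circ> \<delta>) has_vector_derivative w t c) (at t within J)"
      by (rule has_vector_derivative_transform[OF t _ d]) (simp add: assms(2))
  qed
  fix c assume "c \<in> charts M"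
  moreover have "{t \<in> J. \<delta> t \<in> cdom c} = {t \<in> J. \<gamma> t \<in> cdom c}" using assms(2) by auto
  ultimately show "continuous_on {t \<in> J. \<delta> t \<in> cdom c} (\<lambda>t. w t c)" using a by simp
qed

lemma C1_curve_shift:
  assumes "C1_curve M \<gamma> w J" "\<And>t. t \<in> I \<Longrightarrow> t + k \<in> J"
  shows "C1_curve M (\<lambda>t. \<gamma> (t + k)) (\<lambda>t. w (t + k)) I"
  unfolding C1_curve_def
proof (intro conjI ballI)
  note a = assms(1)[unfolded C1_curve_def]
  have sh: "continuous_on S (\<lambda>t. t + k)" for S :: "real set" by (intro continuous_intros)
  show "continuous_on I (\<lambda>t. \<gamma> (t + k))"
    by (rule continuous_on_compose2[OF _ sh]) (use a assms(2) in auto)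
  show "has_velocity M (\<lambda>t. \<gamma> (t + k)) (w (t + k)) t I" if t: "t \<in> I" for t
    unfolding has_velocity_def
  proof (intro conjI ballI)
    show "w (t + k) \<in> tangent_space M (\<gamma> (t + k))" using a assms(2)[OF t] by (simp add: has_velocity_def)
    fix c assume "c \<in> charts_at M (\<gamma> (t + k))"
    then have "((cmap c \<circ> \<gamma>) has_vector_derivative w (t + k) c) (at (1 * t + k) within J)"
      using a assms(2)[OF t] by (simp add: has_velocity_def)
    from has_vector_derivative_affine[OF this, of I]
    show "((cmap c \<circ> (\<lambda>t. \<gamma> (t + k))) has_vector_derivative w (t + k) c) (at t within I)"
      using assms(2) by (simp add: o_def)
  qed
  fix c assume c: "c \<in> charts M"
  show "continuous_on {t \<in> I. \<gamma> (t + k) \<in> cdom c} (\<lambda>t. w (t + k) c)"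
    by (rule continuous_on_compose2[of "{t \<in> J. \<gamma> t \<in> cdom c}" "\<lambda>t. w t c", OF _ sh]) (use a c assms(2) in auto)
qed

lemma future_curve_single:
  assumes "a < b" "C1_curve M \<gamma> w {a..b}" "\<And>t. t \<in> {a..b} \<Longrightarrow> P (\<gamma> t) (w t) \<and> future_vec M (\<gamma> t) (w t)"
  shows "future_curve M P \<gamma> a b"
  unfolding future_curve_def
  by (rule exI[of _ 1], rule exI[of _ "\<lambda>i. if i = 0 then a else b"]) (use assms in auto)

lemma future_curve_concat:
  assumes "future_curve M P \<gamma> a b" "future_curve M P \<delta> a' b'" "\<gamma> b = \<delta> a'"
  shows "\<exists>\<eta> e. future_curve M P \<eta> a e \<and> \<eta> a = \<gamma> a \<and> \<eta> e = \<delta> b'"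
proof -
  obtain k :: nat and s where s: "0 < k" "s 0 = a" "s k = b"
    "\<And>i. i < k \<Longrightarrow> s i < s (Suc i)"
    "\<And>i. i < k \<Longrightarrow> \<exists>w. C1_curve M \<gamma> w {s i..s (Suc i)} \<and> (\<forall>t \<in> {s i..s (Suc i)}. P (\<gamma> t) (w t) \<and> future_vec M (\<gamma> t) (w t))"
    using assms(1) unfolding future_curve_def by metis
  obtain k' :: nat and s' where s': "0 < k'" "s' 0 = a'" "s' k' = b'"
    "\<And>i. i < k' \<Longrightarrow> s' i < s' (Suc i)"
    "\<And>i. i < k' \<Longrightarrow> \<exists>w. C1_curve M \<delta> w {s' i..s' (Suc i)} \<and> (\<forall>t \<in> {s' i..s' (Suc i)}. P (\<delta> t) (w t) \<and> future_vec M (\<delta> t) (w t))"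
    using assms(2) unfolding future_curve_def by metis
  define h where "h = a' - b"
  define \<eta> where "\<eta> t = (if t \<le> b then \<gamma> t else \<delta> (t + h))" for t
  define r where "r i = (if i \<le> k then s i else s' (i - k) - h)" for i
  have smono: "s i \<le> b" if "i \<le> k" for i
    using that
  proof (induction rule: inc_induct)
    case (step n)
    then show ?case using s(4)[of n] by simp
  qed (use s(3) in auto)
  have s'mono: "a' \<le> s' i" if "i \<le> k'" for i
    using that
  proof (induction i)
    case (Suc i)
    then show ?case using s'(4)[of i] by simp
  qed (use s'(2) in auto)
  have sa: "a \<le> s i" if "i \<le> k" for i
    using that
  proof (induction i)
    case (Suc i)
    then show ?case using s(4)[of i] by simp
  qed (use s(2) in auto)
  have eta1: "\<eta> t = \<gamma> t" if "t \<le> b" for t using that by (simp add: \<eta>_def)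
  have eta2: "\<eta> t = \<delta> (t + h)" if "b \<le> t" for t using that assms(3) by (auto simp: \<eta>_def h_def)
  have rk: "r i = s' (i - k) - h" if "k \<le> i" for i using that s(3) s'(2) by (auto simp: r_def h_def)
  have "future_curve M P \<eta> a (b' - h)" unfolding future_curve_def
  proof (rule exI[of _ "k + k'"], rule exI[of _ r], intro conjI allI impI)
    show "0 < k + k'" using s(1) by simp
    show "r 0 = a" using s by (simp add: r_def)
    show "r (k + k') = b' - h" using rk[of "k + k'"] s'(3) by simp
    fix i assume i: "i < k + k'"
    show "r i < r (Suc i)"
    proof (cases "i < k")
      case True then show ?thesis using s(4) by (simp add: r_def)
    next
      case False
      then show ?thesis using rk[of i] rk[of "Suc i"] s'(4)[of "i - k"] i by (simp add: Suc_diff_le)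
    qed
    show "\<exists>w. C1_curve M \<eta> w {r i..r (Suc i)} \<and> (\<forall>t \<in> {r i..r (Suc i)}. P (\<eta> t) (w t) \<and> future_vec M (\<eta> t) (w t))"
    proof (cases "i < k")
      case True
      then obtain w where w: "C1_curve M \<gamma> w {s i..s (Suc i)}" "\<forall>t \<in> {s i..s (Suc i)}. P (\<gamma> t) (w t) \<and> future_vec M (\<gamma> t) (w t)"
        using s(5) by blast
      have r: "r i = s i" "r (Suc i) = s (Suc i)" using True by (auto simp: r_def)
      have e: "\<eta> t = \<gamma> t" if "t \<in> {s i..s (Suc i)}" for t using that smono[of "Suc i"] True by (intro eta1) auto
      show ?thesis unfolding r
        by (rule exI[of _ w]) (use w e C1_curve_cong[OF w(1) e] in auto)
    next
      case False
      define j where "j = i - k"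
      have j: "j < k'" "Suc i - k = Suc j" using False i by (auto simp: j_def)
      then obtain w where w: "C1_curve M \<delta> w {s' j..s' (Suc j)}" "\<forall>t \<in> {s' j..s' (Suc j)}. P (\<delta> t) (w t) \<and> future_vec M (\<delta> t) (w t)"
        using s'(5) by blast
      have r: "r i = s' j - h" "r (Suc i) = s' (Suc j) - h" using rk[of i] rk[of "Suc i"] False j by (auto simp: j_def)
      have e: "\<eta> t = \<delta> (t + h)" if "t \<in> {s' j - h..s' (Suc j) - h}" for t
        using that s'mono[of j] j by (intro eta2) (auto simp: h_def)
      have "C1_curve M (\<lambda>t. \<delta> (t + h)) (\<lambda>t. w (t + h)) {s' j - h..s' (Suc j) - h}"
        by (rule C1_curve_shift[OF w(1)]) auto
      from C1_curve_cong[OF this e]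
      have "C1_curve M \<eta> (\<lambda>t. w (t + h)) {s' j - h..s' (Suc j) - h}" by simp
      then show ?thesis unfolding r
        by (intro exI[of _ "\<lambda>t. w (t + h)"]) (use w e in auto)
    qed
  qed
  moreover have "\<eta> a = \<gamma> a" using sa[of k] s by (intro eta1) auto
  moreover have "\<eta> (b' - h) = \<delta> b'" using eta2[of "b' - h"] s'mono[of k'] s'(3) by (simp add: h_def)
  ultimately show ?thesis by blast
qed

lemma chart_seg_future_curve:
  assumes "chart_seg R x y" and R: "\<And>p v c. v \<in> tangent_space M p \<Longrightarrow> c \<in> charts_at M p \<Longrightarrow> R c (cmap c p) (v c) \<Longrightarrow> P p v \<and> future_vec M p v"
  shows "\<exists>\<gamma> a b. future_curve M P \<gamma> a b \<and> \<gamma> a = x \<and> \<gamma> b = y"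
proof -
  obtain c B T \<xi> \<alpha> \<beta> a b where s: "good_region c B T \<xi>" "x \<in> cdom c" "y \<in> cdom c"
     "\<alpha> a = cmap c x" "\<alpha> b = cmap c y" "coord_curve R c B \<alpha> \<beta> a b" using assms(1) unfolding chart_seg_def by blast
  note g = good_regionD[OF s(1)] and cc = coord_curveD[OF s(6)]
  have "future_curve M P (\<lambda>t. cinv c (\<alpha> t)) a b"
  proof (rule future_curve_single[OF cc(1) coord_curve_velocity[OF g(1,3) s(6)]])
    fix t assume t: "t \<in> {a..b}"
    then have i: "\<alpha> t \<in> img c" using cc(4) g(6) by auto
    then have "c \<in> charts_at M (cinv c (\<alpha> t))" using cinv_in[OF g(1)] g(1) by auto
    then show "P (cinv c (\<alpha> t)) (lift c (cinv c (\<alpha> t)) (\<beta> t)) \<and> future_vec M (cinv c (\<alpha> t)) (lift c (cinv c (\<alpha> t)) (\<beta> t))"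
      using cc(5)[OF t] by (intro R lift_tangent) (auto simp: lift_self cmap_cinv[OF g(1) i])
  qed
  then show ?thesis using s cinv_cmap[OF g(1)] by (intro exI[of _ "\<lambda>t. cinv c (\<alpha> t)"] exI[of _ a] exI[of _ b]) auto
qed

text \<open>Each parameter has a neighbourhood that the curve maps into a good region of one chart;
  bisection chains the resulting segments.\<close>

lemma C1_curve_chart_seg:
  assumes ab: "a < b" and C: "C1_curve M \<gamma> w {a..b}"
    and R: "\<And>t c. t \<in> {a..b} \<Longrightarrow> c \<in> charts_at M (\<gamma> t) \<Longrightarrow> R c (cmap c (\<gamma> t)) (w t c)"
  shows "(chart_seg R)\<^sup>+\<^sup>+ (\<gamma> a) (\<gamma> b)"
proof -
  note C' = C[unfolded C1_curve_def has_velocity_def]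
  define Q where "Q s t \<longleftrightarrow> (a \<le> s \<longrightarrow> s < t \<longrightarrow> t \<le> b \<longrightarrow> (chart_seg R)\<^sup>+\<^sup>+ (\<gamma> s) (\<gamma> t))" for s t
  have "Q a b"
  proof (rule Bolzano)
    show "a \<le> b" using ab by simp
    fix r s t assume "Q r s" "Q s t" "r \<le> s" "s \<le> t"
    then show "Q r t" unfolding Q_def
      by (cases "r = s"; cases "s = t") (auto intro: tranclp_trans)
  next
    fix x assume x: "a \<le> x" "x \<le> b"
    obtain c B T \<xi> where g: "good_region c B T \<xi>" "c \<in> charts_at M (\<gamma> x)" "cmap c (\<gamma> x) \<in> B" by (rule good_region_at)
    note gd = good_regionD[OF g(1)]
    have oN: "open (cdom c \<inter> cmap c -` B)"
      by (rule continuous_open_preimage[OF cont_cmap[OF gd(1)] open_cdom[OF gd(1)] gd(2)])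
    have "\<forall>\<^sub>F t in at x within {a..b}. \<gamma> t \<in> cdom c \<inter> cmap c -` B"
      using C' x oN g(2,3) by (intro topological_tendstoD[of \<gamma> "\<gamma> x"]) (auto simp: continuous_on_def)
    then obtain d where d: "d > 0" "\<And>t. t \<in> {a..b} \<Longrightarrow> t \<noteq> x \<Longrightarrow> dist t x < d \<Longrightarrow> \<gamma> t \<in> cdom c \<inter> cmap c -` B"
      unfolding eventually_at by auto
    have d': "\<gamma> t \<in> cdom c" "cmap c (\<gamma> t) \<in> B" if "t \<in> {a..b}" "dist t x < d" for t
      using d(2)[OF that(1) _ that(2)] g(2,3) by (cases "t = x"; auto)+
    show "\<exists>d>0. \<forall>s t. s \<le> x \<and> x \<le> t \<and> t - s < d \<longrightarrow> Q s t"
    proof (intro exI[of _ d] conjI allI impI d(1))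
      fix s t assume st: "s \<le> x \<and> x \<le> t \<and> t - s < d"
      show "Q s t" unfolding Q_def
      proof (intro impI)
        assume h: "a \<le> s" "s < t" "t \<le> b"
        have sub: "{s..t} \<subseteq> {a..b}" using h by auto
        have dist: "dist r x < d" if "r \<in> {s..t}" for r using that st by (auto simp: dist_real_def)
        have "coord_curve R c B (cmap c \<circ> \<gamma>) (\<lambda>r. w r c) s t"
          unfolding coord_curve_def
        proof (intro conjI ballI h(2))
          show "continuous_on {s..t} (\<lambda>r. w r c)"
          proof (rule continuous_on_subset)
            show "continuous_on {t \<in> {a..b}. \<gamma> t \<in> cdom c} (\<lambda>t. w t c)" using C' gd(1) by blast
            show "{s..t} \<subseteq> {t \<in> {a..b}. \<gamma> t \<in> cdom c}" using d'(1) dist sub by blast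
          qed
          fix r assume r: "r \<in> {s..t}"
          then have r': "r \<in> {a..b}" using sub by auto
          have c: "c \<in> charts_at M (\<gamma> r)" using d'(1)[OF r' dist[OF r]] gd(1) by auto
          show "(cmap c \<circ> \<gamma>) r \<in> B" using d'(2)[OF r' dist[OF r]] by simp
          show "R c ((cmap c \<circ> \<gamma>) r) (w r c)" using R[OF r' c] by simp
          show "((cmap c \<circ> \<gamma>) has_vector_derivative w r c) (at r within {s..t})"
            using C' r' c by (intro has_vector_derivative_within_subset[OF _ sub]) auto
        qed
        then have "chart_seg R (\<gamma> s) (\<gamma> t)" unfolding chart_seg_def
          using g(1) d'(1) dist h sub by (intro exI conjI) auto
        then show "(chart_seg R)\<^sup>+\<^sup>+ (\<gamma> s) (\<gamma> t)" by blast
      qed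
    qed
  qed
  then show ?thesis using ab by (simp add: Q_def)
qed

lemma future_curve_chart_seg:
  assumes "future_curve M P \<gamma> a b"
    and R: "\<And>p v c. P p v \<Longrightarrow> future_vec M p v \<Longrightarrow> v \<in> tangent_space M p \<Longrightarrow> c \<in> charts_at M p \<Longrightarrow> R c (cmap c p) (v c)"
  shows "(chart_seg R)\<^sup>+\<^sup>+ (\<gamma> a) (\<gamma> b)"
proof -
  obtain k :: nat and s where s: "0 < k" "s 0 = a" "s k = b"
    "\<And>i. i < k \<Longrightarrow> s i < s (Suc i)"
    "\<And>i. i < k \<Longrightarrow> \<exists>w. C1_curve M \<gamma> w {s i..s (Suc i)} \<and> (\<forall>t \<in> {s i..s (Suc i)}. P (\<gamma> t) (w t) \<and> future_vec M (\<gamma> t) (w t))"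
    using assms(1) unfolding future_curve_def by metis
  have one: "(chart_seg R)\<^sup>+\<^sup>+ (\<gamma> (s i)) (\<gamma> (s (Suc i)))" if i: "i < k" for i
  proof -
    obtain w where w: "C1_curve M \<gamma> w {s i..s (Suc i)}" "\<forall>t \<in> {s i..s (Suc i)}. P (\<gamma> t) (w t) \<and> future_vec M (\<gamma> t) (w t)"
      using s(5)[OF i] by blast
    show ?thesis
      by (rule C1_curve_chart_seg[OF s(4)[OF i] w(1)]) (use w in \<open>auto intro!: R simp: C1_curve_def has_velocity_def\<close>)
  qed
  have "i < k \<Longrightarrow> (chart_seg R)\<^sup>+\<^sup>+ (\<gamma> (s 0)) (\<gamma> (s (Suc i)))" for i
    by (induction i) (use one in \<open>auto intro: tranclp_trans\<close>)
  from this[of "k - 1"] show ?thesis using s by simp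
qed

text \<open>From here on the relations are handled by induction over segments, without reference to
  break points of curves.\<close>

lemma chron_chart_seg: "chron M x y \<longleftrightarrow> (chart_seg timelike_dir)\<^sup>+\<^sup>+ x y"
proof
  assume "chron M x y"
  then show "(chart_seg timelike_dir)\<^sup>+\<^sup>+ x y" unfolding chron_def
    using future_curve_chart_seg[of "timelike_vec M" _ _ _ timelike_dir] timelike_dir_coord by blast
next
  have s: "\<exists>\<gamma> a b. future_curve M (timelike_vec M) \<gamma> a b \<and> \<gamma> a = x \<and> \<gamma> b = y" if "chart_seg timelike_dir x y" for x y
    using that by (rule chart_seg_future_curve) (use timelike_dir_coord in blast)
  assume "(chart_seg timelike_dir)\<^sup>+\<^sup>+ x y" then show "chron M x y"
  proof induction
    case (base y) then show ?case unfolding chron_def by (rule s)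
  next
    case (step y z) then show ?case using s[OF step(2)] future_curve_concat unfolding chron_def by metis
  qed
qed

lemma causal_chart_seg: "causal M x y \<longleftrightarrow> (chart_seg causal_dir)\<^sup>*\<^sup>* x y"
proof
  assume "causal M x y"
  then have "x = y \<or> (chart_seg causal_dir)\<^sup>+\<^sup>+ x y" unfolding causal_in_def
    using future_curve_chart_seg[of "causal_vec M" _ _ _ causal_dir] causal_dir_coord by blast
  then show "(chart_seg causal_dir)\<^sup>*\<^sup>* x y" by (auto intro: tranclp_into_rtranclp)
next
  have s: "\<exists>\<gamma> a b. future_curve M (causal_vec M) \<gamma> a b \<and> \<gamma> a = x \<and> \<gamma> b = y" if "chart_seg causal_dir x y" for x y
    using that by (rule chart_seg_future_curve) (use causal_dir_coord in blast)
  have "\<exists>\<gamma> a b. future_curve M (causal_vec M) \<gamma> a b \<and> \<gamma> a = x \<and> \<gamma> b = y" if "(chart_seg causal_dir)\<^sup>+\<^sup>+ x y" for x y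
    using that
  proof induction
    case (base y) then show ?case by (rule s)
  next
    case (step y z) then show ?case using s[OF step(2)] future_curve_concat by metis
  qed
  moreover assume "(chart_seg causal_dir)\<^sup>*\<^sup>* x y"
  ultimately show "causal M x y" unfolding causal_in_def by (auto dest: rtranclpD)
qed

lemma causal_refl [simp]: "causal M x x" by (simp add: causal_in_def)

lemma causal_trans: "causal M x y \<Longrightarrow> causal M y z \<Longrightarrow> causal M x z"
  unfolding causal_chart_seg by (rule rtranclp_trans)

lemma chron_trans: "chron M x y \<Longrightarrow> chron M y z \<Longrightarrow> chron M x z"
  unfolding chron_chart_seg by (rule tranclp_trans)

lemma chron_causal: "chron M x y \<Longrightarrow> causal M x y"
  unfolding chron_chart_seg causal_chart_seg using chart_seg_timelike_dir_causal_dir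
  by (metis (no_types, lifting) mono_rtranclp tranclp_into_rtranclp)

section \<open>Variations of causal curves\<close>

lemma form_line_deriv:
  assumes c: "c \<in> charts M" and i: "x + s *\<^sub>R Y \<in> img c"
  shows "((\<lambda>s. coord_met c (x + s *\<^sub>R Y) (u + s *\<^sub>R Y') (u + s *\<^sub>R Y')) has_real_derivative
     2 * (Y' \<bullet> (G c (x + s *\<^sub>R Y) *v (u + s *\<^sub>R Y'))) +
     (u + s *\<^sub>R Y') \<bullet> (dG c (x + s *\<^sub>R Y) Y *v (u + s *\<^sub>R Y'))) (at s)"
proof -
  let ?x = "x + s *\<^sub>R Y" and ?u = "u + s *\<^sub>R Y'"
  have l1: "((\<lambda>s. x + s *\<^sub>R Y) has_derivative (\<lambda>h. h *\<^sub>R Y)) (at s)"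
    and l2: "((\<lambda>s. u + s *\<^sub>R Y') has_derivative (\<lambda>h. h *\<^sub>R Y')) (at s)"
    by (auto intro!: derivative_eq_intros)
  have l3: "((\<lambda>s. G c (x + s *\<^sub>R Y)) has_derivative (\<lambda>h. dG c ?x (h *\<^sub>R Y))) (at s)"
    by (rule has_derivative_compose[OF l1 dG_deriv[OF c i]])
  have "((\<lambda>s. coord_met c (x + s *\<^sub>R Y) (u + s *\<^sub>R Y') (u + s *\<^sub>R Y')) has_derivative
     (\<lambda>h. ?u \<bullet> (G c ?x *v (h *\<^sub>R Y') + dG c ?x (h *\<^sub>R Y) *v ?u) + (h *\<^sub>R Y') \<bullet> (G c ?x *v ?u))) (at s)"
    unfolding coord_met_def by (rule inner_mv_has_derivative[OF l2 l3 l2])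
  moreover have "?u \<bullet> (G c ?x *v (h *\<^sub>R Y') + dG c ?x (h *\<^sub>R Y) *v ?u) + (h *\<^sub>R Y') \<bullet> (G c ?x *v ?u) =
     (2 * (Y' \<bullet> (G c ?x *v ?u)) + ?u \<bullet> (dG c ?x Y *v ?u)) * h" for h
  proof -
    have "?u \<bullet> (G c ?x *v (h *\<^sub>R Y')) = h * (Y' \<bullet> (G c ?x *v ?u))"
      using G_sym[OF c i, of ?u "h *\<^sub>R Y'"] by simp
    moreover have "?u \<bullet> (dG c ?x (h *\<^sub>R Y) *v ?u) = h * (?u \<bullet> (dG c ?x Y *v ?u))"
      by (simp add: linear_cmul[OF dG_linear[OF c i]] bounded_bilinear.scaleR_left[OF bounded_bilinear_matrix_vector])
    ultimately show ?thesis by (simp add: inner_add_right algebra_simps)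
  qed
  ultimately show ?thesis by (simp add: has_field_derivative_def)
qed

lemma cont_form_dG:
  assumes "c \<in> charts M" "continuous_on S x" "x ` S \<subseteq> img c" "continuous_on S h" "continuous_on S u" "continuous_on S v"
  shows "continuous_on S (\<lambda>t. u t \<bullet> (dG c (x t) (h t) *v v t))"
proof -
  have "continuous_on S (\<lambda>t. case (x t, h t) of (y, h) \<Rightarrow> dG c y h)"
    by (rule continuous_on_compose2[OF cont_dG_joint[OF assms(1)]]) (use assms in \<open>auto intro!: continuous_intros\<close>)
  then show ?thesis by (auto intro!: continuous_intros assms)
qed

text \<open>First variation of the energy density: where it is negative, the varied curve becomes timelike.\<close>

definition first_variation :: "('m, 'n) chart \<Rightarrow> real ^ 'n \<Rightarrow> real ^ 'n \<Rightarrow> real ^ 'n \<Rightarrow> real ^ 'n \<Rightarrow> real" where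
  "first_variation c x u Y Y' = 2 * coord_met c x Y' u + u \<bullet> (dG c x Y *v u)"

text \<open>Compactness of the curve with its velocity and variation makes \<open>e0\<close> and
  \<open>\<eta>\<close> independent of \<open>t\<close>. The tolerance \<open>\<eta>\<close> matters
  in \<open>normal_generator\<close>, where the variation must be adjusted slightly so that the
  curve starts on a given submanifold.\<close>

lemma variation:
  assumes g: "good_region c B T \<xi>" and cc: "coord_curve causal_dir c B \<alpha> \<beta> a b"
    and V: "continuous_on {a..b} V" "continuous_on {a..b} V'"
    and F: "\<And>t. t \<in> {a..b} \<Longrightarrow> first_variation c (\<alpha> t) (\<beta> t) (V t) (V' t) < 0"
  obtains e0 \<eta> where "e0 > 0" "\<eta> > 0"
    "\<And>e t Y Y'. 0 < e \<Longrightarrow> e < e0 \<Longrightarrow> t \<in> {a..b} \<Longrightarrow> norm (Y - V t) < \<eta> \<Longrightarrow> norm (Y' - V' t) < \<eta> \<Longrightarrow>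
      \<alpha> t + e *\<^sub>R Y \<in> B \<and> timelike_dir c (\<alpha> t + e *\<^sub>R Y) (\<beta> t + e *\<^sub>R Y')"
proof -
  note gd = good_regionD[OF g] and d = coord_curveD[OF cc]
  let ?S = "B \<times> (UNIV :: ((real ^ 'n) \<times> (real ^ 'n) \<times> (real ^ 'n)) set)"
  let ?E = "\<lambda>p. first_variation c (fst p) (fst (snd p)) (fst (snd (snd p))) (snd (snd (snd p)))"
  let ?H = "\<lambda>p. coord_met c (fst p) (fst (snd p)) (coord_orient c (fst p))"
  have oS: "open ?S" using gd(2) by (intro open_Times) auto
  have i: "fst ` ?S \<subseteq> img c" using gd(3) by auto
  have cE: "continuous_on ?S ?E" unfolding first_variation_def
    by (intro continuous_intros cont_coord_met[OF gd(1)] cont_form_dG[OF gd(1)] i)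
  have cH: "continuous_on ?S ?H"
    by (intro continuous_intros cont_coord_met[OF gd(1)] i continuous_on_compose2[OF cont_coord_orient[OF gd(1)]])
  \<comment> \<open>The open conditions that must survive the perturbation: negative first variation
    and future direction.\<close>
  define W where "W = (?S \<inter> ?E -` {..<0}) \<inter> (?S \<inter> ?H -` {..<0})"
  have oW: "open W" unfolding W_def
    by (intro open_Int continuous_open_preimage cE cH oS open_lessThan)
  define K where "K = (\<lambda>t. (\<alpha> t, \<beta> t, V t, V' t)) ` {a..b}"
  have cK: "compact K" unfolding K_def
    by (intro compact_continuous_image continuous_intros d V compact_Icc)
  have "K \<subseteq> W" unfolding K_def W_def using d(4,5) F by (auto simp: causal_dir_def)
  then obtain r where r: "r > 0" "(\<Union>p\<in>K. ball p r) \<subseteq> W"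
    using compact_subset_open_imp_ball_epsilon_subset[OF cK oW] by blast
  have inW: "(x, u, Y, Y') \<in> W" if "t \<in> {a..b}" "norm (x - \<alpha> t) < r/4" "norm (u - \<beta> t) < r/4" "norm (Y - V t) < r/4" "norm (Y' - V' t) < r/4"
    for x u Y Y' t
  proof -
    have "norm ((x, u, Y, Y') - (\<alpha> t, \<beta> t, V t, V' t)) = norm (x - \<alpha> t, u - \<beta> t, Y - V t, Y' - V' t)" by simp
    also have "\<dots> \<le> norm (x - \<alpha> t) + (norm (u - \<beta> t) + (norm (Y - V t) + norm (Y' - V' t)))"
      by (meson add_left_mono norm_Pair_le order_trans)
    finally have "dist (x, u, Y, Y') (\<alpha> t, \<beta> t, V t, V' t) < r" using that by (simp add: dist_norm)
    then have "(x, u, Y, Y') \<in> ball (\<alpha> t, \<beta> t, V t, V' t) r" by (simp only: mem_ball dist_commute)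
    then show ?thesis using r(2) that(1) unfolding K_def by blast
  qed
  have "bounded (V ` {a..b})" "bounded (V' ` {a..b})"
    by (intro compact_imp_bounded compact_continuous_image V compact_Icc)+
  then obtain R1 R2 where R: "\<And>t. t \<in> {a..b} \<Longrightarrow> norm (V t) \<le> R1" "\<And>t. t \<in> {a..b} \<Longrightarrow> norm (V' t) \<le> R2"
    unfolding bounded_iff by (metis imageI)
  \<comment> \<open>\<open>R\<close> bounds every admissible \<open>Y\<close> and \<open>Y'\<close>,
    so a step below r/(4 R) moves position and velocity by less than r/4.\<close>
  define R where "R = \<bar>R1\<bar> + \<bar>R2\<bar> + r"
  have R0: "R > 0" using r(1) by (simp add: R_def)
  show ?thesis
  proof (rule that[of "r / (4 * R)" "r/4"])
    fix e t Y Y' assume h: "0 < e" "e < r / (4 * R)" "t \<in> {a..b}" "norm (Y - V t) < r/4" "norm (Y' - V' t) < r/4"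
    have "norm Y \<le> norm (Y - V t) + norm (V t)" "norm Y' \<le> norm (Y' - V' t) + norm (V' t)"
      by (metis norm_triangle_sub add.commute)+
    then have nY: "norm Y < R" "norm Y' < R" using h(4,5) R(1,2)[OF h(3)] r(1) by (auto simp: R_def)
    have eR: "e * R < r/4" using h(2) R0 by (simp add: field_simps)
    have sm: "(\<alpha> t + s *\<^sub>R Y, \<beta> t + s *\<^sub>R Y', Y, Y') \<in> W" if "0 \<le> s" "s \<le> e" for s
    proof (rule inW[OF h(3) _ _ h(4,5)])
      have "s * norm Y \<le> e * R" "s * norm Y' \<le> e * R" using that nY h(1) by (auto intro!: mult_mono)
      then show "norm (\<alpha> t + s *\<^sub>R Y - \<alpha> t) < r/4" "norm (\<beta> t + s *\<^sub>R Y' - \<beta> t) < r/4"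
        using that eR by auto
    qed
    let ?q = "\<lambda>s. coord_met c (\<alpha> t + s *\<^sub>R Y) (\<beta> t + s *\<^sub>R Y') (\<beta> t + s *\<^sub>R Y')"
    have dq: "(?q has_real_derivative first_variation c (\<alpha> t + s *\<^sub>R Y) (\<beta> t + s *\<^sub>R Y') Y Y') (at s)" if "0 \<le> s" "s \<le> e" for s
      unfolding first_variation_def coord_met_def[of c _ Y']
      by (rule form_line_deriv[OF gd(1)]) (use sm[OF that] gd(6) in \<open>auto simp: W_def\<close>)
    \<comment> \<open>The energy is at most zero at the start and has negative derivative all along
      the segment, so it ends strictly negative.\<close>
    obtain s where s: "0 < s" "s < e" "?q e - ?q 0 = (e - 0) * first_variation c (\<alpha> t + s *\<^sub>R Y) (\<beta> t + s *\<^sub>R Y') Y Y'"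
      using MVT2[OF h(1) dq] by blast
    moreover have "first_variation c (\<alpha> t + s *\<^sub>R Y) (\<beta> t + s *\<^sub>R Y') Y Y' < 0" using sm[of s] s by (simp add: W_def)
    ultimately have "?q e < ?q 0" using mult_pos_neg[OF h(1)] by fastforce
    also have "?q 0 \<le> 0" using d(5)[OF h(3)] by (simp add: causal_dir_def)
    finally show "\<alpha> t + e *\<^sub>R Y \<in> B \<and> timelike_dir c (\<alpha> t + e *\<^sub>R Y) (\<beta> t + e *\<^sub>R Y')"
      using sm[of e] h(1) unfolding timelike_dir_def by (auto simp: W_def)
  qed (use r R0 in auto)
qed

lemma variation_coord_curve:
  assumes g: "good_region c B T \<xi>" and cc: "coord_curve causal_dir c B \<alpha> \<beta> a b"
    and V: "\<And>t. t \<in> {a..b} \<Longrightarrow> (V has_vector_derivative V' t) (at t within {a..b})" "continuous_on {a..b} V'"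
    and F: "\<And>t. t \<in> {a..b} \<Longrightarrow> first_variation c (\<alpha> t) (\<beta> t) (V t) (V' t) < 0"
  obtains e0 where "e0 > 0"
    "\<And>e. 0 < e \<Longrightarrow> e < e0 \<Longrightarrow> coord_curve timelike_dir c B (\<lambda>t. \<alpha> t + e *\<^sub>R V t) (\<lambda>t. \<beta> t + e *\<^sub>R V' t) a b"
proof -
  note d = coord_curveD[OF cc]
  have cV: "continuous_on {a..b} V" using V(1) by (rule continuous_on_vector_derivative)
  obtain e0 \<eta> where e: "e0 > 0" "\<eta> > 0"
    "\<And>e t Y Y'. 0 < e \<Longrightarrow> e < e0 \<Longrightarrow> t \<in> {a..b} \<Longrightarrow> norm (Y - V t) < \<eta> \<Longrightarrow> norm (Y' - V' t) < \<eta> \<Longrightarrow>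
      \<alpha> t + e *\<^sub>R Y \<in> B \<and> timelike_dir c (\<alpha> t + e *\<^sub>R Y) (\<beta> t + e *\<^sub>R Y')"
    by (rule variation[OF g cc cV V(2) F]) blast+
  show ?thesis
  proof (rule that[OF e(1)])
    fix e assume h: "0 < e" "e < e0"
    show "coord_curve timelike_dir c B (\<lambda>t. \<alpha> t + e *\<^sub>R V t) (\<lambda>t. \<beta> t + e *\<^sub>R V' t) a b"
      unfolding coord_curve_def
    proof (intro conjI ballI d(1))
      show "continuous_on {a..b} (\<lambda>t. \<beta> t + e *\<^sub>R V' t)" by (intro continuous_intros d V)
      fix t assume t: "t \<in> {a..b}"
      show "((\<lambda>t. \<alpha> t + e *\<^sub>R V t) has_vector_derivative \<beta> t + e *\<^sub>R V' t) (at t within {a..b})"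
        by (intro has_vector_derivative_add d(6)[OF t] bounded_linear.has_vector_derivative[OF bounded_linear_scaleR_right] V(1)[OF t])
      show "\<alpha> t + e *\<^sub>R V t \<in> B" "timelike_dir c (\<alpha> t + e *\<^sub>R V t) (\<beta> t + e *\<^sub>R V' t)"
        using e(3)[OF h t, of "V t" "V' t"] e(2) by auto
    qed
  qed
qed

lemma timelike_dir_stable:
  assumes g: "good_region c B T \<xi>" and cc: "coord_curve timelike_dir c B \<alpha> \<beta> a b"
  obtains \<eta> where "\<eta> > 0"
    "\<And>t Y Y'. t \<in> {a..b} \<Longrightarrow> norm Y < \<eta> \<Longrightarrow> norm Y' < \<eta> \<Longrightarrow> \<alpha> t + Y \<in> B \<and> timelike_dir c (\<alpha> t + Y) (\<beta> t + Y')"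
proof -
  note gd = good_regionD[OF g] and d = coord_curveD[OF cc]
  let ?S = "B \<times> (UNIV :: (real ^ 'n) set)"
  have oS: "open ?S" using gd(2) by (intro open_Times) auto
  have i: "fst ` ?S \<subseteq> img c" using gd(3) by auto
  have c1: "continuous_on ?S (\<lambda>p. coord_met c (fst p) (snd p) (snd p))"
    by (intro continuous_intros cont_coord_met[OF gd(1)] i)
  have c2: "continuous_on ?S (\<lambda>p. coord_met c (fst p) (snd p) (coord_orient c (fst p)))"
    by (intro continuous_intros cont_coord_met[OF gd(1)] i continuous_on_compose2[OF cont_coord_orient[OF gd(1)]])
  define W where "W = (?S \<inter> (\<lambda>p. coord_met c (fst p) (snd p) (snd p)) -` {..<0}) \<inter> (?S \<inter> (\<lambda>p. coord_met c (fst p) (snd p) (coord_orient c (fst p))) -` {..<0})"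
  have oW: "open W" unfolding W_def by (intro open_Int continuous_open_preimage c1 c2 oS open_lessThan)
  define K where "K = (\<lambda>t. (\<alpha> t, \<beta> t)) ` {a..b}"
  have cK: "compact K" unfolding K_def
    by (intro compact_continuous_image continuous_intros d compact_Icc)
  have "K \<subseteq> W" unfolding K_def W_def using d(4,5) by (auto simp: timelike_dir_def)
  then obtain r where r: "r > 0" "(\<Union>p\<in>K. ball p r) \<subseteq> W"
    using compact_subset_open_imp_ball_epsilon_subset[OF cK oW] by blast
  show ?thesis
  proof (rule that[of "r/2"])
    fix t and Y Y' :: "real ^ 'n" assume h: "t \<in> {a..b}" "norm Y < r/2" "norm Y' < r/2"
    have "dist (\<alpha> t, \<beta> t) (\<alpha> t + Y, \<beta> t + Y') = norm (- (Y, Y'))" unfolding dist_norm by simp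
    also have "\<dots> \<le> norm Y + norm Y'" unfolding norm_minus_cancel by (rule norm_Pair_le)
    finally have "(\<alpha> t + Y, \<beta> t + Y') \<in> ball (\<alpha> t, \<beta> t) r" using h by simp
    then have "(\<alpha> t + Y, \<beta> t + Y') \<in> W" using r(2) h(1) unfolding K_def by blast
    then show "\<alpha> t + Y \<in> B \<and> timelike_dir c (\<alpha> t + Y) (\<beta> t + Y')" by (auto simp: W_def timelike_dir_def)
  qed (use r in auto)
qed

lemma open_chart_ball:
  assumes "c \<in> charts M" shows "open (cdom c \<inter> cmap c -` ball y \<delta>)"
  by (rule continuous_open_preimage[OF cont_cmap open_cdom open_ball]) (use assms in auto)

text \<open>An affine displacement can move one end of the segment anywhere nearby while the other
  end stays fixed; this is how chronology is seen to be open in each argument.\<close>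

lemma timelike_dir_affine_perturb:
  assumes g: "good_region c B T \<xi>" and cc: "coord_curve timelike_dir c B \<alpha> \<beta> a b"
  obtains \<delta> where "\<delta> > 0" "\<And>v w. norm v < \<delta> \<Longrightarrow> norm w < \<delta> \<Longrightarrow>
     coord_curve timelike_dir c B (\<lambda>t. \<alpha> t + (v + t *\<^sub>R w)) (\<lambda>t. \<beta> t + w) a b"
proof -
  note d = coord_curveD[OF cc]
  obtain \<eta> where e: "\<eta> > 0"
    "\<And>t Y Y'. t \<in> {a..b} \<Longrightarrow> norm Y < \<eta> \<Longrightarrow> norm Y' < \<eta> \<Longrightarrow> \<alpha> t + Y \<in> B \<and> timelike_dir c (\<alpha> t + Y) (\<beta> t + Y')"
    by (rule timelike_dir_stable[OF g cc]) blast
  define R where "R = 1 + \<bar>a\<bar> + \<bar>b\<bar>"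
  have R: "R \<ge> 1" "R > 0" by (auto simp: R_def)
  show ?thesis
  proof (rule that[of "\<eta> / (2 * R)"])
    show "\<eta> / (2 * R) > 0" using e R by simp
    fix v w :: "real ^ 'n" assume vw: "norm v < \<eta> / (2 * R)" "norm w < \<eta> / (2 * R)"
    have "\<eta> / (2 * R) \<le> \<eta> / 2" "R * (\<eta> / (2 * R)) = \<eta> / 2" using e R by (auto simp: field_simps)
    then have w1: "norm v < \<eta> / 2" "norm w < \<eta>" "R * norm w \<le> \<eta> / 2"
      using vw e R mult_left_mono[of "norm w" "\<eta> / (2 * R)" R] by auto
    show "coord_curve timelike_dir c B (\<lambda>t. \<alpha> t + (v + t *\<^sub>R w)) (\<lambda>t. \<beta> t + w) a b"
      unfolding coord_curve_def
    proof (intro conjI ballI d(1))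
      show "continuous_on {a..b} (\<lambda>t. \<beta> t + w)" by (intro continuous_intros d)
      fix t assume t: "t \<in> {a..b}"
      have "((\<lambda>t. v + t *\<^sub>R w) has_vector_derivative w) (at t within {a..b})"
        by (auto intro!: derivative_eq_intros)
      then show "((\<lambda>t. \<alpha> t + (v + t *\<^sub>R w)) has_vector_derivative \<beta> t + w) (at t within {a..b})"
        by (intro has_vector_derivative_add d(6)[OF t])
      have "\<bar>t\<bar> * norm w \<le> R * norm w" using t by (intro mult_right_mono) (auto simp: R_def)
      then have "norm (v + t *\<^sub>R w) < \<eta>" using norm_triangle_ineq[of v "t *\<^sub>R w"] w1 by simp
      then show "\<alpha> t + (v + t *\<^sub>R w) \<in> B" "timelike_dir c (\<alpha> t + (v + t *\<^sub>R w)) (\<beta> t + w)"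
        using e(2)[OF t] w1(2) by blast+
    qed
  qed
qed

lemma chart_seg_timelike_dir_open:
  assumes "chart_seg timelike_dir x y"
  shows "\<exists>U. open U \<and> x \<in> U \<and> (\<forall>x'\<in>U. chart_seg timelike_dir x' y)"
    and "\<exists>U. open U \<and> y \<in> U \<and> (\<forall>y'\<in>U. chart_seg timelike_dir x y')"
proof -
  obtain c B T \<xi> \<alpha> \<beta> a b where s: "good_region c B T \<xi>" "x \<in> cdom c" "y \<in> cdom c"
     "\<alpha> a = cmap c x" "\<alpha> b = cmap c y" "coord_curve timelike_dir c B \<alpha> \<beta> a b" using assms(1) unfolding chart_seg_def by blast
  note gd = good_regionD[OF s(1)] and d = coord_curveD[OF s(6)]
  obtain \<delta> where dl: "\<delta> > 0" "\<And>v w. norm v < \<delta> \<Longrightarrow> norm w < \<delta> \<Longrightarrow>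
     coord_curve timelike_dir c B (\<lambda>t. \<alpha> t + (v + t *\<^sub>R w)) (\<lambda>t. \<beta> t + w) a b" by (rule timelike_dir_affine_perturb[OF s(1,6)]) blast
  define R where "R = (\<bar>a\<bar> + \<bar>b\<bar> + 1) / (b - a)"
  have R: "\<bar>b\<bar> / (b - a) \<le> R" "\<bar>a\<bar> / (b - a) \<le> R" "1 / (b - a) \<le> R"
    using d(1) by (auto simp: R_def divide_right_mono)
  have R0: "R > 0" using R(3) d(1) by (smt (verit) divide_pos_pos)
  have bd: "norm ((k / (b - a)) *\<^sub>R v) < \<delta>" if "norm v < \<delta> / R" "\<bar>k\<bar> / (b - a) \<le> R" for v :: "real ^ 'n" and k
  proof -
    have "norm ((k / (b - a)) *\<^sub>R v) = (\<bar>k\<bar> / (b - a)) * norm v" using d(1) by simp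
    also have "\<dots> \<le> R * norm v" using that by (intro mult_right_mono) auto
    also have "\<dots> < \<delta>" using that R0 by (simp add: field_simps)
    finally show ?thesis .
  qed
  show "\<exists>U. open U \<and> x \<in> U \<and> (\<forall>x'\<in>U. chart_seg timelike_dir x' y)"
  proof (intro exI[of _ "cdom c \<inter> cmap c -` ball (cmap c x) (\<delta> / R)"] conjI ballI open_chart_ball gd(1))
    show "x \<in> cdom c \<inter> cmap c -` ball (cmap c x) (\<delta> / R)" using s dl R0 by simp
    fix x' assume x': "x' \<in> cdom c \<inter> cmap c -` ball (cmap c x) (\<delta> / R)"
    define v where "v = cmap c x' - cmap c x"
    have nv: "norm v < \<delta> / R" using x' by (simp add: v_def dist_norm norm_minus_commute)
    \<comment> \<open>The affine displacement equal to \<open>v\<close> at \<open>a\<close> and to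
      zero at \<open>b\<close>.\<close>
    have "coord_curve timelike_dir c B (\<lambda>t. \<alpha> t + ((b / (b - a)) *\<^sub>R v + t *\<^sub>R ((- 1 / (b - a)) *\<^sub>R v))) (\<lambda>t. \<beta> t + (- 1 / (b - a)) *\<^sub>R v) a b"
      by (rule dl(2)) (use bd[OF nv, of b] bd[OF nv, of "-1"] R in auto)
    moreover have "b / (b - a) + a * (- 1 / (b - a)) = 1" using d(1) by (simp flip: diff_divide_distrib)
    then have "(b / (b - a)) *\<^sub>R v + a *\<^sub>R ((- 1 / (b - a)) *\<^sub>R v) = v"
      by (metis scaleR_add_left scaleR_one scaleR_scaleR)
    moreover have "(b / (b - a)) *\<^sub>R v + b *\<^sub>R ((- 1 / (b - a)) *\<^sub>R v) = 0" by simp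
    ultimately show "chart_seg timelike_dir x' y" unfolding chart_seg_def using s x' by (intro exI conjI) (auto simp: v_def)
  qed
  show "\<exists>U. open U \<and> y \<in> U \<and> (\<forall>y'\<in>U. chart_seg timelike_dir x y')"
  proof (intro exI[of _ "cdom c \<inter> cmap c -` ball (cmap c y) (\<delta> / R)"] conjI ballI open_chart_ball gd(1))
    show "y \<in> cdom c \<inter> cmap c -` ball (cmap c y) (\<delta> / R)" using s dl R0 by simp
    fix y' assume y': "y' \<in> cdom c \<inter> cmap c -` ball (cmap c y) (\<delta> / R)"
    define v where "v = cmap c y' - cmap c y"
    have nv: "norm v < \<delta> / R" using y' by (simp add: v_def dist_norm norm_minus_commute)
    \<comment> \<open>The affine displacement equal to zero at \<open>a\<close> and to
      \<open>v\<close> at \<open>b\<close>.\<close>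
    have "coord_curve timelike_dir c B (\<lambda>t. \<alpha> t + ((- a / (b - a)) *\<^sub>R v + t *\<^sub>R ((1 / (b - a)) *\<^sub>R v))) (\<lambda>t. \<beta> t + (1 / (b - a)) *\<^sub>R v) a b"
      by (rule dl(2)) (use bd[OF nv, of "-a"] bd[OF nv, of 1] R in auto)
    moreover have "- a / (b - a) + b * (1 / (b - a)) = 1" using d(1) by (simp flip: diff_divide_distrib)
    then have "(- a / (b - a)) *\<^sub>R v + b *\<^sub>R ((1 / (b - a)) *\<^sub>R v) = v"
      by (metis scaleR_add_left scaleR_one scaleR_scaleR)
    moreover have "(- a / (b - a)) *\<^sub>R v + a *\<^sub>R ((1 / (b - a)) *\<^sub>R v) = 0" by simp
    ultimately show "chart_seg timelike_dir x y'" unfolding chart_seg_def using s y' by (intro exI conjI) (auto simp: v_def)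
  qed
qed

lemma chron_open_left: "chron M x y \<Longrightarrow> \<exists>U. open U \<and> x \<in> U \<and> (\<forall>x'\<in>U. chron M x' y)"
  unfolding chron_chart_seg by (drule tranclpD) (meson rtranclp_into_tranclp2 chart_seg_timelike_dir_open(1))

lemma chron_open_right: "chron M x y \<Longrightarrow> \<exists>U. open U \<and> y \<in> U \<and> (\<forall>y'\<in>U. chron M x y')"
  unfolding chron_chart_seg by (erule tranclp.cases) (metis chart_seg_timelike_dir_open(2) tranclp.simps)+

lemma open_chron_future: "open (chron_future M A)"
proof (subst open_subopen, rule ballI)
  fix y assume "y \<in> chron_future M A"
  then obtain x where "x \<in> A" "chron M x y" by (auto simp: chron_future_def)
  then show "\<exists>U. open U \<and> y \<in> U \<and> U \<subseteq> chron_future M A"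
    using chron_open_right[of x y] unfolding chron_future_def by blast
qed

lemma cinv_near:
  assumes "c \<in> charts M" "y \<in> cdom c" "open U" "y \<in> U"
  obtains \<delta> where "\<delta> > 0" "\<And>z. z \<in> ball (cmap c y) \<delta> \<Longrightarrow> z \<in> img c \<and> cinv c z \<in> U"
proof -
  have "open (img c \<inter> cinv c -` U)"
    by (rule continuous_open_preimage[OF cont_cinv open_img assms(3)]) (use assms in auto)
  moreover have "cmap c y \<in> img c \<inter> cinv c -` U" using assms cinv_cmap by auto
  ultimately obtain \<delta> where "\<delta> > 0" "ball (cmap c y) \<delta> \<subseteq> img c \<inter> cinv c -` U" by (rule openE)
  then show ?thesis by (intro that[of \<delta>]) auto
qed

lemma small_scale:
  fixes w :: "'x::real_normed_vector"
  assumes "e0 > (0::real)" "\<delta> > 0"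
  obtains e where "0 < e" "e < e0" "norm (e *\<^sub>R w) < \<delta>"
proof -
  define e where "e = min (e0 / 2) (\<delta> / (2 * (norm w + 1)))"
  have n: "norm w + 1 > 0" by (smt (verit) norm_ge_zero)
  have e: "0 < e" "e < e0" "e \<le> \<delta> / (2 * (norm w + 1))" using assms n by (auto simp: e_def min_less_iff_disj)
  have "e * norm w \<le> e * (norm w + 1)" using e by simp
  also have "\<dots> \<le> \<delta> / (2 * (norm w + 1)) * (norm w + 1)" using e(3) n by (intro mult_right_mono) auto
  also have "\<dots> < \<delta>" using n assms mult_pos_pos[OF assms(2) n] by (simp add: field_simps)
  finally show ?thesis using that e by simp
qed

lemma chron_near:
  assumes "open U" "x \<in> U" obtains y where "y \<in> U" "chron M x y"
proof -
  obtain c B T \<xi> where g: "good_region c B T \<xi>" "c \<in> charts_at M x" "cmap c x \<in> B" by (rule good_region_at)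
  note gd = good_regionD[OF g(1)]
  obtain \<delta> where d: "\<delta> > 0" "\<And>z. z \<in> ball (cmap c x) \<delta> \<Longrightarrow> z \<in> img c \<and> cinv c z \<in> U"
    using cinv_near[OF gd(1) _ assms] g(2) by blast
  obtain r where r: "r > 0" "ball (cmap c x) r \<subseteq> B" using gd(2) g(3) openE by blast
  have "min \<delta> r > 0" using d r by simp
  then obtain e where e: "0 < e" "e < 1" "norm (e *\<^sub>R T) < min \<delta> r" by (rule small_scale[OF zero_less_one])
  have "coord_curve timelike_dir c B (\<lambda>t. cmap c x + t *\<^sub>R T) (\<lambda>t. T) 0 e" unfolding coord_curve_def
  proof (intro conjI ballI e continuous_intros)
    fix t assume t: "t \<in> {0..e}"
    show "((\<lambda>t. cmap c x + t *\<^sub>R T) has_vector_derivative T) (at t within {0..e})"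
      by (auto intro!: derivative_eq_intros)
    have "norm (t *\<^sub>R T) \<le> norm (e *\<^sub>R T)" using t by (auto intro: mult_right_mono)
    then show i: "cmap c x + t *\<^sub>R T \<in> B" using e r(2) by (auto simp: dist_norm subset_iff)
    show "timelike_dir c (cmap c x + t *\<^sub>R T) T" by (rule gd(4)[OF i])
  qed
  from chart_segI[OF g(1) this] have "chart_seg timelike_dir x (cinv c (cmap c x + e *\<^sub>R T))" using cinv_cmap[OF gd(1)] g(2) by auto
  moreover have "cinv c (cmap c x + e *\<^sub>R T) \<in> U" using d(2)[of "cmap c x + e *\<^sub>R T"] e by (simp add: dist_norm)
  ultimately show ?thesis using that chron_chart_seg by blast
qed

section \<open>Push-up: causal segments adjacent to chronological relations\<close>

text \<open>Moving along \<open>T\<close> at rate K q gains a multiple of K q, while the change of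
  the metric over a displacement of size at most \<open>q\<close> costs only a fixed multiple of
  \<open>q\<close>. An exponential profile keeps displacement and rate in this proportion.\<close>

lemma push_variation:
  assumes g: "good_region c B T \<xi>" and cc: "coord_curve causal_dir c B \<alpha> \<beta> a b"
  obtains K where "K > 0"
    "\<And>t p q. t \<in> {a..b} \<Longrightarrow> \<bar>p\<bar> \<le> q \<Longrightarrow> 0 < q \<Longrightarrow> first_variation c (\<alpha> t) (\<beta> t) (p *\<^sub>R T) ((K * q) *\<^sub>R T) < 0"
proof -
  note gd = good_regionD[OF g] and d = coord_curveD[OF cc]
  have im: "\<alpha> ` {a..b} \<subseteq> img c" using d(4) gd(6) by auto
  have c1: "continuous_on {a..b} (\<lambda>t. coord_met c (\<alpha> t) T (\<beta> t))"
    by (intro cont_coord_met[OF gd(1)] d im continuous_intros)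
  have c2: "continuous_on {a..b} (\<lambda>t. \<beta> t \<bullet> (dG c (\<alpha> t) T *v \<beta> t))"
    by (intro cont_form_dG[OF gd(1)] d im continuous_intros)
  have ne: "{a..b} \<noteq> {}" using d(1) by auto
  obtain t1 where t1: "t1 \<in> {a..b}" "\<And>t. t \<in> {a..b} \<Longrightarrow> coord_met c (\<alpha> t) T (\<beta> t) \<le> coord_met c (\<alpha> t1) T (\<beta> t1)"
    using continuous_attains_sup[OF compact_Icc ne c1] by blast
  obtain t2 where t2: "\<And>t. t \<in> {a..b} \<Longrightarrow> \<bar>\<beta> t \<bullet> (dG c (\<alpha> t) T *v \<beta> t)\<bar> \<le> \<bar>\<beta> t2 \<bullet> (dG c (\<alpha> t2) T *v \<beta> t2)\<bar>"
    using continuous_attains_sup[OF compact_Icc ne continuous_on_rabs[OF c2]] by blast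
  define g0 where "g0 = - coord_met c (\<alpha> t1) T (\<beta> t1)"
  define m0 where "m0 = \<bar>\<beta> t2 \<bullet> (dG c (\<alpha> t2) T *v \<beta> t2)\<bar>"
  have i1: "\<alpha> t1 \<in> img c" using im t1(1) by auto
  have g0: "g0 > 0" unfolding g0_def
    using causal_dir_timelike_dir_neg[OF gd(1) i1 d(5)[OF t1(1)] gd(4)[OF d(4)[OF t1(1)]]] coord_met_sym[OF gd(1) i1] by simp
  \<comment> \<open>With \<open>m0\<close> bounding the metric term and \<open>g0\<close> the gain,
    this choice leaves a first variation of at most -q.\<close>
  define K where "K = (m0 + 1) / (2 * g0)"
  have K: "K > 0" "2 * K * g0 = m0 + 1" using g0 by (auto simp: K_def m0_def field_simps add_pos_nonneg)
  show ?thesis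
  proof (rule that[OF K(1)])
    fix t p q assume h: "t \<in> {a..b}" "\<bar>p\<bar> \<le> q" "(0::real) < q"
    have i: "\<alpha> t \<in> img c" using im h(1) by auto
    let ?m = "\<beta> t \<bullet> (dG c (\<alpha> t) T *v \<beta> t)"
    have "first_variation c (\<alpha> t) (\<beta> t) (p *\<^sub>R T) ((K * q) *\<^sub>R T) = 2 * (K * q) * coord_met c (\<alpha> t) T (\<beta> t) + p * ?m"
      unfolding first_variation_def coord_met_scale
      by (simp add: linear_cmul[OF dG_linear[OF gd(1) i]] bounded_bilinear.scaleR_left[OF bounded_bilinear_matrix_vector])
    also have "\<dots> \<le> 2 * (K * q) * (- g0) + q * m0"
    proof (rule add_mono)
      show "2 * (K * q) * coord_met c (\<alpha> t) T (\<beta> t) \<le> 2 * (K * q) * (- g0)"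
        using t1(2)[OF h(1)] K h(3) by (intro mult_left_mono) (auto simp: g0_def)
      have "p * ?m \<le> \<bar>p\<bar> * \<bar>?m\<bar>" by (metis abs_ge_self abs_mult)
      also have "\<dots> \<le> q * m0" using h t2[OF h(1)] by (intro mult_mono) (auto simp: m0_def)
      finally show "p * ?m \<le> q * m0" .
    qed
    also have "\<dots> = - q" using K(2) by (simp add: algebra_simps) (metis distrib_left mult.commute mult.left_commute mult_1)
    finally show "first_variation c (\<alpha> t) (\<beta> t) (p *\<^sub>R T) ((K * q) *\<^sub>R T) < 0" using h(3) by simp
  qed
qed

text \<open>The start is fixed and the end is pushed along \<open>T\<close>. The segment becomes
  timelike, and the moved end still lies in the open chronological past of \<open>z\<close>.\<close>

lemma chart_seg_push_left:
  assumes "chart_seg causal_dir x y" "chron M y z" shows "chron M x z"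
proof -
  obtain c B T \<xi> \<alpha> \<beta> a b where s: "good_region c B T \<xi>" "x \<in> cdom c" "y \<in> cdom c"
     "\<alpha> a = cmap c x" "\<alpha> b = cmap c y" "coord_curve causal_dir c B \<alpha> \<beta> a b" using assms(1) unfolding chart_seg_def by blast
  note gd = good_regionD[OF s(1)]
  obtain K where K: "K > 0"
    "\<And>t p q. t \<in> {a..b} \<Longrightarrow> \<bar>p\<bar> \<le> q \<Longrightarrow> 0 < q \<Longrightarrow> first_variation c (\<alpha> t) (\<beta> t) (p *\<^sub>R T) ((K * q) *\<^sub>R T) < 0"
    by (rule push_variation[OF s(1,6)]) blast
  \<comment> \<open>For q = exp(K (t - a)) and p = q - 1 this is the field of
    \<open>push_variation\<close>, vanishing at \<open>a\<close>.\<close>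
  let ?V = "\<lambda>t. (exp (K * (t - a)) - 1) *\<^sub>R T" and ?V' = "\<lambda>t. (K * exp (K * (t - a))) *\<^sub>R T"
  obtain e0 where e0: "e0 > 0"
    "\<And>e. 0 < e \<Longrightarrow> e < e0 \<Longrightarrow> coord_curve timelike_dir c B (\<lambda>t. \<alpha> t + e *\<^sub>R ?V t) (\<lambda>t. \<beta> t + e *\<^sub>R ?V' t) a b"
  proof (rule variation_coord_curve[OF s(1,6), of ?V ?V'])
    fix t assume t: "t \<in> {a..b}"
    show "(?V has_vector_derivative ?V' t) (at t within {a..b})"
      by (intro bounded_linear.has_vector_derivative[OF bounded_linear_scaleR_left])
        (auto intro!: derivative_eq_intros simp: has_real_derivative_iff_has_vector_derivative[symmetric])
    have "exp (K * (t - a)) \<ge> 1" using t K(1) by simp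
    then show "first_variation c (\<alpha> t) (\<beta> t) (?V t) (?V' t) < 0" by (intro K(2)[OF t]) auto
  qed (auto intro!: continuous_intros)
  obtain U where U: "open U" "y \<in> U" "\<And>y'. y' \<in> U \<Longrightarrow> chron M y' z" using chron_open_left[OF assms(2)] by blast
  obtain \<delta> where dl: "\<delta> > 0" "\<And>z. z \<in> ball (cmap c y) \<delta> \<Longrightarrow> z \<in> img c \<and> cinv c z \<in> U"
    using cinv_near[OF gd(1) s(3) U(1,2)] by blast
  obtain e where e: "0 < e" "e < e0" "norm (e *\<^sub>R ?V b) < \<delta>" by (rule small_scale[OF e0(1) dl(1)])
  have "chart_seg timelike_dir (cinv c (\<alpha> a + e *\<^sub>R ?V a)) (cinv c (\<alpha> b + e *\<^sub>R ?V b))"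
    by (rule chart_segI[OF s(1) e0(2)[OF e(1,2)]])
  then have "chron M x (cinv c (\<alpha> b + e *\<^sub>R ?V b))" using s cinv_cmap[OF gd(1)] by (simp add: chron_chart_seg)
  moreover have "cinv c (\<alpha> b + e *\<^sub>R ?V b) \<in> U" using dl(2)[of "\<alpha> b + e *\<^sub>R ?V b"] e(3) s(5) by (simp add: dist_norm)
  ultimately show ?thesis using U(3) chron_trans by blast
qed

lemma chart_seg_push_right:
  assumes "chron M x y" "chart_seg causal_dir y z" shows "chron M x z"
proof -
  obtain c B T \<xi> \<alpha> \<beta> a b where s: "good_region c B T \<xi>" "y \<in> cdom c" "z \<in> cdom c"
     "\<alpha> a = cmap c y" "\<alpha> b = cmap c z" "coord_curve causal_dir c B \<alpha> \<beta> a b" using assms(2) unfolding chart_seg_def by blast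
  note gd = good_regionD[OF s(1)]
  obtain K where K: "K > 0"
    "\<And>t p q. t \<in> {a..b} \<Longrightarrow> \<bar>p\<bar> \<le> q \<Longrightarrow> 0 < q \<Longrightarrow> first_variation c (\<alpha> t) (\<beta> t) (p *\<^sub>R T) ((K * q) *\<^sub>R T) < 0"
    by (rule push_variation[OF s(1,6)]) blast
  \<comment> \<open>The mirror image: the end is fixed and the start recedes along -T, where it is
    still chronologically after \<open>x\<close>.\<close>
  let ?V = "\<lambda>t. (1 - exp (K * (b - t))) *\<^sub>R T" and ?V' = "\<lambda>t. (K * exp (K * (b - t))) *\<^sub>R T"
  obtain e0 where e0: "e0 > 0"
    "\<And>e. 0 < e \<Longrightarrow> e < e0 \<Longrightarrow> coord_curve timelike_dir c B (\<lambda>t. \<alpha> t + e *\<^sub>R ?V t) (\<lambda>t. \<beta> t + e *\<^sub>R ?V' t) a b"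
  proof (rule variation_coord_curve[OF s(1,6), of ?V ?V'])
    fix t assume t: "t \<in> {a..b}"
    show "(?V has_vector_derivative ?V' t) (at t within {a..b})"
      by (intro bounded_linear.has_vector_derivative[OF bounded_linear_scaleR_left])
        (auto intro!: derivative_eq_intros simp: has_real_derivative_iff_has_vector_derivative[symmetric])
    have "exp (K * (b - t)) \<ge> 1" using t K(1) by simp
    then show "first_variation c (\<alpha> t) (\<beta> t) (?V t) (?V' t) < 0" by (intro K(2)[OF t]) auto
  qed (auto intro!: continuous_intros)
  obtain U where U: "open U" "y \<in> U" "\<And>y'. y' \<in> U \<Longrightarrow> chron M x y'" using chron_open_right[OF assms(1)] by blast
  obtain \<delta> where dl: "\<delta> > 0" "\<And>z. z \<in> ball (cmap c y) \<delta> \<Longrightarrow> z \<in> img c \<and> cinv c z \<in> U"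
    using cinv_near[OF gd(1) s(2) U(1,2)] by blast
  obtain e where e: "0 < e" "e < e0" "norm (e *\<^sub>R ?V a) < \<delta>" by (rule small_scale[OF e0(1) dl(1)])
  have "chart_seg timelike_dir (cinv c (\<alpha> a + e *\<^sub>R ?V a)) (cinv c (\<alpha> b + e *\<^sub>R ?V b))"
    by (rule chart_segI[OF s(1) e0(2)[OF e(1,2)]])
  then have "chron M (cinv c (\<alpha> a + e *\<^sub>R ?V a)) z" using s cinv_cmap[OF gd(1)] by (simp add: chron_chart_seg)
  moreover have "cinv c (\<alpha> a + e *\<^sub>R ?V a) \<in> U" using dl(2)[of "\<alpha> a + e *\<^sub>R ?V a"] e(3) s(4) by (simp add: dist_norm)
  ultimately show ?thesis using U(3) chron_trans by blast
qed

lemma push_left: "causal M x y \<Longrightarrow> chron M y z \<Longrightarrow> chron M x z"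
  unfolding causal_chart_seg by (induction rule: converse_rtranclp_induct) (auto intro: chart_seg_push_left)

lemma push_right: "chron M x y \<Longrightarrow> causal M y z \<Longrightarrow> chron M x z"
  unfolding causal_chart_seg by (rotate_tac, induction rule: rtranclp_induct) (auto intro: chart_seg_push_right)

end

lemma has_vector_derivative_Un:
  assumes "(f has_vector_derivative D) (at t within A)" "(f has_vector_derivative D) (at t within B)"
  shows "(f has_vector_derivative D) (at t within (A \<union> B))"
  using assms unfolding has_vector_derivative_def has_derivative_within by (auto intro: Lim_Un)

text \<open>Away from the closure of \<open>B\<close> the filter is trivial. In gluing, this makes
  the second piece harmless at parameters belonging only to the first.\<close>

lemma has_vector_derivative_isolated:
  assumes "t \<notin> closure B" shows "(f has_vector_derivative D) (at t within B)"
proof -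
  have "t \<notin> closure (B - {t})" using assms closure_mono[of "B - {t}" B] by blast
  then have "at t within B = bot" by (simp add: at_within_eq_bot_iff)
  then show ?thesis
    unfolding has_vector_derivative_def has_derivative_def by (simp add: bounded_linear_scaleR_left)
qed

context spacetime_locale
begin

section \<open>Geodesics\<close>

lemma geodesicD:
  assumes "geodesic M \<gamma> w J" "t \<in> J"
  shows "continuous_on J \<gamma>" "w t \<in> tangent_space M (\<gamma> t)"
    and "c \<in> charts_at M (\<gamma> t) \<Longrightarrow> ((\<lambda>s. cmap c (\<gamma> s)) has_vector_derivative w t c) (at t within J)"
    and "c \<in> charts_at M (\<gamma> t) \<Longrightarrow> ((\<lambda>s. w s c) has_vector_derivative acc c (cmap c (\<gamma> t)) (w t c)) (at t within J)"
proof -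
  have h: "has_velocity M \<gamma> (w t) t J" "\<And>c. c \<in> charts_at M (\<gamma> t) \<Longrightarrow> ((\<lambda>s. w s c) has_vector_derivative
        (\<chi> k. - (\<Sum>i\<in>UNIV. \<Sum>j\<in>UNIV. christoffel M c (cmap c (\<gamma> t)) k i j * w t c $ i * w t c $ j))) (at t within J)"
    using assms unfolding geodesic_def by blast+
  show "continuous_on J \<gamma>" using assms(1) unfolding geodesic_def by blast
  show "w t \<in> tangent_space M (\<gamma> t)" using h(1) unfolding has_velocity_def by blast
  assume c: "c \<in> charts_at M (\<gamma> t)"
  show "((\<lambda>s. cmap c (\<gamma> s)) has_vector_derivative w t c) (at t within J)"
    using h(1) c unfolding has_velocity_def o_def by blast
  have "c \<in> charts M" "cmap c (\<gamma> t) \<in> img c" using c by auto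
  from acc_christoffel[OF this] show "((\<lambda>s. w s c) has_vector_derivative acc c (cmap c (\<gamma> t)) (w t c)) (at t within J)"
    using h(2)[OF c] by simp
qed

lemma geodesicI:
  assumes "continuous_on J \<gamma>" "\<And>t. t \<in> J \<Longrightarrow> w t \<in> tangent_space M (\<gamma> t)"
    and x: "\<And>t c. t \<in> J \<Longrightarrow> c \<in> charts_at M (\<gamma> t) \<Longrightarrow> ((\<lambda>s. cmap c (\<gamma> s)) has_vector_derivative w t c) (at t within J)"
    and v: "\<And>t c. t \<in> J \<Longrightarrow> c \<in> charts_at M (\<gamma> t) \<Longrightarrow> ((\<lambda>s. w s c) has_vector_derivative acc c (cmap c (\<gamma> t)) (w t c)) (at t within J)"
  shows "geodesic M \<gamma> w J"
  unfolding geodesic_def has_velocity_def o_def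
proof (intro conjI ballI assms)
  fix t c assume t: "t \<in> J" and c: "c \<in> charts_at M (\<gamma> t)"
  have "c \<in> charts M" "cmap c (\<gamma> t) \<in> img c" using c by auto
  from acc_christoffel[OF this] v[OF t c]
  show "((\<lambda>s. w s c) has_vector_derivative
        (\<chi> k. - (\<Sum>i\<in>UNIV. \<Sum>j\<in>UNIV. christoffel M c (cmap c (\<gamma> t)) k i j * w t c $ i * w t c $ j))) (at t within J)"
    by simp
qed

text \<open>A solution of the equation in one chart solves it in all charts, by the transformation
  law of \<open>acc\<close> and the product rule for the transported velocity.\<close>

lemma geodesic_lift:
  assumes c: "c \<in> charts M" and xi: "\<And>t. t \<in> J \<Longrightarrow> x t \<in> img c"
    and x: "\<And>t. t \<in> J \<Longrightarrow> (x has_vector_derivative u t) (at t within J)"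
    and u: "\<And>t. t \<in> J \<Longrightarrow> (u has_vector_derivative acc c (x t) (u t)) (at t within J)"
  shows "geodesic M (\<lambda>t. cinv c (x t)) (\<lambda>t. lift c (cinv c (x t)) (u t)) J"
proof (rule geodesicI)
  have ch: "c \<in> charts_at M (cinv c (x t))" if "t \<in> J" for t using cinv_in[OF c xi[OF that]] c by auto
  have cx: "continuous_on J x" using x by (rule continuous_on_vector_derivative)
  show cg: "continuous_on J (\<lambda>t. cinv c (x t))"
    by (rule continuous_on_compose2[OF cont_cinv[OF c] cx]) (use xi in auto)
  fix t assume t: "t \<in> J"
  show "lift c (cinv c (x t)) (u t) \<in> tangent_space M (cinv c (x t))" by (intro lift_tangent ch t)
  fix e assume e: "e \<in> charts_at M (cinv c (x t))"
  note ce = c charts_atD(1)[OF e]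
  have o: "x t \<in> overlap c e" using e cinv_in[OF c xi[OF t]] cmap_cinv[OF c xi[OF t]]
    by (metis IntI charts_atD(2) image_eqI)
  have tr: "transition c e z = cmap e (cinv c z)" for z by (simp add: transition_def)
  have le: "lift c (cinv c (x t)) (u t) e = transition_deriv c e (x t) (u t)"
    using e by (simp add: lift_def cmap_cinv[OF c xi[OF t]])
  show "((\<lambda>s. cmap e (cinv c (x s))) has_vector_derivative lift c (cinv c (x t)) (u t) e) (at t within J)"
    using has_derivative_compose[OF x[OF t, unfolded has_vector_derivative_def] transition_deriv_deriv_at[OF ce o]]
    by (simp add: has_vector_derivative_def tr le linear_cmul[OF transition_deriv_lin_at[OF ce o]])
  have D: "((\<lambda>s. transition_deriv c e (x s) (u s)) has_vector_derivative acc e (transition c e (x t)) (transition_deriv c e (x t) (u t))) (at t within J)"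
    using transition_deriv_moving[where x = x, OF ce o x[OF t] u[OF t] t] acc_transform[OF ce o] by simp
  have "\<forall>\<^sub>F s in at t within J. cinv c (x s) \<in> cdom e"
    using cg t open_cdom[OF ce(2)] e by (intro topological_tendstoD[of _ "cinv c (x t)"]) (auto simp: continuous_on_def)
  moreover have "\<forall>\<^sub>F s in at t within J. s \<in> J" by (simp add: eventually_at_filter)
  ultimately have ev: "\<forall>\<^sub>F s in at t within J. transition_deriv c e (x s) (u s) = lift c (cinv c (x s)) (u s) e"
  proof eventually_elim
    case (elim s)
    then show ?case using ce by (simp add: lift_def cmap_cinv[OF c xi] charts_at_def)
  qed
  show "((\<lambda>s. lift c (cinv c (x s)) (u s) e) has_vector_derivative
     acc e (cmap e (cinv c (x t))) (lift c (cinv c (x t)) (u t) e)) (at t within J)"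
    using has_derivative_transform_eventually[OF D[unfolded has_vector_derivative_def] ev le[symmetric] t]
    unfolding has_vector_derivative_def le tr .
qed

lemma geodesic_subset: "geodesic M \<gamma> w J \<Longrightarrow> I \<subseteq> J \<Longrightarrow> geodesic M \<gamma> w I"
proof (rule geodesicI)
  assume g: "geodesic M \<gamma> w J" and I: "I \<subseteq> J"
  show "continuous_on I \<gamma>" using g I continuous_on_subset unfolding geodesic_def by blast
qed (auto intro: geodesicD has_vector_derivative_within_subset)

lemma geodesic_cong:
  assumes g: "geodesic M \<gamma> w J" and e: "\<And>t. t \<in> J \<Longrightarrow> \<gamma>' t = \<gamma> t" "\<And>t. t \<in> J \<Longrightarrow> w' t = w t"
  shows "geodesic M \<gamma>' w' J"
proof (rule geodesicI)
  show "continuous_on J \<gamma>'" using g e by (simp add: geodesic_def cong: continuous_on_cong)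
  fix t assume t: "t \<in> J"
  show "w' t \<in> tangent_space M (\<gamma>' t)" using geodesicD(2)[OF g t] e t by simp
  fix c assume "c \<in> charts_at M (\<gamma>' t)"
  then have c: "c \<in> charts_at M (\<gamma> t)" using e t by simp
  show "((\<lambda>s. cmap c (\<gamma>' s)) has_vector_derivative w' t c) (at t within J)"
    unfolding e(2)[OF t] by (rule has_vector_derivative_transform[OF t _ geodesicD(3)[OF g t c]]) (simp add: e)
  show "((\<lambda>s. w' s c) has_vector_derivative acc c (cmap c (\<gamma>' t)) (w' t c)) (at t within J)"
    unfolding e(1)[OF t] e(2)[OF t]
    by (rule has_vector_derivative_transform[OF t _ geodesicD(4)[OF g t c]]) (simp add: e)
qed

lemma geodesic_affine:
  assumes g: "geodesic M \<gamma> w J" and I: "\<And>t. t \<in> I \<Longrightarrow> k * t + s \<in> J"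
  shows "geodesic M (\<lambda>t. \<gamma> (k * t + s)) (\<lambda>t c. k *\<^sub>R w (k * t + s) c) I"
proof (rule geodesicI)
  show "continuous_on I (\<lambda>t. \<gamma> (k * t + s))"
    by (rule continuous_on_compose2[of J \<gamma>]) (use g I in \<open>auto simp: geodesic_def intro!: continuous_intros\<close>)
  fix t assume t: "t \<in> I"
  show "(\<lambda>c. k *\<^sub>R w (k * t + s) c) \<in> tangent_space M (\<gamma> (k * t + s))"
    by (rule tangent_scale[OF geodesicD(2)[OF g I[OF t]]])
  fix c assume c: "c \<in> charts_at M (\<gamma> (k * t + s))"
  show "((\<lambda>t. cmap c (\<gamma> (k * t + s))) has_vector_derivative k *\<^sub>R w (k * t + s) c) (at t within I)"
    by (rule has_vector_derivative_affine[OF geodesicD(3)[OF g I[OF t] c] I])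
  have i: "c \<in> charts M" "cmap c (\<gamma> (k * t + s)) \<in> img c" using c by auto
  have "((\<lambda>t. w (k * t + s) c) has_vector_derivative k *\<^sub>R acc c (cmap c (\<gamma> (k * t + s))) (w (k * t + s) c)) (at t within I)"
    by (rule has_vector_derivative_affine[OF geodesicD(4)[OF g I[OF t] c] I])
  then have "((\<lambda>t. k *\<^sub>R w (k * t + s) c) has_vector_derivative k *\<^sub>R (k *\<^sub>R acc c (cmap c (\<gamma> (k * t + s))) (w (k * t + s) c))) (at t within I)"
    by (rule bounded_linear.has_vector_derivative[OF bounded_linear_scaleR_right])
  then show "((\<lambda>t. k *\<^sub>R w (k * t + s) c) has_vector_derivative
     acc c (cmap c (\<gamma> (k * t + s))) (k *\<^sub>R w (k * t + s) c)) (at t within I)"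
    by (simp add: acc_scale[OF i])
qed

text \<open>At \<open>m\<close> the two one-sided derivatives coincide, since position and velocity
  do and the equation is autonomous; at any other parameter only one piece is present.\<close>

lemma geodesic_glue:
  assumes g1: "geodesic M \<gamma> w J1" and g2: "geodesic M \<delta> v J2"
    and J: "J1 \<subseteq> {..m}" "J2 \<subseteq> {m..}" "m \<in> J1" "m \<in> J2" and m: "\<gamma> m = \<delta> m" "w m = v m"
  shows "geodesic M (\<lambda>t. if t \<le> m then \<gamma> t else \<delta> t) (\<lambda>t. if t \<le> m then w t else v t) (J1 \<union> J2)"
    (is "geodesic M ?g ?w _")
proof -
  have e1: "geodesic M ?g ?w J1" by (rule geodesic_cong[OF g1]) (use J in auto)
  have e2: "geodesic M ?g ?w J2" by (rule geodesic_cong[OF g2]) (use J m in \<open>auto simp: subset_iff intro: antisym\<close>)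
  have c1: "closure J1 \<subseteq> {..m}" by (rule closure_minimal[OF J(1) closed_atMost])
  have c2: "closure J2 \<subseteq> {m..}" by (rule closure_minimal[OF J(2) closed_atLeast])
  have dU: "(f has_vector_derivative D) (at t within (J1 \<union> J2))"
    if "t \<in> J1 \<union> J2" "t \<in> J1 \<Longrightarrow> (f has_vector_derivative D) (at t within J1)"
      "t \<in> J2 \<Longrightarrow> (f has_vector_derivative D) (at t within J2)" for f :: "real \<Rightarrow> real ^ 'n" and D t
  proof (rule has_vector_derivative_Un)
    show "(f has_vector_derivative D) (at t within J1)"
      using that(1,2) c1 J has_vector_derivative_isolated[of t J1]
      by (cases "t \<in> J1") (fastforce simp: subset_iff)+
    show "(f has_vector_derivative D) (at t within J2)"
      using that(1,3) c2 J has_vector_derivative_isolated[of t J2]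
      by (cases "t \<in> J2") (fastforce simp: subset_iff)+
  qed
  show ?thesis
  proof (rule geodesicI)
    have "continuous_on J1 ?g" "continuous_on J2 ?g" using e1 e2 by (auto simp: geodesic_def)
    then show "continuous_on (J1 \<union> J2) ?g"
    proof -
      assume c: "continuous_on J1 ?g" "continuous_on J2 ?g"
      have "(?g \<longlongrightarrow> ?g t) (at t within J1)" if "t \<in> J1 \<union> J2" for t
      proof (cases "t \<in> J1")
        case False
        then have "t \<notin> closure J1" using that c1 J by (fastforce simp: subset_iff)
        then have "t \<notin> closure (J1 - {t})" using closure_mono[of "J1 - {t}" J1] by blast
        then have "at t within J1 = bot" by (simp add: at_within_eq_bot_iff)
        then show ?thesis by simp
      qed (use c in \<open>auto simp: continuous_on_def\<close>)
      moreover have "(?g \<longlongrightarrow> ?g t) (at t within J2)" if "t \<in> J1 \<union> J2" for t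
      proof (cases "t \<in> J2")
        case False
        then have "t \<notin> closure J2" using that c2 J by (fastforce simp: subset_iff)
        then have "t \<notin> closure (J2 - {t})" using closure_mono[of "J2 - {t}" J2] by blast
        then have "at t within J2 = bot" by (simp add: at_within_eq_bot_iff)
        then show ?thesis by simp
      qed (use c in \<open>auto simp: continuous_on_def\<close>)
      ultimately show ?thesis unfolding continuous_on_def by (blast intro: Lim_Un)
    qed
    fix t assume t: "t \<in> J1 \<union> J2"
    then show "?w t \<in> tangent_space M (?g t)" using geodesicD(2)[OF e1] geodesicD(2)[OF e2] by blast
    fix c assume c: "c \<in> charts_at M (?g t)"
    show "((\<lambda>s. cmap c (?g s)) has_vector_derivative ?w t c) (at t within (J1 \<union> J2))"
      using t geodesicD(3)[OF e1 _ c] geodesicD(3)[OF e2 _ c] by (rule dU)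
    show "((\<lambda>s. ?w s c) has_vector_derivative acc c (cmap c (?g t)) (?w t c)) (at t within (J1 \<union> J2))"
      using t geodesicD(4)[OF e1 _ c] geodesicD(4)[OF e2 _ c] by (rule dU)
  qed
qed

lemma acc_zero: "c \<in> charts M \<Longrightarrow> y \<in> img c \<Longrightarrow> acc c y 0 = 0"
  using acc_scale[of c y 0 0] by simp

lemma geodesic_const: "geodesic M (\<lambda>_. p) (\<lambda>_ _. 0) J"
  by (rule geodesicI) (auto simp: acc_zero tangent_zero charts_at_def)

section \<open>The geodesic flow: uniqueness, continuous dependence, local existence\<close>

definition state :: "('m, 'n) chart \<Rightarrow> (real \<Rightarrow> 'm) \<Rightarrow> (real \<Rightarrow> ('m, 'n) tvector) \<Rightarrow> real \<Rightarrow> (real ^ 'n) \<times> (real ^ 'n)" where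
  "state c \<gamma> w s = (cmap c (\<gamma> s), w s c)"

definition geodesic_spray :: "('m, 'n) chart \<Rightarrow> (real ^ 'n) \<times> (real ^ 'n) \<Rightarrow> (real ^ 'n) \<times> (real ^ 'n)" where
  "geodesic_spray c p = (snd p, acc c (fst p) (snd p))"

lemma loclip_geodesic_spray: "c \<in> charts M \<Longrightarrow> fst p \<in> img c \<Longrightarrow> loclip (geodesic_spray c) p"
  unfolding geodesic_spray_def using loclip_acc[of c "fst p" "snd p"]
  by (intro loclip_Pair[OF loclip_bounded_linear[OF bounded_linear_snd]]) simp

lemma state_deriv:
  assumes "geodesic M \<gamma> w J" "t \<in> J" "c \<in> charts_at M (\<gamma> t)"
  shows "(state c \<gamma> w has_vector_derivative geodesic_spray c (state c \<gamma> w t)) (at t within J)"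
  unfolding state_def geodesic_spray_def fst_conv snd_conv
  by (rule has_vector_derivative_Pair[OF geodesicD(3,4)[OF assms]])

lemma state_continuous:
  assumes "geodesic M \<gamma> w J" "t \<in> J" "c \<in> charts_at M (\<gamma> t)"
  shows "(state c \<gamma> w \<longlongrightarrow> state c \<gamma> w t) (at t within J)"
  using has_vector_derivative_continuous[OF state_deriv[OF assms]] by (simp add: continuous_within)

lemma state_near:
  assumes "geodesic M \<gamma> w J" "t \<in> J" "c \<in> charts_at M (\<gamma> t)" "open S" "state c \<gamma> w t \<in> S"
  obtains d where "d > 0" "\<And>s. s \<in> J \<Longrightarrow> \<bar>s - t\<bar> < d \<Longrightarrow> \<gamma> s \<in> cdom c \<and> state c \<gamma> w s \<in> S"
proof -
  have c: "c \<in> charts M" "\<gamma> t \<in> cdom c" using assms(3) by auto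
  have 1: "\<forall>\<^sub>F s in at t within J. \<gamma> s \<in> cdom c"
    using geodesicD(1)[OF assms(1,2)] assms(2) open_cdom[OF c(1)] c(2)
    by (intro topological_tendstoD[of _ "\<gamma> t"]) (auto simp: continuous_on_def)
  have 2: "\<forall>\<^sub>F s in at t within J. state c \<gamma> w s \<in> S"
    by (rule topological_tendstoD[OF state_continuous[OF assms(1-3)] assms(4,5)])
  obtain d where d: "d > 0" "\<And>s. s \<in> J \<Longrightarrow> s \<noteq> t \<Longrightarrow> dist s t < d \<Longrightarrow> \<gamma> s \<in> cdom c \<and> state c \<gamma> w s \<in> S"
    using eventually_conj[OF 1 2] unfolding eventually_at by auto
  show ?thesis
  proof (rule that[OF d(1)])
    fix s assume "s \<in> J" "\<bar>s - t\<bar> < d"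
    then show "\<gamma> s \<in> cdom c \<and> state c \<gamma> w s \<in> S"
      using d(2)[of s] c(2) assms(5) by (cases "s = t") (auto simp: dist_real_def)
  qed
qed

lemma geodesic_spray_lipschitz:
  assumes "c \<in> charts M" "fst z0 \<in> img c"
  obtains L r where "r > 0" "L > 0" "cball z0 r \<subseteq> img c \<times> UNIV"
    "\<And>y z. y \<in> cball z0 r \<Longrightarrow> z \<in> cball z0 r \<Longrightarrow> norm (geodesic_spray c y - geodesic_spray c z) \<le> L * norm (y - z)"
proof -
  obtain L r1 where L: "L > 0" "r1 > 0" "\<And>y z. y \<in> cball z0 r1 \<Longrightarrow> z \<in> cball z0 r1 \<Longrightarrow> dist (geodesic_spray c y) (geodesic_spray c z) \<le> L * dist y z"
    using loclipE[OF loclip_geodesic_spray[OF assms]] by metis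
  have "open (img c \<times> (UNIV :: (real ^ 'n) set))" "z0 \<in> img c \<times> UNIV"
    using open_img[OF assms(1)] assms(2) by (auto simp: mem_Times_iff intro: open_Times)
  then obtain r2 where r2: "r2 > 0" "cball z0 r2 \<subseteq> img c \<times> UNIV" using open_contains_cball by meson
  show ?thesis
  proof (rule that[of "min r1 r2" L])
    show "cball z0 (min r1 r2) \<subseteq> img c \<times> UNIV" using r2(2) by (meson min.cobounded2 order_trans subset_cball)
    fix y z assume "y \<in> cball z0 (min r1 r2)" "z \<in> cball z0 (min r1 r2)"
    then show "norm (geodesic_spray c y - geodesic_spray c z) \<le> L * norm (y - z)" using L(3)[of y z] by (simp add: dist_norm)
  qed (use L r2 in auto)
qed

lemma state_gronwall:
  assumes "s \<le> t" and g: "geodesic M \<gamma> w {s..t}" "geodesic M \<delta> v {s..t}" and c: "c \<in> charts M"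
    and L: "\<And>y z. y \<in> S \<Longrightarrow> z \<in> S \<Longrightarrow> norm (geodesic_spray c y - geodesic_spray c z) \<le> L * norm (y - z)"
    and S: "\<And>r. r \<in> {s..t} \<Longrightarrow> \<gamma> r \<in> cdom c \<and> state c \<gamma> w r \<in> S" "\<And>r. r \<in> {s..t} \<Longrightarrow> \<delta> r \<in> cdom c \<and> state c \<delta> v r \<in> S"
  shows "norm (state c \<gamma> w t - state c \<delta> v t) \<le> exp (L * (t - s)) * norm (state c \<gamma> w s - state c \<delta> v s)"
    and "norm (state c \<gamma> w s - state c \<delta> v s) \<le> exp (L * (t - s)) * norm (state c \<gamma> w t - state c \<delta> v t)"
proof -
  have 1: "(state c \<gamma> w has_vector_derivative geodesic_spray c (state c \<gamma> w r)) (at r within {s..t})" if "r \<in> {s..t}" for r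
    using S(1)[OF that] c by (intro state_deriv[OF g(1) that]) auto
  have 2: "(state c \<delta> v has_vector_derivative geodesic_spray c (state c \<delta> v r)) (at r within {s..t})" if "r \<in> {s..t}" for r
    using S(2)[OF that] c by (intro state_deriv[OF g(2) that]) auto
  have 3: "norm (geodesic_spray c (state c \<gamma> w r) - geodesic_spray c (state c \<delta> v r)) \<le> L * norm (state c \<gamma> w r - state c \<delta> v r)" if "r \<in> {s..t}" for r
    using S[OF that] L by blast
  show "norm (state c \<gamma> w t - state c \<delta> v t) \<le> exp (L * (t - s)) * norm (state c \<gamma> w s - state c \<delta> v s)"
    by (rule gronwall_right(1)[OF assms(1) 1 2 3])
  show "norm (state c \<gamma> w s - state c \<delta> v s) \<le> exp (L * (t - s)) * norm (state c \<gamma> w t - state c \<delta> v t)"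
    by (rule gronwall_right(2)[OF assms(1) 1 2 3])
qed

lemma state_eqD:
  assumes "geodesic M \<gamma> w I" "geodesic M \<delta> v J" "r \<in> I" "r \<in> J" "c \<in> charts M" "\<gamma> r \<in> cdom c" "\<delta> r \<in> cdom c" "state c \<gamma> w r = state c \<delta> v r"
  shows "\<gamma> r = \<delta> r" "w r = v r"
proof -
  show e: "\<gamma> r = \<delta> r" using assms(5-8) cinv_cmap[OF assms(5)] unfolding state_def by (metis Pair_inject)
  then have "v r \<in> tangent_space M (\<gamma> r)" using geodesicD(2)[OF assms(2,4)] by simp
  then show "w r = v r" using tangent_eq_iff[OF geodesicD(2)[OF assms(1,3)], of "v r" c] assms(5,6,8) by (auto simp: state_def)
qed

text \<open>Agreement of position and velocity is locally constant in the parameter: disagreement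
  persists by Hausdorff separation, agreement by Gronwall's inequality in a chart. Bisection makes
  this global.\<close>

lemma geodesic_unique:
  assumes g: "geodesic M \<gamma> w {a..b}" "geodesic M \<delta> v {a..b}"
    and t0: "t0 \<in> {a..b}" "\<gamma> t0 = \<delta> t0" "w t0 = v t0" and t: "t \<in> {a..b}"
  shows "\<gamma> t = \<delta> t \<and> w t = v t"
proof -
  define A where "A s \<longleftrightarrow> \<gamma> s = \<delta> s \<and> w s = v s" for s
  define Q where "Q s t \<longleftrightarrow> (a \<le> s \<longrightarrow> s \<le> t \<longrightarrow> t \<le> b \<longrightarrow> A s = A t)" for s t
  have loc: "\<exists>d>0. \<forall>s t. s \<le> x \<and> x \<le> t \<and> t - s < d \<longrightarrow> Q s t" if x: "a \<le> x" "x \<le> b" for x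
  proof -
    have xJ: "x \<in> {a..b}" using x by simp
    \<comment> \<open>Where agreement fails at \<open>x\<close> and all around it, both sides of
      \<open>A s = A t\<close> are false.\<close>
    have near: "\<exists>d>0. \<forall>s t. s \<le> x \<and> x \<le> t \<and> t - s < d \<longrightarrow> Q s t"
      if "\<forall>\<^sub>F s in at x within {a..b}. \<not> A s" "\<not> A x"
    proof -
      have "\<exists>d>0. \<forall>s\<in>{a..b}. s \<noteq> x \<and> dist s x < d \<longrightarrow> \<not> A s"
        using that(1) by (simp only: eventually_at)
      then obtain d where "d > 0" "\<forall>s\<in>{a..b}. s \<noteq> x \<and> dist s x < d \<longrightarrow> \<not> A s" by (elim exE conjE)
      then have d: "d > 0" "\<And>s. s \<in> {a..b} \<Longrightarrow> s \<noteq> x \<Longrightarrow> dist s x < d \<Longrightarrow> \<not> A s" by simp_all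
      show ?thesis
      proof (intro exI[of _ d] conjI d(1) allI impI)
        fix s t assume st: "s \<le> x \<and> x \<le> t \<and> t - s < d"
        show "Q s t" unfolding Q_def
        proof (intro impI)
          assume "a \<le> s" "s \<le> t" "t \<le> b"
          then have "\<not> A s" "\<not> A t" using d(2)[of s] d(2)[of t] that(2) st by (cases "s = x"; cases "t = x"; auto simp: dist_real_def)+
          then show "A s = A t" by simp
        qed
      qed
    qed
    have lim: "(\<gamma> \<longlongrightarrow> \<gamma> x) (at x within {a..b})" "(\<delta> \<longlongrightarrow> \<delta> x) (at x within {a..b})"
      using geodesicD(1)[OF g(1) xJ] geodesicD(1)[OF g(2) xJ] xJ by (auto simp: continuous_on_def)
    show ?thesis
    proof (cases "\<gamma> x = \<delta> x")
      case False
      from hausdorff[OF False] obtain U V where UV: "open U" "open V" "\<gamma> x \<in> U" "\<delta> x \<in> V" "U \<inter> V = {}" by (elim exE conjE)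
      have "\<forall>\<^sub>F s in at x within {a..b}. \<gamma> s \<in> U" "\<forall>\<^sub>F s in at x within {a..b}. \<delta> s \<in> V"
        using topological_tendstoD[OF lim(1) UV(1,3)] topological_tendstoD[OF lim(2) UV(2,4)] .
      then have "\<forall>\<^sub>F s in at x within {a..b}. \<not> A s"
        by eventually_elim (use UV(5) in \<open>auto simp: A_def\<close>)
      then show ?thesis by (rule near) (use False in \<open>simp add: A_def\<close>)
    next
      case True
      obtain c where c: "c \<in> charts_at M (\<gamma> x)" using charts_at_ex by blast
      then have c': "c \<in> charts_at M (\<delta> x)" "c \<in> charts M" using True by auto
      note sl = state_continuous[OF g(1) xJ c] state_continuous[OF g(2) xJ c'(1)]
      show ?thesis
      proof (cases "state c \<gamma> w x = state c \<delta> v x")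
        case False
        from hausdorff[OF False] obtain U V where UV: "open U" "open V" "state c \<gamma> w x \<in> U" "state c \<delta> v x \<in> V" "U \<inter> V = {}" by (elim exE conjE)
        have "\<forall>\<^sub>F s in at x within {a..b}. state c \<gamma> w s \<in> U" "\<forall>\<^sub>F s in at x within {a..b}. state c \<delta> v s \<in> V"
          using topological_tendstoD[OF sl(1) UV(1,3)] topological_tendstoD[OF sl(2) UV(2,4)] .
        then have "\<forall>\<^sub>F s in at x within {a..b}. \<not> A s"
          by eventually_elim (use UV(5) in \<open>auto simp: A_def state_def\<close>)
        then show ?thesis by (rule near) (use False in \<open>auto simp add: A_def state_def\<close>)
      next
        case True
        have "fst (state c \<gamma> w x) \<in> img c" using c by (auto simp: state_def)
        then obtain L r where L: "r > 0" "L > 0" "cball (state c \<gamma> w x) r \<subseteq> img c \<times> UNIV"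
          "\<And>y z. y \<in> cball (state c \<gamma> w x) r \<Longrightarrow> z \<in> cball (state c \<gamma> w x) r \<Longrightarrow> norm (geodesic_spray c y - geodesic_spray c z) \<le> L * norm (y - z)"
          using geodesic_spray_lipschitz[OF c'(2)] by metis
        have z: "state c \<gamma> w x \<in> ball (state c \<gamma> w x) r" "state c \<delta> v x \<in> ball (state c \<gamma> w x) r" using L(1) True by auto
        obtain d1 where d1: "d1 > 0" "\<And>s. s \<in> {a..b} \<Longrightarrow> \<bar>s - x\<bar> < d1 \<Longrightarrow> \<gamma> s \<in> cdom c \<and> state c \<gamma> w s \<in> ball (state c \<gamma> w x) r"
          by (rule state_near[OF g(1) xJ c open_ball z(1)]) blast
        obtain d2 where d2: "d2 > 0" "\<And>s. s \<in> {a..b} \<Longrightarrow> \<bar>s - x\<bar> < d2 \<Longrightarrow> \<delta> s \<in> cdom c \<and> state c \<delta> v s \<in> ball (state c \<gamma> w x) r"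
          by (rule state_near[OF g(2) xJ c'(1) open_ball z(2)]) blast
        show ?thesis
        proof (intro exI[of _ "min d1 d2"] conjI allI impI)
          fix s t assume st: "s \<le> x \<and> x \<le> t \<and> t - s < min d1 d2"
          show "Q s t" unfolding Q_def
          proof (intro impI)
            assume h: "a \<le> s" "s \<le> t" "t \<le> b"
            have sub: "{s..t} \<subseteq> {a..b}" using h by auto
            have S: "\<gamma> r' \<in> cdom c \<and> state c \<gamma> w r' \<in> cball (state c \<gamma> w x) r"
              "\<delta> r' \<in> cdom c \<and> state c \<delta> v r' \<in> cball (state c \<gamma> w x) r" if "r' \<in> {s..t}" for r'
            proof -
              have "\<bar>r' - x\<bar> < d1" "\<bar>r' - x\<bar> < d2" "r' \<in> {a..b}" using that st sub by auto
              then show "\<gamma> r' \<in> cdom c \<and> state c \<gamma> w r' \<in> cball (state c \<gamma> w x) r"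
                "\<delta> r' \<in> cdom c \<and> state c \<delta> v r' \<in> cball (state c \<gamma> w x) r"
                using d1(2)[of r'] d2(2)[of r'] by (auto simp: less_imp_le)
            qed
            note gr = state_gronwall[OF h(2) geodesic_subset[OF g(1) sub] geodesic_subset[OF g(2) sub] c'(2) L(4) S]
            have st': "s \<in> {s..t}" "t \<in> {s..t}" "s \<in> {a..b}" "t \<in> {a..b}" using h by auto
            show "A s = A t"
            proof
              assume "A s"
              then have "state c \<gamma> w s = state c \<delta> v s" by (simp add: A_def state_def)
              then have "state c \<gamma> w t = state c \<delta> v t" using gr(1) by simp
              then show "A t" using state_eqD[OF g st'(4,4) c'(2), of ] S[OF st'(2)] by (auto simp: A_def)
            next
              assume "A t"
              then have "state c \<gamma> w t = state c \<delta> v t" by (simp add: A_def state_def)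
              then have "state c \<gamma> w s = state c \<delta> v s" using gr(2) by simp
              then show "A s" using state_eqD[OF g st'(3,3) c'(2)] S[OF st'(1)] by (auto simp: A_def)
            qed
          qed
        qed (use d1 d2 in auto)
      qed
    qed
  qed
  have Q: "Q s t" if "a \<le> s" "s \<le> t" "t \<le> b" for s t
    by (rule Bolzano[of s t Q]) (use that loc in \<open>auto simp: Q_def\<close>)
  have "A t0" using t0 by (simp add: A_def)
  then have "A t" using Q[of t0 t] Q[of t t0] t t0(1) unfolding Q_def by (cases "t0 \<le> t") auto
  then show ?thesis by (simp add: A_def)
qed

text \<open>Convergence in the tangent bundle, expressed without giving the bundle a topology. By
  \<open>tangent_tendstoI\<close> it is enough to check one chart at the limit.\<close>

definition tangent_tendsto :: "(nat \<Rightarrow> 'm) \<Rightarrow> (nat \<Rightarrow> ('m, 'n) tvector) \<Rightarrow> 'm \<Rightarrow> ('m, 'n) tvector \<Rightarrow> bool" where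
  "tangent_tendsto p v q u \<longleftrightarrow> p \<longlonglongrightarrow> q \<and> (\<forall>c\<in>charts_at M q. (\<lambda>n. v n c) \<longlonglongrightarrow> u c)"

lemma cmap_tendsto:
  assumes "c \<in> charts_at M q" "p \<longlonglongrightarrow> q" shows "(\<lambda>n. cmap c (p n)) \<longlonglongrightarrow> cmap c q"
proof -
  have "isCont (cmap c) q" using assms(1) cont_cmap[of c] open_cdom[of c]
    by (auto simp: continuous_on_eq_continuous_at charts_at_def)
  then show ?thesis using assms(2) by (rule isCont_tendsto_compose)
qed

lemma eventually_in_cdom:
  assumes "c \<in> charts_at M q" "p \<longlonglongrightarrow> q" shows "\<forall>\<^sub>F n in sequentially. p n \<in> cdom c"
  using topological_tendstoD[OF assms(2) open_cdom[of c]] charts_atD[OF assms(1)] by blast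

lemma tangent_tendstoI:
  assumes "p \<longlonglongrightarrow> q" "\<And>n. v n \<in> tangent_space M (p n)" "u \<in> tangent_space M q" "c \<in> charts_at M q"
    and vc: "(\<lambda>n. v n c) \<longlonglongrightarrow> u c"
  shows "tangent_tendsto p v q u"
  unfolding tangent_tendsto_def
proof (intro conjI ballI assms(1))
  fix d assume d: "d \<in> charts_at M q"
  have cd: "c \<in> charts M" "d \<in> charts M" using assms(4) d by auto
  have q: "(cmap c q, u c) \<in> overlap c d \<times> UNIV" using assms(4) d by auto
  have ev: "\<forall>\<^sub>F n in sequentially. p n \<in> cdom c \<and> p n \<in> cdom d"
    using eventually_in_cdom[OF assms(4,1)] eventually_in_cdom[OF d assms(1)] by eventually_elim auto
  have "(\<lambda>n. case (cmap c (p n), v n c) of (z, u) \<Rightarrow> transition_deriv c d z u) \<longlonglongrightarrow> (case (cmap c q, u c) of (z, u) \<Rightarrow> transition_deriv c d z u)"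
  proof (rule continuous_on_tendsto_compose[OF cont_transition_deriv_joint[OF cd] _ q])
    show "(\<lambda>n. (cmap c (p n), v n c)) \<longlonglongrightarrow> (cmap c q, u c)"
      by (intro tendsto_intros cmap_tendsto assms vc)
    show "\<forall>\<^sub>F n in sequentially. (cmap c (p n), v n c) \<in> overlap c d \<times> UNIV"
      using ev by eventually_elim auto
  qed
  then have lim: "(\<lambda>n. transition_deriv c d (cmap c (p n)) (v n c)) \<longlonglongrightarrow> u d"
    unfolding prod.case tangent_transition_deriv[OF assms(3,4) d, symmetric] .
  have eq: "\<forall>\<^sub>F n in sequentially. transition_deriv c d (cmap c (p n)) (v n c) = v n d"
    using ev
  proof eventually_elim
    case (elim n)
    then have "c \<in> charts_at M (p n)" "d \<in> charts_at M (p n)" using cd by (blast intro: charts_atI)+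
    then show ?case by (rule tangent_transition_deriv[OF assms(2), symmetric])
  qed
  show "(\<lambda>n. v n d) \<longlonglongrightarrow> u d" by (rule Lim_transform_eventually[OF lim eq])
qed

text \<open>The Gronwall estimate presupposes that \<open>\<delta>\<close> stays in the chart and in
  the Lipschitz ball. The bootstrap: as long as it stays in the closed ball, the estimate puts it in
  the open ball, which leaves room to continue.\<close>

lemma geodesic_stays_near:
  assumes st: "s \<le> t" and g: "geodesic M \<gamma> w {s..t}" and h: "geodesic M \<delta> v {s..t}" and c: "c \<in> charts M"
    and r: "r > 0" "cball z0 r \<subseteq> img c \<times> UNIV" and L: "L > 0"
      "\<And>y z. y \<in> cball z0 r \<Longrightarrow> z \<in> cball z0 r \<Longrightarrow> norm (geodesic_spray c y - geodesic_spray c z) \<le> L * norm (y - z)"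
    and gb: "\<And>x. x \<in> {s..t} \<Longrightarrow> \<gamma> x \<in> cdom c \<and> state c \<gamma> w x \<in> ball z0 (r/2)"
    and ds: "\<delta> s \<in> cdom c" "exp (L * (t - s)) * norm (state c \<delta> v s - state c \<gamma> w s) < r/2"
  shows "\<forall>x\<in>{s..t}. \<delta> x \<in> cdom c \<and> state c \<delta> v x \<in> cball z0 r"
proof -
  have gb': "\<gamma> x \<in> cdom c \<and> state c \<gamma> w x \<in> cball z0 r" if "x \<in> {s..t}" for x
    using gb[OF that] r(1) by auto
  have est: "state c \<delta> v x \<in> ball z0 r" if x: "x \<in> {s..t}" and all: "\<forall>y\<in>{s..x}. \<delta> y \<in> cdom c \<and> state c \<delta> v y \<in> cball z0 r" for x
  proof -
    have sub: "{s..x} \<subseteq> {s..t}" "s \<le> x" using x by auto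
    have S1: "\<delta> y \<in> cdom c \<and> state c \<delta> v y \<in> cball z0 r" if "y \<in> {s..x}" for y using all that by blast
    have S2: "\<gamma> y \<in> cdom c \<and> state c \<gamma> w y \<in> cball z0 r" if "y \<in> {s..x}" for y using gb' sub that by blast
    have "norm (state c \<delta> v x - state c \<gamma> w x) \<le> exp (L * (x - s)) * norm (state c \<delta> v s - state c \<gamma> w s)"
      by (rule state_gronwall(1)[OF sub(2) geodesic_subset[OF h sub(1)] geodesic_subset[OF g sub(1)] c L(2) S1 S2])
    also have "\<dots> \<le> exp (L * (t - s)) * norm (state c \<delta> v s - state c \<gamma> w s)"
      using x L(1) by (intro mult_right_mono) auto
    also have "\<dots> < r/2" by (rule ds(2))
    finally have "dist (state c \<gamma> w x) (state c \<delta> v x) < r/2" by (simp add: dist_norm norm_minus_commute)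
    moreover have "dist z0 (state c \<gamma> w x) < r/2" using gb[OF x] by simp
    ultimately have "dist (state c \<gamma> w x) z0 < r/2" "dist (state c \<gamma> w x) (state c \<delta> v x) < r/2"
      by (simp_all only: dist_commute)
    then have "dist z0 (state c \<delta> v x) < r" by (rule dist_triangle_half_r)
    then show ?thesis by simp
  qed
  \<comment> \<open>A state in the ball says nothing about the limit point of
    \<open>\<delta>\<close> in the manifold; the compact, hence closed, image of the coordinate ball
    keeps that limit in the chart domain.\<close>
  have K: "compact (cball (fst z0) r)" "cball (fst z0) r \<subseteq> img c"
  proof -
    show "cball (fst z0) r \<subseteq> img c"
    proof
      fix y assume "y \<in> cball (fst z0) r"
      then have "(y, snd z0) \<in> cball z0 r" by (simp add: dist_prod_def)
      then show "y \<in> img c" using r(2) by auto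
    qed
  qed simp
  have clK: "closed (cinv c ` cball (fst z0) r)"
    by (intro compact_imp_closed compact_continuous_image continuous_on_subset[OF cont_cinv[OF c] K(2)] K(1))
  have KD: "cinv c ` cball (fst z0) r \<subseteq> cdom c" using K(2) cinv_in[OF c] by blast
  show ?thesis
  proof (rule real_interval_induct[OF st])
    have "exp (L * (t - s)) \<ge> 1" using st L(1) by simp
    then have "norm (state c \<delta> v s - state c \<gamma> w s) < r/2"
      using ds(2) mult_right_mono[of 1 "exp (L * (t - s))" "norm (state c \<delta> v s - state c \<gamma> w s)"] by simp
    then have d1: "dist (state c \<gamma> w s) (state c \<delta> v s) < r/2" by (simp add: dist_norm norm_minus_commute)
    have d2: "dist (state c \<gamma> w s) z0 < r/2" using gb[of s] st by (simp add: dist_commute)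
    have "dist z0 (state c \<delta> v s) < r" by (rule dist_triangle_half_r[OF d2 d1])
    then show "\<delta> s \<in> cdom c \<and> state c \<delta> v s \<in> cball z0 r" using ds(1) by simp
  next
    fix x assume x: "s \<le> x" "x < t" and all: "\<forall>y\<in>{s..x}. \<delta> y \<in> cdom c \<and> state c \<delta> v y \<in> cball z0 r"
    have xJ: "x \<in> {s..t}" using x by auto
    have "\<delta> x \<in> cdom c" using all x by simp
    then have cx: "c \<in> charts_at M (\<delta> x)" using c by auto
    obtain d where d: "d > 0" "\<And>y. y \<in> {s..t} \<Longrightarrow> \<bar>y - x\<bar> < d \<Longrightarrow> \<delta> y \<in> cdom c \<and> state c \<delta> v y \<in> ball z0 r"
      by (rule state_near[OF h xJ cx open_ball est[OF xJ all]]) blast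
    show "\<exists>d>x. \<forall>y. x < y \<and> y < d \<and> y \<le> t \<longrightarrow> \<delta> y \<in> cdom c \<and> state c \<delta> v y \<in> cball z0 r"
    proof (intro exI[of _ "x + d"] conjI allI impI)
      fix y assume "x < y \<and> y < x + d \<and> y \<le> t"
      then show "\<delta> y \<in> cdom c" "state c \<delta> v y \<in> cball z0 r" using d(2)[of y] x by (auto simp: less_imp_le)
    qed (use d in auto)
  next
    fix x assume x: "s < x" "x \<le> t" and all: "\<forall>y\<in>{s..<x}. \<delta> y \<in> cdom c \<and> state c \<delta> v y \<in> cball z0 r"
    have xJ: "x \<in> {s..t}" using x by auto
    have nb: "at x within {s..<x} \<noteq> bot" using x(1) by (simp add: at_within_eq_bot_iff)
    have "(\<delta> \<longlongrightarrow> \<delta> x) (at x within {s..t})"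
      using geodesicD(1)[OF h xJ] xJ by (auto simp: continuous_on_def)
    then have "(\<delta> \<longlongrightarrow> \<delta> x) (at x within {s..<x})"
      by (rule tendsto_within_subset) (use x in auto)
    moreover have "\<forall>\<^sub>F y in at x within {s..<x}. \<delta> y \<in> cinv c ` cball (fst z0) r"
    proof -
      have "\<delta> y \<in> cinv c ` cball (fst z0) r" if "y \<in> {s..<x}" for y
      proof -
        have a: "\<delta> y \<in> cdom c" "dist z0 (state c \<delta> v y) \<le> r" using all that by auto
        have "dist (fst z0) (cmap c (\<delta> y)) \<le> dist z0 (state c \<delta> v y)"
          using dist_fst_le[of z0 "state c \<delta> v y"] by (simp add: state_def)
        then have "cmap c (\<delta> y) \<in> cball (fst z0) r" using a(2) by simp
        then show ?thesis using cinv_cmap[OF c a(1)] by (metis image_eqI)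
      qed
      then show ?thesis by (auto simp: eventually_at_filter)
    qed
    ultimately have "\<delta> x \<in> cinv c ` cball (fst z0) r" by (intro Lim_in_closed_set[OF clK _ nb])
    then have dx: "\<delta> x \<in> cdom c" using KD by blast
    then have cx: "c \<in> charts_at M (\<delta> x)" using c by auto
    have "(state c \<delta> v \<longlongrightarrow> state c \<delta> v x) (at x within {s..<x})"
      using state_continuous[OF h xJ cx] by (rule tendsto_within_subset) (use x in auto)
    moreover have "\<forall>\<^sub>F y in at x within {s..<x}. state c \<delta> v y \<in> cball z0 r"
      using all by (auto simp: eventually_at_filter)
    ultimately have "state c \<delta> v x \<in> cball z0 r" by (intro Lim_in_closed_set[OF closed_cball _ nb])
    then show "\<delta> x \<in> cdom c \<and> state c \<delta> v x \<in> cball z0 r" using dx by blast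
  qed
qed

text \<open>Convergence of states is carried across one chart by the Gronwall estimate and over the
  whole interval by bisection. Existence of all the geodesics on the common interval is an
  assumption here.\<close>

lemma geodesic_continuous_dependence:
  assumes g: "geodesic M \<gamma> w {0..T}" and gn: "\<And>n. geodesic M (\<gamma>n n) (wn n) {0..T}"
    and c0: "tangent_tendsto (\<lambda>n. \<gamma>n n 0) (\<lambda>n. wn n 0) (\<gamma> 0) (w 0)" and t: "t \<in> {0..T}"
  shows "tangent_tendsto (\<lambda>n. \<gamma>n n t) (\<lambda>n. wn n t) (\<gamma> t) (w t)"
proof -
  define A where "A s \<longleftrightarrow> tangent_tendsto (\<lambda>n. \<gamma>n n s) (\<lambda>n. wn n s) (\<gamma> s) (w s)" for s
  define Q where "Q s t \<longleftrightarrow> (0 \<le> s \<longrightarrow> s \<le> t \<longrightarrow> t \<le> T \<longrightarrow> A s \<longrightarrow> A t)" for s t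
  have loc: "\<exists>d>0. \<forall>s t. s \<le> x \<and> x \<le> t \<and> t - s < d \<longrightarrow> Q s t" if x: "0 \<le> x" "x \<le> T" for x
  proof -
    have xJ: "x \<in> {0..T}" using x by simp
    obtain c where cx: "c \<in> charts_at M (\<gamma> x)" using charts_at_ex by blast
    then have c: "c \<in> charts M" and i: "fst (state c \<gamma> w x) \<in> img c" by (auto simp: state_def)
    obtain L r where L: "r > 0" "L > 0" "cball (state c \<gamma> w x) r \<subseteq> img c \<times> UNIV"
      "\<And>y z. y \<in> cball (state c \<gamma> w x) r \<Longrightarrow> z \<in> cball (state c \<gamma> w x) r \<Longrightarrow> norm (geodesic_spray c y - geodesic_spray c z) \<le> L * norm (y - z)"
      using geodesic_spray_lipschitz[OF c i] by metis
    have z: "state c \<gamma> w x \<in> ball (state c \<gamma> w x) (r/2)" using L(1) by simp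
    obtain d where d: "d > 0" "\<And>s. s \<in> {0..T} \<Longrightarrow> \<bar>s - x\<bar> < d \<Longrightarrow> \<gamma> s \<in> cdom c \<and> state c \<gamma> w s \<in> ball (state c \<gamma> w x) (r/2)"
      by (rule state_near[OF g xJ cx open_ball z]) blast
    show ?thesis
    proof (intro exI[of _ d] conjI d(1) allI impI)
      fix s t assume st: "s \<le> x \<and> x \<le> t \<and> t - s < d"
      show "Q s t" unfolding Q_def
      proof (intro impI)
        assume h: "0 \<le> s" "s \<le> t" "t \<le> T" and "A s"
        have sub: "{s..t} \<subseteq> {0..T}" using h by auto
        have gb: "\<gamma> y \<in> cdom c \<and> state c \<gamma> w y \<in> ball (state c \<gamma> w x) (r/2)" if "y \<in> {s..t}" for y
          using that st sub by (intro d(2)) auto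
        have gb': "\<gamma> y \<in> cdom c \<and> state c \<gamma> w y \<in> cball (state c \<gamma> w x) r" if "y \<in> {s..t}" for y
          using gb[OF that] L(1) by auto
        have cs: "c \<in> charts_at M (\<gamma> s)" "c \<in> charts_at M (\<gamma> t)" using gb[of s] gb[of t] h c by auto
        have lim: "(\<lambda>n. \<gamma>n n s) \<longlonglongrightarrow> \<gamma> s" "(\<lambda>n. wn n s c) \<longlonglongrightarrow> w s c"
          using \<open>A s\<close> cs(1) unfolding A_def tangent_tendsto_def by auto
        have zl: "(\<lambda>n. state c (\<gamma>n n) (wn n) s) \<longlonglongrightarrow> state c \<gamma> w s"
          unfolding state_def by (intro tendsto_intros lim(2) cmap_tendsto[OF cs(1) lim(1)])
        have n0: "(\<lambda>n. exp (L * (t - s)) * norm (state c (\<gamma>n n) (wn n) s - state c \<gamma> w s)) \<longlonglongrightarrow> 0"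
          by (rule tendsto_mult_right_zero) (use zl in \<open>auto intro: tendsto_norm_zero simp: LIM_zero_iff\<close>)
        have ev: "\<forall>\<^sub>F n in sequentially. \<gamma>n n s \<in> cdom c \<and>
            exp (L * (t - s)) * norm (state c (\<gamma>n n) (wn n) s - state c \<gamma> w s) < r/2"
          using eventually_in_cdom[OF cs(1) lim(1)] order_tendstoD(2)[OF n0, of "r/2"] L(1)
          by (auto elim: eventually_elim2)
        have ev2: "\<forall>\<^sub>F n in sequentially. \<gamma>n n t \<in> cdom c \<and> norm (state c (\<gamma>n n) (wn n) t - state c \<gamma> w t) \<le>
            exp (L * (t - s)) * norm (state c (\<gamma>n n) (wn n) s - state c \<gamma> w s)"
          using ev
        proof eventually_elim
          case (elim n)
          have near: "\<forall>x'\<in>{s..t}. \<gamma>n n x' \<in> cdom c \<and> state c (\<gamma>n n) (wn n) x' \<in> cball (state c \<gamma> w x) r"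
            by (rule geodesic_stays_near[OF h(2) geodesic_subset[OF g sub] geodesic_subset[OF gn sub] c L(1,3,2,4) gb])
              (use elim in auto)
          have "norm (state c (\<gamma>n n) (wn n) t - state c \<gamma> w t) \<le>
            exp (L * (t - s)) * norm (state c (\<gamma>n n) (wn n) s - state c \<gamma> w s)"
            by (rule state_gronwall(1)[OF h(2) geodesic_subset[OF gn sub] geodesic_subset[OF g sub] c L(4) bspec[OF near] gb'])
          then show ?case using near h(2) by auto
        qed
        have "(\<lambda>n. state c (\<gamma>n n) (wn n) t - state c \<gamma> w t) \<longlonglongrightarrow> 0"
          by (rule Lim_null_comparison[OF _ n0]) (use ev2 in eventually_elim, auto)
        then have zt: "(\<lambda>n. state c (\<gamma>n n) (wn n) t) \<longlonglongrightarrow> state c \<gamma> w t" by (simp add: LIM_zero_iff)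
        have xl: "(\<lambda>n. cmap c (\<gamma>n n t)) \<longlonglongrightarrow> cmap c (\<gamma> t)" and vl: "(\<lambda>n. wn n t c) \<longlonglongrightarrow> w t c"
          using tendsto_fst[OF zt] tendsto_snd[OF zt] by (simp_all add: state_def)
        have i: "cmap c (\<gamma> t) \<in> img c" using cs(2) by auto
        have "(\<lambda>n. cinv c (cmap c (\<gamma>n n t))) \<longlonglongrightarrow> cinv c (cmap c (\<gamma> t))"
          by (rule continuous_on_tendsto_compose[OF cont_cinv[OF c] xl i]) (use ev2 in eventually_elim, auto)
        moreover have "\<forall>\<^sub>F n in sequentially. cinv c (cmap c (\<gamma>n n t)) = \<gamma>n n t"
          using ev2 by eventually_elim (simp add: cinv_cmap[OF c])
        ultimately have "(\<lambda>n. \<gamma>n n t) \<longlonglongrightarrow> \<gamma> t" using cs(2) cinv_cmap[OF c]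
          by (auto simp: tendsto_cong charts_at_def)
        moreover have tt: "t \<in> {0..T}" using h by auto
        ultimately show "A t" unfolding A_def
          by (intro tangent_tendstoI[OF _ geodesicD(2)[OF gn tt] geodesicD(2)[OF g tt] cs(2) vl])
      qed
    qed
  qed
  have "Q 0 t" by (rule Bolzano[of 0 t Q]) (use t loc in \<open>auto simp: Q_def\<close>)
  then show ?thesis using c0 t by (simp add: Q_def A_def)
qed

text \<open>The time \<open>e\<close> is common to all initial data near \<open>z0\<close>. This is
  what allows an incomplete geodesic to be restarted close to its end.\<close>

lemma geodesic_local_existence:
  assumes c: "c \<in> charts M" and z0: "fst z0 \<in> img c"
  obtains e r where "e > 0" "r > 0" "\<And>p v. p \<in> cdom c \<Longrightarrow> v \<in> tangent_space M p \<Longrightarrow> dist z0 (cmap c p, v c) \<le> r \<Longrightarrow>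
    \<exists>\<gamma> w. geodesic M \<gamma> w {0..e} \<and> \<gamma> 0 = p \<and> w 0 = v"
proof -
  obtain L R where L: "R > 0" "L > 0" "cball z0 R \<subseteq> img c \<times> UNIV"
      "\<And>y z. y \<in> cball z0 R \<Longrightarrow> z \<in> cball z0 R \<Longrightarrow> norm (geodesic_spray c y - geodesic_spray c z) \<le> L * norm (y - z)"
    using geodesic_spray_lipschitz[OF c z0] by metis
  obtain e r where er: "e > 0" "r > 0" "\<And>z. z \<in> cball z0 r \<Longrightarrow> \<exists>x. x 0 = z \<and>
    (\<forall>t\<in>{0..e}. x t \<in> cball z0 R \<and> (x has_vector_derivative geodesic_spray c (x t)) (at t within {0..e}))"
    using picard_local[OF loclip_geodesic_spray[OF c z0] L(1)] by blast
  show ?thesis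
  proof (rule that[OF er(1,2)])
    fix p v assume p: "p \<in> cdom c" "v \<in> tangent_space M p" "dist z0 (cmap c p, v c) \<le> r"
    obtain x where x: "x 0 = (cmap c p, v c)" "\<And>t. t \<in> {0..e} \<Longrightarrow> x t \<in> cball z0 R"
       "\<And>t. t \<in> {0..e} \<Longrightarrow> (x has_vector_derivative geodesic_spray c (x t)) (at t within {0..e})"
      using er(3)[of "(cmap c p, v c)"] p(3) by auto
    have "geodesic M (\<lambda>t. cinv c (fst (x t))) (\<lambda>t. lift c (cinv c (fst (x t))) (snd (x t))) {0..e}"
    proof (rule geodesic_lift[OF c])
      fix t assume t: "t \<in> {0..e}"
      show "fst (x t) \<in> img c" using subsetD[OF L(3) x(2)[OF t]] by (simp only: mem_Times_iff)
      show "((\<lambda>t. fst (x t)) has_vector_derivative snd (x t)) (at t within {0..e})"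
        using bounded_linear.has_vector_derivative[OF bounded_linear_fst x(3)[OF t]] by (simp add: geodesic_spray_def)
      show "((\<lambda>t. snd (x t)) has_vector_derivative acc c (fst (x t)) (snd (x t))) (at t within {0..e})"
        using bounded_linear.has_vector_derivative[OF bounded_linear_snd x(3)[OF t]] by (simp add: geodesic_spray_def)
    qed
    moreover have "c \<in> charts_at M p" using c p(1) by auto
    then have "lift c p (v c) = v" using tangent_lift[OF p(2)] by simp
    ultimately show "\<exists>\<gamma> w. geodesic M \<gamma> w {0..e} \<and> \<gamma> 0 = p \<and> w 0 = v"
      using x(1) cinv_cmap[OF c p(1)]
      by (intro exI[of _ "\<lambda>t. cinv c (fst (x t))"] exI[of _ "\<lambda>t. lift c (cinv c (fst (x t))) (snd (x t))"]) simp
  qed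
qed

lemma geodesic_exists:
  assumes "v \<in> tangent_space M p"
  obtains e \<gamma> w where "e > 0" "geodesic M \<gamma> w {0..e}" "\<gamma> 0 = p" "w 0 = v"
proof -
  obtain c where c: "c \<in> charts_at M p" using charts_at_ex by blast
  have "c \<in> charts M" "fst (cmap c p, v c) \<in> img c" using c by auto
  then obtain e r where "e > 0" "r > 0" "\<And>p' v'. p' \<in> cdom c \<Longrightarrow> v' \<in> tangent_space M p' \<Longrightarrow> dist (cmap c p, v c) (cmap c p', v' c) \<le> r \<Longrightarrow>
    \<exists>\<gamma> w. geodesic M \<gamma> w {0..e} \<and> \<gamma> 0 = p' \<and> w 0 = v'"
    by (rule geodesic_local_existence) blast
  from this(1,2) this(3)[of p v] show ?thesis using assms c that by auto
qed

text \<open>The derivative of g(w, w) vanishes by the Euler-Lagrange equation tested against the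
  velocity itself.\<close>

lemma geodesic_norm_const:
  assumes g: "geodesic M \<gamma> w {a..b}" and s: "s \<in> {a..b}" and t: "t \<in> {a..b}"
  shows "met M (\<gamma> s) (w s) (w s) = met M (\<gamma> t) (w t) (w t)"
proof -
  let ?f = "\<lambda>t. met M (\<gamma> t) (w t) (w t)"
  have "(?f has_derivative (\<lambda>h. 0)) (at x within {a..b})" if x: "x \<in> {a..b}" for x
  proof -
    obtain c where cx: "c \<in> charts_at M (\<gamma> x)" using charts_at_ex by blast
    then have c: "c \<in> charts M" "cmap c (\<gamma> x) \<in> img c" "\<gamma> x \<in> cdom c" by auto
    let ?x = "cmap c (\<gamma> x)" and ?u = "w x c"
    have 1: "((\<lambda>s. G c (cmap c (\<gamma> s))) has_derivative (\<lambda>h. dG c ?x (h *\<^sub>R ?u))) (at x within {a..b})"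
      using has_derivative_compose[OF geodesicD(3)[OF g x cx, unfolded has_vector_derivative_def] dG_deriv[OF c(1,2)]] .
    have 2: "((\<lambda>s. w s c) has_derivative (\<lambda>h. h *\<^sub>R acc c ?x ?u)) (at x within {a..b})"
      using geodesicD(4)[OF g x cx] by (simp add: has_vector_derivative_def)
    have "((\<lambda>s. coord_met c (cmap c (\<gamma> s)) (w s c) (w s c)) has_derivative
       (\<lambda>h. ?u \<bullet> (G c ?x *v (h *\<^sub>R acc c ?x ?u) + dG c ?x (h *\<^sub>R ?u) *v ?u) + (h *\<^sub>R acc c ?x ?u) \<bullet> (G c ?x *v ?u))) (at x within {a..b})"
      unfolding coord_met_def by (rule inner_mv_has_derivative[OF 2 1 2])
    moreover have "?u \<bullet> (G c ?x *v (h *\<^sub>R acc c ?x ?u) + dG c ?x (h *\<^sub>R ?u) *v ?u) + (h *\<^sub>R acc c ?x ?u) \<bullet> (G c ?x *v ?u) = 0" for h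
    proof -
      have "?u \<bullet> (G c ?x *v (h *\<^sub>R acc c ?x ?u)) = h * (?u \<bullet> (G c ?x *v acc c ?x ?u))"
        by (simp add: matrix_vector_mult_scaleR)
      moreover have "(h *\<^sub>R acc c ?x ?u) \<bullet> (G c ?x *v ?u) = h * (?u \<bullet> (G c ?x *v acc c ?x ?u))"
        using G_sym[OF c(1,2), of "acc c ?x ?u" ?u] by simp
      moreover have "?u \<bullet> (dG c ?x (h *\<^sub>R ?u) *v ?u) = h * (?u \<bullet> (dG c ?x ?u *v ?u))"
        by (simp add: linear_cmul[OF dG_linear[OF c(1,2)]] bounded_bilinear.scaleR_left[OF bounded_bilinear_matrix_vector])
      moreover have "?u \<bullet> (G c ?x *v acc c ?x ?u) + ?u \<bullet> (dG c ?x ?u *v ?u) = (1/2) * (?u \<bullet> (dG c ?x ?u *v ?u))"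
        by (rule euler_lagrange[OF c(1,2)])
      moreover have "h * p + h * q + h * p = 0" if "p + q = (1/2) * q" for p q :: real
      proof -
        have "h * p + h * q + h * p = h * (2 * p + q)" by (simp add: algebra_simps)
        then show ?thesis using that by simp
      qed
      ultimately show ?thesis by (simp only: inner_add_right)
    qed
    ultimately have D: "((\<lambda>s. coord_met c (cmap c (\<gamma> s)) (w s c) (w s c)) has_derivative (\<lambda>h. 0)) (at x within {a..b})" by simp
    have "\<forall>\<^sub>F s in at x within {a..b}. \<gamma> s \<in> cdom c"
      using geodesicD(1)[OF g x] x open_cdom[OF c(1)] c(3)
      by (intro topological_tendstoD[of _ "\<gamma> x"]) (auto simp: continuous_on_def)
    moreover have "\<forall>\<^sub>F s in at x within {a..b}. s \<in> {a..b}" by (simp add: eventually_at_filter)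
    ultimately have "\<forall>\<^sub>F s in at x within {a..b}. coord_met c (cmap c (\<gamma> s)) (w s c) (w s c) = ?f s"
    proof eventually_elim
      case (elim s)
      show ?case using met_coord[OF geodesicD(2)[OF g elim(2)] geodesicD(2)[OF g elim(2)] charts_atI[OF c(1) elim(1)]] by simp
    qed
    from has_derivative_transform_eventually[OF D this _ x]
    show ?thesis using met_coord[OF geodesicD(2)[OF g x] geodesicD(2)[OF g x] cx] by simp
  qed
  then have "\<exists>k. \<forall>x\<in>{a..b}. ?f x = k" by (intro has_derivative_zero_constant convex_real_interval)
  then show ?thesis using s t by auto
qed

lemma null_future_coord:
  assumes "v \<in> tangent_space M p" "c \<in> charts_at M p"
  shows "null_vec M p v \<and> future_vec M p v \<longleftrightarrow> coord_met c (cmap c p) (v c) (v c) = 0 \<and> causal_dir c (cmap c p) (v c)"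
  unfolding null_vec_def causal_dir_def future_vec_coord[OF assms] met_coord[OF assms(1,1,2)]
  using assms(1) by (auto simp: coord_met_def)

text \<open>The velocity cannot vanish, by uniqueness against a constant geodesic, and its norm is
  constant, so it stays null. Being null and nonzero it is never orthogonal to the time orientation,
  and a continuous function without zeros keeps its sign.\<close>

lemma geodesic_null_future:
  assumes g: "geodesic M \<gamma> w {a..b}" and s: "s \<in> {a..b}" "null_vec M (\<gamma> s) (w s)" "future_vec M (\<gamma> s) (w s)" and t: "t \<in> {a..b}"
  shows "null_vec M (\<gamma> t) (w t) \<and> future_vec M (\<gamma> t) (w t)"
proof -
  have nz: "w x \<noteq> (\<lambda>c. 0)" if x: "x \<in> {a..b}" for x
  proof
    assume "w x = (\<lambda>c. 0)"
    then have "w s = (\<lambda>c. 0)" using geodesic_unique[OF g geodesic_const[of "\<gamma> x"] x _ _ s(1)] by simp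
    then show False using s(2) by (simp add: null_vec_def)
  qed
  have n: "null_vec M (\<gamma> x) (w x)" if x: "x \<in> {a..b}" for x
    using geodesic_norm_const[OF g s(1) x] s(2) nz[OF x] geodesicD(2)[OF g x] by (simp add: null_vec_def)
  let ?h = "\<lambda>x. met M (\<gamma> x) (w x) (torient M (\<gamma> x))"
  have h0: "?h x \<noteq> 0" if x: "x \<in> {a..b}" for x
  proof -
    obtain c where cx: "c \<in> charts_at M (\<gamma> x)" using charts_at_ex by blast
    then have c: "c \<in> charts M" "cmap c (\<gamma> x) \<in> img c" by auto
    note m = met_coord[OF geodesicD(2)[OF g x] torient_field(3) cx] met_coord[OF geodesicD(2)[OF g x] geodesicD(2)[OF g x] cx]
    have "w x c \<noteq> 0"
    proof
      assume "w x c = 0"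
      then have "w x = (\<lambda>c. 0)" using tangent_eq_iff[OF geodesicD(2)[OF g x] tangent_zero cx] by simp
      then show False using nz[OF x] by simp
    qed
    moreover have "coord_met c (cmap c (\<gamma> x)) (w x c) (w x c) = 0" using n[OF x] m(2) by (simp add: null_vec_def)
    ultimately show ?thesis unfolding m(1)
      using timelike_not_orthogonal_causal[OF G_lorentz[OF c], of "coord_orient c (cmap c (\<gamma> x))" "w x c"] coord_orient_timelike[OF c]
      by (simp add: coord_met_def coord_orient_coord_field coord_field_cmap[OF cx])
  qed
  have ch: "continuous_on {a..b} ?h"
    unfolding continuous_on_def
  proof (intro ballI)
    fix x assume x: "x \<in> {a..b}"
    obtain c where cx: "c \<in> charts_at M (\<gamma> x)" using charts_at_ex by blast
    then have c: "c \<in> charts M" "cmap c (\<gamma> x) \<in> img c" "\<gamma> x \<in> cdom c" by auto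
    have sl: "((\<lambda>s. cmap c (\<gamma> s)) \<longlongrightarrow> cmap c (\<gamma> x)) (at x within {a..b})" "((\<lambda>s. w s c) \<longlongrightarrow> w x c) (at x within {a..b})"
      using tendsto_fst[OF state_continuous[OF g x cx]] tendsto_snd[OF state_continuous[OF g x cx]] by (simp_all add: state_def)
    have ec: "\<forall>\<^sub>F s in at x within {a..b}. \<gamma> s \<in> cdom c"
      using geodesicD(1)[OF g x] x open_cdom[OF c(1)] c(3)
      by (intro topological_tendstoD[of _ "\<gamma> x"]) (auto simp: continuous_on_def)
    then have ei: "\<forall>\<^sub>F s in at x within {a..b}. cmap c (\<gamma> s) \<in> img c" by eventually_elim auto
    have "((\<lambda>s. coord_met c (cmap c (\<gamma> s)) (w s c) (coord_orient c (cmap c (\<gamma> s)))) \<longlongrightarrow> coord_met c (cmap c (\<gamma> x)) (w x c) (coord_orient c (cmap c (\<gamma> x)))) (at x within {a..b})"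
      unfolding coord_met_def
      by (intro tendsto_intros sl(2) continuous_on_tendsto_compose[OF cont_G[OF c(1)] sl(1) c(2) ei]
         continuous_on_tendsto_compose[OF cont_coord_orient[OF c(1)] sl(1) c(2) ei])
    moreover have "\<forall>\<^sub>F s in at x within {a..b}. s \<in> {a..b}" by (simp add: eventually_at_filter)
    with ec have "\<forall>\<^sub>F s in at x within {a..b}. coord_met c (cmap c (\<gamma> s)) (w s c) (coord_orient c (cmap c (\<gamma> s))) = ?h s"
    proof eventually_elim
      case (elim s)
      then have "c \<in> charts_at M (\<gamma> s)" using c(1) by auto
      then show ?case using met_coord[OF geodesicD(2)[OF g elim(2)] torient_field(3), of c] by (simp add: coord_orient_coord_field coord_field_cmap)
    qed
    moreover have "coord_met c (cmap c (\<gamma> x)) (w x c) (coord_orient c (cmap c (\<gamma> x))) = ?h x"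
      using met_coord[OF geodesicD(2)[OF g x] torient_field(3) cx] by (simp add: coord_orient_coord_field coord_field_cmap[OF cx])
    ultimately show "(?h \<longlongrightarrow> ?h x) (at x within {a..b})" by (simp add: tendsto_cong)
  qed
  have "?h t < 0"
  proof (rule ccontr)
    assume "\<not> ?h t < 0"
    then have "?h t > 0" "?h s < 0" using h0[OF t] s(3) by (auto simp: future_vec_def)
    moreover have "connected (?h ` {a..b})" by (intro connected_continuous_image ch connected_Icc)
    ultimately have "0 \<in> ?h ` {a..b}" using s(1) t connectedD_interval[of "?h ` {a..b}" "?h s" "?h t" 0] by auto
    then show False using h0 by auto
  qed
  then show ?thesis using n[OF t] by (simp add: future_vec_def)
qed

end

section \<open>Difference quotients and reparametrization\<close>

lemma has_vector_derivative_iff_quotient: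
  fixes f :: "real \<Rightarrow> 'a::real_normed_vector"
  shows "(f has_vector_derivative D) (at x within S) \<longleftrightarrow>
    ((\<lambda>y. (1 / (y - x)) *\<^sub>R (f y - f x)) \<longlongrightarrow> D) (at x within S)"
proof -
  have "((\<lambda>y. norm ((f y - f x) - (y - x) *\<^sub>R D) / norm (y - x)) \<longlongrightarrow> 0) (at x within S) \<longleftrightarrow>
    ((\<lambda>y. norm ((1 / (y - x)) *\<^sub>R (f y - f x) - D)) \<longlongrightarrow> 0) (at x within S)"
  proof (rule tendsto_cong)
    have "norm ((f y - f x) - (y - x) *\<^sub>R D) / norm (y - x) = norm ((1 / (y - x)) *\<^sub>R (f y - f x) - D)" if "y \<noteq> x" for y
    proof -
      have "(1 / (y - x)) *\<^sub>R (f y - f x) - D = (1 / (y - x)) *\<^sub>R ((f y - f x) - (y - x) *\<^sub>R D)"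
        using that by (simp add: scaleR_diff_right)
      then show ?thesis by (simp add: divide_inverse mult.commute)
    qed
    then show "\<forall>\<^sub>F y in at x within S. norm ((f y - f x) - (y - x) *\<^sub>R D) / norm (y - x) = norm ((1 / (y - x)) *\<^sub>R (f y - f x) - D)"
      by (auto simp: eventually_at_filter)
  qed
  then show ?thesis
    unfolding has_vector_derivative_def has_derivative_iff_norm
    by (simp add: bounded_linear_scaleR_left tendsto_norm_zero_iff LIM_zero_iff)
qed

lemma negative_near:
  fixes f g :: "real \<Rightarrow> real"
  assumes "continuous_on {a..b} f" "continuous_on {a..b} g" "t0 \<in> {a..b}" "f t0 < 0"
  obtains d where "d > 0" "\<And>t r. t \<in> {a..b} \<Longrightarrow> \<bar>t - t0\<bar> < d \<Longrightarrow> \<bar>r\<bar> < d \<Longrightarrow> f t + r * g t < 0"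
proof -
  have "bounded (g ` {a..b})" by (intro compact_imp_bounded compact_continuous_image assms compact_Icc)
  then obtain K where "\<forall>x\<in>g ` {a..b}. norm x \<le> K" unfolding bounded_iff by blast
  then have K: "\<bar>g t\<bar> \<le> K" if "t \<in> {a..b}" for t using that by simp
  have "\<forall>\<^sub>F t in at t0 within {a..b}. f t < f t0 / 2"
    using assms by (intro order_tendstoD(2)[of f "f t0"]) (auto simp: continuous_on_def)
  then obtain d1 where d1: "d1 > 0" "\<And>t. t \<in> {a..b} \<Longrightarrow> t \<noteq> t0 \<Longrightarrow> dist t t0 < d1 \<Longrightarrow> f t < f t0 / 2"
    unfolding eventually_at by auto
  \<comment> \<open>The second bound keeps |r g| below half of |f t0|, with \<open>K + 1\<close>
    style slack against division by zero.\<close>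
  define d where "d = min d1 (- f t0 / (2 * (\<bar>K\<bar> + 1)))"
  show ?thesis
  proof (rule that[of d])
    show "d > 0" using d1 assms(4) by (auto simp: d_def intro!: divide_neg_pos)
    fix t r assume h: "t \<in> {a..b}" "\<bar>t - t0\<bar> < d" "\<bar>r\<bar> < d"
    have "f t \<le> f t0 / 2" using d1(2)[of t] h assms(4) by (cases "t = t0") (auto simp: d_def dist_real_def)
    moreover have "r * g t < - f t0 / 2"
    proof -
      have "r * g t \<le> \<bar>r\<bar> * \<bar>g t\<bar>" by (metis abs_ge_self abs_mult)
      also have "\<dots> \<le> \<bar>r\<bar> * (\<bar>K\<bar> + 1)" using K[OF h(1)] by (intro mult_left_mono) auto
      also have "\<dots> < (- f t0 / (2 * (\<bar>K\<bar> + 1))) * (\<bar>K\<bar> + 1)" using h(3) by (intro mult_strict_right_mono) (auto simp: d_def)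
      also have "\<dots> = - f t0 / 2" by (simp add: field_simps)
      finally show ?thesis .
    qed
    ultimately show "f t + r * g t < 0" by simp
  qed
qed

text \<open>Separation of variables: \<open>\<theta>\<close> is the inverse of a primitive
  \<open>s\<close> of 1/c.\<close>

lemma reparametrization:
  fixes c :: "real \<Rightarrow> real"
  assumes ab: "a < b" and cc: "continuous_on {a..b} c" and c0: "\<And>t. t \<in> {a..b} \<Longrightarrow> 0 < c t"
  obtains A B \<theta> where "A < B" "\<theta> A = a" "\<theta> B = b" "\<And>r. r \<in> {A..B} \<Longrightarrow> \<theta> r \<in> {a..b}"
    "\<And>r. r \<in> {A..B} \<Longrightarrow> (\<theta> has_real_derivative c (\<theta> r)) (at r within {A..B})"
proof -
  \<comment> \<open>Clamping extends 1/c beyond [a, b], so that the ends become interior points, as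
    the inverse function rule demands.\<close>
  define cl where "cl t = max a (min b t)" for t
  have cl: "cl t \<in> {a..b}" "t \<in> {a..b} \<Longrightarrow> cl t = t" for t using ab by (auto simp: cl_def)
  define q where "q t = 1 / c (cl t)" for t
  have cq: "continuous_on S q" for S unfolding q_def
  proof (intro continuous_intros continuous_on_compose2[OF cc])
    show "continuous_on S cl" unfolding cl_def by (intro continuous_intros)
    show "\<forall>x\<in>S. c (cl x) \<noteq> 0" using c0[OF cl(1)] by (metis less_irrefl)
  qed (use cl in auto)
  have q0: "q t > 0" for t using c0[OF cl(1)] by (simp add: q_def)
  define s where "s t = integral {a - 1..t} q" for t
  have s1: "(s has_real_derivative q t) (at t within {a - 1..b + 1})" if "t \<in> {a - 1..b + 1}" for t
    unfolding s_def has_real_derivative_iff_has_vector_derivative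
    by (rule integral_has_vector_derivative[OF cq that])
  have s': "(s has_real_derivative q t) (at t)" if "a - 1 < t" "t < b + 1" for t
    using s1[of t] that at_within_Icc_at[of "a - 1" t "b + 1"] by auto
  have cs: "continuous_on {a - 1..b + 1} s" using s1 by (rule DERIV_continuous_on)
  have smono: "s t < s t'" if "a - 1 \<le> t" "t < t'" "t' \<le> b + 1" for t t'
  proof (rule DERIV_pos_imp_increasing_open[OF that(2)])
    show "\<exists>y. (s has_real_derivative y) (at x) \<and> 0 < y" if "t < x" "x < t'" for x
      using s'[of x] q0[of x] that \<open>a - 1 \<le> t\<close> \<open>t' \<le> b + 1\<close> by auto
    show "continuous_on {t..t'} s" by (rule continuous_on_subset[OF cs]) (use that in auto)
  qed
  have inj: "inj_on s {a - 1..b + 1}"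
    by (rule inj_onI) (metis smono atLeastAtMost_iff less_irrefl linorder_neqE_linordered_idom)
  define \<theta> where "\<theta> = the_inv_into {a - 1..b + 1} s"
  have ts: "\<theta> (s t) = t" if "t \<in> {a - 1..b + 1}" for t
    unfolding \<theta>_def by (rule the_inv_into_f_f[OF inj that])
  have img: "s ` {a - 1..b + 1} = {s (a - 1)..s (b + 1)}"
  proof
    show "s ` {a - 1..b + 1} \<subseteq> {s (a - 1)..s (b + 1)}"
    proof clarify
      fix t assume "t \<in> {a - 1..b + 1}"
      then show "s t \<in> {s (a - 1)..s (b + 1)}"
        using smono[of "a - 1" t] smono[of t "b + 1"] ab by (cases "t = a - 1"; cases "t = b + 1") auto
    qed
    show "{s (a - 1)..s (b + 1)} \<subseteq> s ` {a - 1..b + 1}"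
    proof
      fix y assume "y \<in> {s (a - 1)..s (b + 1)}"
      then show "y \<in> s ` {a - 1..b + 1}" using IVT'[of s "a - 1" y "b + 1"] cs ab by fastforce
    qed
  qed
  have ct: "continuous_on {s (a - 1)..s (b + 1)} \<theta>"
    using continuous_on_inv[OF cs compact_Icc, of \<theta>] ts unfolding img by blast
  have in\<theta>: "\<theta> y \<in> {a - 1..b + 1} \<and> s (\<theta> y) = y" if "y \<in> {s (a - 1)..s (b + 1)}" for y
  proof -
    have "y \<in> s ` {a - 1..b + 1}" using that img by simp
    then show ?thesis using ts by auto
  qed
  show ?thesis
  proof (rule that[of "s a" "s b" \<theta>])
    show "s a < s b" using smono ab by simp
    show "\<theta> (s a) = a" "\<theta> (s b) = b" using ts ab by auto
    fix r assume r: "r \<in> {s a..s b}"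
    have r': "r \<in> {s (a - 1)..s (b + 1)}" "s (a - 1) < r" "r < s (b + 1)"
      using r smono[of "a - 1" a] smono[of b "b + 1"] ab by auto
    note i = in\<theta>[OF r'(1)]
    show th: "\<theta> r \<in> {a..b}"
    proof -
      have "\<not> \<theta> r < a" using smono[of "\<theta> r" a] i r ab by auto
      moreover have "\<not> b < \<theta> r" using smono[of b "\<theta> r"] i r ab by auto
      ultimately show ?thesis by auto
    qed
    have "(\<theta> has_real_derivative inverse (q (\<theta> r))) (at r)"
    proof (rule DERIV_inverse_function[where f = s and g = \<theta> and x = r and a = "s (a - 1)" and b = "s (b + 1)"])
      show "(s has_real_derivative q (\<theta> r)) (at (\<theta> r))" using s' th by auto
      show "q (\<theta> r) \<noteq> 0" using q0 by (metis less_irrefl)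
      show "isCont \<theta> r" using ct r'(2,3) by (intro continuous_on_interior[OF ct]) auto
      fix y assume "s (a - 1) < y" "y < s (b + 1)"
      then show "s (\<theta> y) = y" using in\<theta>[of y] by auto
    qed (use r' in auto)
    moreover have "inverse (q (\<theta> r)) = c (\<theta> r)" using cl(2)[OF th] by (simp add: q_def)
    ultimately show "(\<theta> has_real_derivative c (\<theta> r)) (at r within {s a..s b})"
      by (metis has_field_derivative_at_within)
  qed
qed

context spacetime_locale
begin

section \<open>Unbroken null geodesics and rigidity\<close>

definition null_geo :: "(real \<Rightarrow> 'm) \<Rightarrow> (real \<Rightarrow> ('m, 'n) tvector) \<Rightarrow> real \<Rightarrow> real \<Rightarrow> bool" where
  "null_geo \<gamma> w a b \<longleftrightarrow> a < b \<and> geodesic M \<gamma> w {a..b} \<and>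
     (\<forall>t\<in>{a..b}. null_vec M (\<gamma> t) (w t) \<and> future_vec M (\<gamma> t) (w t))"

lemma null_geoD:
  assumes "null_geo \<gamma> w a b"
  shows "a < b" "geodesic M \<gamma> w {a..b}" "\<And>t. t \<in> {a..b} \<Longrightarrow> null_vec M (\<gamma> t) (w t)"
    "\<And>t. t \<in> {a..b} \<Longrightarrow> future_vec M (\<gamma> t) (w t)"
  using assms unfolding null_geo_def by auto

lemma null_geo_causal_dir:
  assumes "null_geo \<gamma> w a b" "t \<in> {a..b}" "c \<in> charts_at M (\<gamma> t)"
  shows "causal_dir c (cmap c (\<gamma> t)) (w t c)"
  using null_geoD[OF assms(1)] null_future_coord[OF geodesicD(2)[OF null_geoD(2)[OF assms(1)] assms(2)] assms(3)] assms(2) by blast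

lemma null_geoI:
  assumes "a < b" "geodesic M \<gamma> w {a..b}" "s \<in> {a..b}" "null_vec M (\<gamma> s) (w s)" "future_vec M (\<gamma> s) (w s)"
  shows "null_geo \<gamma> w a b"
  unfolding null_geo_def using assms geodesic_null_future[OF assms(2-5)] by blast

lemma null_geo_sub: "null_geo \<gamma> w a b \<Longrightarrow> a \<le> a' \<Longrightarrow> a' < b' \<Longrightarrow> b' \<le> b \<Longrightarrow> null_geo \<gamma> w a' b'"
  unfolding null_geo_def by (auto intro: geodesic_subset)

lemma geodesic_velocity_cont:
  assumes "geodesic M \<gamma> w J" "c \<in> charts M"
  shows "continuous_on {t \<in> J. \<gamma> t \<in> cdom c} (\<lambda>t. w t c)"
proof (rule continuous_on_vector_derivative)
  fix t assume t: "t \<in> {t \<in> J. \<gamma> t \<in> cdom c}"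
  then have "c \<in> charts_at M (\<gamma> t)" using assms(2) by auto
  then show "((\<lambda>t. w t c) has_vector_derivative acc c (cmap c (\<gamma> t)) (w t c)) (at t within {t \<in> J. \<gamma> t \<in> cdom c})"
    by (intro has_vector_derivative_within_subset[OF geodesicD(4)[OF assms(1)]]) (use t in auto)
qed

lemma geodesic_C1: "geodesic M \<gamma> w J \<Longrightarrow> C1_curve M \<gamma> w J"
  unfolding C1_curve_def using geodesic_velocity_cont by (auto simp: geodesic_def)

lemma null_geo_causal_strict: "null_geo \<gamma> w a b \<Longrightarrow> (chart_seg causal_dir)\<^sup>+\<^sup>+ (\<gamma> a) (\<gamma> b)"
  by (rule C1_curve_chart_seg[OF null_geoD(1) geodesic_C1[OF null_geoD(2)]]) (auto intro: null_geo_causal_dir)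

lemma null_geo_causal:
  assumes "null_geo \<gamma> w a b" "a \<le> s" "s \<le> t" "t \<le> b" shows "causal M (\<gamma> s) (\<gamma> t)"
proof (cases "s = t")
  case False
  then have "null_geo \<gamma> w s t" using assms by (intro null_geo_sub[OF assms(1,2) _ assms(4)]) simp
  then show ?thesis unfolding causal_chart_seg by (intro tranclp_into_rtranclp null_geo_causal_strict)
qed simp

lemma scale_null_future:
  assumes "null_vec M p v" "future_vec M p v" "k > 0"
  shows "null_vec M p (\<lambda>c. k *\<^sub>R v c) \<and> future_vec M p (\<lambda>c. k *\<^sub>R v c)"
proof -
  have v: "v \<in> tangent_space M p" using assms(1) by (simp add: null_vec_def)
  obtain c where c: "c \<in> charts_at M p" using charts_at_ex by blast
  have "coord_met c (cmap c p) (k *\<^sub>R v c) (k *\<^sub>R v c) = 0 \<and> causal_dir c (cmap c p) (k *\<^sub>R v c)"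
    using null_future_coord[OF v c] assms causal_dir_scale[OF assms(3)] by (auto simp: coord_met_scale)
  then show ?thesis using null_future_coord[OF tangent_scale[OF v, of k] c] by simp
qed

lemma null_geo_affine:
  assumes g: "null_geo \<gamma> w a b" and k: "k > 0" and e: "a' < b'" "k * a' + s = a" "k * b' + s = b"
  shows "null_geo (\<lambda>t. \<gamma> (k * t + s)) (\<lambda>t c. k *\<^sub>R w (k * t + s) c) a' b'"
proof -
  have i: "k * t + s \<in> {a..b}" if "t \<in> {a'..b'}" for t
    using that k mult_left_mono[of a' t k] mult_left_mono[of t b' k] by (auto simp flip: e(2,3))
  show ?thesis unfolding null_geo_def
  proof (intro conjI ballI e(1) geodesic_affine[OF null_geoD(2)[OF g] i])
    fix t assume "t \<in> {a'..b'}"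
    from i[OF this] scale_null_future[OF null_geoD(3,4)[OF g] k]
    show "null_vec M (\<gamma> (k * t + s)) (\<lambda>c. k *\<^sub>R w (k * t + s) c)"
      "future_vec M (\<gamma> (k * t + s)) (\<lambda>c. k *\<^sub>R w (k * t + s) c)" by blast+
  qed
qed

lemma null_geo_glue:
  assumes g: "null_geo \<gamma> w a m" "null_geo \<delta> v m b" "\<gamma> m = \<delta> m" "w m = v m"
  shows "null_geo (\<lambda>t. if t \<le> m then \<gamma> t else \<delta> t) (\<lambda>t. if t \<le> m then w t else v t) a b"
proof (rule null_geoI[where s = m])
  note g1 = null_geoD[OF g(1)] and g2 = null_geoD[OF g(2)]
  show "a < b" using g1 g2 by simp
  show "m \<in> {a..b}" using g1(1) g2(1) by simp
  have "geodesic M (\<lambda>t. if t \<le> m then \<gamma> t else \<delta> t) (\<lambda>t. if t \<le> m then w t else v t) ({a..m} \<union> {m..b})"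
    by (rule geodesic_glue[OF g1(2) g2(2) _ _ _ _ g(3,4)]) (use g1(1) g2(1) in auto)
  moreover have "{a..m} \<union> {m..b} = {a..b}" using g1(1) g2(1) by auto
  ultimately show "geodesic M (\<lambda>t. if t \<le> m then \<gamma> t else \<delta> t) (\<lambda>t. if t \<le> m then w t else v t) {a..b}" by simp
  show "null_vec M (if m \<le> m then \<gamma> m else \<delta> m) (if m \<le> m then w m else v m)"
    "future_vec M (if m \<le> m then \<gamma> m else \<delta> m) (if m \<le> m then w m else v m)"
    using g1(1,3,4) by auto
qed

lemma null_geo_chart:
  assumes g: "null_geo \<gamma> w a b" and t0: "t0 \<in> {a..b}" and gd: "good_region c B T \<xi>" "c \<in> charts_at M (\<gamma> t0)" "cmap c (\<gamma> t0) \<in> B"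
  obtains d where "d > 0"
    "\<And>s t. a \<le> s \<Longrightarrow> s < t \<Longrightarrow> t \<le> b \<Longrightarrow> t0 - d < s \<Longrightarrow> t < t0 + d \<Longrightarrow>
       (\<forall>r\<in>{s..t}. \<gamma> r \<in> cdom c) \<and> coord_curve causal_dir c B (\<lambda>t. cmap c (\<gamma> t)) (\<lambda>t. w t c) s t"
proof -
  note gg = good_regionD[OF gd(1)] and G = null_geoD[OF g]
  have oS: "open (B \<times> (UNIV :: (real ^ 'n) set))" using gg(2) by (intro open_Times) auto
  obtain d where d: "d > 0" "\<And>s. s \<in> {a..b} \<Longrightarrow> \<bar>s - t0\<bar> < d \<Longrightarrow> \<gamma> s \<in> cdom c \<and> state c \<gamma> w s \<in> B \<times> UNIV"
    by (rule state_near[OF G(2) t0 gd(2) oS]) (use gd(3) in \<open>auto simp: state_def\<close>)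
  show ?thesis
  proof (rule that[OF d(1)])
    fix s t assume h: "a \<le> s" "s < t" "t \<le> b" "t0 - d < s" "t < t0 + d"
    have n: "\<gamma> r \<in> cdom c \<and> cmap c (\<gamma> r) \<in> B" if "r \<in> {s..t}" for r
      using d(2)[of r] that h by (auto simp: state_def)
    have sub: "{s..t} \<subseteq> {a..b}" using h by auto
    have "coord_curve causal_dir c B (\<lambda>t. cmap c (\<gamma> t)) (\<lambda>t. w t c) s t" unfolding coord_curve_def
    proof (intro conjI ballI h(2))
      show "continuous_on {s..t} (\<lambda>t. w t c)"
        by (rule continuous_on_subset[OF geodesic_velocity_cont[OF G(2) gg(1)]]) (use n sub in blast)
      fix r assume r: "r \<in> {s..t}"
      have cr: "c \<in> charts_at M (\<gamma> r)" using n[OF r] gg(1) by (blast intro: charts_atI)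
      show "cmap c (\<gamma> r) \<in> B" using n[OF r] by blast
      show "causal_dir c (cmap c (\<gamma> r)) (w r c)" using r sub by (intro null_geo_causal_dir[OF g _ cr]) auto
      show "((\<lambda>t. cmap c (\<gamma> t)) has_vector_derivative w r c) (at r within {s..t})"
        by (rule has_vector_derivative_within_subset[OF geodesicD(3)[OF G(2) _ cr] sub]) (use r sub in auto)
    qed
    then show "(\<forall>r\<in>{s..t}. \<gamma> r \<in> cdom c) \<and> coord_curve causal_dir c B (\<lambda>t. cmap c (\<gamma> t)) (\<lambda>t. w t c) s t" using n by blast
  qed
qed

lemma first_variation_scale:
  assumes "c \<in> charts M" "x \<in> img c"
  shows "first_variation c x u (p *\<^sub>R Z) (q *\<^sub>R Z) = q * (2 * coord_met c x Z u) + p * (u \<bullet> (dG c x Z *v u))"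
  unfolding first_variation_def coord_met_scale
  by (simp add: linear_cmul[OF dG_linear[OF assms]] bounded_bilinear.scaleR_left[OF bounded_bilinear_matrix_vector])

text \<open>At \<open>t0\<close> the term with the slope \<open>\<sigma>\<close> is negative; for
  parameters near \<open>t0\<close> and small coefficients \<open>r\<close> it dominates the term
  with the derivative of the metric.\<close>

lemma short_variation:
  assumes g: "good_region c B T \<xi>" and cc: "coord_curve causal_dir c B \<alpha> \<beta> a b" and t0: "t0 \<in> {a..b}" and Z: "\<sigma> * coord_met c (\<alpha> t0) Z (\<beta> t0) < 0"
  obtains d where "d > 0" "\<And>t r. t \<in> {a..b} \<Longrightarrow> \<bar>t - t0\<bar> < d \<Longrightarrow> \<bar>r\<bar> < d \<Longrightarrow>
     first_variation c (\<alpha> t) (\<beta> t) (r *\<^sub>R Z) (\<sigma> *\<^sub>R Z) < 0"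
proof -
  note gd = good_regionD[OF g] and d = coord_curveD[OF cc]
  have im: "\<alpha> ` {a..b} \<subseteq> img c" using d(4) gd(6) by auto
  have c1: "continuous_on {a..b} (\<lambda>t. \<sigma> * (2 * coord_met c (\<alpha> t) Z (\<beta> t)))"
    by (intro continuous_intros cont_coord_met[OF gd(1)] d im)
  have c2: "continuous_on {a..b} (\<lambda>t. \<beta> t \<bullet> (dG c (\<alpha> t) Z *v \<beta> t))"
    by (intro cont_form_dG[OF gd(1)] d im continuous_intros)
  obtain e where e: "e > 0" "\<And>t r. t \<in> {a..b} \<Longrightarrow> \<bar>t - t0\<bar> < e \<Longrightarrow> \<bar>r\<bar> < e \<Longrightarrow>
     \<sigma> * (2 * coord_met c (\<alpha> t) Z (\<beta> t)) + r * (\<beta> t \<bullet> (dG c (\<alpha> t) Z *v \<beta> t)) < 0"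
    by (rule negative_near[OF c1 c2 t0]) (use Z in auto)
  show ?thesis
  proof (rule that[OF e(1)])
    fix t r assume h: "t \<in> {a..b}" "\<bar>t - t0\<bar> < e" "\<bar>r\<bar> < e"
    have "\<alpha> t \<in> img c" using im h(1) by blast
    then show "first_variation c (\<alpha> t) (\<beta> t) (r *\<^sub>R Z) (\<sigma> *\<^sub>R Z) < 0"
      using e(2)[OF h] by (simp only: first_variation_scale[OF gd(1)])
  qed
qed

lemma coord_curve_sub: "coord_curve R c B \<alpha> \<beta> a b \<Longrightarrow> a \<le> a' \<Longrightarrow> a' < b' \<Longrightarrow> b' \<le> b \<Longrightarrow> coord_curve R c B \<alpha> \<beta> a' b'"
  unfolding coord_curve_def
  by (auto intro: continuous_on_subset has_vector_derivative_within_subset[where S = "{a..b}" and T = "{a'..b'}"])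

section \<open>Corners and normality at the source\<close>

text \<open>Cutting the corner: unless the two velocities are positively proportional, displacing
  the vertex along the separating vector makes both adjacent pieces timelike.\<close>

lemma null_geo_corner:
  assumes g1: "null_geo \<gamma> w a m" and g2: "null_geo \<delta> v m b" and m: "\<gamma> m = \<delta> m" and nc: "\<not> chron M (\<gamma> a) (\<delta> b)"
  obtains k where "k > 0" "v m = (\<lambda>c. k *\<^sub>R w m c)"
proof -
  obtain c B T \<xi> where g: "good_region c B T \<xi>" "c \<in> charts_at M (\<gamma> m)" "cmap c (\<gamma> m) \<in> B" by (rule good_region_at)
  note gd = good_regionD[OF g(1)] and G1 = null_geoD[OF g1] and G2 = null_geoD[OF g2]
  have mJ: "m \<in> {a..m}" "m \<in> {m..b}" using G1(1) G2(1) by auto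
  have i: "cmap c (\<gamma> m) \<in> img c" using g(2) by auto
  have X: "causal_dir c (cmap c (\<gamma> m)) (w m c)" by (rule null_geo_causal_dir[OF g1 mJ(1) g(2)])
  have Y: "causal_dir c (cmap c (\<gamma> m)) (v m c)" using null_geo_causal_dir[OF g2 mJ(2), of c] g(2) m by simp
  have "\<exists>k>0. v m c = k *\<^sub>R w m c"
  proof (rule ccontr)
    assume nk: "\<not> ?thesis"
    obtain Z where Z: "coord_met c (cmap c (\<gamma> m)) Z (w m c) < 0" "0 < coord_met c (cmap c (\<gamma> m)) Z (v m c)"
      using separating_vector[OF G_lorentz[OF gd(1) i] causal_dir_nonzero[OF X] causal_dir_nonzero[OF Y] nk] unfolding coord_met_def by blast
    obtain d1 where d1: "d1 > 0"
      "\<And>s t. a \<le> s \<Longrightarrow> s < t \<Longrightarrow> t \<le> m \<Longrightarrow> m - d1 < s \<Longrightarrow> t < m + d1 \<Longrightarrow>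
       (\<forall>r\<in>{s..t}. \<gamma> r \<in> cdom c) \<and> coord_curve causal_dir c B (\<lambda>t. cmap c (\<gamma> t)) (\<lambda>t. w t c) s t"
      by (rule null_geo_chart[OF g1 mJ(1) g]) blast
    obtain d2 where d2: "d2 > 0"
      "\<And>s t. m \<le> s \<Longrightarrow> s < t \<Longrightarrow> t \<le> b \<Longrightarrow> m - d2 < s \<Longrightarrow> t < m + d2 \<Longrightarrow>
       (\<forall>r\<in>{s..t}. \<delta> r \<in> cdom c) \<and> coord_curve causal_dir c B (\<lambda>t. cmap c (\<delta> t)) (\<lambda>t. v t c) s t"
      by (rule null_geo_chart[OF g2 mJ(2) g(1)]) (use g m in auto)
    define a1 where "a1 = max a (m - d1 / 2)"
    define b1 where "b1 = min b (m + d2 / 2)"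
    have a1: "a \<le> a1" "a1 < m" "m - d1 < a1" using d1(1) G1(1) by (auto simp: a1_def)
    have b1: "b1 \<le> b" "m < b1" "b1 < m + d2" using d2(1) G2(1) by (auto simp: b1_def)
    have C1: "coord_curve causal_dir c B (\<lambda>t. cmap c (\<gamma> t)) (\<lambda>t. w t c) a1 m" "\<forall>r\<in>{a1..m}. \<gamma> r \<in> cdom c"
      using d1(2)[of a1 m] a1 d1(1) by auto
    have C2: "coord_curve causal_dir c B (\<lambda>t. cmap c (\<delta> t)) (\<lambda>t. v t c) m b1" "\<forall>r\<in>{m..b1}. \<delta> r \<in> cdom c"
      using d2(2)[of m b1] b1 d2(1) by auto
    obtain e1 where e1: "e1 > 0" "\<And>t r. t \<in> {a1..m} \<Longrightarrow> \<bar>t - m\<bar> < e1 \<Longrightarrow> \<bar>r\<bar> < e1 \<Longrightarrow>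
       first_variation c (cmap c (\<gamma> t)) (w t c) (r *\<^sub>R Z) (1 *\<^sub>R Z) < 0"
      by (rule short_variation[OF g(1) C1(1), of m 1 Z]) (use a1 Z in auto)
    obtain e2 where e2: "e2 > 0" "\<And>t r. t \<in> {m..b1} \<Longrightarrow> \<bar>t - m\<bar> < e2 \<Longrightarrow> \<bar>r\<bar> < e2 \<Longrightarrow>
       first_variation c (cmap c (\<delta> t)) (v t c) (r *\<^sub>R Z) ((-1) *\<^sub>R Z) < 0"
      by (rule short_variation[OF g(1) C2(1), of m "-1" Z]) (use b1 Z m in auto)
    define h where "h = min (min (e1/2) (e2/2)) (min (m - a1) (b1 - m))"
    have h: "h > 0" "h < e1" "h < e2" "a1 \<le> m - h" "m + h \<le> b1" using e1(1) e2(1) a1 b1 by (auto simp: h_def)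
    have D1: "coord_curve causal_dir c B (\<lambda>t. cmap c (\<gamma> t)) (\<lambda>t. w t c) (m - h) m" by (rule coord_curve_sub[OF C1(1)]) (use h in auto)
    have D2: "coord_curve causal_dir c B (\<lambda>t. cmap c (\<delta> t)) (\<lambda>t. v t c) m (m + h)" by (rule coord_curve_sub[OF C2(1)]) (use h in auto)
    \<comment> \<open>A hat-shaped variation: slope 1 before \<open>m\<close>, slope -1 after it,
      zero at m - h and m + h. The common value h Z at the top makes the two varied pieces
      meet.\<close>
    obtain f1 where f1: "f1 > 0" "\<And>e. 0 < e \<Longrightarrow> e < f1 \<Longrightarrow>
      coord_curve timelike_dir c B (\<lambda>t. cmap c (\<gamma> t) + e *\<^sub>R ((t - (m - h)) *\<^sub>R Z)) (\<lambda>t. w t c + e *\<^sub>R (1 *\<^sub>R Z)) (m - h) m"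
    proof (rule variation_coord_curve[OF g(1) D1, of "\<lambda>t. (t - (m - h)) *\<^sub>R Z" "\<lambda>_. 1 *\<^sub>R Z"])
      fix t assume t: "t \<in> {m - h..m}"
      show "((\<lambda>t. (t - (m - h)) *\<^sub>R Z) has_vector_derivative 1 *\<^sub>R Z) (at t within {m - h..m})"
        by (auto intro!: derivative_eq_intros)
      show "first_variation c (cmap c (\<gamma> t)) (w t c) ((t - (m - h)) *\<^sub>R Z) (1 *\<^sub>R Z) < 0"
        by (rule e1(2)) (use t h in auto)
    qed auto
    obtain f2 where f2: "f2 > 0" "\<And>e. 0 < e \<Longrightarrow> e < f2 \<Longrightarrow>
      coord_curve timelike_dir c B (\<lambda>t. cmap c (\<delta> t) + e *\<^sub>R (((m + h) - t) *\<^sub>R Z)) (\<lambda>t. v t c + e *\<^sub>R ((-1) *\<^sub>R Z)) m (m + h)"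
    proof (rule variation_coord_curve[OF g(1) D2, of "\<lambda>t. ((m + h) - t) *\<^sub>R Z" "\<lambda>_. (-1) *\<^sub>R Z"])
      fix t assume t: "t \<in> {m..m + h}"
      show "((\<lambda>t. ((m + h) - t) *\<^sub>R Z) has_vector_derivative (-1) *\<^sub>R Z) (at t within {m..m + h})"
        by (auto intro!: derivative_eq_intros)
      show "first_variation c (cmap c (\<delta> t)) (v t c) (((m + h) - t) *\<^sub>R Z) ((-1) *\<^sub>R Z) < 0"
        by (rule e2(2)) (use t h in auto)
    qed auto
    define e where "e = min f1 f2 / 2"
    have e: "0 < e" "e < f1" "e < f2" using f1(1) f2(1) by (auto simp: e_def)
    have "\<gamma> (m - h) \<in> cdom c" "\<delta> (m + h) \<in> cdom c" using C1(2) C2(2) h by auto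
    then have s: "chart_seg timelike_dir (\<gamma> (m - h)) (cinv c (cmap c (\<gamma> m) + e *\<^sub>R (h *\<^sub>R Z)))"
      "chart_seg timelike_dir (cinv c (cmap c (\<gamma> m) + e *\<^sub>R (h *\<^sub>R Z))) (\<delta> (m + h))"
      using chart_segI[OF g(1) f1(2)[OF e(1,2)]] chart_segI[OF g(1) f2(2)[OF e(1,3)]] m cinv_cmap[OF gd(1)] by simp_all
    then have "chron M (\<gamma> (m - h)) (\<delta> (m + h))" unfolding chron_chart_seg by (rule tranclp.trancl_into_trancl[OF tranclp.r_into_trancl])
    moreover have "causal M (\<gamma> a) (\<gamma> (m - h))" by (rule null_geo_causal[OF g1]) (use h a1 in auto)
    moreover have "causal M (\<delta> (m + h)) (\<delta> b)" by (rule null_geo_causal[OF g2]) (use h b1 in auto)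
    ultimately show False using nc push_left push_right by blast
  qed
  then obtain k where k: "k > 0" "v m c = k *\<^sub>R w m c" by blast
  have wt: "w m \<in> tangent_space M (\<gamma> m)" "v m \<in> tangent_space M (\<gamma> m)"
    using geodesicD(2)[OF G1(2) mJ(1)] geodesicD(2)[OF G2(2) mJ(2)] m by simp_all
  have "v m = (\<lambda>c. k *\<^sub>R w m c)"
    using tangent_eq_iff[OF wt(2) tangent_scale[OF wt(1), of k] g(2)] k(2) by simp
  then show ?thesis using that k(1) by blast
qed

text \<open>If the generator were not normal to \<open>S\<close>, sliding its starting point along
  \<open>S\<close> in the favourable direction would make it timelike near the start, and a point of
  \<open>S\<close> would precede its end chronologically.\<close>

lemma normal_generator:
  assumes g1: "null_geo \<gamma> w 0 L" and u: "u \<in> tangent_of M S (\<gamma> 0)" and nc: "\<And>p. p \<in> S \<Longrightarrow> \<not> chron M p (\<gamma> L)"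
  shows "met M (\<gamma> 0) (w 0) u = 0"
proof (rule ccontr)
  assume n0: "met M (\<gamma> 0) (w 0) u \<noteq> 0"
  obtain \<kappa> z \<epsilon> where k: "0 < \<epsilon>" "C1_curve M \<kappa> z {-\<epsilon><..<\<epsilon>}" "\<kappa> ` {-\<epsilon><..<\<epsilon>} \<subseteq> S" "\<kappa> 0 = \<gamma> 0" "z 0 = u"
    using u unfolding tangent_of_def by blast
  obtain c B T \<xi> where g: "good_region c B T \<xi>" "c \<in> charts_at M (\<gamma> 0)" "cmap c (\<gamma> 0) \<in> B" by (rule good_region_at)
  note gd = good_regionD[OF g(1)] and G1 = null_geoD[OF g1]
  have 0: "0 \<in> {0..L}" using G1(1) by auto
  have "has_velocity M \<kappa> u 0 {-\<epsilon><..<\<epsilon>}" using k unfolding C1_curve_def by auto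
  then have u: "u \<in> tangent_space M (\<gamma> 0)" and kd: "((\<lambda>s. cmap c (\<kappa> s)) has_vector_derivative u c) (at 0)"
    using g(2) k(1,4) at_within_open[of 0 "{-\<epsilon><..<\<epsilon>}"] unfolding has_velocity_def o_def by auto
  \<comment> \<open>The sign picks the direction along the curve in \<open>S\<close> for which the
    first variation is negative.\<close>
  define \<sigma> where "\<sigma> = (if met M (\<gamma> 0) (w 0) u > 0 then 1 else (-1) :: real)"
  define Z where "Z = \<sigma> *\<^sub>R u c"
  have i: "cmap c (\<gamma> 0) \<in> img c" using g(2) by auto
  have Z: "coord_met c (cmap c (\<gamma> 0)) Z (w 0 c) > 0"
    using n0 met_coord[OF geodesicD(2)[OF G1(2) 0] u g(2)] coord_met_sym[OF gd(1) i, of "u c" "w 0 c"]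
    by (auto simp: Z_def coord_met_scale \<sigma>_def)
  obtain d1 where d1: "d1 > 0"
    "\<And>s t. 0 \<le> s \<Longrightarrow> s < t \<Longrightarrow> t \<le> L \<Longrightarrow> 0 - d1 < s \<Longrightarrow> t < 0 + d1 \<Longrightarrow>
     (\<forall>r\<in>{s..t}. \<gamma> r \<in> cdom c) \<and> coord_curve causal_dir c B (\<lambda>t. cmap c (\<gamma> t)) (\<lambda>t. w t c) s t"
    by (rule null_geo_chart[OF g1 0 g]) blast
  define b1 where "b1 = min L (d1/2)"
  have b1: "0 < b1" "b1 \<le> L" "b1 < d1" using d1(1) G1(1) by (auto simp: b1_def)
  have C1: "coord_curve causal_dir c B (\<lambda>t. cmap c (\<gamma> t)) (\<lambda>t. w t c) 0 b1" "\<forall>r\<in>{0..b1}. \<gamma> r \<in> cdom c"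
    using d1(2)[of 0 b1] b1 d1(1) by auto
  obtain e1 where e1: "e1 > 0" "\<And>t r. t \<in> {0..b1} \<Longrightarrow> \<bar>t - 0\<bar> < e1 \<Longrightarrow> \<bar>r\<bar> < e1 \<Longrightarrow>
     first_variation c (cmap c (\<gamma> t)) (w t c) (r *\<^sub>R Z) ((-1) *\<^sub>R Z) < 0"
    by (rule short_variation[OF g(1) C1(1), of 0 "-1" Z]) (use b1 Z in auto)
  define h where "h = min b1 (e1 / 2)"
  have h: "h > 0" "h < e1" "h \<le> b1" using b1 e1(1) by (auto simp: h_def)
  have D1: "coord_curve causal_dir c B (\<lambda>t. cmap c (\<gamma> t)) (\<lambda>t. w t c) 0 h" by (rule coord_curve_sub[OF C1(1)]) (use h in auto)
  note dd = coord_curveD[OF D1]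
  obtain e0 \<eta> where e: "e0 > 0" "\<eta> > 0"
    "\<And>e t Y Y'. 0 < e \<Longrightarrow> e < e0 \<Longrightarrow> t \<in> {0..h} \<Longrightarrow> norm (Y - (h - t) *\<^sub>R Z) < \<eta> \<Longrightarrow> norm (Y' - (-1) *\<^sub>R Z) < \<eta> \<Longrightarrow>
      cmap c (\<gamma> t) + e *\<^sub>R Y \<in> B \<and> timelike_dir c (cmap c (\<gamma> t) + e *\<^sub>R Y) (w t c + e *\<^sub>R Y')"
  proof (rule variation[OF g(1) D1, of "\<lambda>t. (h - t) *\<^sub>R Z" "\<lambda>_. (-1) *\<^sub>R Z"])
    fix t assume t: "t \<in> {0..h}"
    show "first_variation c (cmap c (\<gamma> t)) (w t c) ((h - t) *\<^sub>R Z) ((-1) *\<^sub>R Z) < 0"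
      by (rule e1(2)) (use t h in auto)
  qed (auto intro!: continuous_intros)
  \<comment> \<open>A straight displacement by \<open>Z\<close> would miss \<open>S\<close>. With
    this difference quotient in place of \<open>Z\<close> the varied curve starts exactly at a point
    of \<open>\<kappa>\<close>, and \<open>q e\<close> tends to \<open>Z\<close>.\<close>
  define q where "q e = (1 / (e * h)) *\<^sub>R (cmap c (\<kappa> (\<sigma> * (e * h))) - cmap c (\<gamma> 0))" for e
  have s0: "\<sigma> \<noteq> 0" "\<bar>\<sigma>\<bar> = 1" "\<sigma> * \<sigma> = 1" by (auto simp: \<sigma>_def)
  have kq: "((\<lambda>s. (1 / s) *\<^sub>R (cmap c (\<kappa> s) - cmap c (\<gamma> 0))) \<longlongrightarrow> u c) (at 0)"
    using kd k(4) by (simp add: has_vector_derivative_iff_quotient)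
  have "((\<lambda>e. (1 / (\<sigma> * (e * h))) *\<^sub>R (cmap c (\<kappa> (\<sigma> * (e * h))) - cmap c (\<gamma> 0))) \<longlongrightarrow> u c) (at_right 0)"
  proof (rule filterlim_compose[OF kq])
    show "filterlim (\<lambda>e. \<sigma> * (e * h)) (at 0) (at_right 0)"
      unfolding filterlim_at using s0(1) h(1)
      by (auto intro!: tendsto_eq_intros eventually_at_right_less simp: eventually_at_filter)
  qed
  then have "((\<lambda>e. \<sigma> *\<^sub>R ((1 / (\<sigma> * (e * h))) *\<^sub>R (cmap c (\<kappa> (\<sigma> * (e * h))) - cmap c (\<gamma> 0)))) \<longlongrightarrow> Z) (at_right 0)"
    unfolding Z_def by (intro tendsto_intros)
  then have "(q \<longlongrightarrow> Z) (at_right 0)" unfolding q_def using s0(1) by simp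
  \<comment> \<open>The factor 1 + h covers both deviations from the model variation: at most h |q -
    Z| in position and |q - Z| in slope.\<close>
  then have q1: "\<forall>\<^sub>F e in at_right 0. dist (q e) Z < \<eta> / (1 + h)" using e(2) h(1) by (intro tendstoD) auto
  have q2: "\<forall>\<^sub>F e in at_right 0. \<kappa> (\<sigma> * (e * h)) \<in> cdom c \<and> \<sigma> * (e * h) \<in> {-\<epsilon><..<\<epsilon>}"
  proof -
    have "\<forall>\<^sub>F s in at 0. s \<in> {-\<epsilon><..<\<epsilon>}" using k(1) by (intro eventually_at_in_open') auto
    moreover have "(\<kappa> \<longlongrightarrow> \<kappa> 0) (at 0)"
      using k(1,2) at_within_open[of 0 "{-\<epsilon><..<\<epsilon>}"] unfolding C1_curve_def continuous_on_def by force
    then have "\<forall>\<^sub>F s in at 0. \<kappa> s \<in> cdom c"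
      by (rule topological_tendstoD) (use open_cdom[OF gd(1)] g(2) k(4) in auto)
    ultimately have "\<forall>\<^sub>F s in at 0. \<kappa> s \<in> cdom c \<and> s \<in> {-\<epsilon><..<\<epsilon>}" by eventually_elim auto
    moreover have "filterlim (\<lambda>e. \<sigma> * (e * h)) (at 0) (at_right 0)"
      unfolding filterlim_at using s0(1) h(1)
      by (auto intro!: tendsto_eq_intros eventually_at_right_less simp: eventually_at_filter)
    ultimately show ?thesis by (rule eventually_compose_filterlim)
  qed
  have q3: "\<forall>\<^sub>F e in at_right 0. 0 < e \<and> e < e0" using e(1)
    by (intro eventually_at_rightI[of 0 e0]) auto
  have "\<exists>e. dist (q e) Z < \<eta> / (1 + h) \<and> (\<kappa> (\<sigma> * (e * h)) \<in> cdom c \<and> \<sigma> * (e * h) \<in> {-\<epsilon><..<\<epsilon>}) \<and> (0 < e \<and> e < e0)"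
    by (rule eventually_happens'[OF trivial_limit_at_right_real eventually_conj[OF q1 eventually_conj[OF q2 q3]]])
  then obtain e' where e': "dist (q e') Z < \<eta> / (1 + h)" "\<kappa> (\<sigma> * (e' * h)) \<in> cdom c" "\<sigma> * (e' * h) \<in> {-\<epsilon><..<\<epsilon>}" "0 < e'" "e' < e0"
    by blast
  have qe: "cmap c (\<gamma> 0) + e' *\<^sub>R (h *\<^sub>R q e') = cmap c (\<kappa> (\<sigma> * (e' * h)))" unfolding q_def using e'(4) h(1) by simp
  have "norm (q e' - Z) < \<eta> / (1 + h)" using e'(1) by (simp add: dist_norm)
  then have qn1: "(1 + h) * norm (q e' - Z) < \<eta>" using h(1) by (simp add: field_simps)
  have "coord_curve timelike_dir c B (\<lambda>t. cmap c (\<gamma> t) + e' *\<^sub>R ((h - t) *\<^sub>R q e')) (\<lambda>t. w t c + e' *\<^sub>R ((-1) *\<^sub>R q e')) 0 h"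
    unfolding coord_curve_def
  proof (intro conjI ballI h(1))
    show "continuous_on {0..h} (\<lambda>t. w t c + e' *\<^sub>R ((-1) *\<^sub>R q e'))" by (intro continuous_intros dd)
    fix t assume t: "t \<in> {0..h}"
    have "((\<lambda>t. e' *\<^sub>R ((h - t) *\<^sub>R q e')) has_vector_derivative e' *\<^sub>R ((-1) *\<^sub>R q e')) (at t within {0..h})"
      by (auto intro!: derivative_eq_intros)
    then show "((\<lambda>t. cmap c (\<gamma> t) + e' *\<^sub>R ((h - t) *\<^sub>R q e')) has_vector_derivative w t c + e' *\<^sub>R ((-1) *\<^sub>R q e')) (at t within {0..h})"
      by (intro has_vector_derivative_add dd(6)[OF t])
    have "norm ((h - t) *\<^sub>R q e' - (h - t) *\<^sub>R Z) = \<bar>h - t\<bar> * norm (q e' - Z)"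
      by (simp flip: scaleR_diff_right)
    also have "\<dots> \<le> (1 + h) * norm (q e' - Z)" using t h(1) by (intro mult_right_mono) auto
    finally have a: "norm ((h - t) *\<^sub>R q e' - (h - t) *\<^sub>R Z) < \<eta>" using qn1 by simp
    have "norm ((-1) *\<^sub>R q e' - (-1) *\<^sub>R Z) = norm (q e' - Z)" by (simp add: norm_minus_commute)
    also have "\<dots> \<le> (1 + h) * norm (q e' - Z)" using h(1) by (simp add: mult_le_cancel_right1)
    finally have b: "norm ((-1) *\<^sub>R q e' - (-1) *\<^sub>R Z) < \<eta>" using qn1 by simp
    show "cmap c (\<gamma> t) + e' *\<^sub>R ((h - t) *\<^sub>R q e') \<in> B"
      "timelike_dir c (cmap c (\<gamma> t) + e' *\<^sub>R ((h - t) *\<^sub>R q e')) (w t c + e' *\<^sub>R ((-1) *\<^sub>R q e'))"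
      using e(3)[OF e'(4,5) t a b] by blast+
  qed
  from chart_segI[OF g(1) this] have "chart_seg timelike_dir (\<kappa> (\<sigma> * (e' * h))) (\<gamma> h)"
    using qe cinv_cmap[OF gd(1)] C1(2) h e'(2) by simp
  then have "chron M (\<kappa> (\<sigma> * (e' * h))) (\<gamma> h)" by (simp add: chron_chart_seg)
  moreover have "causal M (\<gamma> h) (\<gamma> L)" by (rule null_geo_causal[OF g1]) (use h b1 in auto)
  ultimately have "chron M (\<kappa> (\<sigma> * (e' * h))) (\<gamma> L)" by (rule push_right)
  then show False using nc k(3) e'(3) by blast
qed

text \<open>Having no corner, the two velocities differ by a factor \<open>k\<close>, and rescaling
  the first piece removes it. The parameter of \<open>\<delta>\<close> is kept, so that different
  backward extensions of one generator can be compared.\<close>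

lemma null_geo_join:
  assumes g: "null_geo \<gamma> w a b" "null_geo \<delta> v a' b'" "\<gamma> b = \<delta> a'" and nc: "\<not> chron M (\<gamma> a) (\<delta> b')"
  obtains \<eta> z e k where "k > 0" "null_geo \<eta> z e b'" "e < a'" "k * (e - a') + b = a"
    "\<And>t. t \<in> {a'..b'} \<Longrightarrow> \<eta> t = \<delta> t \<and> z t = v t"
    "\<And>t. t \<in> {e..a'} \<Longrightarrow> \<eta> t = \<gamma> (k * (t - a') + b) \<and> z t = (\<lambda>c. k *\<^sub>R w (k * (t - a') + b) c)"
proof -
  have ab: "a < b" "a' < b'" using null_geoD(1)[OF g(1)] null_geoD(1)[OF g(2)] by auto
  have "null_geo (\<lambda>t. \<gamma> (1 * t + (b - a'))) (\<lambda>t c. 1 *\<^sub>R w (1 * t + (b - a')) c) (a - b + a') a'"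
    by (rule null_geo_affine[OF g(1)]) (use ab in auto)
  then have "null_geo (\<lambda>t. \<gamma> (t + (b - a'))) (\<lambda>t. w (t + (b - a'))) (a - b + a') a'" by simp
  from null_geo_corner[OF this g(2)] obtain k where k: "k > 0" "v a' = (\<lambda>c. k *\<^sub>R w b c)"
    using g(3) nc by auto
  define e where "e = a' - (b - a) / k"
  have e: "e < a'" "k * (e - a') + b = a" using k(1) ab by (auto simp: e_def field_simps)
  have sh: "k * t + (b - k * a') = k * (t - a') + b" for t by (simp add: algebra_simps)
  have "null_geo (\<lambda>t. \<gamma> (k * t + (b - k * a'))) (\<lambda>t c. k *\<^sub>R w (k * t + (b - k * a')) c) e a'"
    by (rule null_geo_affine[OF g(1) k(1) e(1)]) (use e(2) in \<open>simp_all add: algebra_simps\<close>)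
  then have n: "null_geo (\<lambda>t. \<gamma> (k * (t - a') + b)) (\<lambda>t c. k *\<^sub>R w (k * (t - a') + b) c) e a'"
    unfolding sh .
  show ?thesis
  proof (rule that[OF k(1) null_geo_glue[OF n g(2)] e])
    show "\<gamma> (k * (a' - a') + b) = \<delta> a'" using g(3) by simp
    show "(\<lambda>c. k *\<^sub>R w (k * (a' - a') + b) c) = v a'" using k(2) by simp
  qed (use g(3) k(2) in auto)
qed

section \<open>Rigidity of causal curves between points that are not chronologically related\<close>

text \<open>A variation with fixed ends and negative first variation would join \<open>x\<close> to
  \<open>y\<close> by a timelike segment. Hence \<open>momentum_equation\<close> applies, and its
  factor is the speed of an affine parametrization.\<close>

lemma chart_seg_rigid:
  assumes "chart_seg causal_dir x y" and nc: "\<not> chron M x y"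
  shows "\<exists>\<gamma> w a b. null_geo \<gamma> w a b \<and> \<gamma> a = x \<and> \<gamma> b = y"
proof -
  obtain c B T \<xi> \<alpha> \<beta> a b where s: "good_region c B T \<xi>" "x \<in> cdom c" "y \<in> cdom c"
     "\<alpha> a = cmap c x" "\<alpha> b = cmap c y" "coord_curve causal_dir c B \<alpha> \<beta> a b" using assms(1) unfolding chart_seg_def by blast
  note gd = good_regionD[OF s(1)] and d = coord_curveD[OF s(6)]
  have notim: False if "coord_curve timelike_dir c B \<alpha>' \<beta>' a' b'" "\<alpha>' a' = \<alpha> a" "\<alpha>' b' = \<alpha> b" for \<alpha>' \<beta>' a' b'
    using chart_segI[OF s(1) that(1)] that(2,3) s(2-5) cinv_cmap[OF gd(1)] nc chron_chart_seg by auto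
  have im: "\<alpha> t \<in> img c" if "t \<in> {a..b}" for t using d(4)[OF that] gd(6) by blast
  then have im': "\<alpha> ` {a..b} \<subseteq> img c" by blast
  \<comment> \<open>\<open>l\<close> is the momentum of the curve and \<open>m\<close> represents
    the position derivative of g(\<beta>, \<beta>); the first variation is then 2 (V' . l) + V .
    m.\<close>
  define l where "l t = G c (\<alpha> t) *v \<beta> t" for t
  define m where "m t = (\<Sum>e\<in>Basis. (\<beta> t \<bullet> (dG c (\<alpha> t) e *v \<beta> t)) *\<^sub>R e)" for t
  have Vm: "V \<bullet> m t = \<beta> t \<bullet> (dG c (\<alpha> t) V *v \<beta> t)" if t: "t \<in> {a..b}" for V t
  proof -
    interpret mv: bounded_bilinear "(*v) :: real^'n^'n \<Rightarrow> real^'n \<Rightarrow> real^'n" by (rule bounded_bilinear_matrix_vector)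
    interpret D: linear "dG c (\<alpha> t)" by (rule dG_linear[OF gd(1) im[OF t]])
    have "\<beta> t \<bullet> (dG c (\<alpha> t) V *v \<beta> t) = \<beta> t \<bullet> (dG c (\<alpha> t) (\<Sum>e\<in>Basis. (V \<bullet> e) *\<^sub>R e) *v \<beta> t)"
      by (simp add: euclidean_representation)
    also have "\<dots> = (\<Sum>e\<in>Basis. (V \<bullet> e) * (\<beta> t \<bullet> (dG c (\<alpha> t) e *v \<beta> t)))"
      by (simp add: D.sum D.scale mv.sum_left mv.scaleR_left inner_sum_right)
    finally show ?thesis by (simp add: m_def inner_sum_right mult.commute)
  qed
  have cl: "continuous_on {a..b} l" unfolding l_def
    by (intro continuous_intros d continuous_on_compose2[OF cont_G[OF gd(1)] d(3) im'])
  have cm: "continuous_on {a..b} m" unfolding m_def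
    by (intro continuous_intros cont_form_dG[OF gd(1)] d im')
  have lT: "l t \<bullet> T < 0" if t: "t \<in> {a..b}" for t
    using causal_dir_timelike_dir_neg[OF gd(1) im[OF t] d(5)[OF t] gd(4)[OF d(4)[OF t]]] G_sym[OF gd(1) im[OF t], of "\<beta> t" T]
    by (simp add: l_def coord_met_def inner_commute)
  obtain k where k: "continuous_on {a..b} k" "\<And>t. t \<in> {a..b} \<Longrightarrow> 0 < k t"
    "\<And>t. t \<in> {a..b} \<Longrightarrow> ((\<lambda>t. k t *\<^sub>R l t) has_vector_derivative (k t / 2) *\<^sub>R m t) (at t within {a..b})"
  proof (rule momentum_equation[OF d(1) cl cm lT])
    fix V V' assume V: "\<And>t. t \<in> {a..b} \<Longrightarrow> (V has_vector_derivative V' t) (at t within {a..b})"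
      "continuous_on {a..b} V'" "V a = 0" "V b = 0" "\<And>t. t \<in> {a..b} \<Longrightarrow> 2 * (V' t \<bullet> l t) + V t \<bullet> m t < 0"
    obtain e0 where e0: "e0 > 0"
      "\<And>e. 0 < e \<Longrightarrow> e < e0 \<Longrightarrow> coord_curve timelike_dir c B (\<lambda>t. \<alpha> t + e *\<^sub>R V t) (\<lambda>t. \<beta> t + e *\<^sub>R V' t) a b"
    proof (rule variation_coord_curve[OF s(1,6) V(1,2)])
      fix t assume t: "t \<in> {a..b}"
      show "first_variation c (\<alpha> t) (\<beta> t) (V t) (V' t) < 0"
        using V(5)[OF t] Vm[OF t] unfolding first_variation_def l_def coord_met_def by simp
    qed auto
    have "coord_curve timelike_dir c B (\<lambda>t. \<alpha> t + (e0/2) *\<^sub>R V t) (\<lambda>t. \<beta> t + (e0/2) *\<^sub>R V' t) a b"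
      using e0 by simp
    then show False by (rule notim) (use V in auto)
  next
    fix k assume "continuous_on {a..b} k" "\<And>t. t \<in> {a..b} \<Longrightarrow> 0 < k t"
      "\<And>t. t \<in> {a..b} \<Longrightarrow> ((\<lambda>t. k t *\<^sub>R l t) has_vector_derivative (k t / 2) *\<^sub>R m t) (at t within {a..b})"
    then show thesis by (rule that)
  qed
  obtain A B' \<theta> where th: "A < B'" "\<theta> A = a" "\<theta> B' = b" "\<And>r. r \<in> {A..B'} \<Longrightarrow> \<theta> r \<in> {a..b}"
    "\<And>r. r \<in> {A..B'} \<Longrightarrow> (\<theta> has_real_derivative k (\<theta> r)) (at r within {A..B'})"
    by (rule reparametrization[OF d(1) k(1,2)]) blast+
  \<comment> \<open>The velocity after the change of parameter \<open>\<theta>\<close>, which runs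
    with speed \<open>k\<close>.\<close>
  define u where "u t = k t *\<^sub>R \<beta> t" for t
  have cu: "continuous_on {a..b} u" unfolding u_def by (intro continuous_intros k(1) d)
  have Gu: "G c (\<alpha> t) *v u t = k t *\<^sub>R l t" for t by (simp add: u_def l_def matrix_vector_mult_scaleR)
  \<comment> \<open>The velocity is a priori only continuous. The momentum k l = G u is
    differentiable, so \<open>u\<close> is too: the difference quotient of G u is split into one of
    \<open>G\<close> and one of \<open>u\<close>, and the invertible matrix at \<open>t\<close> is
    removed.\<close>
  have u': "(u has_vector_derivative (1 / k t) *\<^sub>R acc c (\<alpha> t) (u t)) (at t within {a..b})" if t: "t \<in> {a..b}" for t
  proof -
    let ?N = "matrix_inv (G c (\<alpha> t))" and ?F = "at t within {a..b}"
    have "invertible (G c (\<alpha> t))" by (rule lorentz_mat_invertible[OF G_lorentz[OF gd(1) im[OF t]]])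
    then have inv: "?N ** G c (\<alpha> t) = mat 1" "G c (\<alpha> t) ** ?N = mat 1"
      unfolding invertible_def matrix_inv_def by (rule someI2_ex, blast)+
    have G': "((\<lambda>s. G c (\<alpha> s)) has_vector_derivative dG c (\<alpha> t) (\<beta> t)) ?F"
      using has_derivative_compose[OF d(6)[OF t, unfolded has_vector_derivative_def] dG_deriv[OF gd(1) im[OF t]]]
      by (simp add: has_vector_derivative_def linear_cmul[OF dG_linear[OF gd(1) im[OF t]]])
    have ul: "(u \<longlongrightarrow> u t) ?F" using cu t by (simp add: continuous_on_def)
    let ?r = "(k t / 2) *\<^sub>R m t - dG c (\<alpha> t) (\<beta> t) *v u t"
    have "((\<lambda>s. ?N *v ((1 / (s - t)) *\<^sub>R (k s *\<^sub>R l s - k t *\<^sub>R l t) -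
        ((1 / (s - t)) *\<^sub>R (G c (\<alpha> s) - G c (\<alpha> t))) *v u s)) \<longlongrightarrow> ?N *v ?r) ?F"
      using k(3)[OF t] G' unfolding has_vector_derivative_iff_quotient
      by (intro tendsto_mv[OF tendsto_const] tendsto_diff tendsto_mv ul)
    moreover have "?N *v ((1 / (s - t)) *\<^sub>R (k s *\<^sub>R l s - k t *\<^sub>R l t) -
        ((1 / (s - t)) *\<^sub>R (G c (\<alpha> s) - G c (\<alpha> t))) *v u s) = (1 / (s - t)) *\<^sub>R (u s - u t)" for s
    proof -
      have "(1 / (s - t)) *\<^sub>R (k s *\<^sub>R l s - k t *\<^sub>R l t) - ((1 / (s - t)) *\<^sub>R (G c (\<alpha> s) - G c (\<alpha> t))) *v u s
        = (1 / (s - t)) *\<^sub>R (G c (\<alpha> t) *v (u s - u t))"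
        unfolding Gu[symmetric] bounded_bilinear.scaleR_left[OF bounded_bilinear_matrix_vector]
          bounded_bilinear.diff_left[OF bounded_bilinear_matrix_vector] bounded_bilinear.diff_right[OF bounded_bilinear_matrix_vector]
        by (simp flip: scaleR_diff_right)
      also have "\<dots> = G c (\<alpha> t) *v ((1 / (s - t)) *\<^sub>R (u s - u t))" by (simp add: matrix_vector_mult_scaleR)
      finally show ?thesis by (simp add: matrix_vector_mul_assoc inv)
    qed
    ultimately have D: "(u has_vector_derivative ?N *v ?r) ?F" unfolding has_vector_derivative_iff_quotient by simp
    have "k t *\<^sub>R (?N *v ?r) = acc c (\<alpha> t) (u t)"
    proof (rule acc_unique[OF gd(1) im[OF t]])
      fix h
      have "G c (\<alpha> t) *v (k t *\<^sub>R (?N *v ?r)) = k t *\<^sub>R ?r"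
        by (simp add: matrix_vector_mult_scaleR matrix_vector_mul_assoc inv)
      moreover have "dG c (\<alpha> t) (u t) *v u t = k t *\<^sub>R (dG c (\<alpha> t) (\<beta> t) *v u t)"
        by (simp add: u_def linear_cmul[OF dG_linear[OF gd(1) im[OF t]]] bounded_bilinear.scaleR_left[OF bounded_bilinear_matrix_vector])
      moreover have "u t \<bullet> (dG c (\<alpha> t) h *v u t) = k t * k t * (h \<bullet> m t)"
        unfolding Vm[OF t] by (simp add: u_def matrix_vector_mult_scaleR)
      ultimately show "h \<bullet> (G c (\<alpha> t) *v (k t *\<^sub>R (?N *v ?r))) + h \<bullet> (dG c (\<alpha> t) (u t) *v u t) =
          1 / 2 * (u t \<bullet> (dG c (\<alpha> t) h *v u t))"
        by (simp add: scaleR_diff_right inner_diff_right)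
    qed
    then have "(1 / k t) *\<^sub>R (k t *\<^sub>R (?N *v ?r)) = (1 / k t) *\<^sub>R acc c (\<alpha> t) (u t)" by (simp only:)
    then have "?N *v ?r = (1 / k t) *\<^sub>R acc c (\<alpha> t) (u t)"
      using k(2)[OF t] unfolding scaleR_scaleR by simp
    then show ?thesis using D by simp
  qed
  let ?x = "\<lambda>r. \<alpha> (\<theta> r)" and ?u = "\<lambda>r. u (\<theta> r)"
  have chain: "((\<lambda>r. f (\<theta> r)) has_vector_derivative k (\<theta> r) *\<^sub>R f') (at r within {A..B'})"
    if "(f has_vector_derivative f') (at (\<theta> r) within {a..b})" "r \<in> {A..B'}" for f :: "real \<Rightarrow> real ^ 'n" and f' r
  proof -
    have "(f has_vector_derivative f') (at (\<theta> r) within \<theta> ` {A..B'})"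
      by (rule has_vector_derivative_within_subset[OF that(1)]) (use th(4) in auto)
    then show ?thesis
      using vector_diff_chain_within[OF th(5)[OF that(2), unfolded has_real_derivative_iff_has_vector_derivative], of f f']
      by (simp add: o_def)
  qed
  have geo: "geodesic M (\<lambda>r. cinv c (?x r)) (\<lambda>r. lift c (cinv c (?x r)) (?u r)) {A..B'}"
  proof (rule geodesic_lift[OF gd(1)])
    fix r assume r: "r \<in> {A..B'}"
    show "?x r \<in> img c" by (rule im[OF th(4)[OF r]])
    show "(?x has_vector_derivative ?u r) (at r within {A..B'})"
      using chain[OF d(6)[OF th(4)[OF r]] r] by (simp add: u_def)
    show "(?u has_vector_derivative acc c (?x r) (?u r)) (at r within {A..B'})"
      using chain[OF u'[OF th(4)[OF r]] r] k(2)[OF th(4)[OF r]] by simp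
  qed
  have ca: "causal_dir c (?x r) (?u r)" if r: "r \<in> {A..B'}" for r
    unfolding u_def by (intro causal_dir_scale k(2) d(5) th(4) r)
  have ch: "c \<in> charts_at M (cinv c (?x r))" "cmap c (cinv c (?x r)) = ?x r" if r: "r \<in> {A..B'}" for r
    using cinv_in[OF gd(1) im[OF th(4)[OF r]]] cmap_cinv[OF gd(1) im[OF th(4)[OF r]]] gd(1) by auto
  have mt: "met M (cinv c (?x r)) (lift c (cinv c (?x r)) (?u r)) (lift c (cinv c (?x r)) (?u r)) = coord_met c (?x r) (?u r) (?u r)"
    if r: "r \<in> {A..B'}" for r
    unfolding met_lift[OF ch(1)[OF r]] ch(2)[OF r] ..
  have AB: "A \<in> {A..B'}" "B' \<in> {A..B'}" using th(1) by auto
  \<comment> \<open>Energy is constant along a geodesic: if negative somewhere it is negative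
    everywhere, and the segment would be timelike.\<close>
  have null: "coord_met c (?x A) (?u A) (?u A) = 0"
  proof (rule ccontr)
    assume "coord_met c (?x A) (?u A) (?u A) \<noteq> 0"
    then have neg: "coord_met c (?x A) (?u A) (?u A) < 0" using ca[OF AB(1)] by (simp add: causal_dir_def)
    have all: "timelike_dir c (?x r) (?u r)" if r: "r \<in> {A..B'}" for r
      using geodesic_norm_const[OF geo r AB(1)] neg ca[OF r] unfolding mt[OF r] mt[OF AB(1)] by (simp add: timelike_dir_def causal_dir_def)
    have "coord_curve timelike_dir c B ?x ?u A B'" unfolding coord_curve_def
    proof (intro conjI ballI th(1) all)
      have "continuous_on {A..B'} \<theta>" using th(5) by (rule DERIV_continuous_on)
      then show "continuous_on {A..B'} ?u" by (rule continuous_on_compose2[OF cu]) (use th(4) in auto)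
      fix r assume r: "r \<in> {A..B'}"
      show "?x r \<in> B" by (rule d(4)[OF th(4)[OF r]])
      show "(?x has_vector_derivative ?u r) (at r within {A..B'})"
        using chain[OF d(6)[OF th(4)[OF r]] r] by (simp add: u_def)
    qed
    then show False by (rule notim) (use th in auto)
  qed
  have "null_vec M (cinv c (?x A)) (lift c (cinv c (?x A)) (?u A)) \<and> future_vec M (cinv c (?x A)) (lift c (cinv c (?x A)) (?u A))"
    using null_future_coord[OF lift_tangent[OF ch(1)[OF AB(1)]] ch(1)[OF AB(1)]] null ca[OF AB(1)]
    by (simp add: lift_self[OF ch(1)[OF AB(1)]] ch(2)[OF AB(1)])
  then have "null_geo (\<lambda>r. cinv c (?x r)) (\<lambda>r. lift c (cinv c (?x r)) (?u r)) A B'"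
    using null_geoI[OF th(1) geo AB(1)] by blast
  then show ?thesis using th(2,3) s(2-5) cinv_cmap[OF gd(1)]
    by (intro exI[of _ "\<lambda>r. cinv c (?x r)"] exI[of _ "\<lambda>r. lift c (cinv c (?x r)) (?u r)"] exI[of _ A] exI[of _ B']) simp
qed

text \<open>By push-up no part of the chain is chronological when the whole is not. Each link is
  therefore a null geodesic, and consecutive ones join without a corner.\<close>

lemma causal_rigid_strict:
  assumes "(chart_seg causal_dir)\<^sup>+\<^sup>+ x y" "\<not> chron M x y"
  shows "\<exists>\<gamma> w a b. null_geo \<gamma> w a b \<and> \<gamma> a = x \<and> \<gamma> b = y"
  using assms
proof (induction rule: tranclp_induct)
  case (base y)
  then show ?case by (rule chart_seg_rigid)
next
  case (step y z)
  have yz: "causal M y z" using step.hyps(2) unfolding causal_chart_seg by blast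
  have xy: "causal M x y" using step.hyps(1) unfolding causal_chart_seg by (rule tranclp_into_rtranclp)
  have "\<not> chron M x y" using step.prems push_right yz by blast
  then obtain \<gamma> w a b where g: "null_geo \<gamma> w a b" "\<gamma> a = x" "\<gamma> b = y" using step.IH by blast
  have "\<not> chron M y z" using step.prems push_left xy by blast
  then obtain \<delta> v a' b' where h: "null_geo \<delta> v a' b'" "\<delta> a' = y" "\<delta> b' = z" using chart_seg_rigid[OF step.hyps(2)] by blast
  have jn: "\<gamma> b = \<delta> a'" "\<not> chron M (\<gamma> a) (\<delta> b')" using g h step.prems by auto
  obtain \<eta> z' e k where
    j: "null_geo \<eta> z' e b'" "e < a'" "k * (e - a') + b = a" "\<And>t. t \<in> {a'..b'} \<Longrightarrow> \<eta> t = \<delta> t \<and> z' t = v t"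
    "\<And>t. t \<in> {e..a'} \<Longrightarrow> \<eta> t = \<gamma> (k * (t - a') + b) \<and> z' t = (\<lambda>c. k *\<^sub>R w (k * (t - a') + b) c)"
    by (rule null_geo_join[OF g(1) h(1) jn]) (rule that)
  have "\<eta> e = x" using j(2,3,5) g(2) by auto
  moreover have "\<eta> b' = z" using j(4)[of b'] h(3) null_geoD(1)[OF h(1)] by auto
  ultimately show ?case using j(1) by blast
qed

section \<open>Monotonicity of local time functions\<close>

lemma C1_time_increasing:
  assumes g: "good_region c B T \<xi>" and ab: "a < b" and C: "C1_curve M \<gamma> w {a..b}"
    and P: "\<And>t. t \<in> {a..b} \<Longrightarrow> causal_vec M (\<gamma> t) (w t) \<and> future_vec M (\<gamma> t) (w t)"
    and V: "\<And>t. t \<in> {a..b} \<Longrightarrow> \<gamma> t \<in> cdom c \<and> cmap c (\<gamma> t) \<in> B"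
  shows "\<xi> \<bullet> cmap c (\<gamma> a) < \<xi> \<bullet> cmap c (\<gamma> b)"
proof -
  note gd = good_regionD[OF g] and C' = C[unfolded C1_curve_def has_velocity_def o_def]
  have ch: "c \<in> charts_at M (\<gamma> t)" if "t \<in> {a..b}" for t using V[OF that] gd(1) by (blast intro: charts_atI)
  have D: "((\<lambda>t. \<xi> \<bullet> cmap c (\<gamma> t)) has_real_derivative \<xi> \<bullet> w t c) (at t within {a..b})" if t: "t \<in> {a..b}" for t
  proof -
    have "((\<lambda>t. cmap c (\<gamma> t)) has_vector_derivative w t c) (at t within {a..b})" using C' t ch[OF t] by blast
    from bounded_linear.has_vector_derivative[OF bounded_linear_inner_right this]
    show ?thesis by (simp add: has_real_derivative_iff_has_vector_derivative)
  qed
  have pos: "0 < \<xi> \<bullet> w t c" if t: "t \<in> {a..b}" for t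
  proof -
    have "w t \<in> tangent_space M (\<gamma> t)" using C' t by blast
    then have "causal_dir c (cmap c (\<gamma> t)) (w t c)" using causal_dir_coord[OF _ ch[OF t]] P[OF t] by blast
    then show ?thesis using gd(5) V[OF t] by blast
  qed
  show ?thesis
  proof (rule DERIV_pos_imp_increasing_open[OF ab])
    show "continuous_on {a..b} (\<lambda>t. \<xi> \<bullet> cmap c (\<gamma> t))" using D by (rule DERIV_continuous_on)
    fix t assume t: "a < t" "t < b"
    then have "((\<lambda>t. \<xi> \<bullet> cmap c (\<gamma> t)) has_real_derivative \<xi> \<bullet> w t c) (at t)"
      using D[of t] at_within_Icc_at[of a t b] by auto
    then show "\<exists>y. ((\<lambda>t. \<xi> \<bullet> cmap c (\<gamma> t)) has_real_derivative y) (at t) \<and> 0 < y" using pos[of t] t by auto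
  qed
qed

lemma future_curve_time_increasing:
  assumes g: "good_region c B T \<xi>" and C: "future_curve M (causal_vec M) \<gamma> a b"
    and V: "\<gamma> ` {a..b} \<subseteq> {p \<in> cdom c. cmap c p \<in> B}"
  shows "\<xi> \<bullet> cmap c (\<gamma> a) < \<xi> \<bullet> cmap c (\<gamma> b)"
proof -
  obtain k :: nat and s where s: "0 < k" "s 0 = a" "s k = b"
    "\<And>i. i < k \<Longrightarrow> s i < s (Suc i)"
    "\<And>i. i < k \<Longrightarrow> \<exists>w. C1_curve M \<gamma> w {s i..s (Suc i)} \<and> (\<forall>t \<in> {s i..s (Suc i)}. causal_vec M (\<gamma> t) (w t) \<and> future_vec M (\<gamma> t) (w t))"
    using C unfolding future_curve_def by metis
  have mono: "i \<le> j \<Longrightarrow> j \<le> k \<Longrightarrow> s i \<le> s j" for i j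
  proof (induction j)
    case (Suc j)
    then show ?case using s(4)[of j] by (cases "i = Suc j") auto
  qed simp
  have one: "\<xi> \<bullet> cmap c (\<gamma> (s i)) < \<xi> \<bullet> cmap c (\<gamma> (s (Suc i)))" if i: "i < k" for i
  proof -
    obtain w where w: "C1_curve M \<gamma> w {s i..s (Suc i)}" "\<forall>t \<in> {s i..s (Suc i)}. causal_vec M (\<gamma> t) (w t) \<and> future_vec M (\<gamma> t) (w t)"
      using s(5)[OF i] by blast
    have "{s i..s (Suc i)} \<subseteq> {a..b}" using mono[of 0 i] mono[of "Suc i" k] i s(2,3) by auto
    then show ?thesis using C1_time_increasing[OF g s(4)[OF i] w(1)] w(2) V by blast
  qed
  have "i < k \<Longrightarrow> \<xi> \<bullet> cmap c (\<gamma> (s 0)) < \<xi> \<bullet> cmap c (\<gamma> (s (Suc i)))" for i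
  proof (induction i)
    case (Suc i)
    then show ?case using one[of "Suc i"] by simp
  qed (use one in auto)
  from this[of "k - 1"] show ?thesis using s by simp
qed

end

section \<open>Generators of the achronal boundary\<close>

locale causal_spacetime = spacetime_locale M for M :: "('m::{t2_space, second_countable_topology}, 'n::finite) spacetime" +
  assumes strongly_causal: "strongly_causal M" and causally_closed: "causally_closed M"
begin

text \<open>Along the first bit of a loop the local time function \<open>\<xi>\<close> strictly
  increases; strong causality confines the return to the same region, where \<open>\<xi>\<close>
  would have to increase again.\<close>

lemma no_causal_loop: "\<not> (chart_seg causal_dir)\<^sup>+\<^sup>+ x x"
proof
  assume "(chart_seg causal_dir)\<^sup>+\<^sup>+ x x"
  then obtain y where y: "chart_seg causal_dir x y" "(chart_seg causal_dir)\<^sup>*\<^sup>* y x" by (auto dest: tranclpD)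
  obtain c B T \<xi> \<alpha> \<beta> a b where s: "good_region c B T \<xi>" "x \<in> cdom c" "y \<in> cdom c"
     "\<alpha> a = cmap c x" "\<alpha> b = cmap c y" "coord_curve causal_dir c B \<alpha> \<beta> a b" using y(1) unfolding chart_seg_def by blast
  note gd = good_regionD[OF s(1)] and d = coord_curveD[OF s(6)]
  define V where "V = {p \<in> cdom c. cmap c p \<in> B}"
  have "open (cdom c \<inter> cmap c -` B)" by (rule continuous_open_preimage[OF cont_cmap[OF gd(1)] open_cdom[OF gd(1)] gd(2)])
  then have "open V" unfolding V_def by (simp add: Collect_conj_eq vimage_def)
  moreover have "x \<in> V" using s d(1) d(4)[of a] by (auto simp: V_def)
  ultimately obtain U where U: "open U" "x \<in> U" "U \<subseteq> V" "\<And>p q. p \<in> U \<Longrightarrow> q \<in> U \<Longrightarrow> causal M p q \<Longrightarrow> causal_in M U p q"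
    using strongly_causal unfolding strongly_causal_def by meson
  have im: "\<alpha> t \<in> img c" if "t \<in> {a..b}" for t using d(4)[OF that] gd(6) by blast
  have "continuous_on {a..b} (\<lambda>t. cinv c (\<alpha> t))"
    by (rule continuous_on_compose2[OF cont_cinv[OF gd(1)] d(3)]) (use im in blast)
  then have "((\<lambda>t. cinv c (\<alpha> t)) \<longlongrightarrow> cinv c (\<alpha> a)) (at a within {a..b})" using d(1) by (simp add: continuous_on_def)
  then have "\<forall>\<^sub>F t in at a within {a..b}. cinv c (\<alpha> t) \<in> U"
    by (rule topological_tendstoD) (use U(1,2) s cinv_cmap[OF gd(1)] in auto)
  then obtain e where e: "e > 0" "\<forall>t\<in>{a..b}. t \<noteq> a \<and> dist t a < e \<longrightarrow> cinv c (\<alpha> t) \<in> U"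
    unfolding eventually_at by blast
  \<comment> \<open>A parameter so early that the point reached is still in the neighbourhood
    \<open>U\<close>.\<close>
  define t where "t = min b (a + e / 2)"
  have t: "a < t" "t \<le> b" "t \<in> {a..b}" "dist t a < e" using e(1) d(1) by (auto simp: t_def dist_real_def)
  define x' where "x' = cinv c (\<alpha> t)"
  have x'U: "x' \<in> U" using e(2) t by (auto simp: x'_def)
  have cx': "cmap c x' = \<alpha> t" unfolding x'_def by (rule cmap_cinv[OF gd(1) im[OF t(3)]])
  have C1: "coord_curve causal_dir c B \<alpha> \<beta> a t" by (rule coord_curve_sub[OF s(6)]) (use t in auto)
  have "future_curve M (causal_vec M) (\<lambda>t. cinv c (\<alpha> t)) a t \<and> (\<lambda>t. cinv c (\<alpha> t)) ` {a..t} \<subseteq> V"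
  proof
    show "(\<lambda>t. cinv c (\<alpha> t)) ` {a..t} \<subseteq> V"
    proof (rule image_subsetI)
      fix r assume "r \<in> {a..t}"
      then have r: "r \<in> {a..b}" using t by auto
      show "cinv c (\<alpha> r) \<in> V" unfolding V_def
        using cinv_in[OF gd(1) im[OF r]] cmap_cinv[OF gd(1) im[OF r]] d(4)[OF r] by simp
    qed
    show "future_curve M (causal_vec M) (\<lambda>t. cinv c (\<alpha> t)) a t"
    proof (rule future_curve_single[OF t(1) coord_curve_velocity[OF gd(1,3) C1]])
      fix r assume "r \<in> {a..t}"
      then have r: "r \<in> {a..b}" using t by auto
      have "c \<in> charts_at M (cinv c (\<alpha> r))" using cinv_in[OF gd(1) im[OF r]] gd(1) by auto
      from causal_dir_coord[OF lift_tangent[OF this] this] show "causal_vec M (cinv c (\<alpha> r)) (lift c (cinv c (\<alpha> r)) (\<beta> r)) \<and>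
          future_vec M (cinv c (\<alpha> r)) (lift c (cinv c (\<alpha> r)) (\<beta> r))"
        using d(5)[OF r] lift_self[OF \<open>c \<in> charts_at M (cinv c (\<alpha> r))\<close>] cmap_cinv[OF gd(1) im[OF r]] by simp
    qed
  qed
  from future_curve_time_increasing[OF s(1) conjunct1[OF this]] conjunct2[OF this]
  have less: "\<xi> \<bullet> cmap c x < \<xi> \<bullet> \<alpha> t"
    using cmap_cinv[OF gd(1) im[OF t(3)]] cinv_cmap[OF gd(1) s(2)] s(4) unfolding V_def by simp
  have "causal M x' x"
  proof (cases "t = b")
    case True
    then show ?thesis using y(2) s(3,5) cinv_cmap[OF gd(1)] by (simp add: x'_def causal_chart_seg)
  next
    case False
    then have "coord_curve causal_dir c B \<alpha> \<beta> t b" using t by (intro coord_curve_sub[OF s(6)]) auto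
    from chart_segI[OF s(1) this] have "chart_seg causal_dir x' y" using s(3,5) cinv_cmap[OF gd(1)] by (simp add: x'_def)
    then show ?thesis using y(2) by (simp add: causal_chart_seg)
  qed
  \<comment> \<open>The actual return may leave the chart; strong causality replaces it by a curve
    inside \<open>U\<close>, on which \<open>\<xi>\<close> is defined and increasing.\<close>
  from U(4)[OF x'U U(2) this] have "x' = x \<or> \<xi> \<bullet> cmap c x' < \<xi> \<bullet> cmap c x"
  proof (unfold causal_in_def, elim disjE)
    assume "\<exists>\<gamma> a b. future_curve M (causal_vec M) \<gamma> a b \<and> \<gamma> a = x' \<and> \<gamma> b = x \<and> \<gamma> ` {a..b} \<subseteq> U"
    then obtain \<gamma> a b where g: "future_curve M (causal_vec M) \<gamma> a b" "\<gamma> a = x'" "\<gamma> b = x" "\<gamma> ` {a..b} \<subseteq> U" by blast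
    have "\<gamma> ` {a..b} \<subseteq> {p \<in> cdom c. cmap c p \<in> B}" using g(4) U(3) unfolding V_def by blast
    from future_curve_time_increasing[OF s(1) g(1) this] show ?thesis using g by simp
  qed auto
  then show False using less cx' by auto
qed

lemma causal_antisym: "causal M x y \<Longrightarrow> causal M y x \<Longrightarrow> x = y"
  unfolding causal_chart_seg using no_causal_loop by (metis rtranclpD tranclp_rtranclp_tranclp)

lemma null_geo_distinct: "null_geo \<gamma> w a b \<Longrightarrow> \<gamma> a \<noteq> \<gamma> b"
  using null_geo_causal_strict no_causal_loop by metis

lemma causal_rigid:
  assumes "causal M x y" "x \<noteq> y" "\<not> chron M x y"
  obtains \<gamma> w a b where "null_geo \<gamma> w a b" "\<gamma> a = x" "\<gamma> b = y"
proof -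
  have "(chart_seg causal_dir)\<^sup>+\<^sup>+ x y" using assms(1,2) unfolding causal_chart_seg by (auto dest: rtranclpD)
  from causal_rigid_strict[OF this assms(3)] show ?thesis using that by blast
qed

lemma causal_limit:
  assumes "p \<longlonglongrightarrow> x" "q \<longlonglongrightarrow> y" "\<And>n. causal M (p n) (q n)" shows "causal M x y"
proof -
  have "(\<lambda>n. (p n, q n)) \<longlonglongrightarrow> (x, y)" by (intro tendsto_intros assms)
  then have "(x, y) \<in> {(x, y). causal M x y}"
    using causally_closed unfolding causally_closed_def by (rule closed_sequentially[rotated -1]) (use assms(3) in auto)
  then show ?thesis by simp
qed

end

context spacetime_locale
begin

lemma chron_split:
  assumes "chron M x y" obtains z where "chron M x z" "chron M z y"
proof -
  obtain z where z: "chart_seg timelike_dir x z" "(chart_seg timelike_dir)\<^sup>*\<^sup>* z y" using assms unfolding chron_chart_seg by (auto dest: tranclpD)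
  obtain c B T \<xi> \<alpha> \<beta> a b where s: "good_region c B T \<xi>" "x \<in> cdom c" "z \<in> cdom c"
     "\<alpha> a = cmap c x" "\<alpha> b = cmap c z" "coord_curve timelike_dir c B \<alpha> \<beta> a b" using z(1) unfolding chart_seg_def by blast
  note gd = good_regionD[OF s(1)] and d = coord_curveD[OF s(6)]
  define m where "m = (a + b) / 2"
  have m: "a < m" "m < b" using d(1) by (auto simp: m_def)
  have "chart_seg timelike_dir (cinv c (\<alpha> a)) (cinv c (\<alpha> m))" "chart_seg timelike_dir (cinv c (\<alpha> m)) (cinv c (\<alpha> b))"
    using m by (auto intro!: chart_segI[OF s(1)] coord_curve_sub[OF s(6)])
  then have "chart_seg timelike_dir x (cinv c (\<alpha> m))" "chart_seg timelike_dir (cinv c (\<alpha> m)) z" using s cinv_cmap[OF gd(1)] by auto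
  then show ?thesis using that z(2) unfolding chron_chart_seg
    by (meson rtranclp_into_tranclp2 tranclp.r_into_trancl)
qed

text \<open>An intermediate point decouples the ends: openness is used separately before and after
  it.\<close>

lemma chron_open:
  assumes "chron M x y" obtains U V where "open U" "x \<in> U" "open V" "y \<in> V" "\<And>p q. p \<in> U \<Longrightarrow> q \<in> V \<Longrightarrow> chron M p q"
proof -
  obtain z where z: "chron M x z" "chron M z y" by (rule chron_split[OF assms])
  obtain U where U: "open U" "x \<in> U" "\<forall>p\<in>U. chron M p z" using chron_open_left[OF z(1)] by blast
  obtain V where V: "open V" "y \<in> V" "\<forall>q\<in>V. chron M z q" using chron_open_right[OF z(2)] by blast
  show ?thesis by (rule that[OF U(1,2) V(1,2)]) (use U V chron_trans in blast)
qed

lemma timelike_dir_cone_rev: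
  assumes "c \<in> charts M" "y \<in> img c" "coord_met c y u u \<le> 0" "coord_met c y u W < 0" "timelike_dir c y W"
  shows "causal_dir c y u"
proof -
  have "W \<bullet> (G c y *v coord_orient c y) < 0" using assms(5) by (simp add: timelike_dir_def coord_met_def)
  then show ?thesis
    using time_cone[OF G_lorentz[OF assms(1,2)], of W "coord_orient c y" u] coord_orient_timelike[OF assms(1,2)] assms
    by (simp add: causal_dir_def timelike_dir_def coord_met_def)
qed

end

context causal_spacetime
begin

text \<open>Limits of points in the chronological future of \<open>A\<close> are causally after
  \<open>A\<close> by compactness of \<open>A\<close> and causal closedness; conversely a small
  chronological step from a point causally after \<open>A\<close> enters that future. Later
  arguments use only this description of the boundary.\<close>

lemma hypersurface_iff:
  assumes A: "compact A"
  shows "x \<in> hypersurface M A \<longleftrightarrow> (\<exists>a\<in>A. causal M a x) \<and> \<not> (\<exists>a\<in>A. chron M a x)"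
proof -
  have H: "hypersurface M A = closure (chron_future M A) - chron_future M A"
    unfolding hypersurface_def frontier_def using interior_open[OF open_chron_future] by simp
  show ?thesis
  proof
    assume x: "x \<in> hypersurface M A"
    then have "x \<in> closure (chron_future M A)" unfolding H by blast
    then obtain y where y: "\<And>n. y n \<in> chron_future M A" "y \<longlonglongrightarrow> x" unfolding closure_sequential by blast
    then have "\<forall>n. \<exists>a\<in>A. chron M a (y n)" unfolding chron_future_def by blast
    then obtain a where a: "\<And>n. a n \<in> A" "\<And>n. chron M (a n) (y n)" by metis
    obtain a0 r where r: "a0 \<in> A" "strict_mono r" "(a \<circ> r) \<longlonglongrightarrow> a0"
      using compact_imp_seq_compact[OF A] a(1) unfolding seq_compact_def by blast
    have "causal M a0 x"
      by (rule causal_limit[OF r(3) LIMSEQ_subseq_LIMSEQ[OF y(2) r(2)]]) (use a(2) chron_causal in auto)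
    then show "(\<exists>a\<in>A. causal M a x) \<and> \<not> (\<exists>a\<in>A. chron M a x)"
      using x r(1) unfolding H chron_future_def by blast
  next
    assume x: "(\<exists>a\<in>A. causal M a x) \<and> \<not> (\<exists>a\<in>A. chron M a x)"
    then obtain a where a: "a \<in> A" "causal M a x" by blast
    have "x \<in> closure (chron_future M A)"
    proof (rule ccontr)
      assume "x \<notin> closure (chron_future M A)"
      then have "open (- closure (chron_future M A))" "x \<in> - closure (chron_future M A)" by auto
      then obtain y where y: "y \<in> - closure (chron_future M A)" "chron M x y" by (rule chron_near)
      then have "y \<in> chron_future M A" using push_left[OF a(2) y(2)] a(1) by (auto simp: chron_future_def)
      then show False using y(1) closure_subset by blast
    qed
    then show "x \<in> hypersurface M A" using x unfolding H chron_future_def by blast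
  qed
qed

lemma hypersurfaceD:
  assumes "compact A" "x \<in> hypersurface M A"
  shows "\<exists>a\<in>A. causal M a x" "a \<in> A \<Longrightarrow> \<not> chron M a x"
  using assms hypersurface_iff by blast+

lemma hypersurface_achronal:
  assumes A: "compact A" and x: "x \<in> hypersurface M A" "y \<in> hypersurface M A" shows "\<not> chron M x y"
  using hypersurfaceD[OF A x(1)] hypersurfaceD(2)[OF A x(2)] push_left by blast

lemma regularD:
  assumes A: "compact A" and x: "x \<in> regular_part M (hypersurface M A)"
  shows "x \<in> hypersurface M A" "\<exists>y\<in>hypersurface M A. causal M x y \<and> y \<noteq> x" "\<exists>y\<in>hypersurface M A. causal M y x \<and> y \<noteq> x"
  using x unfolding regular_part_def initial_points_def final_points_def by auto

text \<open>A regular point is not final, so achronality and rigidity give a null geodesic from it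
  to a later point of the boundary. All uniqueness statements at \<open>x\<close> are read off from
  this continuation.\<close>

lemma regular_generator:
  assumes A: "compact A" and x: "x \<in> regular_part M (hypersurface M A)"
  obtains \<sigma> u s0 s1 where "null_geo \<sigma> u s0 s1" "\<sigma> s0 = x" "\<sigma> s1 \<in> hypersurface M A"
proof -
  obtain y where y: "y \<in> hypersurface M A" "causal M x y" "y \<noteq> x" using regularD(2)[OF A x] by blast
  have "\<not> chron M x y" by (rule hypersurface_achronal[OF A regularD(1)[OF A x] y(1)])
  then obtain \<gamma> w a b where "null_geo \<gamma> w a b" "\<gamma> a = x" "\<gamma> b = y" using causal_rigid[OF y(2)] y(3) by metis
  then show ?thesis using that y(1) by blast
qed

text \<open>Rigidity gives a null geodesic from \<open>p\<close>, and the later point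
  \<open>\<sigma> s1\<close>, still not chronologically after \<open>p\<close>, forbids a corner at
  \<open>\<sigma> s0\<close>.\<close>

lemma backward_extension:
  assumes s: "null_geo \<sigma> u s0 s1" and p: "causal M p (\<sigma> s0)" "p \<noteq> \<sigma> s0" "\<not> chron M p (\<sigma> s1)"
  obtains \<eta> z e where "null_geo \<eta> z e s1" "e < s0" "\<eta> e = p" "\<And>t. t \<in> {s0..s1} \<Longrightarrow> \<eta> t = \<sigma> t \<and> z t = u t"
proof -
  have c: "causal M (\<sigma> s0) (\<sigma> s1)" by (rule null_geo_causal[OF s]) (use null_geoD(1)[OF s] in auto)
  then have "\<not> chron M p (\<sigma> s0)" using p(3) push_right by blast
  then obtain \<gamma> w a b where g: "null_geo \<gamma> w a b" "\<gamma> a = p" "\<gamma> b = \<sigma> s0" by (rule causal_rigid[OF p(1,2)])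
  have nc: "\<not> chron M (\<gamma> a) (\<sigma> s1)" using g p by simp
  obtain \<eta> z e k where j: "k > 0" "null_geo \<eta> z e s1" "e < s0" "k * (e - s0) + b = a"
    "\<And>t. t \<in> {s0..s1} \<Longrightarrow> \<eta> t = \<sigma> t \<and> z t = u t"
    "\<And>t. t \<in> {e..s0} \<Longrightarrow> \<eta> t = \<gamma> (k * (t - s0) + b) \<and> z t = (\<lambda>c. k *\<^sub>R w (k * (t - s0) + b) c)"
    by (rule null_geo_join[OF g(1) s g(3) nc]) (rule that)
  have "\<eta> e = p" using j(3,4) j(6)[of e] g(2) by simp
  then show ?thesis using that j by blast
qed

lemma backward_unique:
  assumes n: "null_geo \<eta> z e s1" "null_geo \<eta>' z' e' s1" and e: "e \<le> e'" "e' \<le> s0" "s0 \<le> s1"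
    and a: "\<eta> s0 = \<eta>' s0" "z s0 = z' s0"
  shows "\<eta> e' = \<eta>' e' \<and> z e' = z' e'"
proof (rule geodesic_unique[of \<eta> z e' s1 \<eta>' z' s0])
  show "geodesic M \<eta> z {e'..s1}" by (rule geodesic_subset[OF null_geoD(2)[OF n(1)]]) (use e in auto)
  show "geodesic M \<eta>' z' {e'..s1}" by (rule null_geoD(2)[OF n(2)])
qed (use a e in auto)

text \<open>Past points of the horizon that are not chronologically related to a later point of a
  generator all lie on the backward extension of that generator.\<close>

lemma generator_total:
  assumes s: "null_geo \<sigma> u s0 s1" and p: "causal M p (\<sigma> s0)" "\<not> chron M p (\<sigma> s1)"
    and q: "causal M q (\<sigma> s0)" "\<not> chron M q (\<sigma> s1)"
  shows "causal M p q \<or> causal M q p"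
proof (cases "p = \<sigma> s0 \<or> q = \<sigma> s0")
  case True then show ?thesis using p q by auto
next
  case False
  have s01: "s0 \<in> {s0..s1}" "s0 \<le> s1" using null_geoD(1)[OF s] by auto
  obtain \<eta> z e where h: "null_geo \<eta> z e s1" "e < s0" "\<eta> e = p" "\<And>t. t \<in> {s0..s1} \<Longrightarrow> \<eta> t = \<sigma> t \<and> z t = u t"
    using backward_extension[OF s p(1) _ p(2)] False by metis
  obtain \<eta>' z' e' where h': "null_geo \<eta>' z' e' s1" "e' < s0" "\<eta>' e' = q" "\<And>t. t \<in> {s0..s1} \<Longrightarrow> \<eta>' t = \<sigma> t \<and> z' t = u t"
    using backward_extension[OF s q(1) _ q(2)] False by metis
  have a: "\<eta> s0 = \<eta>' s0" "z s0 = z' s0" using h(4)[OF s01(1)] h'(4)[OF s01(1)] by auto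
  show ?thesis
  proof (cases "e \<le> e'")
    case True
    then have "\<eta> e' = q" using backward_unique[OF h(1) h'(1) True _ s01(2) a] h'(2,3) by simp
    then show ?thesis using null_geo_causal[OF h(1), of e e'] True h'(2) h(3) s01(2) by auto
  next
    case False
    then have "\<eta>' e = p" using backward_unique[OF h'(1) h(1) _ _ s01(2)] a h(2,3) by simp
    then show ?thesis using null_geo_causal[OF h'(1), of e' e] False h(2) h'(3) s01(2) by auto
  qed
qed

lemma finite_total_min:
  assumes "finite F" "F \<noteq> {}" "\<And>p q. p \<in> F \<Longrightarrow> q \<in> F \<Longrightarrow> causal M p q \<or> causal M q p"
  shows "\<exists>m\<in>F. \<forall>q\<in>F. causal M m q"
  using assms
proof (induction rule: finite_ne_induct)
  case (insert x F)
  then obtain m where m: "m \<in> F" "\<forall>q\<in>F. causal M m q" by auto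
  then show ?case using insert.prems[of x m] causal_trans by (metis causal_refl insertCI insertE)
qed auto

lemma closed_causal_past: "closed {p. causal M p q}" "closed {q. causal M p q}"
proof -
  have c: "closed {(x, y). causal M x y}" using causally_closed unfolding causally_closed_def .
  have "closed ((\<lambda>p. (p, q)) -` {(x, y). causal M x y})" "closed ((\<lambda>q. (p, q)) -` {(x, y). causal M x y})"
    by (intro closed_vimage c continuous_intros)+
  then show "closed {p. causal M p q}" "closed {q. causal M p q}" by (simp_all add: vimage_def)
qed

text \<open>The points of \<open>A\<close> below \<open>x\<close> form a compact set, totally
  ordered because they lie on one backward extension; closed pasts then give a least element by
  compactness.\<close>

lemma past_min_exists:
  assumes A: "compact A" and x: "x \<in> regular_part M (hypersurface M A)"
  shows "\<exists>p\<in>A. causal M p x \<and> (\<forall>q\<in>A. causal M q x \<longrightarrow> causal M p q)"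
proof (rule ccontr)
  assume no: "\<not> ?thesis"
  obtain \<sigma> u s0 s1 where s: "null_geo \<sigma> u s0 s1" "\<sigma> s0 = x" "\<sigma> s1 \<in> hypersurface M A" by (rule regular_generator[OF A x])
  define J where "J = A \<inter> {p. causal M p x}"
  have J: "compact J" unfolding J_def by (rule compact_Int_closed[OF A closed_causal_past(1)])
  have tot: "causal M p q \<or> causal M q p" if "p \<in> J" "q \<in> J" for p q
    using generator_total[OF s(1), of p q] that s(2) hypersurfaceD(2)[OF A s(3)] unfolding J_def by blast
  have ne: "J \<noteq> {}" using hypersurfaceD(1)[OF A regularD(1)[OF A x]] unfolding J_def by blast
  \<comment> \<open>Without a least element every point fails to precede some other, which gives an
    open cover. The least element of the index set of a finite subcover lies in no member of
    it.\<close>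
  have "J \<subseteq> (\<Union>q\<in>J. - {p. causal M p q})"
  proof
    fix p assume "p \<in> J"
    then show "p \<in> (\<Union>q\<in>J. - {p. causal M p q})" using no unfolding J_def by blast
  qed
  then obtain F where F: "F \<subseteq> J" "finite F" "J \<subseteq> (\<Union>q\<in>F. - {p. causal M p q})"
    by (rule compactE_image[OF J, rotated]) (use closed_causal_past(1) in auto)
  have "F \<noteq> {}" using F(3) ne by auto
  then obtain m where m: "m \<in> F" "\<forall>q\<in>F. causal M m q" using finite_total_min[OF F(2)] tot F(1) by (meson subset_iff)
  then show False using F by blast
qed

lemma past_min_eq:
  assumes "p \<in> A" "causal M p x" "\<And>q. q \<in> A \<Longrightarrow> causal M q x \<Longrightarrow> causal M p q"
  shows "past_min M A x = p"
  unfolding past_min_def by (rule the_equality) (use assms causal_antisym in blast)+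

lemma past_min:
  assumes A: "compact A" and x: "x \<in> regular_part M (hypersurface M A)"
  shows "past_min M A x \<in> A" "causal M (past_min M A x) x" "past_min M A x \<noteq> x"
    "q \<in> A \<Longrightarrow> causal M q x \<Longrightarrow> causal M (past_min M A x) q"
proof -
  obtain p where p: "p \<in> A" "causal M p x" "\<And>q. q \<in> A \<Longrightarrow> causal M q x \<Longrightarrow> causal M p q"
    using past_min_exists[OF A x] by blast
  have e: "past_min M A x = p" by (rule past_min_eq) (use p in auto)
  show "past_min M A x \<in> A" "causal M (past_min M A x) x" "q \<in> A \<Longrightarrow> causal M q x \<Longrightarrow> causal M (past_min M A x) q"
    unfolding e using p by auto
  obtain y where y: "y \<in> hypersurface M A" "causal M y x" "y \<noteq> x" using regularD(3)[OF A x] by blast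
  obtain a where a: "a \<in> A" "causal M a y" using hypersurfaceD(1)[OF A y(1)] by blast
  \<comment> \<open>Were \<open>x\<close> itself the minimum, an earlier boundary point
    \<open>y\<close> and a source point \<open>a\<close> below it would give x <= a <= y <=
    x.\<close>
  show "past_min M A x \<noteq> x" unfolding e
  proof
    assume "p = x"
    then have "causal M x y" using p(3)[OF a(1) causal_trans[OF a(2) y(2)]] a(2) causal_trans by blast
    then show False using causal_antisym y by blast
  qed
qed

section \<open>The natural gauge\<close>

text \<open>The condition under the \<open>THE\<close> of \<open>gauge_vec\<close>, with the base
  point as a separate argument.\<close>

definition gauge_spec :: "'m set \<Rightarrow> ('m \<Rightarrow> ('m, 'n) tvector) \<Rightarrow> 'm \<Rightarrow> 'm \<Rightarrow> ('m, 'n) tvector \<Rightarrow> bool" where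
  "gauge_spec A W p x v \<longleftrightarrow> v \<in> normal_space M (initial_points M (hypersurface M A)) p \<and>
     met M p v v = 0 \<and> met M p v (W p) < 0 \<and> is_exp M p v x"

lemma field_timelike_dir:
  assumes "gauge_field M A W" "c \<in> charts_at M p" shows "timelike_dir c (cmap c p) (W p c)" "W p \<in> tangent_space M p"
proof -
  show "W p \<in> tangent_space M p" using assms(1) unfolding gauge_field_def timelike_vec_def by blast
  then show "timelike_dir c (cmap c p) (W p c)" using assms timelike_dir_coord[OF _ assms(2), of "W p"] unfolding gauge_field_def by blast
qed

text \<open>The gauge field and the time orientation lie in the same cone, so either of them decides
  whether a null vector is future-directed and nonzero.\<close>

lemma null_future_field:
  assumes W: "gauge_field M A W" and v: "v \<in> tangent_space M p"
  shows "met M p v v = 0 \<and> met M p v (W p) < 0 \<longleftrightarrow> null_vec M p v \<and> future_vec M p v"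
proof -
  obtain c where c: "c \<in> charts_at M p" using charts_at_ex by blast
  then have i: "c \<in> charts M" "cmap c p \<in> img c" by auto
  note f = field_timelike_dir[OF W c]
  show ?thesis
    unfolding null_future_coord[OF v c] met_coord[OF v v c] met_coord[OF v f(2) c]
    using timelike_dir_cone_rev[OF i _ _ f(1), of "v c"] causal_dir_timelike_dir_neg[OF i _ f(1), of "v c"] by auto
qed

lemma gauge_spec_null_geo:
  assumes W: "gauge_field M A W" and g: "gauge_spec A W p x v"
  obtains \<gamma> w where "null_geo \<gamma> w 0 1" "\<gamma> 0 = p" "w 0 = v" "\<gamma> 1 = x"
proof -
  obtain \<gamma> w where e: "geodesic M \<gamma> w {0..1}" "\<gamma> 0 = p" "w 0 = v" "\<gamma> 1 = x"
    using g unfolding gauge_spec_def is_exp_def by blast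
  have "v \<in> tangent_space M p" using geodesicD(2)[OF e(1), of 0] e by simp
  then have "null_vec M p v \<and> future_vec M p v" using null_future_field[OF W, of v p] g unfolding gauge_spec_def by blast
  then have "null_geo \<gamma> w 0 1" using e by (intro null_geoI[where s = 0]) auto
  then show ?thesis using that e by blast
qed

lemma null_geo_gauge_spec:
  assumes A: "compact A" and W: "gauge_field M A W" and g: "null_geo \<gamma> w 0 1" and x: "\<gamma> 1 \<in> hypersurface M A"
  shows "gauge_spec A W (\<gamma> 0) (\<gamma> 1) (w 0)"
proof -
  have z: "0 \<in> {0..1::real}" by simp
  have v: "w 0 \<in> tangent_space M (\<gamma> 0)" by (rule geodesicD(2)[OF null_geoD(2)[OF g] z])
  have "met M (\<gamma> 0) (w 0) (w 0) = 0 \<and> met M (\<gamma> 0) (w 0) (W (\<gamma> 0)) < 0"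
    using null_future_field[OF W v] null_geoD(3,4)[OF g z] by blast
  moreover have "met M (\<gamma> 0) (w 0) u = 0" if "u \<in> tangent_of M (initial_points M (hypersurface M A)) (\<gamma> 0)" for u
    by (rule normal_generator[OF g that]) (use hypersurface_achronal[OF A _ x] in \<open>auto simp: initial_points_def\<close>)
  ultimately show ?thesis using v null_geoD(2)[OF g]
    unfolding gauge_spec_def normal_space_def is_exp_def by blast
qed

text \<open>Both candidate geodesics are prolonged by the generator leaving \<open>x\<close> and
  rescaled to its parameter. They then share position and velocity at \<open>x\<close>, hence
  coincide before it; reaching \<open>p\<close> at the same parameter forces equal scale
  factors.\<close>

lemma gauge_spec_unique:
  assumes A: "compact A" and W: "gauge_field M A W" and x: "x \<in> regular_part M (hypersurface M A)"
    and p: "p \<in> A" and v: "gauge_spec A W p x v" "gauge_spec A W p x v'"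
  shows "v = v'"
proof -
  obtain \<sigma> u s0 s1 where s: "null_geo \<sigma> u s0 s1" "\<sigma> s0 = x" "\<sigma> s1 \<in> hypersurface M A" by (rule regular_generator[OF A x])
  have s01: "s0 \<in> {s0..s1}" "s0 \<le> s1" using null_geoD(1)[OF s(1)] by auto
  have nc: "\<not> chron M p (\<sigma> s1)" by (rule hypersurfaceD(2)[OF A s(3) p])
  have ex: "\<exists>\<eta> z e k. k > 0 \<and> null_geo \<eta> z e s1 \<and> e < s0 \<and> k * (e - s0) + 1 = 0 \<and> \<eta> s0 = \<sigma> s0 \<and> z s0 = u s0 \<and>
      \<eta> e = p \<and> z e = (\<lambda>c. k *\<^sub>R v c)" if v: "gauge_spec A W p x v" for v
  proof -
    obtain \<gamma> w where g: "null_geo \<gamma> w 0 1" "\<gamma> 0 = p" "w 0 = v" "\<gamma> 1 = x" by (rule gauge_spec_null_geo[OF W v])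
    have a: "\<gamma> 1 = \<sigma> s0" "\<not> chron M (\<gamma> 0) (\<sigma> s1)" using g s nc by auto
    obtain \<eta> z e k where j: "k > 0" "null_geo \<eta> z e s1" "e < s0" "k * (e - s0) + 1 = 0"
      "\<And>t. t \<in> {s0..s1} \<Longrightarrow> \<eta> t = \<sigma> t \<and> z t = u t"
      "\<And>t. t \<in> {e..s0} \<Longrightarrow> \<eta> t = \<gamma> (k * (t - s0) + 1) \<and> z t = (\<lambda>c. k *\<^sub>R w (k * (t - s0) + 1) c)"
      by (rule null_geo_join[OF g(1) s(1) a]) (rule that)
    have "\<eta> e = p" "z e = (\<lambda>c. k *\<^sub>R v c)" using j(3,4) j(6)[of e] g by simp_all
    then show ?thesis using j(1-4) j(5)[OF s01(1)] by blast
  qed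
  obtain \<eta> z e k where h: "k > 0" "null_geo \<eta> z e s1" "e < s0" "k * (e - s0) + 1 = 0" "\<eta> s0 = \<sigma> s0" "z s0 = u s0"
    "\<eta> e = p" "z e = (\<lambda>c. k *\<^sub>R v c)" using ex[OF v(1)] by blast
  obtain \<eta>' z' e' k' where h': "k' > 0" "null_geo \<eta>' z' e' s1" "e' < s0" "k' * (e' - s0) + 1 = 0" "\<eta>' s0 = \<sigma> s0" "z' s0 = u s0"
    "\<eta>' e' = p" "z' e' = (\<lambda>c. k' *\<^sub>R v' c)" using ex[OF v(2)] by blast
  have aa: "\<eta> s0 = \<eta>' s0" "z s0 = z' s0" using h h' by auto
  \<comment> \<open>Reaching \<open>p\<close> at two different parameters would make the longer
    extension pass through \<open>p\<close> twice, a causal loop.\<close>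
  have "\<not> e < e'"
  proof
    assume l: "e < e'"
    then have "\<eta> e' = p" using backward_unique[OF h(2) h'(2) _ _ s01(2) aa] h'(3,7) by simp
    moreover have "null_geo \<eta> z e e'" by (rule null_geo_sub[OF h(2)]) (use l h'(3) s01 in auto)
    ultimately show False using null_geo_distinct h(7) by metis
  qed
  moreover have "\<not> e' < e"
  proof
    assume l: "e' < e"
    then have "\<eta>' e = p" using backward_unique[OF h'(2) h(2) _ _ s01(2) aa[symmetric]] h(3,7) by simp
    moreover have "null_geo \<eta>' z' e' e" by (rule null_geo_sub[OF h'(2)]) (use l h(3) s01 in auto)
    ultimately show False using null_geo_distinct h'(7) by metis
  qed
  ultimately have e: "e = e'" by simp
  have "(k - k') * (e - s0) = 0" using h(4) h'(4) unfolding e by (simp add: algebra_simps)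
  then have k: "k = k'" using h(3) by simp
  have "z e = z' e" using backward_unique[OF h(2) h'(2) _ _ s01(2) aa] h(3) e by simp
  then have "k *\<^sub>R v c = k *\<^sub>R v' c" for c using h(8) h'(8) e k by metis
  then show ?thesis using h(1) by auto
qed

lemma gauge_vec_eq:
  assumes A: "compact A" and W: "gauge_field M A W" and x: "x \<in> regular_part M (hypersurface M A)"
    and v: "gauge_spec A W (past_min M A x) x v"
  shows "gauge_vec M A W x = v"
  unfolding gauge_vec_def Let_def
proof (rule the_equality)
  show "v \<in> normal_space M (initial_points M (hypersurface M A)) (past_min M A x) \<and> met M (past_min M A x) v v = 0 \<and>
    met M (past_min M A x) v (W (past_min M A x)) < 0 \<and> is_exp M (past_min M A x) v x"
    using v unfolding gauge_spec_def .
  fix v' assume "v' \<in> normal_space M (initial_points M (hypersurface M A)) (past_min M A x) \<and> met M (past_min M A x) v' v' = 0 \<and>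
    met M (past_min M A x) v' (W (past_min M A x)) < 0 \<and> is_exp M (past_min M A x) v' x"
  then have "gauge_spec A W (past_min M A x) x v'" unfolding gauge_spec_def .
  then show "v' = v" using gauge_spec_unique[OF A W x past_min(1)[OF A x] _ v] by blast
qed

lemma gauge_vec_spec:
  assumes A: "compact A" and W: "gauge_field M A W" and x: "x \<in> regular_part M (hypersurface M A)"
  shows "gauge_spec A W (past_min M A x) x (gauge_vec M A W x)"
proof -
  let ?p = "past_min M A x"
  have "\<not> chron M ?p x" by (rule hypersurfaceD(2)[OF A regularD(1)[OF A x] past_min(1)[OF A x]])
  then obtain \<gamma> w a b where g: "null_geo \<gamma> w a b" "\<gamma> a = ?p" "\<gamma> b = x"
    by (rule causal_rigid[OF past_min(2,3)[OF A x]])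
  have "null_geo (\<lambda>t. \<gamma> ((b - a) * t + a)) (\<lambda>t c. (b - a) *\<^sub>R w ((b - a) * t + a) c) 0 1"
    by (rule null_geo_affine[OF g(1)]) (use null_geoD(1)[OF g(1)] in auto)
  from null_geo_gauge_spec[OF A W this] have "gauge_spec A W ?p x (\<lambda>c. (b - a) *\<^sub>R w a c)"
    using g regularD(1)[OF A x] by simp
  then show ?thesis using gauge_vec_eq[OF A W x] by metis
qed

end

context spacetime_locale
begin

section \<open>Maximal null geodesics and sequential compactness\<close>

lemma geodesic_local:
  assumes "\<And>t. t \<in> J \<Longrightarrow> \<exists>N. open N \<and> t \<in> N \<and> geodesic M \<gamma> w (J \<inter> N)"
  shows "geodesic M \<gamma> w J"
proof (rule geodesicI)
  have at: "at t within J = at t within (J \<inter> N)" if "open N" "t \<in> N" for t N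
    by (rule at_within_nhd[of t N]) (use that in auto)
  show "continuous_on J \<gamma>" unfolding continuous_on_def
  proof
    fix t assume t: "t \<in> J"
    then obtain N where N: "open N" "t \<in> N" "geodesic M \<gamma> w (J \<inter> N)" using assms by blast
    then show "(\<gamma> \<longlongrightarrow> \<gamma> t) (at t within J)"
      unfolding at[OF N(1,2)] using t by (auto simp: geodesic_def continuous_on_def)
  qed
  fix t assume t: "t \<in> J"
  then obtain N where N: "open N" "t \<in> N" "geodesic M \<gamma> w (J \<inter> N)" using assms by blast
  have tN: "t \<in> J \<inter> N" using t N by blast
  show "w t \<in> tangent_space M (\<gamma> t)" by (rule geodesicD(2)[OF N(3) tN])
  fix c assume c: "c \<in> charts_at M (\<gamma> t)"
  show "((\<lambda>s. cmap c (\<gamma> s)) has_vector_derivative w t c) (at t within J)"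
    "((\<lambda>s. w s c) has_vector_derivative acc c (cmap c (\<gamma> t)) (w t c)) (at t within J)"
    unfolding at[OF N(1,2)] by (rule geodesicD(3,4)[OF N(3) tN c])+
qed

lemma geodesic_velocity_unique:
  assumes "a < b" "geodesic M \<gamma> w {a..b}" "geodesic M \<gamma>' w' {a..b}" "\<And>t. t \<in> {a..b} \<Longrightarrow> \<gamma>' t = \<gamma> t" "t \<in> {a..b}"
  shows "w' t = w t"
proof -
  obtain c where c: "c \<in> charts_at M (\<gamma> t)" using charts_at_ex by blast
  have c': "c \<in> charts_at M (\<gamma>' t)" using c assms(4,5) by simp
  have "((\<lambda>s. cmap c (\<gamma> s)) has_vector_derivative w' t c) (at t within {a..b})"
    by (rule has_vector_derivative_transform[OF assms(5) _ geodesicD(3)[OF assms(3,5) c']]) (simp add: assms(4))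
  then have "w' t c = w t c"
    using vector_derivative_unique_within_closed_interval[of a b t] assms(1,5) geodesicD(3)[OF assms(2,5) c] by fastforce
  then show ?thesis
    using tangent_eq_iff[OF _ geodesicD(2)[OF assms(2,5)] c, of "w' t"] geodesicD(2)[OF assms(3,5)] assms(4,5) by simp
qed

text \<open>The end \<open>b\<close> is the supremum of the existence times, at most 1 because the
  solution does not reach 1. An extension beyond \<open>b\<close> would itself provide a larger
  existence time.\<close>

lemma maximal_null_geodesic_exists:
  assumes v: "null_vec M p v" "future_vec M p v"
    and no: "\<not> (\<exists>\<gamma> w. geodesic M \<gamma> w {0..1} \<and> \<gamma> 0 = p \<and> w 0 = v)"
  obtains \<gamma> w b where "maximal_null_geodesic M \<gamma> (ereal b)" "0 < b" "b \<le> 1" "geodesic M \<gamma> w (ray (ereal b))" "\<gamma> 0 = p" "w 0 = v"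
proof -
  have vt: "v \<in> tangent_space M p" using v by (simp add: null_vec_def)
  define E where "E = {e. 0 < e \<and> (\<exists>\<gamma> w. geodesic M \<gamma> w {0..e} \<and> \<gamma> 0 = p \<and> w 0 = v)}"
  have E1: "e \<le> 1" if "e \<in> E" for e
  proof (rule ccontr)
    assume "\<not> e \<le> 1"
    then have "{0..1} \<subseteq> {0..e}" by auto
    then show False using that no geodesic_subset unfolding E_def by blast
  qed
  obtain e0 \<gamma>0 w0 where "e0 > 0" "geodesic M \<gamma>0 w0 {0..e0}" "\<gamma>0 0 = p" "w0 0 = v"
    by (rule geodesic_exists[OF vt])
  then have e0: "e0 \<in> E" unfolding E_def by blast
  have bdd: "bdd_above E" using E1 by (rule bdd_aboveI)
  define b where "b = Sup E"
  have b0: "0 < b" using cSup_upper[OF e0 bdd] e0 unfolding b_def E_def by auto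
  have b1: "b \<le> 1" unfolding b_def using e0 E1 by (intro cSup_least) auto
  have "\<forall>e\<in>E. \<exists>g. geodesic M (fst g) (snd g) {0..e} \<and> fst g 0 = p \<and> snd g 0 = v" unfolding E_def by auto
  then obtain g where g: "\<And>e. e \<in> E \<Longrightarrow> geodesic M (fst (g e)) (snd (g e)) {0..e}"
    "\<And>e. e \<in> E \<Longrightarrow> fst (g e) 0 = p" "\<And>e. e \<in> E \<Longrightarrow> snd (g e) 0 = v" by metis
  have "\<exists>e\<in>E. t < e" if "t < b" for t using that less_cSup_iff[OF _ bdd, of t] e0 unfolding b_def by auto
  then obtain \<epsilon> where \<epsilon>: "\<And>t. t < b \<Longrightarrow> \<epsilon> t \<in> E \<and> t < \<epsilon> t" by metis
  \<comment> \<open>For each \<open>t\<close> some solution lives beyond \<open>t\<close>;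
    uniqueness makes these choices agree, so they form one geodesic.\<close>
  define \<gamma> where "\<gamma> t = fst (g (\<epsilon> t)) t" for t
  define w where "w t = snd (g (\<epsilon> t)) t" for t
  have agree: "\<gamma> t = fst (g e) t \<and> w t = snd (g e) t" if "e \<in> E" "0 \<le> t" "t \<le> e" "t < b" for e t
  proof -
    have e': "\<epsilon> t \<in> E" "t < \<epsilon> t" using \<epsilon>[OF that(4)] by auto
    show ?thesis unfolding \<gamma>_def w_def
      by (rule geodesic_unique[of _ _ 0 t _ _ 0])
        (use geodesic_subset[OF g(1)[OF e'(1)], of "{0..t}"] geodesic_subset[OF g(1)[OF that(1)], of "{0..t}"] that e' g(2,3) in auto)
  qed
  have ray: "ray (ereal b) = {0..<b}" unfolding ray_def by auto
  have geo: "geodesic M \<gamma> w {0..<b}"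
  proof (rule geodesic_local)
    fix t assume t: "t \<in> {0..<b}"
    then have e: "\<epsilon> t \<in> E" "t < \<epsilon> t" using \<epsilon> by auto
    have "geodesic M \<gamma> w ({0..<b} \<inter> {..<\<epsilon> t})"
    proof (rule geodesic_cong)
      show "geodesic M (fst (g (\<epsilon> t))) (snd (g (\<epsilon> t))) ({0..<b} \<inter> {..<\<epsilon> t})"
        by (rule geodesic_subset[OF g(1)[OF e(1)]]) auto
    qed (use agree[OF e(1)] in auto)
    then show "\<exists>N. open N \<and> t \<in> N \<and> geodesic M \<gamma> w ({0..<b} \<inter> N)" using e(2) by (intro exI[of _ "{..<\<epsilon> t}"]) auto
  qed
  have init: "\<gamma> 0 = p" "w 0 = v" using agree[OF e0, of 0] g(2,3)[OF e0] e0 b0 by (auto simp: E_def)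
  have nf: "null_vec M (\<gamma> t) (w t) \<and> future_vec M (\<gamma> t) (w t)" if "t \<in> {0..<b}" for t
  proof (rule geodesic_null_future[of _ _ 0 t 0])
    show "geodesic M \<gamma> w {0..t}" by (rule geodesic_subset[OF geo]) (use that in auto)
  qed (use that init v in auto)
  have "maximal_null_geodesic M \<gamma> (ereal b)" unfolding maximal_null_geodesic_def
  proof (intro conjI notI)
    show "null_geodesic M \<gamma> (ereal b)" unfolding null_geodesic_def ray using b0 geo nf by auto
    assume "\<exists>\<gamma>' b' w'. ereal b < b' \<and> geodesic M \<gamma>' w' (ray b') \<and> (\<forall>t\<in>ray (ereal b). \<gamma>' t = \<gamma> t)"
    then obtain \<gamma>' b' w' where c: "ereal b < b'" "geodesic M \<gamma>' w' (ray b')" "\<And>t. t \<in> {0..<b} \<Longrightarrow> \<gamma>' t = \<gamma> t"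
      unfolding ray by blast
    obtain e where e: "ereal b < ereal e" "ereal e < b'" using ereal_dense2[OF c(1)] by blast
    then have be: "b < e" by simp
    have sub: "{0..e} \<subseteq> ray b'" unfolding ray_def using e(2) by (auto intro: le_less_trans[of _ "ereal e"])
    have ge: "geodesic M \<gamma>' w' {0..e}" by (rule geodesic_subset[OF c(2) sub])
    \<comment> \<open>Maximality speaks of extending the curve only, so the initial velocity of the
      extension must be recovered from the positions.\<close>
    have "w' 0 = w 0"
    proof (rule geodesic_velocity_unique[of 0 "b/2" \<gamma> w \<gamma>'])
      show "geodesic M \<gamma> w {0..b/2}" by (rule geodesic_subset[OF geo]) (use b0 in auto)
      show "geodesic M \<gamma>' w' {0..b/2}" by (rule geodesic_subset[OF ge]) (use be b0 in auto)
    qed (use b0 c(3) in auto)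
    moreover have "\<gamma>' 0 = \<gamma> 0" using c(3) b0 by simp
    ultimately have "e \<in> E" unfolding E_def using ge init b0 be by auto
    then have "e \<le> b" unfolding b_def by (rule cSup_upper[OF _ bdd])
    then show False using be by simp
  qed
  then show ?thesis using that[of \<gamma> b w] b0 b1 geo init unfolding ray by blast
qed

lemma precompact_nbhd:
  fixes x :: 'm
  obtains U where "open U" "x \<in> U" "compact (closure U)"
proof -
  obtain c where c: "c \<in> charts_at M x" using charts_at_ex by blast
  then have cc: "c \<in> charts M" "cmap c x \<in> img c" by auto
  obtain r where r: "r > 0" "cball (cmap c x) r \<subseteq> img c"
    using open_img[OF cc(1)] cc(2) open_contains_cball by blast
  have K: "compact (cinv c ` cball (cmap c x) r)"
    by (intro compact_continuous_image continuous_on_subset[OF cont_cinv[OF cc(1)] r(2)] compact_cball)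
  let ?U = "cdom c \<inter> cmap c -` ball (cmap c x) r"
  have "?U \<subseteq> cinv c ` cball (cmap c x) r"
  proof
    fix p assume "p \<in> ?U"
    then have "p = cinv c (cmap c p)" "cmap c p \<in> cball (cmap c x) r" using cinv_cmap[OF cc(1)] by (auto simp: less_imp_le)
    then show "p \<in> cinv c ` cball (cmap c x) r" by blast
  qed
  then have "closure ?U \<subseteq> cinv c ` cball (cmap c x) r" by (rule closure_minimal) (rule compact_imp_closed[OF K])
  then have "compact (closure ?U)" using K by (metis closed_closure compact_Int_closed inf.absorb_iff2)
  then show ?thesis by (intro that[of ?U] open_chart_ball cc(1)) (use c r in auto)
qed

text \<open>Second countability gives a countable cover by open sets with compact closure. A set
  inside no finite union of them contains a sequence that eventually leaves each one, which has no
  convergent subsequence.\<close>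

lemma compact_closureI:
  fixes S :: "'m set"
  assumes S: "\<And>x. (\<And>n. x n \<in> S) \<Longrightarrow> \<exists>l. \<exists>r :: nat \<Rightarrow> nat. strict_mono r \<and> (x \<circ> r) \<longlonglongrightarrow> l"
  shows "compact (closure S)"
proof -
  define F where "F = {U :: 'm set. open U \<and> compact (closure U)}"
  have "\<exists>U\<in>F. x \<in> U" for x :: 'm using precompact_nbhd[of x] unfolding F_def by blast
  then have UF: "\<Union>F = UNIV" by blast
  obtain F' where F': "F' \<subseteq> F" "countable F'" "\<Union>F' = \<Union>F"
    by (rule Lindelof[of F]) (auto simp: F_def)
  have ne: "F' \<noteq> {}" using F'(3) UF by auto
  define f where "f = from_nat_into F'"
  have rf: "range f = F'" unfolding f_def by (rule range_from_nat_into[OF ne F'(2)])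
  have "\<exists>n. S \<subseteq> (\<Union>i\<le>n. f i)"
  proof (rule ccontr)
    assume "\<not> ?thesis"
    then have "\<forall>n. \<exists>x. x \<in> S \<and> x \<notin> (\<Union>i\<le>n. f i)" by blast
    then obtain x where x: "\<And>n. x n \<in> S" "\<And>n. x n \<notin> (\<Union>i\<le>n. f i)" by metis
    obtain l and r :: "nat \<Rightarrow> nat" where l: "strict_mono r" "(x \<circ> r) \<longlonglongrightarrow> l" using S[of x, OF x(1)] by blast
    obtain j where j: "l \<in> f j" using F'(3) UF rf by (metis UNIV_I UnionE imageE)
    have "open (f j)" using rf F'(1) unfolding F_def by blast
    then have "\<forall>\<^sub>F n in sequentially. (x \<circ> r) n \<in> f j" using topological_tendstoD[OF l(2) _ j] by blast
    then obtain N where N: "\<And>n. n \<ge> N \<Longrightarrow> x (r n) \<in> f j" unfolding eventually_sequentially by auto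
    have "j \<le> r (max N j)" using seq_suble[OF l(1), of "max N j"] by simp
    then show False using N[of "max N j"] x(2)[of "r (max N j)"] by auto
  qed
  then obtain n where n: "S \<subseteq> (\<Union>i\<le>n. f i)" by blast
  have fc: "compact (closure (f i))" for i using rf F'(1) unfolding F_def by blast
  have K: "compact (\<Union>i\<le>n. closure (f i))" by (intro compact_UN fc) auto
  have "closure S \<subseteq> (\<Union>i\<le>n. closure (f i))"
  proof (rule closure_minimal[OF _ compact_imp_closed[OF K]])
    show "S \<subseteq> (\<Union>i\<le>n. closure (f i))"
      by (rule order_trans[OF n UN_mono[OF order_refl closure_subset]])
  qed
  then show ?thesis using K by (metis closed_closure compact_Int_closed inf.absorb_iff2)
qed

end

context causal_spacetime
begin

section \<open>Weak completeness implies properness\<close>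

lemma proper_gauge_of_complete:
  assumes A: "compact A" and G: "natural_gauge M A \<Gamma>" and wc: "weakly_future_null_complete M"
  shows "proper_gauge M A \<Gamma>"
  unfolding proper_gauge_def
proof (intro allI impI compact_closureI)
  fix K :: "real set" and x :: "nat \<Rightarrow> 'm"
  assume K: "compact K" and xn: "\<And>n. x n \<in> {x \<in> regular_part M (hypersurface M A). \<Gamma> x \<in> K}"
  obtain W where W: "gauge_field M A W" "\<And>y. y \<in> regular_part M (hypersurface M A) \<Longrightarrow>
     \<Gamma> y = - met M (past_min M A y) (gauge_vec M A W y) (W (past_min M A y))"
    using G unfolding natural_gauge_def by blast
  have xr: "x n \<in> regular_part M (hypersurface M A)" "\<Gamma> (x n) \<in> K" for n using xn by auto
  obtain R where R: "\<And>k. k \<in> K \<Longrightarrow> \<bar>k\<bar> \<le> R" using compact_imp_bounded[OF K] unfolding bounded_iff by auto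
  define p where "p n = past_min M A (x n)" for n
  define v where "v n = gauge_vec M A W (x n)" for n
  have pA: "p n \<in> A" for n unfolding p_def by (rule past_min(1)[OF A xr(1)])
  have spec: "gauge_spec A W (p n) (x n) (v n)" for n unfolding p_def v_def by (rule gauge_vec_spec[OF A W(1) xr(1)])
  have "\<forall>n. \<exists>g. null_geo (fst g) (snd g) 0 1 \<and> fst g 0 = p n \<and> snd g 0 = v n \<and> fst g 1 = x n"
    using gauge_spec_null_geo[OF W(1) spec] by (metis fst_conv snd_conv)
  then obtain g where g: "\<And>n. null_geo (fst (g n)) (snd (g n)) 0 1" "\<And>n. fst (g n) 0 = p n"
    "\<And>n. snd (g n) 0 = v n" "\<And>n. fst (g n) 1 = x n" by metis
  have vt: "v n \<in> tangent_space M (p n)" for n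
    using geodesicD(2)[OF null_geoD(2)[OF g(1)], of 0 n] g(2,3)[of n] by simp
  have vnf: "null_vec M (p n) (v n) \<and> future_vec M (p n) (v n)" for n
    using null_geoD(3,4)[OF g(1), of 0 n] g(2,3)[of n] by simp
  obtain q r1 where r1: "q \<in> A" "strict_mono r1" "(p \<circ> r1) \<longlonglongrightarrow> q"
    using compact_imp_seq_compact[OF A] pA unfolding seq_compact_def by blast
  obtain c where cq: "c \<in> charts_at M q" using charts_at_ex by blast
  then have c: "c \<in> charts M" "cmap c q \<in> img c" by auto
  have Wf: "continuous_on (img c) (coord_field W c)" using W(1) cont_coord_field[OF _ c(1)] unfolding gauge_field_def by blast
  \<comment> \<open>Paired with an initial vector, this covector field is minus its product with
    \<open>W\<close>, the value of the gauge; \<open>cone_bound\<close> then bounds the vector by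
    the gauge.\<close>
  let ?\<omega> = "\<lambda>y. - (G c y *v coord_field W c y)"
  have om: "continuous_on (img c) ?\<omega>" by (intro continuous_intros cont_G c(1) Wf)
  have TW: "timelike_dir c (cmap c q) (W q c)" by (rule field_timelike_dir(1)[OF W(1) cq])
  obtain \<delta> C where dC: "\<delta> > 0" "C > 0" "ball (cmap c q) \<delta> \<subseteq> img c"
    "\<And>y u. y \<in> ball (cmap c q) \<delta> \<Longrightarrow> causal_dir c y u \<Longrightarrow> norm u \<le> C * (?\<omega> y \<bullet> u)"
    by (rule cone_bound[OF c TW om]) (auto simp: coord_field_cmap[OF cq])
  have bound: "norm (v n c) \<le> C * R" if h: "p n \<in> cdom c" "cmap c (p n) \<in> ball (cmap c q) \<delta>" for n
  proof -
    have cn: "c \<in> charts_at M (p n)" using h(1) c(1) by (rule charts_atI[rotated])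
    have "causal_dir c (cmap c (p n)) (v n c)" using null_future_coord[OF vt cn] vnf by blast
    then have "norm (v n c) \<le> C * (?\<omega> (cmap c (p n)) \<bullet> v n c)" by (rule dC(4)[OF h(2)])
    also have "?\<omega> (cmap c (p n)) \<bullet> v n c = - met M (p n) (v n) (W (p n))"
      unfolding met_coord[OF vt field_timelike_dir(2)[OF W(1) cn] cn] by (simp add: coord_field_cmap[OF cn] coord_met_def inner_commute)
    also have "\<dots> = \<Gamma> (x n)" using W(2)[OF xr(1)] by (simp add: p_def v_def)
    also have "C * \<Gamma> (x n) \<le> C * R" using R[OF xr(2), of n] dC(2) by (intro mult_left_mono) auto
    finally show ?thesis .
  qed
  have "\<forall>\<^sub>F n in sequentially. (p \<circ> r1) n \<in> cdom c \<inter> cmap c -` ball (cmap c q) \<delta>"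
    by (rule topological_tendstoD[OF r1(3) open_chart_ball[OF c(1)]]) (use cq dC(1) in auto)
  then obtain N where N: "\<And>n. n \<ge> N \<Longrightarrow> p (r1 n) \<in> cdom c \<and> cmap c (p (r1 n)) \<in> ball (cmap c q) \<delta>"
    unfolding eventually_sequentially by auto
  \<comment> \<open>The bound holds in the chart \<open>c\<close> only, hence from the index
    \<open>N\<close> on at which the base points have entered it.\<close>
  have "v (r1 (n + N)) c \<in> cball 0 (C * R)" for n using bound[of "r1 (n + N)"] N[of "n + N"] by simp
  then obtain V r2 where r2: "strict_mono r2" "((\<lambda>n. v (r1 (n + N)) c) \<circ> r2) \<longlonglongrightarrow> V"
    using compact_imp_seq_compact[OF compact_cball[of "0 :: real ^ 'n" "C * R"]] unfolding seq_compact_def by metis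
  define s where "s n = r1 (r2 n + N)" for n
  have sm: "strict_mono s" unfolding s_def using r1(2) r2(1) by (simp add: strict_mono_def)
  have pl: "(\<lambda>n. p (s n)) \<longlonglongrightarrow> q"
  proof -
    have "strict_mono (\<lambda>n. r2 n + N)" using r2(1) by (simp add: strict_mono_def)
    from LIMSEQ_subseq_LIMSEQ[OF r1(3) this] show ?thesis by (simp add: s_def o_def)
  qed
  have vl: "(\<lambda>n. v (s n) c) \<longlonglongrightarrow> V" using r2(2) by (simp add: s_def o_def)
  define u where "u = lift c q V"
  have ut: "u \<in> tangent_space M q" "u c = V" unfolding u_def using lift_tangent[OF cq] lift_self[OF cq] by auto
  have tc: "tangent_tendsto (\<lambda>n. p (s n)) (\<lambda>n. v (s n)) q u"
    by (rule tangent_tendstoI[OF pl vt ut(1) cq]) (use vl ut(2) in simp)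
  \<comment> \<open>The time \<open>t\<close> is arbitrary in [0, 1], because the limiting geodesic
    may fail to exist up to 1; the approximating ones all do.\<close>
  have dep: "tangent_tendsto (\<lambda>n. fst (g (s n)) t) (\<lambda>n. snd (g (s n)) t) (\<gamma> t) (w t)"
    if "geodesic M \<gamma> w {0..t}" "\<gamma> 0 = q" "w 0 = u" "0 \<le> t" "t \<le> 1" for \<gamma> w t
    by (rule geodesic_continuous_dependence[OF that(1)])
      (use that tc g(2,3) geodesic_subset[OF null_geoD(2)[OF g(1)], of "{0..t}"] in auto)
  show "\<exists>l. \<exists>r :: nat \<Rightarrow> nat. strict_mono r \<and> (x \<circ> r) \<longlonglongrightarrow> l"
  proof (cases "\<exists>\<gamma> w. geodesic M \<gamma> w {0..1} \<and> \<gamma> 0 = q \<and> w 0 = u")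
    case True
    then obtain \<gamma> w where "geodesic M \<gamma> w {0..1}" "\<gamma> 0 = q" "w 0 = u" by blast
    from dep[OF this] have "(\<lambda>n. x (s n)) \<longlonglongrightarrow> \<gamma> 1" by (simp add: tangent_tendsto_def g(4))
    then show ?thesis using sm by (intro exI[of _ "\<gamma> 1"] exI[of _ s]) (simp add: o_def)
  next
    case False
    \<comment> \<open>For the zero vector the constant curve would be a geodesic on [0, 1].\<close>
    have "u \<noteq> (\<lambda>c. 0)" using False geodesic_const[of q "{0..1}"] by blast
    then have V0: "V \<noteq> 0" using tangent_eq_iff[OF ut(1) tangent_zero cq] ut(2) by auto
    have yi: "\<forall>\<^sub>F n in sequentially. cmap c (p (s n)) \<in> img c"
      using eventually_in_cdom[OF cq pl] by eventually_elim auto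
    note yl = cmap_tendsto[OF cq pl]
    have Gl: "(\<lambda>n. G c (cmap c (p (s n)))) \<longlonglongrightarrow> G c (cmap c q)"
      by (rule continuous_on_tendsto_compose[OF cont_G[OF c(1)] yl c(2) yi])
    have tl: "(\<lambda>n. coord_orient c (cmap c (p (s n)))) \<longlonglongrightarrow> coord_orient c (cmap c q)"
      by (rule continuous_on_tendsto_compose[OF cont_coord_orient[OF c(1)] yl c(2) yi])
    have nfc: "\<forall>\<^sub>F n in sequentially. coord_met c (cmap c (p (s n))) (v (s n) c) (v (s n) c) = 0 \<and> causal_dir c (cmap c (p (s n))) (v (s n) c)"
      using eventually_in_cdom[OF cq pl]
    proof eventually_elim
      case (elim n)
      then have "c \<in> charts_at M (p (s n))" using c(1) by (blast intro: charts_atI)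
      then show ?case using null_future_coord[OF vt] vnf by blast
    qed
    have "(\<lambda>n. coord_met c (cmap c (p (s n))) (v (s n) c) (v (s n) c)) \<longlonglongrightarrow> coord_met c (cmap c q) V V"
      unfolding coord_met_def by (intro tendsto_inner tendsto_mv Gl vl)
    moreover have "(\<lambda>n. coord_met c (cmap c (p (s n))) (v (s n) c) (v (s n) c)) \<longlonglongrightarrow> 0"
      by (rule tendsto_eventually) (use nfc in eventually_elim, blast)
    ultimately have n0: "coord_met c (cmap c q) V V = 0" by (rule LIMSEQ_unique)
    have "(\<lambda>n. coord_met c (cmap c (p (s n))) (v (s n) c) (coord_orient c (cmap c (p (s n))))) \<longlonglongrightarrow> coord_met c (cmap c q) V (coord_orient c (cmap c q))"
      unfolding coord_met_def by (intro tendsto_inner tendsto_mv Gl vl tl)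
    then have "coord_met c (cmap c q) V (coord_orient c (cmap c q)) \<le> 0"
      by (rule tendsto_upperbound) (use nfc in \<open>auto elim!: eventually_mono simp: causal_dir_def\<close>)
    moreover have "coord_met c (cmap c q) V (coord_orient c (cmap c q)) \<noteq> 0"
      using timelike_not_orthogonal_causal[OF G_lorentz[OF c], of "coord_orient c (cmap c q)" V] coord_orient_timelike[OF c] n0 V0 by (simp add: coord_met_def)
    ultimately have "coord_met c (cmap c q) (u c) (u c) = 0 \<and> causal_dir c (cmap c q) (u c)" using n0 ut(2) by (simp add: causal_dir_def)
    then have nf: "null_vec M q u" "future_vec M q u" using null_future_coord[OF ut(1) cq] by blast+
    obtain \<gamma> w b where m: "maximal_null_geodesic M \<gamma> (ereal b)" "0 < b" "b \<le> 1" "geodesic M \<gamma> w (ray (ereal b))" "\<gamma> 0 = q" "w 0 = u"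
      by (rule maximal_null_geodesic_exists[OF nf False])
    have "ereal b = \<infinity> \<or> (\<exists>t \<in> ray (ereal b). chron M (\<gamma> 0) (\<gamma> t))"
      using wc m(1) unfolding weakly_future_null_complete_def by blast
    then obtain t where t: "t \<in> ray (ereal b)" "chron M q (\<gamma> t)" using m(5) by auto
    have t': "0 \<le> t" "t < b" using t(1) by (auto simp: ray_def)
    have "geodesic M \<gamma> w {0..t}" by (rule geodesic_subset[OF m(4)]) (use t' in \<open>auto simp: ray_def\<close>)
    then have gl: "(\<lambda>n. fst (g (s n)) t) \<longlonglongrightarrow> \<gamma> t" using dep[of \<gamma> w t] m t' by (simp add: tangent_tendsto_def)
    \<comment> \<open>Openness in both arguments lets the base points and generators near the limit
      replace \<open>q\<close> and \<open>\<gamma> t\<close>. Push-up along the rest of the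
      generator then makes \<open>x (s n)\<close> chronologically later than a point of
      \<open>A\<close>.\<close>
    obtain U1 U2 where U: "open U1" "q \<in> U1" "open U2" "\<gamma> t \<in> U2" "\<And>p q. p \<in> U1 \<Longrightarrow> q \<in> U2 \<Longrightarrow> chron M p q"
      by (rule chron_open[OF t(2)]) blast
    have "\<forall>\<^sub>F n in sequentially. chron M (p (s n)) (fst (g (s n)) t)"
      using topological_tendstoD[OF pl U(1,2)] topological_tendstoD[OF gl U(3,4)] by eventually_elim (rule U(5))
    then obtain n where n: "chron M (p (s n)) (fst (g (s n)) t)" unfolding eventually_sequentially by blast
    have "causal M (fst (g (s n)) t) (x (s n))" using null_geo_causal[OF g(1), of t 1 "s n"] t' m(3) g(4) by simp
    then have "chron M (p (s n)) (x (s n))" using push_right[OF n] by blast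
    then show ?thesis using hypersurfaceD(2)[OF A regularD(1)[OF A xr(1)] pA] by blast
  qed
qed

end

context spacetime_locale
begin

section \<open>Proper gauges trap generators in compact sets\<close>

lemma null_geo_of_halfopen:
  assumes "geodesic M \<gamma> w {0..<\<beta>}" "\<And>t. t \<in> {0..<\<beta>} \<Longrightarrow> null_vec M (\<gamma> t) (w t) \<and> future_vec M (\<gamma> t) (w t)"
    and "0 \<le> s" "s < t" "t < \<beta>"
  shows "null_geo \<gamma> w s t"
proof -
  have sub: "{s..t} \<subseteq> {0..<\<beta>}" using assms(3-5) by auto
  show ?thesis unfolding null_geo_def using assms(2,4) sub geodesic_subset[OF assms(1) sub] by blast
qed

text \<open>The acceleration is homogeneous of degree two in the velocity, so its maximum over unit
  vectors and a compact coordinate ball is the constant.\<close>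

lemma acc_quadratic_bound:
  assumes c: "c \<in> charts M" and y0: "y0 \<in> img c"
  obtains r K where "r > 0" "K \<ge> 0" "\<And>y u. y \<in> cball y0 r \<Longrightarrow> norm (acc c y u) \<le> K * (norm u)\<^sup>2"
proof -
  obtain r where r: "r > 0" "cball y0 r \<subseteq> img c" using open_img[OF c] y0 open_contains_cball by blast
  let ?S = "cball y0 r \<times> sphere (0 :: real ^ 'n) 1"
  have "continuous_on ?S (\<lambda>p. acc c (fst p) (snd p))"
  proof (intro continuous_at_imp_continuous_on ballI)
    fix p assume "p \<in> ?S"
    then have "fst p \<in> img c" using r(2) by auto
    from loclip_isCont[OF loclip_acc[OF c this, of "snd p"]] show "isCont (\<lambda>p. acc c (fst p) (snd p)) p" by simp
  qed
  then have "compact ((\<lambda>p. acc c (fst p) (snd p)) ` ?S)" by (intro compact_continuous_image compact_Times) auto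
  then have "bounded ((\<lambda>p. acc c (fst p) (snd p)) ` ?S)" by (rule compact_imp_bounded)
  then obtain K where K: "\<forall>z\<in>(\<lambda>p. acc c (fst p) (snd p)) ` ?S. norm z \<le> K"
    unfolding bounded_iff by (elim exE)
  show ?thesis
  proof (rule that[OF r(1), of "max K 0"])
    fix y and u :: "real ^ 'n" assume y: "y \<in> cball y0 r"
    then have i: "y \<in> img c" using r(2) by blast
    show "norm (acc c y u) \<le> max K 0 * (norm u)\<^sup>2"
    proof (cases "u = 0")
      case True then show ?thesis using acc_zero[OF c i] by simp
    next
      case False
      define e where "e = (1 / norm u) *\<^sub>R u"
      have "(y, e) \<in> ?S" using y False by (simp add: e_def)
      then have e: "norm (acc c y e) \<le> K" using K by force
      have "u = norm u *\<^sub>R e" using False by (simp add: e_def)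
      then have "acc c y u = (norm u * norm u) *\<^sub>R acc c y e" using acc_scale[OF c i, of "norm u" e] by simp
      then have "norm (acc c y u) = (norm u)\<^sup>2 * norm (acc c y e)" by (simp add: power2_eq_square)
      also have "\<dots> \<le> (norm u)\<^sup>2 * max K 0" using e by (intro mult_left_mono) auto
      finally show ?thesis by (simp add: mult.commute)
    qed
  qed simp
qed

text \<open>Near the limit point a local time function \<open>\<xi>\<close> controls the speed through a Riccati
  inequality, so the velocity stays bounded and the local flow continues the geodesic.\<close>

lemma extend_geodesic:
  assumes b: "0 < \<beta>" and g: "geodesic M \<gamma> w {0..<\<beta>}"
    and nf: "\<And>t. t \<in> {0..<\<beta>} \<Longrightarrow> null_vec M (\<gamma> t) (w t) \<and> future_vec M (\<gamma> t) (w t)"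
    and lim: "(\<gamma> \<longlongrightarrow> q) (at_left \<beta>)"
  obtains \<gamma>' w' e where "\<beta> < e" "geodesic M \<gamma>' w' {0..e}" "\<And>t. t \<in> {0..<\<beta>} \<Longrightarrow> \<gamma>' t = \<gamma> t"
proof -
  obtain c where cq: "c \<in> charts_at M q" using charts_at_ex by blast
  then have c: "c \<in> charts M" "cmap c q \<in> img c" by auto
  define T where "T = coord_orient c (cmap c q)"
  have T: "timelike_dir c (cmap c q) T" unfolding T_def timelike_dir_def using coord_orient_timelike[OF c] by simp
  define \<xi> where "\<xi> = - (G c (cmap c q) *v T)"
  obtain \<delta> C where d: "\<delta> > 0" "C > 0" "ball (cmap c q) \<delta> \<subseteq> img c"
    "\<And>y u. y \<in> ball (cmap c q) \<delta> \<Longrightarrow> causal_dir c y u \<Longrightarrow> norm u \<le> C * (\<xi> \<bullet> u)"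
    by (rule cone_bound[OF c T, of "\<lambda>_. \<xi>"]) (auto simp: \<xi>_def)
  obtain r K where r: "r > 0" "K \<ge> 0" "\<And>y u. y \<in> cball (cmap c q) r \<Longrightarrow> norm (acc c y u) \<le> K * (norm u)\<^sup>2"
    by (rule acc_quadratic_bound[OF c])  blast
  define \<rho> where "\<rho> = min \<delta> r"
  have \<rho>: "\<rho> > 0" "\<rho> \<le> \<delta>" "\<rho> \<le> r" using d r by (auto simp: \<rho>_def)
  have "\<forall>\<^sub>F t in at_left \<beta>. \<gamma> t \<in> cdom c \<inter> cmap c -` ball (cmap c q) \<rho>"
    by (rule topological_tendstoD[OF lim open_chart_ball[OF c(1)]]) (use cq \<rho> in auto)
  then obtain s1' where s1': "s1' < \<beta>" "\<And>t. s1' < t \<Longrightarrow> t < \<beta> \<Longrightarrow> \<gamma> t \<in> cdom c \<inter> cmap c -` ball (cmap c q) \<rho>"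
    unfolding eventually_at_left[OF b] by blast
  define s1 where "s1 = (max 0 s1' + \<beta>) / 2"
  have s1: "0 < s1" "s1 < \<beta>" "s1' < s1" using s1'(1) b by (auto simp: s1_def max_def)
  have near: "\<gamma> t \<in> cdom c" "cmap c (\<gamma> t) \<in> ball (cmap c q) \<rho>" if "s1 \<le> t" "t < \<beta>" for t
    using s1'(2)[of t] that s1 by auto
  have ch: "c \<in> charts_at M (\<gamma> t)" if "s1 \<le> t" "t < \<beta>" for t using near(1)[OF that] c(1) by (blast intro: charts_atI)
  have ca: "causal_dir c (cmap c (\<gamma> t)) (w t c)" if t: "s1 \<le> t" "t < \<beta>" for t
    using null_future_coord[OF geodesicD(2)[OF g, of t] ch[OF t]] nf[of t] t s1 by auto
  define h where "h t = \<xi> \<bullet> w t c" for t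
  have wb: "norm (w t c) \<le> C * h t" if t: "s1 \<le> t" "t < \<beta>" for t
    unfolding h_def by (rule d(4)[OF _ ca[OF t]]) (use near(2)[OF t] \<rho> in auto)
  have h0: "h t > 0" if t: "s1 \<le> t" "t < \<beta>" for t
  proof -
    have "0 < norm (w t c)" using causal_dir_nonzero[OF ca[OF t]] by simp
    then have "0 < C * h t" using wb[OF t] by linarith
    then show ?thesis using d(2) by (simp add: zero_less_mult_iff)
  qed
  \<comment> \<open>Cauchy-Schwarz, the quadratic bound on the acceleration and
    \<open>norm (w t c) \<le> C * h t\<close> combine to h' <= K' h^2.\<close>
  define K' where "K' = norm \<xi> * K * C\<^sup>2"
  \<comment> \<open>Since \<open>h\<close> is the derivative of the time function along the curve,
    dividing the Riccati inequality by \<open>h\<close> gives (ln h)' <= K' (\<xi> . x)': this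
    difference is nonincreasing.\<close>
  define f where "f t = ln (h t) - K' * (\<xi> \<bullet> cmap c (\<gamma> t))" for t
  have f': "\<exists>D. (f has_real_derivative D) (at t within {s1..<\<beta>}) \<and> D \<le> 0" if t: "s1 \<le> t" "t < \<beta>" for t
  proof -
    have tJ: "t \<in> {0..<\<beta>}" and sub: "{s1..<\<beta>} \<subseteq> {0..<\<beta>}" using t s1 by auto
    let ?F = "at t within {s1..<\<beta>}"
    have x': "((\<lambda>t. \<xi> \<bullet> cmap c (\<gamma> t)) has_real_derivative h t) ?F"
      using bounded_linear.has_vector_derivative[OF bounded_linear_inner_right
        has_vector_derivative_within_subset[OF geodesicD(3)[OF g tJ ch[OF t]] sub], of \<xi>]
      by (simp add: has_real_derivative_iff_has_vector_derivative h_def)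
    have h': "(h has_real_derivative \<xi> \<bullet> acc c (cmap c (\<gamma> t)) (w t c)) ?F"
      using bounded_linear.has_vector_derivative[OF bounded_linear_inner_right
        has_vector_derivative_within_subset[OF geodesicD(4)[OF g tJ ch[OF t]] sub], of \<xi>]
      unfolding h_def has_real_derivative_iff_has_vector_derivative .
    have "(f has_real_derivative (\<xi> \<bullet> acc c (cmap c (\<gamma> t)) (w t c)) / h t - K' * h t) ?F"
      unfolding f_def
      by (rule derivative_eq_intros h' x' h0[OF t] refl | simp add: divide_inverse mult.commute)+
    moreover have "(\<xi> \<bullet> acc c (cmap c (\<gamma> t)) (w t c)) / h t - K' * h t \<le> 0"
    proof -
      have "\<xi> \<bullet> acc c (cmap c (\<gamma> t)) (w t c) \<le> norm \<xi> * norm (acc c (cmap c (\<gamma> t)) (w t c))" by (rule norm_cauchy_schwarz)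
      also have "\<dots> \<le> norm \<xi> * (K * (norm (w t c))\<^sup>2)"
        by (intro mult_left_mono r(3)) (use near(2)[OF t] \<rho> in auto)
      also have "\<dots> \<le> norm \<xi> * (K * (C * h t)\<^sup>2)"
        using wb[OF t] r(2) by (intro mult_left_mono power_mono) auto
      also have "\<dots> = K' * h t * h t" by (simp add: K'_def power2_eq_square)
      finally show ?thesis using h0[OF t] by (simp add: field_simps)
    qed
    ultimately show ?thesis by blast
  qed
  have fle: "f t \<le> f s1" if t: "s1 \<le> t" "t < \<beta>" for t
  proof (rule DERIV_nonpos_imp_decreasing_open[OF t(1)])
    show "\<exists>D. (f has_real_derivative D) (at x) \<and> D \<le> 0" if "s1 < x" "x < t" for x
    proof -
      have "x \<in> interior {s1..<\<beta>}" using that t by simp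
      then have "at x within {s1..<\<beta>} = at x" by (rule at_within_interior)
      then show ?thesis using f'[of x] that t by auto
    qed
    show "continuous_on {s1..t} f" unfolding continuous_on_eq_continuous_within
    proof
      fix x assume "x \<in> {s1..t}"
      then obtain D where "(f has_real_derivative D) (at x within {s1..<\<beta>})" using f'[of x] t by auto
      then have "continuous (at x within {s1..<\<beta>}) f" by (rule DERIV_continuous)
      then show "continuous (at x within {s1..t}) f" by (rule continuous_within_subset) (use t in auto)
    qed
  qed
  \<comment> \<open>The time function is bounded on the chart ball, so the monotonicity of
    \<open>f\<close> bounds ln h by \<open>L\<close> up to the end.\<close>
  define L where "L = f s1 + K' * (norm \<xi> * (norm (cmap c q) + \<rho>))"
  have K'0: "K' \<ge> 0" using r(2) by (simp add: K'_def)
  have wbd: "norm (w t c) \<le> C * exp L" if t: "s1 \<le> t" "t < \<beta>" for t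
  proof -
    have "norm (cmap c (\<gamma> t)) \<le> norm (cmap c q) + dist (cmap c q) (cmap c (\<gamma> t))"
      by (metis dist_commute dist_norm norm_triangle_sub)
    then have n: "norm (cmap c (\<gamma> t)) \<le> norm (cmap c q) + \<rho>" using near(2)[OF t] by simp
    have "\<xi> \<bullet> cmap c (\<gamma> t) \<le> norm \<xi> * norm (cmap c (\<gamma> t))" by (rule norm_cauchy_schwarz)
    also have "\<dots> \<le> norm \<xi> * (norm (cmap c q) + \<rho>)" using n by (intro mult_left_mono) auto
    finally have "K' * (\<xi> \<bullet> cmap c (\<gamma> t)) \<le> K' * (norm \<xi> * (norm (cmap c q) + \<rho>))" using K'0 by (intro mult_left_mono) auto
    then have "ln (h t) \<le> L" using fle[OF t] unfolding f_def L_def by simp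
    then have "h t \<le> exp L" using h0[OF t] by (metis exp_le_cancel_iff exp_ln)
    then have "C * h t \<le> C * exp L" using d(2) by (intro mult_left_mono) auto
    then show ?thesis using wb[OF t] by simp
  qed
  define \<tau> where "\<tau> n = \<beta> - (\<beta> - s1) / (real n + 1)" for n :: nat
  have \<tau>1: "s1 \<le> \<tau> n" "\<tau> n < \<beta>" for n
  proof -
    have "(\<beta> - s1) / (real n + 1) \<le> (\<beta> - s1) / 1" using s1(2) by (intro divide_left_mono) auto
    then show "s1 \<le> \<tau> n" by (simp add: \<tau>_def)
    have "0 < (\<beta> - s1) / (real n + 1)" using s1(2) by (intro divide_pos_pos) auto
    then show "\<tau> n < \<beta>" by (simp add: \<tau>_def)
  qed
  have \<tau>l: "\<tau> \<longlonglongrightarrow> \<beta>" unfolding \<tau>_def by real_asymp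
  have "w (\<tau> n) c \<in> cball 0 (C * exp L)" for n using wbd[OF \<tau>1] by simp
  then obtain V \<sigma> where \<sigma>: "strict_mono \<sigma>" "((\<lambda>n. w (\<tau> n) c) \<circ> \<sigma>) \<longlonglongrightarrow> V"
    using compact_imp_seq_compact[OF compact_cball[of "0 :: real ^ 'n" "C * exp L"]] unfolding seq_compact_def by metis
  have \<tau>s: "(\<lambda>n. \<tau> (\<sigma> n)) \<longlonglongrightarrow> \<beta>" using LIMSEQ_subseq_LIMSEQ[OF \<tau>l \<sigma>(1)] by (simp add: o_def)
  have "filterlim (\<lambda>n. \<tau> (\<sigma> n)) (at_left \<beta>) sequentially"
    unfolding filterlim_at using \<tau>s \<tau>1 by (auto intro!: always_eventually simp: less_le)
  then have gl: "(\<lambda>n. \<gamma> (\<tau> (\<sigma> n))) \<longlonglongrightarrow> q" by (rule filterlim_compose[OF lim])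
  have "fst (cmap c q, V) \<in> img c" using c(2) by simp
  then obtain e r' where e: "e > 0" "r' > 0" "\<And>p v. p \<in> cdom c \<Longrightarrow> v \<in> tangent_space M p \<Longrightarrow> dist (cmap c q, V) (cmap c p, v c) \<le> r' \<Longrightarrow>
    \<exists>\<gamma> w. geodesic M \<gamma> w {0..e} \<and> \<gamma> 0 = p \<and> w 0 = v"
    by (rule geodesic_local_existence[OF c(1)]) blast
  have zl: "(\<lambda>n. (cmap c (\<gamma> (\<tau> (\<sigma> n))), w (\<tau> (\<sigma> n)) c)) \<longlonglongrightarrow> (cmap c q, V)"
    using \<sigma>(2) by (intro tendsto_intros cmap_tendsto[OF cq gl]) (simp add: o_def)
  have "\<forall>\<^sub>F n in sequentially. dist (cmap c (\<gamma> (\<tau> (\<sigma> n))), w (\<tau> (\<sigma> n)) c) (cmap c q, V) < r' \<and> \<beta> - e < \<tau> (\<sigma> n)"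
    using tendstoD[OF zl e(2)] order_tendstoD(1)[OF \<tau>s, of "\<beta> - e"] e(1) by (auto intro: eventually_conj)
  then obtain n where n: "dist (cmap c (\<gamma> (\<tau> (\<sigma> n))), w (\<tau> (\<sigma> n)) c) (cmap c q, V) < r'" "\<beta> - e < \<tau> (\<sigma> n)"
    unfolding eventually_sequentially by blast
  \<comment> \<open>The restart: the state at \<open>s\<close> is close to the limit state and
    \<open>s\<close> is closer to \<open>\<beta>\<close> than the guaranteed existence time
    \<open>e\<close>.\<close>
  define s where "s = \<tau> (\<sigma> n)"
  have s: "s1 \<le> s" "s < \<beta>" "\<beta> < s + e" using \<tau>1[of "\<sigma> n"] n(2) by (auto simp: s_def)
  have sJ: "s \<in> {0..<\<beta>}" using s s1 by auto
  obtain \<eta> z where z: "geodesic M \<eta> z {0..e}" "\<eta> 0 = \<gamma> s" "z 0 = w s"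
    using e(3)[OF near(1)[OF s(1,2)] geodesicD(2)[OF g sJ]] n(1) by (auto simp: s_def dist_commute)
  have "geodesic M (\<lambda>t. \<eta> (1 * t + - s)) (\<lambda>t c. 1 *\<^sub>R z (1 * t + - s) c) {s..s + e}"
    by (rule geodesic_affine[OF z(1)]) auto
  then have g2: "geodesic M (\<lambda>t. \<eta> (t - s)) (\<lambda>t. z (t - s)) {s..s + e}" by simp
  have g1: "geodesic M \<gamma> w {0..s}" by (rule geodesic_subset[OF g]) (use s in auto)
  have "geodesic M (\<lambda>t. if t \<le> s then \<gamma> t else \<eta> (t - s)) (\<lambda>t. if t \<le> s then w t else z (t - s)) ({0..s} \<union> {s..s + e})"
    by (rule geodesic_glue[OF g1 g2]) (use s s1 z e(1) in auto)
  moreover have "{0..s} \<union> {s..s + e} = {0..s + e}" using s s1 e(1) by auto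
  ultimately have g3: "geodesic M (\<lambda>t. if t \<le> s then \<gamma> t else \<eta> (t - s)) (\<lambda>t. if t \<le> s then w t else z (t - s)) {0..s + e}" by simp
  show ?thesis
  proof (rule that[OF s(3) g3])
    fix t assume t: "t \<in> {0..<\<beta>}"
    show "(if t \<le> s then \<gamma> t else \<eta> (t - s)) = \<gamma> t"
    proof (cases "t \<le> s")
      case False
      have 1: "geodesic M \<gamma> w {s..t}" by (rule geodesic_subset[OF g]) (use t s s1 in auto)
      have 2: "geodesic M (\<lambda>t. \<eta> (t - s)) (\<lambda>t. z (t - s)) {s..t}"
        by (rule geodesic_subset[OF g2]) (use False t s(3) in auto)
      have "\<eta> (t - s) = \<gamma> t \<and> z (t - s) = w t"
        by (rule geodesic_unique[OF 2 1, of s]) (use False z in auto)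
      then show ?thesis using False by simp
    qed simp
  qed
qed

end

context causal_spacetime
begin

text \<open>One backward extension to the minimum at \<open>s0\<close> serves all later points.
  Reparametrizing the piece from \<open>e\<close> to \<open>t\<close> over [0, 1] multiplies its
  initial velocity by t - e, which makes the gauge affine in \<open>t\<close>.\<close>

lemma gauge_along_generator:
  assumes A: "compact A" and W: "gauge_field M A W"
    and g: "geodesic M \<gamma> w {0..<\<beta>}" "\<And>t. t \<in> {0..<\<beta>} \<Longrightarrow> null_vec M (\<gamma> t) (w t) \<and> future_vec M (\<gamma> t) (w t)"
    and s0: "0 \<le> s0" "s0 < \<beta>" and H: "\<And>t. s0 \<le> t \<Longrightarrow> t < \<beta> \<Longrightarrow> \<gamma> t \<in> regular_part M (hypersurface M A)"
  obtains p V e where "e < s0" "met M p V (W p) < 0"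
    "\<And>t. s0 < t \<Longrightarrow> t < \<beta> \<Longrightarrow> past_min M A (\<gamma> t) = p \<and> gauge_vec M A W (\<gamma> t) = (\<lambda>c. (t - e) *\<^sub>R V c)"
    "V \<in> tangent_space M p" "W p \<in> tangent_space M p"
proof -
  have n: "null_geo \<gamma> w s t" if "0 \<le> s" "s < t" "t < \<beta>" for s t
    by (rule null_geo_of_halfopen[OF g that])
  \<comment> \<open>A later point on the boundary is needed to exclude a corner at
    \<open>\<gamma> s0\<close>.\<close>
  define s1 where "s1 = (s0 + \<beta>) / 2"
  have s1: "s0 < s1" "s1 < \<beta>" using s0 by (auto simp: s1_def)
  define p where "p = past_min M A (\<gamma> s0)"
  note x0 = H[OF order_refl s0(2)]
  have p: "p \<in> A" "causal M p (\<gamma> s0)" "p \<noteq> \<gamma> s0" "\<And>q. q \<in> A \<Longrightarrow> causal M q (\<gamma> s0) \<Longrightarrow> causal M p q"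
    unfolding p_def using past_min[OF A x0] by auto
  have hyp: "\<gamma> t \<in> hypersurface M A" if "s0 \<le> t" "t < \<beta>" for t by (rule regularD(1)[OF A H[OF that]])
  have "\<not> chron M p (\<gamma> s1)" by (rule hypersurfaceD(2)[OF A hyp p(1)]) (use s1 in auto)
  then obtain \<eta> z e where h: "null_geo \<eta> z e s1" "e < s0" "\<eta> e = p" "\<And>t. t \<in> {s0..s1} \<Longrightarrow> \<eta> t = \<gamma> t \<and> z t = w t"
    by (rule backward_extension[OF n[OF s0(1) s1] p(2,3)]) (rule that)
  have h0: "null_geo \<eta> z e s0" by (rule null_geo_sub[OF h(1)]) (use h(2) s1 in auto)
  have eJ: "e \<in> {e..s0}" using h(2) by auto
  have Vt: "z e \<in> tangent_space M p" using geodesicD(2)[OF null_geoD(2)[OF h0] eJ] h(3) by simp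
  obtain c where "c \<in> charts_at M p" using charts_at_ex by blast
  then have Wt: "W p \<in> tangent_space M p" by (rule field_timelike_dir(2)[OF W])
  have neg: "met M p (z e) (W p) < 0" using null_future_field[OF W Vt] null_geoD(3,4)[OF h0 eJ] h(3) by simp
  show ?thesis
  proof (rule that[OF h(2) neg _ Vt Wt])
    fix t assume t: "s0 < t" "t < \<beta>"
    have xt: "\<gamma> t \<in> regular_part M (hypersurface M A)" by (rule H) (use t in auto)
    have c0t: "causal M (\<gamma> s0) (\<gamma> t)" by (rule null_geo_causal[OF n[OF s0(1) t]]) (use t in auto)
    \<comment> \<open>The minima at \<open>s0\<close> and at \<open>t\<close> precede each other:
      one lies below the later point, and the other, being below the first, lies below the earlier
      point.\<close>
    have pt: "past_min M A (\<gamma> t) = p"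
    proof -
      let ?p' = "past_min M A (\<gamma> t)"
      have "causal M ?p' p" by (rule past_min(4)[OF A xt p(1) causal_trans[OF p(2) c0t]])
      moreover from this have "causal M p ?p'" by (intro p(4) past_min(1)[OF A xt] causal_trans[OF _ p(2)])
      ultimately show ?thesis by (rule causal_antisym)
    qed
    have "null_geo (\<lambda>r. if r \<le> s0 then \<eta> r else \<gamma> r) (\<lambda>r. if r \<le> s0 then z r else w r) e t"
      by (rule null_geo_glue[OF h0 n[OF s0(1) t]]) (use h(4)[of s0] s1 in auto)
    then have "null_geo (\<lambda>r. (\<lambda>r. if r \<le> s0 then \<eta> r else \<gamma> r) ((t - e) * r + e))
        (\<lambda>r c. (t - e) *\<^sub>R (\<lambda>r. if r \<le> s0 then z r else w r) ((t - e) * r + e) c) 0 1"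
      by (rule null_geo_affine) (use h(2) t in auto)
    from null_geo_gauge_spec[OF A W this] have "gauge_spec A W p (\<gamma> t) (\<lambda>c. (t - e) *\<^sub>R z e c)"
      using h(2,3) t hyp[of t] by (simp add: if_distrib cong: if_cong)
    then have "gauge_vec M A W (\<gamma> t) = (\<lambda>c. (t - e) *\<^sub>R z e c)" by (intro gauge_vec_eq[OF A W xt]) (simp add: pt)
    then show "past_min M A (\<gamma> t) = p \<and> gauge_vec M A W (\<gamma> t) = (\<lambda>c. (t - e) *\<^sub>R z e c)" using pt by blast
  qed
qed

text \<open>Causal closedness puts every point of the curve below every cluster point at
  \<open>\<beta>\<close>, hence any two cluster points below each other; antisymmetry leaves only
  one.\<close>

lemma converges_of_precompact:
  assumes g: "\<And>s t. s0 < s \<Longrightarrow> s < t \<Longrightarrow> t < \<beta> \<Longrightarrow> causal M (\<gamma> s) (\<gamma> t)" and s0: "s0 < (\<beta> :: real)"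
    and K: "compact K" "\<And>t. s0 < t \<Longrightarrow> t < \<beta> \<Longrightarrow> \<gamma> t \<in> K"
  obtains q where "(\<gamma> \<longlongrightarrow> q) (at_left \<beta>)"
proof -
  have below: "causal M (\<gamma> s) q" if t: "\<And>n::nat. s0 < \<tau> n" "\<And>n. \<tau> n < \<beta>" "\<tau> \<longlonglongrightarrow> \<beta>" "(\<lambda>n. \<gamma> (\<tau> n)) \<longlonglongrightarrow> q" and s: "s0 < s" "s < \<beta>" for \<tau> q s
  proof -
    obtain N where N: "\<And>n. n \<ge> N \<Longrightarrow> s < \<tau> n"
      using order_tendstoD(1)[OF t(3) s(2)] unfolding eventually_sequentially by blast
    show ?thesis
      by (rule causal_limit[OF tendsto_const LIMSEQ_ignore_initial_segment[OF t(4), of N]])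
        (use g s N t(2) in auto)
  qed
  have ex: "\<exists>q\<in>K. \<exists>r :: nat \<Rightarrow> nat. strict_mono r \<and> (\<lambda>n. \<gamma> (\<tau> (r n))) \<longlonglongrightarrow> q" if "\<And>n::nat. s0 < \<tau> n" "\<And>n. \<tau> n < \<beta>" for \<tau>
  proof -
    have "\<forall>n. (\<lambda>n. \<gamma> (\<tau> n)) n \<in> K" using K(2) that by blast
    from compact_imp_seq_compact[OF K(1), unfolded seq_compact_def, rule_format, OF this[rule_format]]
    show ?thesis by (auto simp: o_def)
  qed
  have sub: "(\<lambda>n. \<tau> (r n)) \<longlonglongrightarrow> \<beta>" if "\<tau> \<longlonglongrightarrow> \<beta>" "strict_mono r" for \<tau> and r :: "nat \<Rightarrow> nat"
    using LIMSEQ_subseq_LIMSEQ[OF that] by (simp add: o_def)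
  \<comment> \<open>The offset 2 keeps even the first term strictly after \<open>s0\<close>.\<close>
  define \<tau> where "\<tau> n = \<beta> - (\<beta> - s0) / (real n + 2)" for n :: nat
  have \<tau>: "s0 < \<tau> n" "\<tau> n < \<beta>" for n
  proof -
    have "(\<beta> - s0) / (real n + 2) < (\<beta> - s0) / 1" using s0 by (intro divide_strict_left_mono) auto
    then show "s0 < \<tau> n" by (simp add: \<tau>_def)
    have "0 < (\<beta> - s0) / (real n + 2)" using s0 by (intro divide_pos_pos) auto
    then show "\<tau> n < \<beta>" by (simp add: \<tau>_def)
  qed
  have \<tau>l: "\<tau> \<longlonglongrightarrow> \<beta>" unfolding \<tau>_def by real_asymp
  obtain q and r :: "nat \<Rightarrow> nat" where q: "strict_mono r" "(\<lambda>n. \<gamma> (\<tau> (r n))) \<longlonglongrightarrow> q" using ex[of \<tau>] \<tau> by blast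
  have "(\<gamma> \<longlongrightarrow> q) (at_left \<beta>)"
  proof (rule topological_tendstoI, rule ccontr)
    fix N assume N: "open N" "q \<in> N" and no: "\<not> (\<forall>\<^sub>F t in at_left \<beta>. \<gamma> t \<in> N)"
    have "\<exists>t. \<tau> n < t \<and> t < \<beta> \<and> \<gamma> t \<notin> N" for n
      using no unfolding eventually_at_left[OF s0] using \<tau>(2) by blast
    then obtain \<upsilon> where u: "\<And>n. \<tau> n < \<upsilon> n" "\<And>n. \<upsilon> n < \<beta>" "\<And>n. \<gamma> (\<upsilon> n) \<notin> N" by metis
    have u0: "s0 < \<upsilon> n" for n using u(1) \<tau>(1) by (meson less_trans)
    have ul: "\<upsilon> \<longlonglongrightarrow> \<beta>"
      by (rule tendsto_sandwich[OF _ _ \<tau>l tendsto_const]) (use u in \<open>auto intro!: always_eventually less_imp_le\<close>)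
    obtain q' and r' :: "nat \<Rightarrow> nat" where q': "strict_mono r'" "(\<lambda>n. \<gamma> (\<upsilon> (r' n))) \<longlonglongrightarrow> q'" using ex[of \<upsilon>] u0 u(2) by blast
    have "causal M q' q"
      by (rule causal_limit[OF q'(2) tendsto_const]) (rule below[of "\<lambda>n. \<tau> (r n)", OF \<tau> sub[OF \<tau>l q(1)] q(2) u0 u(2)])
    moreover have "causal M q q'"
      by (rule causal_limit[OF q(2) tendsto_const]) (rule below[of "\<lambda>n. \<upsilon> (r' n)", OF u0 u(2) sub[OF ul q'(1)] q'(2) \<tau>])
    ultimately have "q' = q" by (rule causal_antisym)
    then have "\<forall>\<^sub>F n in sequentially. \<gamma> (\<upsilon> (r' n)) \<in> N" using topological_tendstoD[OF q'(2) N(1)] N(2) by blast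
    then show False using u(3) unfolding eventually_sequentially by blast
  qed
  then show ?thesis by (rule that)
qed

lemma trapped_generator_complete:
  assumes A: "compact A" and G: "natural_gauge M A \<Gamma>" "proper_gauge M A \<Gamma>"
    and m: "maximal_null_geodesic M \<gamma> b"
    and t1: "t1 \<in> ray b" "\<And>t. t \<in> ray b \<Longrightarrow> t1 \<le> t \<Longrightarrow> \<gamma> t \<in> hypersurface M A"
  shows "b = \<infinity>"
proof (rule ccontr)
  assume "b \<noteq> \<infinity>"
  moreover have "0 < b" using m unfolding maximal_null_geodesic_def null_geodesic_def by blast
  ultimately obtain \<beta> where b: "b = ereal \<beta>" "0 < \<beta>" by (cases b) auto
  have ray: "ray b = {0..<\<beta>}" unfolding ray_def b by auto
  obtain w where g: "geodesic M \<gamma> w {0..<\<beta>}" "\<And>t. t \<in> {0..<\<beta>} \<Longrightarrow> null_vec M (\<gamma> t) (w t) \<and> future_vec M (\<gamma> t) (w t)"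
    using m unfolding maximal_null_geodesic_def null_geodesic_def ray by blast
  have n: "null_geo \<gamma> w s t" if "0 \<le> s" "s < t" "t < \<beta>" for s t
    by (rule null_geo_of_halfopen[OF g that])
  have t10: "0 \<le> t1" "t1 < \<beta>" using t1(1) unfolding ray by auto
  \<comment> \<open>Inside the trapped stretch each point has an earlier and a later point of the
    boundary on the same curve, distinct from it because there are no causal loops.\<close>
  have reg: "\<gamma> t \<in> regular_part M (hypersurface M A)" if t: "t1 < t" "t < \<beta>" for t
  proof -
    define t' where "t' = (t + \<beta>) / 2"
    have t': "t < t'" "t' < \<beta>" using t by (auto simp: t'_def)
    have n1: "null_geo \<gamma> w t1 t" and n2: "null_geo \<gamma> w t t'" using n t t' t10 by auto
    have "\<gamma> t1 \<in> hypersurface M A" "\<gamma> t \<in> hypersurface M A" "\<gamma> t' \<in> hypersurface M A"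
      using t1(2) t t' t10 unfolding ray by auto
    moreover have "causal M (\<gamma> t1) (\<gamma> t)" "\<gamma> t1 \<noteq> \<gamma> t"
      using null_geo_causal[OF n1, of t1 t] null_geo_distinct[OF n1] t by auto
    moreover have "causal M (\<gamma> t) (\<gamma> t')" "\<gamma> t' \<noteq> \<gamma> t"
      using null_geo_causal[OF n2, of t t'] null_geo_distinct[OF n2] t' by auto
    ultimately show ?thesis unfolding regular_part_def initial_points_def final_points_def by blast
  qed
  \<comment> \<open>The point at \<open>t1\<close> may be initial; regularity is available only
    strictly after it.\<close>
  define s0 where "s0 = (t1 + \<beta>) / 2"
  have s0: "t1 < s0" "s0 < \<beta>" "0 \<le> s0" using t10 by (auto simp: s0_def)
  obtain W where W: "gauge_field M A W" "\<And>y. y \<in> regular_part M (hypersurface M A) \<Longrightarrow>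
     \<Gamma> y = - met M (past_min M A y) (gauge_vec M A W y) (W (past_min M A y))"
    using G(1) unfolding natural_gauge_def by blast
  obtain p V e where e: "e < s0" "met M p V (W p) < 0"
    "\<And>t. s0 < t \<Longrightarrow> t < \<beta> \<Longrightarrow> past_min M A (\<gamma> t) = p \<and> gauge_vec M A W (\<gamma> t) = (\<lambda>c. (t - e) *\<^sub>R V c)"
    "V \<in> tangent_space M p" "W p \<in> tangent_space M p"
    by (rule gauge_along_generator[OF A W(1) g s0(3,2) reg]) (use s0 in auto)
  \<comment> \<open>The value that the affine gauge would take at the missing end
    \<open>\<beta>\<close>; it bounds the gauge on the whole stretch.\<close>
  define R where "R = (\<beta> - e) * - met M p V (W p)"
  let ?K = "closure {x \<in> regular_part M (hypersurface M A). \<Gamma> x \<in> {0..R}}"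
  have K: "compact ?K" using G(2) unfolding proper_gauge_def by blast
  have inK: "\<gamma> t \<in> ?K" if t: "s0 < t" "t < \<beta>" for t
  proof -
    have rt: "\<gamma> t \<in> regular_part M (hypersurface M A)" using reg t s0 by auto
    have "\<Gamma> (\<gamma> t) = - met M p (\<lambda>c. (t - e) *\<^sub>R V c) (W p)" using W(2)[OF rt] e(3)[OF t] by simp
    also have "met M p (\<lambda>c. (t - e) *\<^sub>R V c) (W p) = (t - e) * met M p V (W p)"
      using met_lin[OF e(4) e(4,5), of "t - e" 0] by simp
    finally have "\<Gamma> (\<gamma> t) = (t - e) * - met M p V (W p)" by simp
    moreover have "0 \<le> (t - e) * - met M p V (W p)" using e(1,2) t by (intro mult_nonneg_nonneg) auto
    moreover have "(t - e) * - met M p V (W p) \<le> R" unfolding R_def using e(2) t by (intro mult_right_mono) auto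
    ultimately show ?thesis using rt by (intro subsetD[OF closure_subset]) simp
  qed
  obtain q where q: "(\<gamma> \<longlongrightarrow> q) (at_left \<beta>)"
  proof (rule converges_of_precompact[OF _ s0(2) K inK])
    fix s t assume "s0 < s" "s < t" "t < \<beta>"
    then show "causal M (\<gamma> s) (\<gamma> t)" using null_geo_causal[OF n[of s t], of s t] s0 by auto
  qed
  obtain \<gamma>' w' e' where x: "\<beta> < e'" "geodesic M \<gamma>' w' {0..e'}" "\<And>t. t \<in> {0..<\<beta>} \<Longrightarrow> \<gamma>' t = \<gamma> t"
    by (rule extend_geodesic[OF b(2) g q]) (assumption | rule that)+
  have "geodesic M \<gamma>' w' (ray (ereal e'))" by (rule geodesic_subset[OF x(2)]) (auto simp: ray_def)
  moreover have "b < ereal e'" using x(1) b(1) by simp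
  ultimately show False using m x(3) unfolding maximal_null_geodesic_def ray by blast
qed

end

theorem proposition8p3:
  fixes M :: "('m::{t2_space, second_countable_topology}, 'n::finite) spacetime"
  assumes "time_oriented_lorentzian M"
    and "strongly_causal M"
    and "causally_closed M"
  shows
    "(\<forall>A G. admissible_source M A \<and> natural_gauge M A G \<and> extends_by_zero M A G \<and>
        weakly_future_null_complete M \<longrightarrow> proper_gauge M A G)
     \<and>
     (\<forall>A. admissible_source M A \<and> (\<exists>G. natural_gauge M A G \<and> proper_gauge M A G) \<longrightarrow>
        (\<forall>\<gamma> b. maximal_null_geodesic M \<gamma> b \<longrightarrow>
           b = \<infinity> \<or>
           (\<exists>t0 \<in> ray b. \<forall>t \<in> ray b. t0 \<le> t \<longrightarrow> \<gamma> t \<notin> hypersurface M A)))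
     \<and>
     ((\<forall>p. \<exists>G. natural_gauge M {p} G \<and> proper_gauge M {p} G) \<longrightarrow>
        weakly_future_null_complete M)"
proof -
  interpret causal_spacetime M by unfold_locales (use assms in auto)
  have causal_along: "causal M (\<gamma> s) (\<gamma> t)" if m: "maximal_null_geodesic M \<gamma> b" and st: "s \<in> ray b" "t \<in> ray b" "s \<le> t" for \<gamma> b s t
  proof (cases "s = t")
    case False
    obtain w where w: "geodesic M \<gamma> w (ray b)" "\<forall>t\<in>ray b. null_vec M (\<gamma> t) (w t) \<and> future_vec M (\<gamma> t) (w t)"
      using m unfolding maximal_null_geodesic_def null_geodesic_def by blast
    have sub: "{s..t} \<subseteq> ray b"
    proof
      fix r assume "r \<in> {s..t}"
      then show "r \<in> ray b" using st unfolding ray_def by (auto intro: le_less_trans[of _ "ereal t"])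
    qed
    have "null_geo \<gamma> w s t" unfolding null_geo_def using False st(3) geodesic_subset[OF w(1) sub] w(2) sub by auto
    then show ?thesis using null_geo_causal[of \<gamma> w s t s t] st(3) by simp
  qed simp
  have zero: "0 \<in> ray b" if "maximal_null_geodesic M \<gamma> b" for \<gamma> b
    using that unfolding maximal_null_geodesic_def null_geodesic_def ray_def by (auto simp: zero_ereal_def)
  have A: "compact A" if "admissible_source M A" for A using that unfolding admissible_source_def by blast
  show ?thesis
  proof (intro conjI allI impI)
    fix A G assume "admissible_source M A \<and> natural_gauge M A G \<and> extends_by_zero M A G \<and> weakly_future_null_complete M"
    then show "proper_gauge M A G" using proper_gauge_of_complete A by blast
  next
    fix A \<gamma> b assume h: "admissible_source M A \<and> (\<exists>G. natural_gauge M A G \<and> proper_gauge M A G)"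
      and m: "maximal_null_geodesic M \<gamma> b"
    then obtain G where G: "natural_gauge M A G" "proper_gauge M A G" by blast
    have cA: "compact A" using h A by blast
    show "b = \<infinity> \<or> (\<exists>t0\<in>ray b. \<forall>t\<in>ray b. t0 \<le> t \<longrightarrow> \<gamma> t \<notin> hypersurface M A)"
    proof (rule disjCI)
      assume "\<not> (\<exists>t0\<in>ray b. \<forall>t\<in>ray b. t0 \<le> t \<longrightarrow> \<gamma> t \<notin> hypersurface M A)"
      then have re: "\<And>t0. t0 \<in> ray b \<Longrightarrow> \<exists>t\<in>ray b. t0 \<le> t \<and> \<gamma> t \<in> hypersurface M A" by blast
      obtain t1 where t1: "t1 \<in> ray b" "\<gamma> t1 \<in> hypersurface M A" using re[OF zero[OF m]] by blast
      show "b = \<infinity>"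
      proof (rule trapped_generator_complete[OF cA G m t1(1)])
        \<comment> \<open>Between two visits the curve stays on the boundary: it is causally after
          \<open>A\<close> through \<open>\<gamma> t1\<close>, and if it were chronologically after
          \<open>A\<close>, so would be the later visit \<open>\<gamma> t'\<close>. Hence a curve
          that keeps returning never leaves.\<close>
        fix t assume t: "t \<in> ray b" "t1 \<le> t"
        obtain t' where t': "t' \<in> ray b" "t \<le> t'" "\<gamma> t' \<in> hypersurface M A" using re[OF t(1)] by blast
        have "causal M (\<gamma> t1) (\<gamma> t)" "causal M (\<gamma> t) (\<gamma> t')" using causal_along[OF m] t t' t1(1) by auto
        then show "\<gamma> t \<in> hypersurface M A"
          using hypersurfaceD(1)[OF cA t1(2)] hypersurfaceD(2)[OF cA t'(3)] causal_trans push_right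
          unfolding hypersurface_iff[OF cA] by blast
      qed
    qed
  next
    assume all: "\<forall>p. \<exists>G. natural_gauge M {p} G \<and> proper_gauge M {p} G"
    show "weakly_future_null_complete M" unfolding weakly_future_null_complete_def
    proof (intro allI impI disjCI)
      fix \<gamma> b assume m: "maximal_null_geodesic M \<gamma> b" and no: "\<not> (\<exists>t\<in>ray b. chron M (\<gamma> 0) (\<gamma> t))"
      obtain G where G: "natural_gauge M {\<gamma> 0} G" "proper_gauge M {\<gamma> 0} G" using all by blast
      have c: "compact {\<gamma> 0}" by simp
      show "b = \<infinity>"
      proof (rule trapped_generator_complete[OF c G m zero[OF m]])
        fix t assume t: "t \<in> ray b" "0 \<le> t"
        \<comment> \<open>Points causally but not chronologically after the vertex form the
          light-cone, so the failure of \<open>chron\<close> traps the whole geodesic.\<close>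
        have "causal M (\<gamma> 0) (\<gamma> t)" by (rule causal_along[OF m zero[OF m] t])
        then show "\<gamma> t \<in> hypersurface M {\<gamma> 0}" unfolding hypersurface_iff[OF c] using no t by blast
      qed
    qed
  qed
qed

end
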